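(* For each $1 \leq s \leq n$, $A_s[\ell] \cong J_s[\ell]/J_{s-1}[\ell]$ (an isomorphism of $G_k$-modules induced by the projection $J_s\to A_s$).
   Context: $k$ is a number field, $\bar k$ a fixed algebraic closure, $G_k=\mathrm{Gal}(\bar k/k)$, $\ell$ a prime. $\mathcal{T}(k,\ell)$ is the maximal pro-$\ell$ extension of $k(\mu_{\ell^\infty})$ unramified away from $\ell$. For a $G_k$-set $T$, $k(T)$ is the subfield of $\bar k$ fixed by the kernel of $G_k\to\mathrm{Aut}(T)$. Curve: $C/k$ is a smooth projective geometrically irreducible curve with affine model $y^{\ell^n}=f(x)$, $n\ge1$, $f=\lambda\prod_{\xi\in S}(x-\xi)^{n_\xi}\in k[x]$, $\lambda\in k^\times$, $S\subset\bar k$ the (finite) set of distinct roots of $f$, $0<n_\xi<\ell^n$, and $S$ equals the branch locus of the $x$-coordinate covering $C\to\mathbb{P}^1$ (in particular $\infty$ is not a branch point, so $\ell^n\mid\deg f$). The Jacobian $J$ of $C$ has good reduction at all finite places not above $\ell$, and $k(S)\subseteq\mathcal{T}(k,\ell)$. Tower: for $0\le s\le n$, $C_s/k$ is the smooth projective curve with affine model $(y_s)^{\ell^s}=f(x)$ (so $C_0=\mathbb{P}^1$, $C_n=C$), and for $s\ge1$, $\pi_s\colon C_s\to C_{s-1}$ is the degree $\ell$ map given by $y_{s-1}=y_s^\ell$. $J_s=\mathrm{Jac}(C_s)$. The pullback $\pi_s^*\colon J_{s-1}\to J_s$ is a closed immersion, by which $J_{s-1}$ is viewed as an abelian subvariety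 of $J_s$; $A_s:=J_s/J_{s-1}$ for $1\le s\le n$. *)

theory Defs
  imports "HOL-Algebra.Algebraic_Closure_Type" "HOL-Algebra.Generated_Fields" "HOL-Algebra.Free_Abelian_Groups"
begin

hide_const (open) Coset.order Polynomials.degree Poly_Mapping.degree

section \<open>Number fields inside a fixed algebraic closure\<close>

text \<open>Throughout, the type \<open>'a\<close> plays the role of the algebraic closure of the number field;
  subfields are subsets of \<open>'a\<close>.\<close>

abbreviation ring_of :: "'a::{alg_closed_field, field_char_0} set \<Rightarrow> 'a ring"
  where "ring_of A \<equiv> (ring_of_type_algebra :: 'a ring)\<lparr>carrier := A\<rparr>"

definition number_field :: "'a::{alg_closed_field, field_char_0} set \<Rightarrow> bool"
  where "number_field k \<longleftrightarrow>
    subfield k ring_of_type_algebra \<and> ring.finite_dimension ring_of_type_algebra \<rat> k"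

definition gal :: "'a::{alg_closed_field, field_char_0} set \<Rightarrow> ('a \<Rightarrow> 'a) set"
  where "gal F = {\<sigma>. bij \<sigma> \<and> (\<forall>a b. \<sigma> (a + b) = \<sigma> a + \<sigma> b) \<and> (\<forall>a b. \<sigma> (a * b) = \<sigma> a * \<sigma> b)
                    \<and> (\<forall>a\<in>F. \<sigma> a = a)}"

text \<open>The field \<open>k(T)\<close> of a Galois set \<open>T\<close>: the fixed field of the kernel of the action on \<open>T\<close>.\<close>

definition field_of_set ::
  "'a::{alg_closed_field, field_char_0} set \<Rightarrow> (('a \<Rightarrow> 'a) \<Rightarrow> 't \<Rightarrow> 't) \<Rightarrow> 't set \<Rightarrow> 'a set"
  where "field_of_set k act T = {a. \<forall>\<sigma>\<in>gal k. (\<forall>t\<in>T. act \<sigma> t = t) \<longrightarrow> \<sigma> a = a}"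

definition integers_of :: "'a::{alg_closed_field, field_char_0} set \<Rightarrow> 'a set"
  where "integers_of L = {a \<in> L. algebraic_int a}"

text \<open>\<open>L\<close> is Galois over \<open>F\<close>. Every prime of \<open>L\<close> not above \<open>l\<close> has trivial inertia group in
  \<open>Gal(L/F)\<close>; automorphisms of \<open>L\<close> are represented by their extensions to \<open>'a\<close>.\<close>

definition unramified_away_from ::
  "nat \<Rightarrow> 'a::{alg_closed_field, field_char_0} set \<Rightarrow> 'a set \<Rightarrow> bool"
  where "unramified_away_from l F L \<longleftrightarrow>
    (\<forall>\<PP>. maximalideal \<PP> (ring_of (integers_of L)) \<and> of_nat l \<notin> \<PP> \<longrightarrow>
       (\<forall>\<sigma>\<in>gal F. (\<forall>a\<in>integers_of L. \<sigma> a - a \<in> \<PP>) \<longrightarrow> (\<forall>a\<in>L. \<sigma> a = a)))"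

definition cyclotomic_tower :: "nat \<Rightarrow> 'a::{alg_closed_field, field_char_0} set \<Rightarrow> 'a set"
  where "cyclotomic_tower l k =
    generate_field ring_of_type_algebra (k \<union> {\<zeta>. \<exists>m. \<zeta> ^ (l ^ m) = 1})"

text \<open>The maximal pro-\<open>l\<close> extension of \<open>k(\<mu>\<^bsub>l^\<infinity>\<^esub>)\<close> unramified away from \<open>l\<close>, as the compositum of
  all finite Galois extensions of \<open>l\<close>-power degree unramified away from \<open>l\<close>. The degree is the order
  of the Galois group, whose elements are the restrictions to \<open>L\<close>. Infinite places impose
  no condition, since \<open>k(\<mu>\<^bsub>l^\<infinity>\<^esub>)\<close> is totally complex.\<close>

definition max_pro_ext :: "nat \<Rightarrow> 'a::{alg_closed_field, field_char_0} set \<Rightarrow> 'a set"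
  where "max_pro_ext l k =
    (let F = cyclotomic_tower l k in
     generate_field ring_of_type_algebra
       (\<Union>{L. subfield L ring_of_type_algebra \<and> F \<subseteq> L \<and> (\<forall>\<sigma>\<in>gal F. \<sigma> ` L = L)
             \<and> (\<exists>m. card ((\<lambda>\<sigma>. restrict \<sigma> L) ` gal F) = l ^ m)
             \<and> unramified_away_from l F L}))"


section \<open>Function fields, places and divisors\<close>

text \<open>All function fields live in a fixed algebraic closure of the rational function
  field in \<open>x\<close>. A curve over \<open>'a\<close> with coordinate functions \<open>x\<close>, \<open>w\<close> is given by \<open>w\<close>; it stands
  for the smooth projective curve with function field \<open>'a(x, w)\<close>, whose points are the
  places of that field.\<close>

type_synonym 'a ffun = "'a poly fract alg_closure"

definition fun_of_poly :: "'a::{alg_closed_field, field_char_0} poly \<Rightarrow> 'a ffun"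
  where "fun_of_poly p = to_ac (to_fract p)"

definition eval_xw :: "'a::{alg_closed_field, field_char_0} ffun \<Rightarrow> 'a poly poly \<Rightarrow> 'a ffun"
  where "eval_xw w P = poly (map_poly fun_of_poly P) w"

definition function_field :: "'a::{alg_closed_field, field_char_0} ffun \<Rightarrow> 'a ffun set"
  where "function_field w = {eval_xw w P / eval_xw w Q | P Q. eval_xw w Q \<noteq> 0}"

text \<open>Automorphisms of \<open>'a\<close> act on rational functions in \<open>x\<close> and \<open>w\<close> through the coefficients.
  This is well defined if \<open>w\<close> satisfies an equation as in the tower below, with coefficients
  fixed by \<open>\<sigma>\<close>.\<close>

definition fun_act ::
  "'a::{alg_closed_field, field_char_0} ffun \<Rightarrow> ('a \<Rightarrow> 'a) \<Rightarrow> 'a ffun \<Rightarrow> 'a ffun"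
  where "fun_act w \<sigma> g =
    (THE h. \<exists>P Q. eval_xw w Q \<noteq> 0 \<and> g = eval_xw w P / eval_xw w Q \<and>
       h = eval_xw w (map_poly (map_poly \<sigma>) P) / eval_xw w (map_poly (map_poly \<sigma>) Q))"

text \<open>A place is represented by its valuation ring. In a function field of one variable all of
  these are discrete, and over an algebraically closed field all places have degree one.\<close>

definition places :: "'a::{alg_closed_field, field_char_0} ffun \<Rightarrow> 'a ffun set set"
  where "places w = {P. subring P ring_of_type_algebra \<and> P \<subset> function_field w
     \<and> (\<forall>c. fun_of_poly [:c:] \<in> P) \<and> (\<forall>g\<in>function_field w. g \<in> P \<or> inverse g \<in> P)}"

definition max_ideal_of :: "'b::Fields.field set \<Rightarrow> 'b set"
  where "max_ideal_of P = {a \<in> P. a = 0 \<or> inverse a \<notin> P}"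

definition uniformizer :: "'b::Fields.field set \<Rightarrow> 'b \<Rightarrow> bool"
  where "uniformizer P t \<longleftrightarrow> max_ideal_of P = (\<lambda>a. t * a) ` P"

definition ord_at :: "'b::Fields.field set \<Rightarrow> 'b \<Rightarrow> int"
  where "ord_at P g = (THE e. \<exists>t. uniformizer P t \<and> g / t powi e \<in> P - max_ideal_of P)"

definition residue_at :: "'a::{alg_closed_field, field_char_0} ffun set \<Rightarrow> 'a ffun \<Rightarrow> 'a"
  where "residue_at P g = (THE c. g - fun_of_poly [:c:] \<in> max_ideal_of P)"

definition divisor_degree :: "('p \<Rightarrow>\<^sub>0 int) \<Rightarrow> int"
  where "divisor_degree D = (\<Sum>P\<in>Poly_Mapping.keys D. Poly_Mapping.lookup D P)"

definition Div0 :: "'a::{alg_closed_field, field_char_0} ffun \<Rightarrow> ('a ffun set \<Rightarrow>\<^sub>0 int) monoid"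
  where "Div0 w = (free_Abelian_group (places w))
     \<lparr>carrier := {D \<in> carrier (free_Abelian_group (places w)). divisor_degree D = 0}\<rparr>"

definition principal_divisors ::
  "'a::{alg_closed_field, field_char_0} ffun \<Rightarrow> ('a ffun set \<Rightarrow>\<^sub>0 int) set"
  where "principal_divisors w = {D \<in> carrier (free_Abelian_group (places w)).
     \<exists>g\<in>function_field w - {0}. \<forall>P\<in>places w. Poly_Mapping.lookup D P = ord_at P g}"


section \<open>Jacobians (geometric points), Galois action and pullback\<close>

definition Jac :: "'a::{alg_closed_field, field_char_0} ffun \<Rightarrow> ('a ffun set \<Rightarrow>\<^sub>0 int) set monoid"
  where "Jac w = Div0 w Mod principal_divisors w"

definition divisor_class ::
  "'a::{alg_closed_field, field_char_0} ffun \<Rightarrow> ('a ffun set \<Rightarrow>\<^sub>0 int) \<Rightarrow> ('a ffun set \<Rightarrow>\<^sub>0 int) set"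
  where "divisor_class w D = principal_divisors w #>\<^bsub>Div0 w\<^esub> D"

definition div_act :: "'a::{alg_closed_field, field_char_0} ffun \<Rightarrow> ('a \<Rightarrow> 'a) \<Rightarrow>
    ('a ffun set \<Rightarrow>\<^sub>0 int) \<Rightarrow> ('a ffun set \<Rightarrow>\<^sub>0 int)"
  where "div_act w \<sigma> = frag_extend (\<lambda>P. frag_of (fun_act w \<sigma> ` P))"

definition Jac_act :: "'a::{alg_closed_field, field_char_0} ffun \<Rightarrow> ('a \<Rightarrow> 'a) \<Rightarrow>
    ('a ffun set \<Rightarrow>\<^sub>0 int) set \<Rightarrow> ('a ffun set \<Rightarrow>\<^sub>0 int) set"
  where "Jac_act w \<sigma> U = div_act w \<sigma> ` U"

text \<open>An inclusion of function fields \<open>'a(x, v) \<subseteq> 'a(x, w)\<close> is a covering from the curve of \<open>w\<close>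
  to the curve of \<open>v\<close>, which sends a place to its intersection with the smaller field.\<close>

definition fibre :: "'a::{alg_closed_field, field_char_0} ffun \<Rightarrow> 'a ffun \<Rightarrow> 'a ffun set \<Rightarrow> 'a ffun set set"
  where "fibre v w P = {Q \<in> places w. Q \<inter> function_field v = P}"

definition ram_index :: "'a::{alg_closed_field, field_char_0} ffun set \<Rightarrow> 'a ffun set \<Rightarrow> int"
  where "ram_index P Q = (THE e. \<exists>t. uniformizer P t \<and> e = ord_at Q t)"

definition branch_locus :: "'a::{alg_closed_field, field_char_0} ffun \<Rightarrow> 'a ffun \<Rightarrow> 'a ffun set set"
  where "branch_locus v w = {P \<in> places v. \<exists>Q\<in>fibre v w P. ram_index P Q > 1}"

definition div_pullback :: "'a::{alg_closed_field, field_char_0} ffun \<Rightarrow> 'a ffun \<Rightarrow>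
    ('a ffun set \<Rightarrow>\<^sub>0 int) \<Rightarrow> ('a ffun set \<Rightarrow>\<^sub>0 int)"
  where "div_pullback v w =
    frag_extend (\<lambda>P. \<Sum>Q\<in>fibre v w P. frag_cmul (ram_index P Q) (frag_of Q))"

definition Jac_pullback :: "'a::{alg_closed_field, field_char_0} ffun \<Rightarrow> 'a ffun \<Rightarrow>
    ('a ffun set \<Rightarrow>\<^sub>0 int) set \<Rightarrow> ('a ffun set \<Rightarrow>\<^sub>0 int) set"
  where "Jac_pullback v w U = (\<Union>D\<in>U. divisor_class w (div_pullback v w D))"

text \<open>The point of the projective line with \<open>x\<close>-coordinate \<open>\<xi>\<close>.\<close>

definition affine_place :: "'a::{alg_closed_field, field_char_0} \<Rightarrow> 'a ffun set"
  where "affine_place \<xi> = {fun_of_poly p / fun_of_poly q | p q. poly q \<xi> \<noteq> 0}"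


section \<open>Good reduction of a Jacobian\<close>

type_synonym 'a mpolynomial = "(nat \<Rightarrow>\<^sub>0 nat) \<Rightarrow>\<^sub>0 'a"

definition mp_eval :: "'a::comm_ring_1 mpolynomial \<Rightarrow> (nat \<Rightarrow> 'a) \<Rightarrow> 'a"
  where "mp_eval p z = (\<Sum>m\<in>Poly_Mapping.keys p. Poly_Mapping.lookup p m *
     (\<Prod>i\<in>Poly_Mapping.keys m. z i ^ Poly_Mapping.lookup m i))"

definition mp_partial :: "nat \<Rightarrow> 'a::comm_ring_1 mpolynomial \<Rightarrow> (nat \<Rightarrow> 'a) \<Rightarrow> 'a"
  where "mp_partial j p z =
    (\<Sum>m\<in>Poly_Mapping.keys p. Poly_Mapping.lookup p m * of_nat (Poly_Mapping.lookup m j) *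
     (\<Prod>i\<in>Poly_Mapping.keys m. z i ^ (Poly_Mapping.lookup m i - (if i = j then 1 else 0))))"

definition mp_coeffs_in :: "'a::comm_ring_1 set \<Rightarrow> 'a mpolynomial \<Rightarrow> bool"
  where "mp_coeffs_in A p \<longleftrightarrow> (\<forall>m. Poly_Mapping.lookup p m \<in> A)"

definition mp_homogeneous :: "nat set \<Rightarrow> nat \<Rightarrow> 'a::comm_ring_1 mpolynomial \<Rightarrow> bool"
  where "mp_homogeneous V d p \<longleftrightarrow>
    (\<forall>m\<in>Poly_Mapping.keys p. Poly_Mapping.keys m \<subseteq> V \<and> (\<Sum>i\<in>V. Poly_Mapping.lookup m i) = d)"

definition mp_bihomogeneous :: "nat \<Rightarrow> nat \<Rightarrow> nat \<Rightarrow> 'a::comm_ring_1 mpolynomial \<Rightarrow> bool"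
  where "mp_bihomogeneous N d e p \<longleftrightarrow>
    (\<forall>m\<in>Poly_Mapping.keys p. Poly_Mapping.keys m \<subseteq> {..2*N+1}
        \<and> (\<Sum>i\<in>{..N}. Poly_Mapping.lookup m i) = d \<and> (\<Sum>i\<in>{N+1..2*N+1}. Poly_Mapping.lookup m i) = e)"

text \<open>A point of projective \<open>N\<close>-space is the set of its homogeneous coordinate vectors (only the
  entries \<open>0, \<dots>, N\<close> of a vector matter).\<close>

definition proj_point :: "nat \<Rightarrow> (nat \<Rightarrow> 'a::Fields.field) \<Rightarrow> (nat \<Rightarrow> 'a) set"
  where "proj_point N z = {u. \<exists>c. c \<noteq> 0 \<and> (\<forall>i\<le>N. u i = c * z i)}"

definition proj_zeros :: "nat \<Rightarrow> 'a::Fields.field mpolynomial set \<Rightarrow> (nat \<Rightarrow> 'a) set set"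
  where "proj_zeros N F = {proj_point N z | z. (\<exists>i\<le>N. z i \<noteq> 0) \<and> (\<forall>f\<in>F. mp_eval f z = 0)}"

text \<open>The closed subscheme of projective \<open>N\<close>-space over the ring \<open>A\<close> cut out by \<open>F\<close> is smooth of
  relative dimension \<open>g\<close>. Here \<open>R\<close> is a valuation ring of \<open>'a\<close> with maximal ideal \<open>M\<close>, and \<open>A = R \<inter> k\<close>.
  Geometric points of the generic fibre (\<open>q = 0\<close>) and of the special fibre (\<open>q = M\<close>) have coordinates
  in \<open>R\<close>, not all in \<open>q\<close>, read modulo \<open>q\<close>. Near such a point the scheme has to be cut out by
  \<open>N - g\<close> equations with independent differentials: after inverting some form \<open>h\<close> not
  vanishing there, the members of \<open>E\<close> generate the ideal.\<close>

definition smooth_projective_scheme ::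
  "'a::{alg_closed_field, field_char_0} set \<Rightarrow> 'a set \<Rightarrow> 'a set \<Rightarrow> nat \<Rightarrow> nat \<Rightarrow> 'a mpolynomial set \<Rightarrow> bool"
  where "smooth_projective_scheme A R M N g F \<longleftrightarrow>
    finite F \<and> (\<forall>f\<in>F. mp_coeffs_in A f \<and> (\<exists>d. mp_homogeneous {..N} d f)) \<and>
    (\<forall>q\<in>{{0}, M}. \<forall>z. (\<forall>i\<le>N. z i \<in> R) \<and> (\<exists>i\<le>N. z i \<notin> q) \<and> (\<forall>f\<in>F. mp_eval f z \<in> q) \<longrightarrow>
      (\<exists>E\<subseteq>F. card E + g = N \<and>
         (\<forall>c. (\<forall>e\<in>E. c e \<in> R) \<and> (\<forall>i\<le>N. (\<Sum>e\<in>E. c e * mp_partial i e z) \<in> q) \<longrightarrow> (\<forall>e\<in>E. c e \<in> q)) \<and>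
         (\<exists>h d. mp_coeffs_in A h \<and> mp_homogeneous {..N} d h \<and> mp_eval h z \<notin> q \<and>
            (\<forall>f\<in>F. \<exists>b. (\<forall>e\<in>E. mp_coeffs_in A (b e)) \<and> h * f = (\<Sum>e\<in>E. b e * e)))))"

text \<open>\<open>\<phi>\<close> identifies the Jacobian of the curve of \<open>w\<close>, as a variety over \<open>k\<close>, with the projective
  variety defined by \<open>F\<close>: it is a Galois equivariant bijection on geometric points,
  the transported addition is a morphism, and so is the Abel-Jacobi map \<open>P \<mapsto> \<phi>[P - P\<^sub>0]\<close>.
  The universal property of the Jacobian then gives a homomorphism of abelian varieties which is bijective
  on geometric points, hence, in characteristic zero, an isomorphism.\<close>

definition jacobian_variety_model ::
  "'a::{alg_closed_field, field_char_0} set \<Rightarrow> 'a ffun \<Rightarrow> nat \<Rightarrow> 'a mpolynomial set \<Rightarrow>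
     (('a ffun set \<Rightarrow>\<^sub>0 int) set \<Rightarrow> (nat \<Rightarrow> 'a) set) \<Rightarrow> bool"
  where "jacobian_variety_model k w N F \<phi> \<longleftrightarrow>
    bij_betw \<phi> (carrier (Jac w)) (proj_zeros N F) \<and>
    (\<forall>\<sigma>\<in>gal k. \<forall>U\<in>carrier (Jac w). \<phi> (Jac_act w \<sigma> U) = (\<lambda>z. \<sigma> \<circ> z) ` \<phi> U) \<and>
    (\<forall>U\<in>carrier (Jac w). \<forall>V\<in>carrier (Jac w). \<exists>G d e.
       let val = (\<lambda>z u i. mp_eval (G i) (\<lambda>j. if j \<le> N then z j else u (j - (N+1)))) in
       (\<forall>i\<le>N. mp_bihomogeneous N d e (G i)) \<and>
       (\<forall>z\<in>\<phi> U. \<forall>u\<in>\<phi> V. \<exists>i\<le>N. val z u i \<noteq> 0) \<and>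
       (\<forall>U'\<in>carrier (Jac w). \<forall>V'\<in>carrier (Jac w). \<forall>z\<in>\<phi> U'. \<forall>u\<in>\<phi> V'.
          (\<exists>i\<le>N. val z u i \<noteq> 0) \<longrightarrow> val z u \<in> \<phi> (U' \<otimes>\<^bsub>Jac w\<^esub> V'))) \<and>
    (\<exists>P\<^sub>0\<in>places w. \<exists>h. (\<forall>i\<le>N. h i \<in> function_field w) \<and>
       (\<forall>P\<in>places w. \<exists>r\<in>function_field w.
          (\<forall>i\<le>N. r * h i \<in> P) \<and> (\<exists>i\<le>N. r * h i \<notin> max_ideal_of P) \<and>
          (\<lambda>i. residue_at P (r * h i)) \<in> \<phi> (divisor_class w (frag_of P - frag_of P\<^sub>0))))"

definition localization_at :: "'a::{alg_closed_field, field_char_0} set \<Rightarrow> 'a set"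
  where "localization_at \<PP> = {a / b | a b. algebraic_int a \<and> algebraic_int b \<and> b \<notin> \<PP>}"

text \<open>Finite places of \<open>k\<close> are given by primes \<open>\<PP>\<close> of the ring of all algebraic integers above them; the
  valuation ring of \<open>k\<close> is \<open>localization_at \<PP> \<inter> k\<close>. Good reduction is the existence of a smooth
  projective model; such a model of an abelian variety is an abelian scheme, and abelian schemes over
  discrete valuation rings are projective.\<close>

definition jacobian_good_reduction_at ::
  "'a::{alg_closed_field, field_char_0} set \<Rightarrow> 'a ffun \<Rightarrow> 'a set \<Rightarrow> bool"
  where "jacobian_good_reduction_at k w \<PP> \<longleftrightarrow>
    (\<exists>N g F \<phi>. smooth_projective_scheme (localization_at \<PP> \<inter> k) (localization_at \<PP>)
                 (max_ideal_of (localization_at \<PP>)) N g F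
             \<and> jacobian_variety_model k w N F \<phi>)"

definition jacobian_good_reduction_away_from ::
  "nat \<Rightarrow> 'a::{alg_closed_field, field_char_0} set \<Rightarrow> 'a ffun \<Rightarrow> bool"
  where "jacobian_good_reduction_away_from l k w \<longleftrightarrow>
    (\<forall>\<PP>. maximalideal \<PP> (ring_of (integers_of UNIV)) \<and> of_nat l \<notin> \<PP>
        \<longrightarrow> jacobian_good_reduction_at k w \<PP>)"


section \<open>Torsion and Galois modules\<close>

definition torsion :: "nat \<Rightarrow> ('g, 'm) monoid_scheme \<Rightarrow> ('g, 'm) monoid_scheme"
  where "torsion m G = G\<lparr>carrier := {a \<in> carrier G. a [^]\<^bsub>G\<^esub> m = \<one>\<^bsub>G\<^esub>}\<rparr>"

text \<open>The group and its action by automorphisms only; continuity of the action is not part of the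
  definition.\<close>

definition galois_module ::
  "('a \<Rightarrow> 'a) set \<Rightarrow> ('g, 'm) monoid_scheme \<Rightarrow> (('a \<Rightarrow> 'a) \<Rightarrow> 'g \<Rightarrow> 'g) \<Rightarrow> bool"
  where "galois_module \<Gamma> M act \<longleftrightarrow> comm_group M \<and> (\<forall>\<sigma>\<in>\<Gamma>. act \<sigma> \<in> iso M M) \<and>
     (\<forall>a\<in>carrier M. act id a = a \<and> (\<forall>\<sigma>\<in>\<Gamma>. \<forall>\<tau>\<in>\<Gamma>. act (\<sigma> \<circ> \<tau>) a = act \<sigma> (act \<tau> a)))"

definition galois_module_iso ::
  "('a \<Rightarrow> 'a) set \<Rightarrow> ('g, 'm) monoid_scheme \<Rightarrow> (('a \<Rightarrow> 'a) \<Rightarrow> 'g \<Rightarrow> 'g) \<Rightarrow>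
     ('h, 'n) monoid_scheme \<Rightarrow> (('a \<Rightarrow> 'a) \<Rightarrow> 'h \<Rightarrow> 'h) \<Rightarrow> ('g \<Rightarrow> 'h) \<Rightarrow> bool"
  where "galois_module_iso \<Gamma> M act M' act' \<psi> \<longleftrightarrow>
     galois_module \<Gamma> M act \<and> galois_module \<Gamma> M' act' \<and> \<psi> \<in> iso M M' \<and>
     (\<forall>\<sigma>\<in>\<Gamma>. \<forall>a\<in>carrier M. \<psi> (act \<sigma> a) = act' \<sigma> (\<psi> a))"


section \<open>The tower of superelliptic curves\<close>

text \<open>With \<open>y = y\<^sub>n\<close>, the relations \<open>y\<^bsub>s-1\<^esub> = y\<^sub>s ^ l\<close> force \<open>y\<^sub>s = y ^ (l ^ (n - s))\<close>.\<close>

definition tower_coord :: "nat \<Rightarrow> nat \<Rightarrow> 'a::{alg_closed_field, field_char_0} ffun \<Rightarrow> nat \<Rightarrow> 'a ffun"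
  where "tower_coord l n y s = y ^ (l ^ (n - s))"

definition J_tower :: "nat \<Rightarrow> nat \<Rightarrow> 'a::{alg_closed_field, field_char_0} ffun \<Rightarrow> nat \<Rightarrow>
    ('a ffun set \<Rightarrow>\<^sub>0 int) set monoid"
  where "J_tower l n y s = Jac (tower_coord l n y s)"

definition pi_star :: "nat \<Rightarrow> nat \<Rightarrow> 'a::{alg_closed_field, field_char_0} ffun \<Rightarrow> nat \<Rightarrow>
    ('a ffun set \<Rightarrow>\<^sub>0 int) set \<Rightarrow> ('a ffun set \<Rightarrow>\<^sub>0 int) set"
  where "pi_star l n y s = Jac_pullback (tower_coord l n y (s - 1)) (tower_coord l n y s)"

text \<open>Geometric points of the quotient abelian variety \<open>J\<^sub>s / J\<^bsub>s-1\<^esub>\<close>; over an algebraically closed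
  field these are the quotient of the groups of points.\<close>

definition A_tower :: "nat \<Rightarrow> nat \<Rightarrow> 'a::{alg_closed_field, field_char_0} ffun \<Rightarrow> nat \<Rightarrow>
    ('a ffun set \<Rightarrow>\<^sub>0 int) set set monoid"
  where "A_tower l n y s = J_tower l n y s Mod (pi_star l n y s ` carrier (J_tower l n y (s - 1)))"

definition quotient_act :: "nat \<Rightarrow> nat \<Rightarrow> 'a::{alg_closed_field, field_char_0} ffun \<Rightarrow> nat \<Rightarrow>
    ('a \<Rightarrow> 'a) \<Rightarrow> ('a ffun set \<Rightarrow>\<^sub>0 int) set set \<Rightarrow> ('a ffun set \<Rightarrow>\<^sub>0 int) set set"
  where "quotient_act l n y s \<sigma> U = Jac_act (tower_coord l n y s) \<sigma> ` U"

end

theory Submission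
  imports Defs
begin

text \<open>The sequence \<open>0 \<rightarrow> J\<^bsub>s-1\<^esub> \<rightarrow> J\<^sub>s \<rightarrow> A\<^sub>s \<rightarrow> 0\<close> stays exact on \<open>l\<close>-torsion because pullback is injective on divisor
  classes and \<open>J\<^bsub>s-1\<^esub>\<close> is \<open>l\<close>-divisible. Irreducibility gives a root of \<open>f\<close> of order prime to \<open>l\<close>, hence a
  totally ramified place, which yields injectivity: if the pullback of \<open>D\<close> is the divisor of \<open>g\<close>, then \<open>g\<close> is
  an eigenvector of the deck transformation, and its order at that place forces the eigenvalue \<open>1\<close>.
  For divisibility let \<open>\<tau>\<close> generate the group of \<open>C\<^sub>s\<close> over the projective line. Every \<open>x - a\<close> is a norm
  (an explicit form of Tsen's theorem), so \<open>J\<^sub>s = (1 - \<tau>) J\<^sub>s\<close>; and \<open>(1 - \<tau>) ^ (l ^ s)\<close> is divisible by \<open>l\<close>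
  in \<open>\<int>[\<tau>]\<close> since \<open>\<tau> ^ (l ^ s) = 1\<close>.\<close>

section \<open>Valuation rings and discrete valuations\<close>

text \<open>A Jacobian is here nothing but a group of divisor classes, so multiplication by
  \<open>l\<close> cannot be recognised as an isogeny, and its surjectivity has to be produced by
  explicit divisors. Norms help because the divisor of the norm of \<open>g\<close> is the
  push-forward of the divisor of \<open>g\<close>. Once linear polynomials are norms, every
  difference of two points of the line is the push-forward of a principal divisor upstairs, and a
  divisor of degree 0 can be moved in its class to one of degree 0 on every fibre. Such a divisor
  lies in the image of \<open>1 - \<tau>\<close>: a fibre is a single orbit, and the totally
  ramified place is a fixed base point. The other obstacle is that a place is given as a bare
  valuation ring over the constants. That it is discrete with residue field the constants, that
  fibres are finite orbits, and that principal divisors have degree 0 is checked on the projective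
  line and carried up through a cyclic Kummer extension.\<close>

locale subfld =
  fixes K :: "'b::Fields.field set"
  assumes one_mem: "1 \<in> K"
    and diff_mem: "a \<in> K \<Longrightarrow> b \<in> K \<Longrightarrow> a - b \<in> K"
    and mult_mem: "a \<in> K \<Longrightarrow> b \<in> K \<Longrightarrow> a * b \<in> K"
    and inverse_mem: "a \<in> K \<Longrightarrow> inverse a \<in> K"
begin

lemma zero_mem: "0 \<in> K" using diff_mem[OF one_mem one_mem] by simp
lemma uminus_mem: "a \<in> K \<Longrightarrow> - a \<in> K" using diff_mem[OF zero_mem] by simp
lemma add_mem: "a \<in> K \<Longrightarrow> b \<in> K \<Longrightarrow> a + b \<in> K"
  using diff_mem[of a "- b"] uminus_mem by simp
lemma divide_mem: "a \<in> K \<Longrightarrow> b \<in> K \<Longrightarrow> a / b \<in> K"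
  by (simp add: divide_inverse mult_mem inverse_mem)
lemma power_mem: "a \<in> K \<Longrightarrow> a ^ n \<in> K" by (induction n) (auto simp: one_mem mult_mem)
lemma power_int_mem: "a \<in> K \<Longrightarrow> a powi n \<in> K"
  by (auto simp: power_int_def power_mem inverse_mem)
lemma sum_mem: "(\<And>i. i \<in> A \<Longrightarrow> u i \<in> K) \<Longrightarrow> sum u A \<in> K"
  by (induction A rule: infinite_finite_induct) (auto simp: zero_mem add_mem)
lemma prod_mem: "(\<And>i. i \<in> A \<Longrightarrow> u i \<in> K) \<Longrightarrow> prod u A \<in> K"
  by (induction A rule: infinite_finite_induct) (auto simp: one_mem mult_mem)

lemmas mem_rules = zero_mem one_mem uminus_mem add_mem diff_mem mult_mem inverse_mem divide_mem
  power_mem power_int_mem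

end

text \<open>\<open>P = K\<close> is allowed and no value group is given: places arrive as bare
  valuation rings, and properness and discreteness enter separately.\<close>

locale val_ring = subfld K for K :: "'b::Fields.field set" +
  fixes P :: "'b set"
  assumes subset: "P \<subseteq> K"
    and one_in: "1 \<in> P"
    and diff_in: "a \<in> P \<Longrightarrow> b \<in> P \<Longrightarrow> a - b \<in> P"
    and mult_in: "a \<in> P \<Longrightarrow> b \<in> P \<Longrightarrow> a * b \<in> P"
    and total: "a \<in> K \<Longrightarrow> a \<in> P \<or> inverse a \<in> P"
begin

abbreviation M where "M \<equiv> max_ideal_of P"

lemma zero_in: "0 \<in> P" using diff_in[OF one_in one_in] by simp
lemma uminus_in: "a \<in> P \<Longrightarrow> - a \<in> P" using diff_in[OF zero_in] by simp
lemma add_in: "a \<in> P \<Longrightarrow> b \<in> P \<Longrightarrow> a + b \<in> P"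
  using diff_in[of a "- b"] uminus_in by simp
lemma power_in: "a \<in> P \<Longrightarrow> a ^ n \<in> P" by (induction n) (auto simp: one_in mult_in)
lemma sum_in: "(\<And>i. i \<in> A \<Longrightarrow> u i \<in> P) \<Longrightarrow> sum u A \<in> P"
  by (induction A rule: infinite_finite_induct) (auto simp: zero_in add_in)
lemma in_K: "a \<in> P \<Longrightarrow> a \<in> K" using subset by blast
lemma M_in: "a \<in> M \<Longrightarrow> a \<in> P" by (simp add: max_ideal_of_def)
lemma zero_in_M: "0 \<in> M" by (simp add: max_ideal_of_def zero_in)
lemma one_notin_M: "1 \<notin> M" by (simp add: max_ideal_of_def one_in)

lemma mult_M: "a \<in> M \<Longrightarrow> b \<in> P \<Longrightarrow> a * b \<in> M"
proof -
  assume a: "a \<in> M" and b: "b \<in> P"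
  have "inverse a \<in> P" if "a * b \<noteq> 0" "inverse (a * b) \<in> P"
  proof -
    have "b * inverse (a * b) = inverse a" using that(1) by (simp add: field_simps)
    then show ?thesis using mult_in[OF b that(2)] by argo
  qed
  then show ?thesis using a b by (auto simp: max_ideal_of_def mult_in)
qed

lemma M_iff: "a \<in> K \<Longrightarrow> a \<noteq> 0 \<Longrightarrow> a \<in> M \<longleftrightarrow> inverse a \<notin> P"
  using total by (auto simp: max_ideal_of_def)

lemma add_M:
  assumes a: "a \<in> M" and b: "b \<in> M"
  shows "a + b \<in> M"
proof (cases "a = 0 \<or> b = 0")
  case False
  have "a / b \<in> P \<or> b / a \<in> P"
    using total[of "a / b"] divide_mem[OF in_K in_K] a b M_in by fastforce
  then show ?thesis
  proof
    assume "a / b \<in> P"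
    then have "b * (1 + a / b) \<in> M" using b by (intro mult_M add_in one_in)
    then show ?thesis using False by (simp add: field_simps)
  next
    assume "b / a \<in> P"
    then have "a * (1 + b / a) \<in> M" using a by (intro mult_M add_in one_in)
    then show ?thesis using False by (simp add: field_simps)
  qed
qed (use a b in auto)

lemma uminus_M: "a \<in> M \<Longrightarrow> - a \<in> M"
  using mult_M[of a "-1"] uminus_in[OF one_in] by simp
lemma diff_M: "a \<in> M \<Longrightarrow> b \<in> M \<Longrightarrow> a - b \<in> M"
  using add_M[of a "- b"] uminus_M by simp
lemma sum_M: "(\<And>i. i \<in> A \<Longrightarrow> u i \<in> M) \<Longrightarrow> sum u A \<in> M"
  by (induction A rule: infinite_finite_induct) (auto simp: zero_in_M add_M)

lemma M_prime: "a \<in> P \<Longrightarrow> b \<in> P \<Longrightarrow> a * b \<in> M \<Longrightarrow> a \<in> M \<or> b \<in> M"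
  using mult_in[of "inverse a" "inverse b"] by (auto simp: max_ideal_of_def)

lemma power_in_iff:
  assumes "a \<in> K" "n > 0"
  shows "a ^ n \<in> P \<longleftrightarrow> a \<in> P"
proof
  assume an: "a ^ n \<in> P"
  show "a \<in> P"
  proof (rule ccontr)
    assume na: "a \<notin> P"
    then have "inverse a \<in> P" and "a \<noteq> 0" using total[OF assms(1)] zero_in by auto
    then have "inverse a ^ (n - 1) * a ^ n \<in> P" by (intro mult_in power_in an)
    also have "inverse a ^ (n - 1) * a ^ n = a"
      using \<open>a \<noteq> 0\<close> \<open>n > 0\<close> by (cases n) (auto simp: field_simps)
    finally show False using na by simp
  qed
qed (rule power_in)

text \<open>Otherwise \<open>inverse g\<close> lies in \<open>P\<close>, and dividing the equation
  by \<open>g ^ (n - 1)\<close> writes \<open>g\<close> itself as a polynomial in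
  \<open>inverse g\<close> with coefficients in \<open>P\<close>.\<close>

lemma integrally_closed:
  assumes "g \<in> K" "\<And>i. i < n \<Longrightarrow> c i \<in> P" "g ^ n = (\<Sum>i<n. c i * g ^ i)"
  shows "g \<in> P"
proof (rule ccontr)
  assume g: "g \<notin> P"
  then have ig: "inverse g \<in> P" and "g \<noteq> 0" using total[OF assms(1)] zero_in by auto
  have "n > 0" using assms(3) by (cases n) auto
  have "g = g ^ n / g ^ (n - 1)"
    using \<open>g \<noteq> 0\<close> \<open>n > 0\<close> by (cases n) auto
  also have "\<dots> = (\<Sum>i<n. c i * g ^ i) / g ^ (n - 1)" using assms(3) by simp
  also have "\<dots> = (\<Sum>i<n. c i * inverse g ^ (n - 1 - i))"
    unfolding sum_divide_distrib
  proof (rule sum.cong[OF refl])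
    fix i assume "i \<in> {..<n}"
    then have "g ^ (n - 1) = g ^ i * g ^ (n - 1 - i)" by (simp flip: power_add)
    then show "c i * g ^ i / g ^ (n - 1) = c i * inverse g ^ (n - 1 - i)"
      using \<open>g \<noteq> 0\<close> by (simp add: field_simps)
  qed
  also have "\<dots> \<in> P" by (intro sum_in mult_in power_in ig) (use assms(2) in auto)
  finally show False using g by simp
qed



text \<open>The least value in a vanishing sum is attained twice: divided by a term of least value,
  all other terms would otherwise lie in \<open>M\<close> and sum to \<open>-1\<close>. Equality of
  values is expressed by divisibility in both directions because no value function exists
  yet.\<close>

lemma sum_eq_0_same_value:
  assumes "finite A" "A \<noteq> {}" "\<And>i. i \<in> A \<Longrightarrow> u i \<in> K - {0}" "sum u A = 0"
  obtains i j where "i \<in> A" "j \<in> A" "i \<noteq> j" "u i / u j \<in> P" "u j / u i \<in> P"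
proof -
  have "\<exists>j\<in>A. \<forall>i\<in>A. u i / u j \<in> P"
    using assms(1-3)
  proof (induction A rule: finite_ne_induct)
    case (singleton x)
    then show ?case by (simp add: one_in)
  next
    case (insert x A)
    then obtain j where j: "j \<in> A" "\<And>i. i \<in> A \<Longrightarrow> u i / u j \<in> P" by auto
    have K: "u x \<in> K - {0}" "u j \<in> K - {0}" using insert.prems j by auto
    then have "u x / u j \<in> P \<or> u j / u x \<in> P"
      using total[of "u x / u j"] divide_mem by fastforce
    then show ?case
    proof
      assume "u x / u j \<in> P"
      then show ?thesis using j by auto
    next
      assume jx: "u j / u x \<in> P"
      have "u i / u x \<in> P" if "i \<in> A" for i
      proof -
        have "(u i / u j) * (u j / u x) = u i / u x" using K by (simp add: field_simps)
        then show ?thesis using mult_in[OF j(2)[OF that] jx] by argo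
      qed
      then show ?thesis using K one_in by auto
    qed
  qed
  then obtain j where j: "j \<in> A" "\<And>i. i \<in> A \<Longrightarrow> u i / u j \<in> P" by auto
  have "\<exists>i\<in>A - {j}. u j / u i \<in> P"
  proof (rule ccontr)
    assume neg: "\<not> ?thesis"
    have "u i / u j \<in> M" if "i \<in> A - {j}" for i
      using neg that j(2)[of i] by (auto simp: max_ideal_of_def)
    then have "(\<Sum>i\<in>A - {j}. u i / u j) \<in> M" by (rule sum_M)
    also have "(\<Sum>i\<in>A - {j}. u i / u j) = (sum u A - u j) / u j"
      using j(1) assms(1) by (simp add: sum_diff1 sum_divide_distrib[symmetric])
    also have "\<dots> = - 1" using assms(3)[OF j(1)] assms(4) by simp
    finally show False using uminus_M[of "-1"] one_notin_M by simp
  qed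
  then obtain i where "i \<in> A" "i \<noteq> j" "u j / u i \<in> P" by auto
  then show thesis using that[of i j] j by auto
qed

end

text \<open>The ultrametric inequality is not a separate clause: it follows from the second one,
  since the rings \<open>P\<close> in question are closed under addition. The value at
  \<open>0\<close> is left free.\<close>

definition is_val :: "'b::Fields.field set \<Rightarrow> 'b set \<Rightarrow> ('b \<Rightarrow> int) \<Rightarrow> bool"
  where "is_val K P \<phi> \<longleftrightarrow> (\<forall>g\<in>K - {0}. \<forall>h\<in>K - {0}. \<phi> (g * h) = \<phi> g + \<phi> h)
     \<and> (\<forall>g\<in>K - {0}. g \<in> P \<longleftrightarrow> 0 \<le> \<phi> g)"

context subfld
begin

lemma is_val_mult: "is_val K P \<phi> \<Longrightarrow> g \<in> K \<Longrightarrow> h \<in> K \<Longrightarrow> g \<noteq> 0 \<Longrightarrow> h \<noteq> 0 \<Longrightarrow> \<phi> (g * h) = \<phi> g + \<phi> h"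
  by (simp add: is_val_def)

lemma is_val_nonneg: "is_val K P \<phi> \<Longrightarrow> g \<in> K \<Longrightarrow> g \<noteq> 0 \<Longrightarrow> g \<in> P \<longleftrightarrow> 0 \<le> \<phi> g"
  by (simp add: is_val_def)

lemma is_val_one: "is_val K P \<phi> \<Longrightarrow> \<phi> 1 = 0"
  using is_val_mult[of P \<phi> 1 1] one_mem by simp

lemma is_val_inverse:
  assumes "is_val K P \<phi>" "g \<in> K" "g \<noteq> 0"
  shows "\<phi> (inverse g) = - \<phi> g"
  using is_val_mult[OF assms(1,2) inverse_mem[OF assms(2)]] assms is_val_one[OF assms(1)] by simp

lemma is_val_divide:
  assumes "is_val K P \<phi>" "g \<in> K" "g \<noteq> 0" "h \<in> K" "h \<noteq> 0"
  shows "\<phi> (g / h) = \<phi> g - \<phi> h"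
  using is_val_mult[OF assms(1,2) inverse_mem[OF assms(4)]] is_val_inverse assms
  by (simp add: divide_inverse)

lemma is_val_power:
  assumes "is_val K P \<phi>" "g \<in> K" "g \<noteq> 0"
  shows "\<phi> (g ^ n) = int n * \<phi> g"
  by (induction n) (use assms in \<open>auto simp: is_val_one is_val_mult power_mem algebra_simps\<close>)

lemma is_val_power_int:
  assumes "is_val K P \<phi>" "g \<in> K" "g \<noteq> 0"
  shows "\<phi> (g powi n) = n * \<phi> g"
  using assms is_val_power[OF assms(1), of "inverse g"] is_val_power[OF assms]
  by (auto simp: power_int_def inverse_mem is_val_inverse)

end

text \<open>Any integer-valued valuation that is not identically zero will do. Lifting a place along
  an extension produces a multiple of the normalised valuation, and \<open>normalized_val\<close>
  rescales afterwards.\<close>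

locale dvr = val_ring K P for K :: "'b::Fields.field set" and P +
  assumes discrete: "\<exists>\<phi>. is_val K P \<phi> \<and> (\<exists>g\<in>K - {0}. \<phi> g \<noteq> 0)"
begin

text \<open>The least positive value \<open>d\<close> divides all values, as a remainder modulo
  \<open>d\<close> would be a smaller positive value; dividing by \<open>d\<close>
  normalises.\<close>

lemma normalized_val: "\<exists>\<phi>. is_val K P \<phi> \<and> (\<exists>g\<in>K - {0}. \<phi> g = 1)"
proof -
  obtain \<phi> g where v: "is_val K P \<phi>" and g: "g \<in> K" "g \<noteq> 0" "\<phi> g \<noteq> 0" using discrete by auto
  have "\<exists>n::nat. n > 0 \<and> (\<exists>g\<in>K - {0}. \<phi> g = int n)"
  proof (cases "\<phi> g > 0")
    case True
    then show ?thesis using g by (intro exI[of _ "nat (\<phi> g)"]) auto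
  next
    case False
    then show ?thesis using g is_val_inverse[OF v g(1,2)] inverse_mem[OF g(1)]
      by (intro exI[of _ "nat (- \<phi> g)"]) (auto intro!: bexI[of _ "inverse g"])
  qed
  define d where "d = (LEAST n::nat. n > 0 \<and> (\<exists>g\<in>K - {0}. \<phi> g = int n))"
  have d: "d > 0 \<and> (\<exists>g\<in>K - {0}. \<phi> g = int d)"
    unfolding d_def by (rule LeastI_ex) fact
  then obtain t where t: "t \<in> K" "t \<noteq> 0" "\<phi> t = int d" by auto
  have dvd: "int d dvd \<phi> h" if h: "h \<in> K" "h \<noteq> 0" for h
  proof (rule ccontr)
    assume "\<not> ?thesis"
    then have pos: "\<phi> h mod int d > 0"
      by (metis d dvd_eq_mod_eq_0 of_nat_0_less_iff pos_mod_sign order_le_less)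
    define h' where "h' = h / t powi (\<phi> h div int d)"
    have h': "h' \<in> K" "h' \<noteq> 0" using h t by (auto simp: h'_def power_int_mem divide_mem)
    have "\<phi> h' = \<phi> h - (\<phi> h div int d) * int d"
      unfolding h'_def using t h
      by (subst is_val_divide[OF v]) (auto simp: power_int_mem is_val_power_int[OF v])
    then have "\<phi> h' = int (nat (\<phi> h mod int d))"
      using pos by (simp add: minus_div_mult_eq_mod)
    then have "nat (\<phi> h mod int d) > 0 \<and> (\<exists>g\<in>K - {0}. \<phi> g = int (nat (\<phi> h mod int d)))"
      using pos h' by (intro conjI bexI[of _ h']) auto
    then have "d \<le> nat (\<phi> h mod int d)"
      unfolding d_def by (rule Least_le)
    moreover have "\<phi> h mod int d < int d" using d by simp
    ultimately show False using pos by linarith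
  qed
  have "is_val K P (\<lambda>g. \<phi> g div int d)"
    unfolding is_val_def
  proof (intro conjI ballI)
    fix g h assume "g \<in> K - {0}" "h \<in> K - {0}"
    then show "\<phi> (g * h) div int d = \<phi> g div int d + \<phi> h div int d"
      using dvd by (simp add: is_val_mult[OF v] div_plus_div_distrib_dvd_left)
  next
    fix g assume "g \<in> K - {0}"
    then show "g \<in> P \<longleftrightarrow> 0 \<le> \<phi> g div int d"
      using d is_val_nonneg[OF v] by (simp add: pos_imp_zdiv_nonneg_iff)
  qed
  moreover have "\<phi> t div int d = 1" using t d by simp
  ultimately show ?thesis using t(1,2) by blast
qed

lemma M_iff_val:
  assumes v: "is_val K P \<phi>" and "a \<in> K"
  shows "a \<in> M \<longleftrightarrow> a = 0 \<or> \<phi> a > 0"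
proof (cases "a = 0")
  case False
  then show ?thesis
    using M_iff[OF assms(2) False] is_val_nonneg[OF v inverse_mem[OF assms(2)]]
      is_val_inverse[OF v assms(2) False] by auto
qed (simp add: zero_in_M)

lemma uniformizer_iff_val:
  assumes v: "is_val K P \<phi>" and t: "t \<in> K" "t \<noteq> 0" "\<phi> t = 1"
  shows "uniformizer P s \<longleftrightarrow> s \<in> K \<and> s \<noteq> 0 \<and> \<phi> s = 1"
proof
  assume u: "uniformizer P s"
  then have "s * 1 \<in> M" using one_in unfolding uniformizer_def by blast
  then have s: "s \<in> K" "s \<in> M" using M_in in_K by auto
  have "t \<in> M" using t M_iff_val[OF v] by simp
  then obtain a where a: "a \<in> P" "t = s * a" using u unfolding uniformizer_def by blast
  then have "s \<noteq> 0" "a \<noteq> 0" using t by auto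
  moreover have "\<phi> s > 0" using s M_iff_val[OF v] \<open>s \<noteq> 0\<close> by auto
  moreover have "1 = \<phi> s + \<phi> a" using t a is_val_mult[OF v s(1) in_K] calculation by simp
  moreover have "\<phi> a \<ge> 0" using a is_val_nonneg[OF v in_K] calculation by auto
  ultimately show "s \<in> K \<and> s \<noteq> 0 \<and> \<phi> s = 1" using s by auto
next
  assume s: "s \<in> K \<and> s \<noteq> 0 \<and> \<phi> s = 1"
  have "a \<in> M \<longleftrightarrow> a \<in> (\<lambda>a. s * a) ` P" for a
  proof
    assume a: "a \<in> M"
    then have aK: "a \<in> K" using M_in in_K by auto
    have "a / s \<in> P"
    proof (cases "a = 0")
      case False
      then have "\<phi> (a / s) \<ge> 0" using a M_iff_val[OF v aK] is_val_divide[OF v aK] s by auto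
      then show ?thesis using is_val_nonneg[OF v, of "a / s"] False s aK divide_mem by auto
    qed (simp add: zero_in)
    then show "a \<in> (\<lambda>a. s * a) ` P" using s by (intro image_eqI[of _ _ "a / s"]) auto
  next
    assume "a \<in> (\<lambda>a. s * a) ` P"
    then obtain b where b: "b \<in> P" "a = s * b" by auto
    have "s \<in> M" using M_iff_val[OF v] s by auto
    then show "a \<in> M" using b mult_M by auto
  qed
  then show "uniformizer P s" unfolding uniformizer_def by blast
qed

text \<open>Every uniformizer has value 1, so the description defining \<open>ord_at\<close> does
  not depend on the uniformizer and agrees with any normalised valuation.\<close>

lemma ord_at_eqI:
  assumes v: "is_val K P \<phi>" and t: "t \<in> K" "t \<noteq> 0" "\<phi> t = 1" and g: "g \<in> K" "g \<noteq> 0"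
  shows "ord_at P g = \<phi> g"
proof -
  note M = M_iff_val[OF v] and unif = uniformizer_iff_val[OF v t]
  have key: "g / s powi e \<in> P - M \<longleftrightarrow> \<phi> g = e" if "s \<in> K" "s \<noteq> 0" "\<phi> s = 1" for s e
  proof -
    have "\<phi> (g / s powi e) = \<phi> g - e"
      using that g by (subst is_val_divide[OF v]) (auto simp: power_int_mem is_val_power_int[OF v])
    moreover have "g / s powi e \<in> K" "g / s powi e \<noteq> 0" using that g by (auto simp: power_int_mem divide_mem)
    ultimately show ?thesis using M is_val_nonneg[OF v] by auto
  qed
  show ?thesis unfolding ord_at_def
  proof (rule the_equality)
    show "\<exists>t. uniformizer P t \<and> g / t powi \<phi> g \<in> P - M"
      using key[OF t] t unif by auto
  next
    fix e assume "\<exists>t. uniformizer P t \<and> g / t powi e \<in> P - M"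
    then obtain s where "uniformizer P s" "g / s powi e \<in> P - M" by blast
    then show "e = \<phi> g" using key[of s e] unif[of s] by blast
  qed
qed

lemma is_val_ord_at: "is_val K P (ord_at P)"
  and ex_uniformizer: "\<exists>t\<in>K - {0}. ord_at P t = 1"
proof -
  obtain \<phi> t where v: "is_val K P \<phi>" and t: "t \<in> K" "t \<noteq> 0" "\<phi> t = 1" using normalized_val by auto
  have *: "ord_at P g = \<phi> g" if "g \<in> K" "g \<noteq> 0" for g using ord_at_eqI[OF v t that] .
  show "is_val K P (ord_at P)"
    using v unfolding is_val_def by (auto simp: * mult_mem)
  show "\<exists>t\<in>K - {0}. ord_at P t = 1" using t * by auto
qed

lemmas ord_mult = is_val_mult[OF is_val_ord_at]
lemmas ord_nonneg_iff = is_val_nonneg[OF is_val_ord_at]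
lemmas ord_one = is_val_one[OF is_val_ord_at]
lemmas ord_inverse = is_val_inverse[OF is_val_ord_at]
lemmas ord_divide = is_val_divide[OF is_val_ord_at]
lemmas ord_power = is_val_power[OF is_val_ord_at]
lemmas ord_power_int = is_val_power_int[OF is_val_ord_at]

lemma uniformizer_iff: "uniformizer P s \<longleftrightarrow> s \<in> K \<and> s \<noteq> 0 \<and> ord_at P s = 1"
  using uniformizer_iff_val[OF is_val_ord_at] ex_uniformizer by blast

lemma ord_pos_iff: "g \<in> K \<Longrightarrow> g \<noteq> 0 \<Longrightarrow> g \<in> M \<longleftrightarrow> 0 < ord_at P g"
  using ord_nonneg_iff[of "inverse g"] by (auto simp: M_iff inverse_mem ord_inverse)

lemma ord_zero_iff: "g \<in> K \<Longrightarrow> g \<noteq> 0 \<Longrightarrow> ord_at P g = 0 \<longleftrightarrow> g \<in> P \<and> inverse g \<in> P"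
  using ord_nonneg_iff[of "inverse g"] ord_nonneg_iff[of g] by (auto simp: inverse_mem ord_inverse)

lemma ord_prod:
  "(\<And>i. i \<in> A \<Longrightarrow> u i \<in> K - {0}) \<Longrightarrow> ord_at P (prod u A) = (\<Sum>i\<in>A. ord_at P (u i))"
proof (induction A rule: infinite_finite_induct)
  case (insert x A)
  then have "prod u A \<in> K" "prod u A \<noteq> 0" by (auto intro!: prod_mem)
  then show ?case using insert by (simp add: ord_mult)
qed (auto simp: ord_one)

lemma ord_add_ge:
  assumes "g \<in> K" "h \<in> K" "g \<noteq> 0" "h \<noteq> 0" "g + h \<noteq> 0"
  shows "min (ord_at P g) (ord_at P h) \<le> ord_at P (g + h)"
proof -
  have *: "ord_at P g \<le> ord_at P (g + h)"
    if "g \<in> K" "h \<in> K" "g \<noteq> 0" "h \<noteq> 0" "g + h \<noteq> 0" "ord_at P g \<le> ord_at P h" for g h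
  proof -
    have "h / g \<in> P" using that ord_nonneg_iff[of "h / g"] by (simp add: divide_mem ord_divide)
    then have "(g + h) / g \<in> P" using add_in[OF one_in] that by (simp add: add_divide_distrib)
    then show ?thesis using that ord_nonneg_iff[of "(g + h) / g"]
      by (simp add: divide_mem ord_divide add_mem)
  qed
  show ?thesis using *[of g h] *[of h g] assms by (auto simp: min_def add.commute)
qed

lemma ord_uminus:
  assumes "g \<in> K" "g \<noteq> 0" shows "ord_at P (- g) = ord_at P g"
proof -
  have "2 * ord_at P (-1) = 0"
    using ord_mult[of "-1" "-1"] ord_one by (simp add: one_mem uminus_mem)
  then show ?thesis using ord_mult[of "-1" g] assms by (simp add: one_mem uminus_mem)
qed

lemma ord_add_eq:
  assumes "g \<in> K" "h \<in> K" "g \<noteq> 0" "h \<noteq> 0" "ord_at P g < ord_at P h"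
  shows "g + h \<noteq> 0" "ord_at P (g + h) = ord_at P g"
proof -
  show *: "g + h \<noteq> 0"
    using ord_uminus[OF assms(2,4)] assms(5) by (metis add_eq_0_iff2 less_irrefl)
  show "ord_at P (g + h) = ord_at P g"
    using ord_add_ge[OF assms(1-4) *] ord_add_ge[of "g + h" "- h"] assms * ord_uminus[OF assms(2,4)]
    by (auto simp: add_mem uminus_mem)
qed

text \<open>A ring strictly above \<open>P\<close> contains an element \<open>b\<close> of negative
  order, and dividing by a large power of \<open>b\<close> moves any element of \<open>K\<close>
  into \<open>P\<close>. An inclusion of places is therefore an equality.\<close>

lemma dvr_maximal:
  assumes "val_ring K P'" "P \<subseteq> P'" "P' \<noteq> K"
  shows "P' = P"
proof (rule ccontr)
  interpret P': val_ring K P' by fact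
  assume "P' \<noteq> P"
  then obtain b where b: "b \<in> P'" "b \<notin> P" using assms(2) by blast
  then have bK: "b \<in> K" "b \<noteq> 0" using P'.in_K zero_in by auto
  have ob: "ord_at P b < 0" using b bK ord_nonneg_iff[of b] by auto
  have "g \<in> P'" if g: "g \<in> K" for g
  proof (cases "g = 0")
    case False
    define N where "N = nat \<bar>ord_at P g\<bar>"
    have "int N * ord_at P b \<le> int N * (- 1)" using ob by (intro mult_left_mono) auto
    then have "ord_at P (g / b ^ N) \<ge> 0"
      using g bK False by (simp add: ord_divide power_mem ord_power N_def)
    then have "g / b ^ N \<in> P" using ord_nonneg_iff[of "g / b ^ N"] g bK False
      by (simp add: divide_mem power_mem)
    then have "(g / b ^ N) * b ^ N \<in> P'" using assms(2) b by (intro P'.mult_in P'.power_in) auto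
    then show ?thesis using bK by simp
  qed (simp add: P'.zero_in)
  then show False using assms(3) P'.in_K by blast
qed

lemma proper: "P \<noteq> K"
proof
  assume PK: "P = K"
  obtain t where "t \<in> K" "t \<noteq> 0" "ord_at P t = 1" using ex_uniformizer by auto
  then have "inverse t \<in> P" using PK inverse_mem by simp
  then show False using ord_nonneg_iff[of "inverse t"] \<open>t \<in> K\<close> \<open>t \<noteq> 0\<close> \<open>ord_at P t = 1\<close>
    ord_inverse[of t] inverse_mem by auto
qed

end

section \<open>Weak approximation at finitely many discrete places\<close>

lemma ex_ord_pos_notin:
  assumes "dvr K Q" "dvr K Q'" "Q \<noteq> Q'"
  shows "\<exists>h\<in>K. h \<in> max_ideal_of Q \<and> h \<notin> Q'"
proof -
  interpret Q: dvr K Q by fact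
  interpret Q': dvr K Q' by fact
  obtain a where a: "a \<in> Q" "a \<notin> Q'"
    using Q.dvr_maximal[OF Q'.val_ring_axioms] Q'.proper assms(3) by blast
  obtain b where b: "b \<in> Q'" "b \<notin> Q"
    using Q'.dvr_maximal[OF Q.val_ring_axioms] Q.proper assms(3) by blast
  have K: "a \<in> K" "b \<in> K" "a \<noteq> 0" "b \<noteq> 0" using a b Q.in_K Q'.in_K Q.zero_in Q'.zero_in by auto
  have "ord_at Q (a / b) > 0" "ord_at Q' (a / b) < 0"
    using a b K Q.ord_nonneg_iff Q'.ord_nonneg_iff by (force simp: Q.ord_divide Q'.ord_divide)+
  then show ?thesis using K Q.ord_pos_iff[of "a / b"] Q'.ord_nonneg_iff[of "a / b"]
    by (intro bexI[of _ "a / b"]) (auto simp: Q.divide_mem)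
qed

text \<open>In the induction step \<open>h\<close> has poles on \<Omega> and \<open>h'\<close> has
  one at the new place \<open>R\<close>; the combination \<open>h + c * h'\<close> is tried for all
  \<open>c\<close> in the infinite set \<open>C\<close>. Each place rejects at most one
  \<open>c\<close>: two would put first \<open>h'\<close>, then \<open>h\<close> into its
  ring.\<close>

lemma separating_element:
  assumes "finite \<Omega>" "dvr K Q" "\<And>Q'. Q' \<in> \<Omega> \<Longrightarrow> dvr K Q' \<and> Q' \<noteq> Q"
    and C: "infinite C" "\<And>c. c \<in> C \<Longrightarrow> c \<in> Q" "\<And>Q' c. Q' \<in> \<Omega> \<Longrightarrow> c \<in> C \<Longrightarrow> c \<in> Q'"
      "\<And>Q' c d. Q' \<in> \<Omega> \<Longrightarrow> c \<in> C \<Longrightarrow> d \<in> C \<Longrightarrow> inverse (c - d) \<in> Q'"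
  shows "\<exists>h\<in>max_ideal_of Q. \<forall>Q'\<in>\<Omega>. h \<notin> Q'"
  using assms(1,3) C(3,4)
proof (induction \<Omega> rule: finite_induct)
  case empty
  interpret Q: dvr K Q by fact
  show ?case using Q.zero_in_M by auto
next
  case (insert R \<Omega>)
  interpret Q: dvr K Q by fact
  obtain h where h: "h \<in> max_ideal_of Q" "\<And>Q'. Q' \<in> \<Omega> \<Longrightarrow> h \<notin> Q'"
    using insert by auto
  obtain h' where h': "h' \<in> max_ideal_of Q" "h' \<notin> R"
    using ex_ord_pos_notin[of K Q R] insert.prems assms(2) by auto
  have bad: "finite {c \<in> C. h + c * h' \<in> Q'}" if Q': "Q' \<in> insert R \<Omega>" for Q'
  proof -
    interpret Q': dvr K Q' using insert.prems Q' by auto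
    have "c = d" if c: "c \<in> C" "h + c * h' \<in> Q'" and d: "d \<in> C" "h + d * h' \<in> Q'" for c d
    proof (rule ccontr)
      assume "c \<noteq> d"
      have "inverse (c - d) * ((h + c * h') - (h + d * h')) \<in> Q'"
        using c d insert.prems Q' by (intro Q'.mult_in Q'.diff_in) auto
      also have "inverse (c - d) * ((h + c * h') - (h + d * h')) = inverse (c - d) * (c - d) * h'"
        by (simp add: algebra_simps)
      finally have h'Q: "h' \<in> Q'" using \<open>c \<noteq> d\<close> by simp
      have cQ: "c \<in> Q'" using c Q' insert.prems by auto
      have "h + c * h' - c * h' \<in> Q'" using h'Q cQ c by (intro Q'.diff_in Q'.mult_in) auto
      then show False using h'Q h h' Q' by auto
    qed
    then have one: "\<And>c d. c \<in> {c \<in> C. h + c * h' \<in> Q'} \<Longrightarrow> d \<in> {c \<in> C. h + c * h' \<in> Q'} \<Longrightarrow> c = d"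
      by blast
    show ?thesis
    proof (cases "{c \<in> C. h + c * h' \<in> Q'} = {}")
      case False
      then obtain c where "c \<in> {c \<in> C. h + c * h' \<in> Q'}" by blast
      then have "{c \<in> C. h + c * h' \<in> Q'} \<subseteq> {c}" using one by blast
      then show ?thesis by (rule finite_subset) simp
    qed (simp only: finite.emptyI)
  qed
  have "finite (\<Union>Q'\<in>insert R \<Omega>. {c \<in> C. h + c * h' \<in> Q'})"
    using bad insert.hyps by blast
  then have "C - (\<Union>Q'\<in>insert R \<Omega>. {c \<in> C. h + c * h' \<in> Q'}) \<noteq> {}"
    using C(1) by (metis Diff_infinite_finite finite.emptyI)
  then obtain c where c: "c \<in> C" "\<And>Q'. Q' \<in> insert R \<Omega> \<Longrightarrow> h + c * h' \<notin> Q'" by blast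
  have "h' * c \<in> max_ideal_of Q" using h'(1) C(2)[OF c(1)] by (rule Q.mult_M)
  then have "h + c * h' \<in> max_ideal_of Q" using h Q.add_M by (simp add: mult.commute)
  then show ?case using c by blast
qed

lemma weak_approximation:
  assumes "finite \<Omega>" "dvr K Q" "\<And>Q'. Q' \<in> \<Omega> \<Longrightarrow> dvr K Q' \<and> Q' \<noteq> Q"
    and C: "infinite C" "\<And>c. c \<in> C \<Longrightarrow> c \<in> Q" "\<And>Q' c. Q' \<in> \<Omega> \<Longrightarrow> c \<in> C \<Longrightarrow> c \<in> Q'"
      "\<And>Q' c d. Q' \<in> \<Omega> \<Longrightarrow> c \<in> C \<Longrightarrow> d \<in> C \<Longrightarrow> inverse (c - d) \<in> Q'"
  shows "\<exists>g\<in>K - {0}. ord_at Q g = 1 \<and> (\<forall>Q'\<in>\<Omega>. ord_at Q' g = 0)"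
proof -
  interpret Q: dvr K Q by fact
  obtain h where h: "h \<in> max_ideal_of Q" "\<And>Q'. Q' \<in> \<Omega> \<Longrightarrow> h \<notin> Q'"
    using separating_element[OF assms] by auto
  obtain t where t: "t \<in> K" "t \<noteq> 0" "ord_at Q t = 1" using Q.ex_uniformizer by auto
  show ?thesis
  \<comment> \<open>An empty \<Omega> would permit \<open>h = 0\<close>; otherwise \<open>h\<close>
    lies outside some valuation ring and is nonzero.\<close>
  proof (cases "\<Omega> = {}")
    case True
    then show ?thesis using t by auto
  next
    case False
    then have h0: "h \<noteq> 0" using h(2) val_ring.zero_in[OF dvr.axioms(1)] assms(3) by blast
    have hK: "h \<in> K" using h Q.M_in Q.in_K by auto
    \<comment> \<open>The exponent beats every \<open>ord_at Q' t\<close>, so that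
      \<open>h ^ N\<close> dominates \<open>t\<close> where \<open>h\<close> has a pole; being at
      least 2, it also makes \<open>h ^ N\<close> vanish to higher order than \<open>t\<close> at
      \<open>Q\<close>.\<close>
    define N where "N = Max (insert 2 ((\<lambda>Q'. 1 + nat \<bar>ord_at Q' t\<bar>) ` \<Omega>))"
    have N2: "N \<ge> 2" and N: "\<And>Q'. Q' \<in> \<Omega> \<Longrightarrow> N \<ge> 1 + nat \<bar>ord_at Q' t\<bar>"
      unfolding N_def using assms(1) by (auto intro: Max_ge)
    have hN: "h ^ N \<in> K" "h ^ N \<noteq> 0" using h0 hK by (auto simp: Q.power_mem)
    have "ord_at Q h > 0" using Q.ord_pos_iff hK h0 h by auto
    then have "int N * ord_at Q h \<ge> int N * 1" by (intro mult_left_mono) auto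
    then have ohN: "ord_at Q (h ^ N) > 1" using N2 Q.ord_power[OF hK h0, of N] by linarith
    note 1 = Q.ord_add_eq[OF t(1) hN(1) t(2) hN(2)] Q.ord_add_eq[OF Q.one_mem hN(1) _ hN(2)]
    have nz: "t + h ^ N \<noteq> 0" "1 + h ^ N \<noteq> 0" and oQ: "ord_at Q (t + h ^ N) = 1" "ord_at Q (1 + h ^ N) = 0"
      using 1 ohN t by (auto simp: Q.ord_one)
    \<comment> \<open>Near \<open>Q\<close> this is close to \<open>t\<close>, and where
      \<open>h\<close> has a pole it is close to 1.\<close>
    define g where "g = (t + h ^ N) / (1 + h ^ N)"
    have gK: "g \<in> K - {0}" unfolding g_def using nz t hN by (auto simp: Q.mem_rules)
    moreover have "ord_at Q g = 1" unfolding g_def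
      using nz oQ t hN by (simp add: Q.mem_rules Q.ord_divide)
    moreover have "ord_at Q' g = 0" if Q': "Q' \<in> \<Omega>" for Q'
    proof -
      interpret Q': dvr K Q' using assms(3) Q' by auto
      have "ord_at Q' h < 0" using h(2)[OF Q'] Q'.ord_nonneg_iff[OF hK h0] by auto
      then have "int N * ord_at Q' h \<le> int N * (- 1)" by (intro mult_left_mono) auto
      then have *: "ord_at Q' (h ^ N) \<le> - int N" using hK h0 by (simp add: Q'.ord_power)
      have "ord_at Q' (h ^ N + t) = ord_at Q' (h ^ N)"
        using * N[OF Q'] hN t by (intro Q'.ord_add_eq(2)) auto
      moreover have "ord_at Q' (h ^ N + 1) = ord_at Q' (h ^ N)"
        using * N[OF Q'] hN t Q'.ord_one Q.one_mem by (intro Q'.ord_add_eq(2)) auto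
      ultimately show ?thesis unfolding g_def using nz t hN
        by (simp add: Q.mem_rules Q'.ord_divide add.commute)
    qed
    ultimately show ?thesis by blast
  qed
qed

section \<open>Extension of places\<close>

definition coeffs_in :: "'b::comm_ring_1 set \<Rightarrow> 'b poly set"
  where "coeffs_in B = {p. \<forall>i. coeff p i \<in> B}"

definition ring_set :: "'b::comm_ring_1 set \<Rightarrow> bool"
  where "ring_set B \<longleftrightarrow> 1 \<in> B \<and> (\<forall>a\<in>B. \<forall>b\<in>B. a - b \<in> B \<and> a * b \<in> B)"

lemma ring_setD:
  assumes "ring_set B"
  shows "1 \<in> B" "0 \<in> B" "a \<in> B \<Longrightarrow> b \<in> B \<Longrightarrow> a - b \<in> B" "a \<in> B \<Longrightarrow> b \<in> B \<Longrightarrow> a * b \<in> B"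
    "a \<in> B \<Longrightarrow> - a \<in> B" "a \<in> B \<Longrightarrow> b \<in> B \<Longrightarrow> a + b \<in> B"
proof -
  have 1: "1 \<in> B" and d: "\<And>a b. a \<in> B \<Longrightarrow> b \<in> B \<Longrightarrow> a - b \<in> B \<and> a * b \<in> B"
    using assms by (auto simp: ring_set_def)
  have 0: "0 \<in> B" using d[OF 1 1] by simp
  have u: "a \<in> B \<Longrightarrow> - a \<in> B" for a using d[OF 0, of a] by simp
  show "1 \<in> B" "0 \<in> B" "a \<in> B \<Longrightarrow> b \<in> B \<Longrightarrow> a - b \<in> B" "a \<in> B \<Longrightarrow> b \<in> B \<Longrightarrow> a * b \<in> B"
    "a \<in> B \<Longrightarrow> - a \<in> B" "a \<in> B \<Longrightarrow> b \<in> B \<Longrightarrow> a + b \<in> B"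
    using 0 1 d u d[OF _ u, of a b] by auto
qed

lemma ring_set_sum: "ring_set B \<Longrightarrow> (\<And>i. i \<in> A \<Longrightarrow> u i \<in> B) \<Longrightarrow> sum u A \<in> B"
  by (induction A rule: infinite_finite_induct) (auto simp: ring_setD)

lemma ring_set_coeffs_in:
  assumes "ring_set B" shows "ring_set (coeffs_in B)"
  unfolding ring_set_def coeffs_in_def
  using assms by (auto simp: ring_setD coeff_1 coeff_mult intro!: ring_set_sum)

lemma monom_coeffs_in: "ring_set B \<Longrightarrow> b \<in> B \<Longrightarrow> monom b n \<in> coeffs_in B"
  by (auto simp: coeffs_in_def ring_setD)

lemma pCons_coeffs_in: "ring_set B \<Longrightarrow> b \<in> B \<Longrightarrow> p \<in> coeffs_in B \<Longrightarrow> pCons b p \<in> coeffs_in B"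
  by (auto simp: coeffs_in_def coeff_pCons split: nat.splits)

lemma pCons_coeffs_inD:
  assumes "pCons b p \<in> coeffs_in B" shows "b \<in> B" "p \<in> coeffs_in B"
proof -
  have *: "coeff (pCons b p) i \<in> B" for i using assms by (simp add: coeffs_in_def)
  show "b \<in> B" using *[of 0] by simp
  show "p \<in> coeffs_in B" using *[of "Suc i" for i] by (simp add: coeffs_in_def)
qed

definition adjoin :: "'b::comm_ring_1 set \<Rightarrow> 'b \<Rightarrow> 'b set"
  where "adjoin B u = (\<lambda>p. poly p u) ` coeffs_in B"

lemma adjoin:
  assumes "ring_set B"
  shows "ring_set (adjoin B u)" "B \<subseteq> adjoin B u" "u \<in> adjoin B u"
proof -
  note r = ring_set_coeffs_in[OF assms]
  have "poly p u - poly q u = poly (p - q) u" "poly p u * poly q u = poly (p * q) u" for p q by auto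
  then show "ring_set (adjoin B u)"
    unfolding ring_set_def adjoin_def
    using ring_setD(1)[OF r] ring_setD(3,4)[OF r]
    by (auto intro!: image_eqI[of 1 _ 1] simp del: poly_diff poly_mult)
  show "B \<subseteq> adjoin B u"
  proof
    fix b assume "b \<in> B"
    then show "b \<in> adjoin B u" unfolding adjoin_def
      using monom_coeffs_in[OF assms, of b 0] by (intro image_eqI[of _ _ "monom b 0"]) (auto simp: poly_monom)
  qed
  show "u \<in> adjoin B u" unfolding adjoin_def
    using monom_coeffs_in[OF assms ring_setD(1)[OF assms], of 1]
    by (intro image_eqI[of _ _ "monom 1 1"]) (auto simp: poly_monom)
qed

text \<open>Chevalley's extension theorem for a principal maximal ideal: a subring of \<open>K\<close> that is maximal among
  those not containing \<open>inverse t\<close> is a valuation ring.\<close>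

context
  fixes B :: "'b::Fields.field set" and t :: 'b
  assumes B: "ring_set B" and t: "t \<in> B" "t \<noteq> 0"
    and unit: "\<And>b. b \<in> B \<Longrightarrow> inverse (1 - t * b) \<in> B" "\<And>b. b \<in> B \<Longrightarrow> 1 - t * b \<noteq> 0"
begin

text \<open>A certificate for \<open>inverse t\<close> lying in \<open>B\<close> with
  \<open>u\<close> adjoined, normalised to have no constant term: a constant coefficient
  \<open>b\<close> is moved to the other side and the unit \<open>1 - t * b\<close> is divided
  out.\<close>

definition unit_relation :: "'b \<Rightarrow> 'b poly \<Rightarrow> bool"
  where "unit_relation u p \<longleftrightarrow> p \<in> coeffs_in B \<and> 1 = t * u * poly p u"

lemma unit_relation_exists:
  assumes "inverse t \<in> adjoin B u"
  shows "\<exists>p. unit_relation u p"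
proof -
  obtain p where p: "p \<in> coeffs_in B" "inverse t = poly p u" using assms by (auto simp: adjoin_def)
  obtain b q where bq: "p = pCons b q" by (cases p)
  have b: "b \<in> B" and q: "q \<in> coeffs_in B"
    using pCons_coeffs_inD[of b q] p(1) bq by auto
  have "1 = t * poly p u" using p t by (metis right_inverse)
  also have "\<dots> = t * b + t * u * poly q u" by (simp add: bq algebra_simps)
  finally have eq: "1 - t * b = t * u * poly q u" by (metis add_diff_cancel_left')
  define c where "c = inverse (1 - t * b)"
  have "c \<in> B" "1 - t * b \<noteq> 0" using unit b by (auto simp: c_def)
  then have "c * (1 - t * b) = 1" by (simp add: c_def)
  then have "1 = t * u * poly (smult c q) u" unfolding eq by (simp add: mult_ac)
  moreover have "smult c q \<in> coeffs_in B"
    using q \<open>c \<in> B\<close> B by (auto simp: coeffs_in_def ring_setD)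
  ultimately show ?thesis by (auto simp: unit_relation_def)
qed

text \<open>With \<open>n = degree p\<close>, multiplying the relation of \<open>inverse u\<close>
  by \<open>u ^ (n + 1)\<close> turns it into \<open>u ^ (n + 1) = t * poly r u\<close> with
  \<open>r\<close> of degree at most \<open>n\<close>. Substituted into the leading term of the
  relation of \<open>u\<close>, this lowers the degree, and the new constant term is again absorbed
  by a unit.\<close>

lemma unit_relation_lower:
  assumes p: "unit_relation u p" and q: "unit_relation (inverse u) q" and "u \<noteq> 0"
    and deg: "degree q \<le> degree p"
  shows "\<exists>p'. unit_relation u p' \<and> (degree p' < degree p \<or> p' = 0)"
proof -
  define n where "n = degree p"
  define a where "a = coeff p n"
  define p1 where "p1 = p - monom a n"
  have aB: "a \<in> B" using p by (auto simp: unit_relation_def coeffs_in_def a_def)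
  have p1: "p1 \<in> coeffs_in B" using p B aB
    by (auto simp: unit_relation_def coeffs_in_def p1_def ring_setD)
  have dp1: "degree p1 < n \<or> p1 = 0"
  proof -
    have "degree p1 \<le> n" unfolding p1_def n_def by (intro degree_diff_le) (auto intro: degree_monom_le)
    moreover have "coeff p1 n = 0" by (simp add: p1_def a_def)
    ultimately show ?thesis by (metis leading_coeff_0_iff le_neq_implies_less)
  qed
  \<comment> \<open>\<open>u ^ n * q(1 / u)\<close> as a polynomial in \<open>u\<close>\<close>
  define r where "r = (\<Sum>j\<le>n. monom (coeff q j) (n - j))"
  have rB: "r \<in> coeffs_in B" unfolding r_def
    using q B by (intro ring_set_sum[OF ring_set_coeffs_in] monom_coeffs_in)
      (auto simp: unit_relation_def coeffs_in_def)
  have "poly q (inverse u) = (\<Sum>j\<le>n. coeff q j * inverse u ^ j)"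
    unfolding poly_altdef using deg n_def
    by (intro sum.mono_neutral_left) (auto simp: coeff_eq_0)
  then have "u ^ n * poly q (inverse u) = poly r u"
    unfolding r_def by (simp add: poly_sum poly_monom sum_distrib_left, intro sum.cong refl)
      (use \<open>u \<noteq> 0\<close> in \<open>auto simp: power_diff field_simps\<close>)
  then have un: "u ^ (n + 1) = t * poly r u"
    using q \<open>u \<noteq> 0\<close> unfolding unit_relation_def
    by (metis (no_types, lifting) add.commute inverse_inverse_eq mult.assoc mult.commute mult.right_neutral
      nonzero_inverse_mult_distrib plus_1_eq_Suc power_Suc right_inverse mult.left_commute)
  obtain r0 r1 where r01: "r = pCons r0 r1" by (cases r)
  have r01B: "r0 \<in> B" "r1 \<in> coeffs_in B"
    using pCons_coeffs_inD[of r0 r1] rB r01 by auto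
  have dr1: "degree r1 < n \<or> r1 = 0"
  proof -
    have "degree r \<le> n" unfolding r_def
      by (intro degree_sum_le) (auto intro: order.trans[OF degree_monom_le])
    then show ?thesis using r01 by (cases "r1 = 0") (auto simp: degree_pCons_eq)
  qed
  have "1 = t * u * poly p1 u + t * a * u ^ (n + 1)"
    using p by (simp add: unit_relation_def p1_def poly_monom algebra_simps)
  also have "\<dots> = t * u * poly p1 u + t * a * (t * (r0 + u * poly r1 u))"
    by (simp only: un r01 poly_pCons)
  finally have eq: "1 - t * (a * t * r0) = t * u * poly (p1 + smult (a * t) r1) u"
    by (simp add: algebra_simps)
  have arB: "a * t * r0 \<in> B" using aB t r01B B by (simp add: ring_setD)
  define c where "c = inverse (1 - t * (a * t * r0))"
  have "c * (1 - t * (a * t * r0)) = 1" using unit(2)[OF arB] by (simp add: c_def)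
  then have "1 = t * u * poly (smult c (p1 + smult (a * t) r1)) u"
    unfolding eq by (simp add: mult_ac)
  moreover have "c \<in> B" using unit arB by (auto simp: c_def)
  then have "smult c (p1 + smult (a * t) r1) \<in> coeffs_in B"
    using p1 r01B aB t B by (auto simp: coeffs_in_def ring_setD)
  moreover have "degree (smult c (p1 + smult (a * t) r1)) < n \<or> smult c (p1 + smult (a * t) r1) = 0"
  proof -
    have "degree (p1 + smult (a * t) r1) < n \<or> p1 + smult (a * t) r1 = 0"
      using dp1 dr1 by (cases "p1 = 0"; cases "r1 = 0")
        (auto intro!: degree_add_less order.strict_trans1[OF degree_smult_le])
    then show ?thesis by (auto intro: order.strict_trans1[OF degree_smult_le])
  qed
  ultimately show ?thesis unfolding unit_relation_def n_def by blast
qed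

text \<open>The end of the descent: \<open>unit_relation_lower\<close> also allows
  \<open>p' = 0\<close>, which is the only way to go below degree 0.\<close>

lemma not_unit_relation_0: "\<not> unit_relation u 0"
  by (simp add: unit_relation_def)

text \<open>Infinite descent on the sum of the degrees. The two relations play symmetric roles, so
  one of largest degree can always be lowered.\<close>

lemma no_two_unit_relations:
  assumes "unit_relation u p" "unit_relation (inverse u) q" "u \<noteq> 0"
  shows False
  using assms
proof (induction "degree p + degree q" arbitrary: u p q rule: less_induct)
  case less
  show ?case
  proof (cases "degree q \<le> degree p")
    case True
    then obtain p' where "unit_relation u p'" "degree p' < degree p \<or> p' = 0"
      using unit_relation_lower less.prems by blast
    then show False using less not_unit_relation_0 by (metis add_less_cancel_right)
  next
    case False
    then obtain q' where "unit_relation (inverse u) q'" "degree q' < degree q \<or> q' = 0"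
      using unit_relation_lower[of "inverse u" q p] less.prems by force
    then show False using less not_unit_relation_0 by (metis add_less_cancel_left)
  qed
qed

end

theorem ex_val_ring_above:
  assumes "subfld K" "ring_set P" "P \<subseteq> K" "t \<in> P" "t \<noteq> 0" "inverse t \<notin> P"
  shows "\<exists>B. val_ring K B \<and> P \<subseteq> B \<and> inverse t \<notin> B"
proof -
  interpret subfld K by fact
  define \<A> where "\<A> = {B. ring_set B \<and> P \<subseteq> B \<and> B \<subseteq> K \<and> inverse t \<notin> B}"
  have "\<exists>B\<in>\<A>. \<forall>A\<in>\<A>. B \<subseteq> A \<longrightarrow> A = B"
  proof (rule subset_Zorn_nonempty)
    show "\<A> \<noteq> {}" using assms by (auto simp: \<A>_def)
    fix \<C> assume C: "\<C> \<noteq> {}" "subset.chain \<A> \<C>"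
    have sub: "\<C> \<subseteq> \<A>" and ch: "\<And>A A'. A \<in> \<C> \<Longrightarrow> A' \<in> \<C> \<Longrightarrow> A \<subseteq> A' \<or> A' \<subseteq> A"
      using C(2) by (auto simp: subset.chain_def)
    have "a - b \<in> \<Union>\<C> \<and> a * b \<in> \<Union>\<C>" if ab: "a \<in> \<Union>\<C>" "b \<in> \<Union>\<C>" for a b
    proof -
      obtain A A' where A: "A \<in> \<C>" "a \<in> A" and A': "A' \<in> \<C>" "b \<in> A'" using ab by auto
      obtain Z where Z: "Z \<in> \<C>" "a \<in> Z" "b \<in> Z" using ch[OF A(1) A'(1)] A A' by blast
      then have "ring_set Z" using sub by (auto simp: \<A>_def)
      then have "a - b \<in> Z" "a * b \<in> Z" using Z by (auto simp: ring_setD)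
      then show ?thesis using Z by blast
    qed
    moreover have "1 \<in> \<Union>\<C>" using C(1) sub by (auto simp: \<A>_def ring_set_def)
    ultimately have "ring_set (\<Union>\<C>)" by (auto simp: ring_set_def)
    then show "\<Union>\<C> \<in> \<A>" using C(1) sub by (auto simp: \<A>_def)
  qed
  then obtain B where BA: "B \<in> \<A>" and maxi: "\<And>A. A \<in> \<A> \<Longrightarrow> B \<subseteq> A \<Longrightarrow> A = B" by blast
  have B: "ring_set B" "P \<subseteq> B" "B \<subseteq> K" "inverse t \<notin> B" using BA by (auto simp: \<A>_def)
  have tB: "t \<in> B" using B assms by auto
  \<comment> \<open>Maximality: adjoining an element outside \<open>B\<close> must bring in
    \<open>inverse t\<close>.\<close>
  have adj: "inverse t \<in> adjoin B u" if u: "u \<in> K" "u \<notin> B" for u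
  proof (rule ccontr)
    assume "inverse t \<notin> adjoin B u"
    moreover have "adjoin B u \<subseteq> K"
      using B(3) u by (auto simp: adjoin_def coeffs_in_def poly_altdef intro!: sum_mem mult_mem power_mem)
    ultimately have "adjoin B u \<in> \<A>" using B adjoin[OF B(1), of u] by (auto simp: \<A>_def)
    then have "adjoin B u = B" using maxi adjoin(2)[OF B(1)] by blast
    then show False using adjoin(3)[OF B(1), of u] u by auto
  qed
  have nz: "1 - t * b \<noteq> 0" if "b \<in> B" for b
  proof
    assume "1 - t * b = 0"
    then have "inverse t = b" by (metis eq_iff_diff_eq_0 inverse_unique)
    then show False using B that by simp
  qed
  \<comment> \<open>If \<open>s = 1 - t * b\<close> had no inverse in \<open>B\<close>, then
    \<open>inverse t\<close> would be a polynomial in \<open>inverse s\<close>. Clearing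
    denominators puts \<open>s ^ degree p * inverse t\<close> into \<open>B\<close>; as
    \<open>s ^ degree p\<close> is congruent to 1 modulo \<open>t\<close>, this differs from
    \<open>inverse t\<close> by an element of \<open>B\<close>.\<close>
  have unit: "inverse (1 - t * b) \<in> B" if b: "b \<in> B" for b
  proof (rule ccontr)
    define s where "s = 1 - t * b"
    have sB: "s \<in> B" unfolding s_def using b tB B(1) by (simp add: ring_setD)
    assume "\<not> ?thesis"
    then have "inverse t \<in> adjoin B (inverse s)"
      using B sB by (intro adj inverse_mem) (auto simp: s_def)
    then obtain p where p: "p \<in> coeffs_in B" "inverse t = poly p (inverse s)" by (auto simp: adjoin_def)
    have s0: "s \<noteq> 0" using nz[OF b] by (simp add: s_def)
    have pw: "s ^ k \<in> B" for k using sB B(1) by (induction k) (auto simp: ring_setD)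
    have spB: "s ^ degree p * inverse t \<in> B"
    proof -
      have "s ^ degree p * inverse t = (\<Sum>i\<le>degree p. coeff p i * s ^ (degree p - i))"
        using s0 unfolding p(2) poly_altdef
        by (auto simp: sum_distrib_left power_diff field_simps intro!: sum.cong)
      also have "\<dots> \<in> B" using p pw B(1) by (auto simp: coeffs_in_def ring_setD intro!: ring_set_sum)
      finally show ?thesis .
    qed
    have "\<exists>c\<in>B. s ^ k = 1 - t * c" for k
    proof (induction k)
      case 0
      then show ?case using B(1) by (auto intro!: bexI[of _ 0] simp: ring_setD)
    next
      case (Suc k)
      then obtain c where "c \<in> B" "s ^ k = 1 - t * c" by auto
      moreover have "s ^ Suc k = s * s ^ k" by simp
      ultimately have "s ^ Suc k = (1 - t * b) * (1 - t * c)" by (simp only: s_def)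
      then show ?case using B(1) b tB \<open>c \<in> B\<close>
        by (intro bexI[of _ "b + c - t * b * c"]) (auto simp: ring_setD algebra_simps)
    qed
    then obtain c where c: "c \<in> B" "s ^ degree p = 1 - t * c" by blast
    have "s ^ degree p * inverse t + c = inverse t"
      unfolding c(2) using assms(5) by (simp add: left_diff_distrib)
    then show False using ring_setD(6)[OF B(1) spB c(1)] B by simp
  qed
  have "val_ring K B"
  proof (unfold_locales)
    fix u assume u: "u \<in> K"
    show "u \<in> B \<or> inverse u \<in> B"
    proof (rule ccontr)
      assume neg: "\<not> ?thesis"
      then have u0: "u \<noteq> 0" using B(1) ring_setD by auto
      obtain p where p: "unit_relation B t u p"
        using unit_relation_exists[OF B(1) tB assms(5) unit nz adj] u neg by blast
      obtain q where q: "unit_relation B t (inverse u) q"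
        using unit_relation_exists[OF B(1) tB assms(5) unit nz adj] inverse_mem[OF u] neg by blast
      show False
        by (rule no_two_unit_relations[OF B(1) tB assms(5) unit nz p q u0])
    qed
  qed (use B in \<open>auto simp: ring_setD\<close>)
  then show ?thesis using B by blast
qed

section \<open>Automorphisms and constants\<close>

text \<open>Only values on \<open>K\<close> are controlled. The automorphisms of function fields
  used later are definite descriptions that say nothing outside \<open>K\<close>.\<close>

locale fld_aut = subfld K for K :: "'b::Fields.field set" +
  fixes \<alpha> :: "'b \<Rightarrow> 'b"
  assumes aut_add: "a \<in> K \<Longrightarrow> b \<in> K \<Longrightarrow> \<alpha> (a + b) = \<alpha> a + \<alpha> b"
    and aut_mult: "a \<in> K \<Longrightarrow> b \<in> K \<Longrightarrow> \<alpha> (a * b) = \<alpha> a * \<alpha> b"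
    and aut_image: "\<alpha> ` K = K"
begin

lemma aut_mem: "a \<in> K \<Longrightarrow> \<alpha> a \<in> K" using aut_image by blast
lemma aut_0: "\<alpha> 0 = 0" using aut_add[OF zero_mem zero_mem] by (metis add_0 add_right_cancel)
lemma aut_1: "\<alpha> 1 = 1"
proof -
  obtain a where a: "a \<in> K" "\<alpha> a = 1" using aut_image one_mem by force
  then show ?thesis using aut_mult[OF a(1) one_mem] by simp
qed
lemma aut_uminus: "a \<in> K \<Longrightarrow> \<alpha> (- a) = - \<alpha> a"
  using aut_add[of a "- a"] uminus_mem aut_0 by (simp add: eq_neg_iff_add_eq_0 add.commute)
lemma aut_diff: "a \<in> K \<Longrightarrow> b \<in> K \<Longrightarrow> \<alpha> (a - b) = \<alpha> a - \<alpha> b"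
  using aut_add[of a "- b"] uminus_mem by (simp add: aut_uminus)
lemma aut_eq_0_iff: "a \<in> K \<Longrightarrow> \<alpha> a = 0 \<longleftrightarrow> a = 0"
  using aut_mult[of a "inverse a"] inverse_mem aut_0 aut_1 by (cases "a = 0") auto
lemma aut_inverse: "a \<in> K \<Longrightarrow> \<alpha> (inverse a) = inverse (\<alpha> a)"
  using aut_mult[of a "inverse a"] inverse_mem aut_0 aut_1 aut_eq_0_iff
  by (cases "a = 0") (auto simp: inverse_unique aut_0)
lemma aut_divide: "a \<in> K \<Longrightarrow> b \<in> K \<Longrightarrow> \<alpha> (a / b) = \<alpha> a / \<alpha> b"
  by (simp add: divide_inverse aut_mult inverse_mem aut_inverse)
lemma aut_power: "a \<in> K \<Longrightarrow> \<alpha> (a ^ n) = \<alpha> a ^ n"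
  by (induction n) (auto simp: aut_1 aut_mult power_mem)
lemma aut_sum: "(\<And>i. i \<in> A \<Longrightarrow> u i \<in> K) \<Longrightarrow> \<alpha> (sum u A) = (\<Sum>i\<in>A. \<alpha> (u i))"
  by (induction A rule: infinite_finite_induct) (auto simp: aut_0 aut_add sum_mem)
lemma aut_prod: "(\<And>i. i \<in> A \<Longrightarrow> u i \<in> K) \<Longrightarrow> \<alpha> (prod u A) = (\<Prod>i\<in>A. \<alpha> (u i))"
  by (induction A rule: infinite_finite_induct) (auto simp: aut_1 aut_mult prod_mem)
lemma inj_aut: "inj_on \<alpha> K"
proof (rule inj_onI)
  fix a b assume "a \<in> K" "b \<in> K" "\<alpha> a = \<alpha> b"
  then show "a = b" using aut_diff[of a b] aut_eq_0_iff[of "a - b"] diff_mem by simp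
qed

lemma fld_aut_funpow: "fld_aut K (\<alpha> ^^ i)"
proof (induction i)
  case 0
  then show ?case by unfold_locales auto
next
  case (Suc i)
  interpret s: fld_aut K "\<alpha> ^^ i" by fact
  have "(\<alpha> ^^ Suc i) ` K = K"
    by (simp only: funpow.simps image_comp[symmetric] s.aut_image aut_image)
  then show ?case by unfold_locales (auto simp: s.aut_add s.aut_mult aut_add aut_mult s.aut_mem)
qed

lemma map_poly_aut_mult:
  assumes "p \<in> coeffs_in K" "q \<in> coeffs_in K"
  shows "map_poly \<alpha> (p * q) = map_poly \<alpha> p * map_poly \<alpha> q"
  using assms
  by (intro poly_eqI) (auto simp: coeff_map_poly aut_0 coeff_mult coeffs_in_def mult_mem aut_sum aut_mult)

lemma ring_set_K: "ring_set K" by (simp add: ring_set_def one_mem diff_mem mult_mem)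

lemma prod_coeffs_in:
  "ring_set B \<Longrightarrow> (\<And>i. i \<in> A \<Longrightarrow> u i \<in> coeffs_in B) \<Longrightarrow> prod u A \<in> coeffs_in B"
  by (induction A rule: infinite_finite_induct) (auto simp: ring_setD[OF ring_set_coeffs_in])

lemma map_poly_aut_prod:
  "(\<And>i. i \<in> A \<Longrightarrow> u i \<in> coeffs_in K) \<Longrightarrow> map_poly \<alpha> (prod u A) = (\<Prod>i\<in>A. map_poly \<alpha> (u i))"
  by (induction A rule: infinite_finite_induct)
    (auto simp: map_poly_aut_mult prod_coeffs_in ring_set_K map_poly_1' aut_1)

lemma val_ring_image:
  assumes "val_ring K P" shows "val_ring K (\<alpha> ` P)"
proof -
  interpret P: val_ring K P by fact
  show ?thesis
  proof
    show "\<alpha> ` P \<subseteq> K" using P.in_K aut_mem by auto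
    show "1 \<in> \<alpha> ` P" using P.one_in aut_1 by force
    fix a b assume "a \<in> \<alpha> ` P" "b \<in> \<alpha> ` P"
    then obtain a' b' where "a' \<in> P" "b' \<in> P" "a = \<alpha> a'" "b = \<alpha> b'" by auto
    then show "a - b \<in> \<alpha> ` P" "a * b \<in> \<alpha> ` P"
      using aut_diff[of a' b'] aut_mult[of a' b'] P.in_K P.diff_in[of a' b'] P.mult_in[of a' b']
      by (auto intro: image_eqI[of _ _ "a' - b'"] image_eqI[of _ _ "a' * b'"])
  next
    fix a assume "a \<in> K"
    then obtain b where b: "b \<in> K" "a = \<alpha> b" using aut_image by blast
    then show "a \<in> \<alpha> ` P \<or> inverse a \<in> \<alpha> ` P"
      using P.total[OF b(1)] aut_inverse[OF b(1)] by force
  qed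
qed

lemma aut_in_image_iff:
  assumes "a \<in> K" "P \<subseteq> K" shows "\<alpha> a \<in> \<alpha> ` P \<longleftrightarrow> a \<in> P"
  using assms inj_aut by (auto simp: inj_on_def)

lemma aut_max_ideal_iff:
  assumes "val_ring K P" "a \<in> K"
  shows "\<alpha> a \<in> max_ideal_of (\<alpha> ` P) \<longleftrightarrow> a \<in> max_ideal_of P"
proof -
  interpret P: val_ring K P by fact
  show ?thesis unfolding max_ideal_of_def
    using assms aut_in_image_iff[OF _ P.subset] aut_eq_0_iff[of a]
    by (auto simp flip: aut_inverse simp: inverse_mem)
qed

lemma dvr_image:
  assumes "dvr K P"
  shows "dvr K (\<alpha> ` P)" and "g \<in> K \<Longrightarrow> g \<noteq> 0 \<Longrightarrow> ord_at (\<alpha> ` P) (\<alpha> g) = ord_at P g"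
proof -
  interpret P: dvr K P by fact
  interpret \<alpha>P: val_ring K "\<alpha> ` P" by (rule val_ring_image) unfold_locales
  define \<phi> where "\<phi> h = ord_at P (inv_into K \<alpha> h)" for h
  have \<phi>: "\<phi> (\<alpha> g) = ord_at P g" if "g \<in> K" for g
    using that inj_aut by (simp add: \<phi>_def)
  have K: "\<exists>g'. g' \<in> K \<and> g' \<noteq> 0 \<and> g = \<alpha> g'" if "g \<in> K - {0}" for g
    using that aut_image aut_eq_0_iff by blast
  have v: "is_val K (\<alpha> ` P) \<phi>" unfolding is_val_def
  proof (intro conjI ballI)
    fix g h assume "g \<in> K - {0}" "h \<in> K - {0}"
    then obtain g' h' where "g' \<in> K" "g' \<noteq> 0" "g = \<alpha> g'" "h' \<in> K" "h' \<noteq> 0" "h = \<alpha> h'" using K by blast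
    then show "\<phi> (g * h) = \<phi> g + \<phi> h"
      by (simp add: \<phi> P.ord_mult mult_mem flip: aut_mult)
  next
    fix g assume "g \<in> K - {0}"
    then obtain g' where "g' \<in> K" "g' \<noteq> 0" "g = \<alpha> g'" using K by blast
    then show "(g \<in> \<alpha> ` P) \<longleftrightarrow> 0 \<le> \<phi> g"
      by (simp add: \<phi> P.ord_nonneg_iff aut_in_image_iff[OF _ P.subset])
  qed
  obtain t where t: "t \<in> K" "t \<noteq> 0" "ord_at P t = 1" using P.ex_uniformizer by auto
  have t': "\<alpha> t \<in> K" "\<alpha> t \<noteq> 0" "\<phi> (\<alpha> t) = 1" using t by (auto simp: aut_mem aut_eq_0_iff \<phi>)
  show "dvr K (\<alpha> ` P)"
    by unfold_locales (rule exI[of _ \<phi>], use v t' in \<open>auto intro!: bexI[of _ "\<alpha> t"]\<close>)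
  then interpret \<alpha>P': dvr K "\<alpha> ` P" .
  show "ord_at (\<alpha> ` P) (\<alpha> g) = ord_at P g" if "g \<in> K" "g \<noteq> 0"
    using \<alpha>P'.ord_at_eqI[OF v t', of "\<alpha> g"] that by (simp add: \<phi> aut_mem aut_eq_0_iff)
qed

end

section \<open>Constants and places of degree one\<close>

locale cplace = dvr K P for K :: "'b::Fields.field set" and P +
  fixes \<kappa> :: "'a \<Rightarrow> 'b"
  assumes const_in: "\<kappa> c \<in> P"
    and residue: "g \<in> P \<Longrightarrow> \<exists>c. g - \<kappa> c \<in> max_ideal_of P"

locale const_field =
  fixes \<kappa> :: "'a::{alg_closed_field, field_char_0} \<Rightarrow> 'b::Fields.field"
  assumes \<kappa>_1: "\<kappa> 1 = 1" and \<kappa>_add: "\<kappa> (a + b) = \<kappa> a + \<kappa> b" and \<kappa>_mult: "\<kappa> (a * b) = \<kappa> a * \<kappa> b"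
begin

lemma \<kappa>_0: "\<kappa> 0 = 0" using \<kappa>_add[of 0 0] by (metis add_0 add_right_cancel)
lemma \<kappa>_uminus: "\<kappa> (- a) = - \<kappa> a"
  using \<kappa>_add[of a "- a"] \<kappa>_0 by (simp add: eq_neg_iff_add_eq_0 add.commute)
lemma \<kappa>_diff: "\<kappa> (a - b) = \<kappa> a - \<kappa> b" using \<kappa>_add[of a "- b"] \<kappa>_uminus by simp
lemma \<kappa>_eq_0_iff: "\<kappa> a = 0 \<longleftrightarrow> a = 0"
  using \<kappa>_mult[of a "inverse a"] \<kappa>_0 \<kappa>_1 by (cases "a = 0") auto
lemma \<kappa>_inverse: "\<kappa> (inverse a) = inverse (\<kappa> a)"
  using \<kappa>_mult[of a "inverse a"] \<kappa>_0 \<kappa>_1 \<kappa>_eq_0_iff[of a] by (cases "a = 0") (auto simp: field_simps)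
lemma \<kappa>_sum: "\<kappa> (sum u A) = (\<Sum>i\<in>A. \<kappa> (u i))"
  by (induction A rule: infinite_finite_induct) (auto simp: \<kappa>_0 \<kappa>_add)
lemma \<kappa>_power: "\<kappa> (a ^ n) = \<kappa> a ^ n"
  by (induction n) (auto simp: \<kappa>_1 \<kappa>_mult)
lemma \<kappa>_inj: "\<kappa> a = \<kappa> b \<longleftrightarrow> a = b"
  using \<kappa>_diff[of a b] \<kappa>_eq_0_iff[of "a - b"] by auto
lemma infinite_range_\<kappa>: "infinite (range \<kappa>)"
  using \<kappa>_inj infinite_UNIV_char_0 by (intro range_inj_infinite[THEN contrapos_nn] ) (auto simp: inj_def dest: finite_imageD)

text \<open>This is \<open>places\<close> detached from the type of function fields (see
  \<open>places_eq\<close>). Discreteness and the residue field are to be proved, not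
  demanded.\<close>

definition const_places :: "'b set \<Rightarrow> 'b set set"
  where "const_places K = {Q. val_ring K Q \<and> range \<kappa> \<subseteq> Q \<and> Q \<noteq> K}"

text \<open>The constants serve as the infinite set \<open>C\<close>: the difference of two distinct
  constants is a nonzero constant, hence a unit at every place. Equal constants need no exception
  since \<open>inverse 0 = 0\<close>.\<close>

lemma \<kappa>_weak_approximation:
  assumes "finite \<Omega>" "dvr K Q" "range \<kappa> \<subseteq> Q" "Q \<notin> \<Omega>"
    "\<And>Q'. Q' \<in> \<Omega> \<Longrightarrow> dvr K Q' \<and> range \<kappa> \<subseteq> Q'"
  shows "\<exists>g\<in>K - {0}. ord_at Q g = 1 \<and> (\<forall>Q'\<in>\<Omega>. ord_at Q' g = 0)"
proof (rule weak_approximation[where C = "range \<kappa>"])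
  fix Q' c d assume "Q' \<in> \<Omega>" and "c \<in> range \<kappa>" "d \<in> range \<kappa>"
  then obtain a b where "c = \<kappa> a" "d = \<kappa> b" "range \<kappa> \<subseteq> Q'" using assms(5) by auto
  then show "inverse (c - d) \<in> Q'" by (auto simp: \<kappa>_diff[symmetric] \<kappa>_inverse[symmetric])
qed (use assms infinite_range_\<kappa> in auto)

lemma \<kappa>_in_max_ideal_iff:
  assumes "val_ring K Q" "range \<kappa> \<subseteq> Q"
  shows "\<kappa> c \<in> max_ideal_of Q \<longleftrightarrow> c = 0"
proof -
  have "\<kappa> (inverse c) \<in> Q" "\<kappa> c \<in> Q" using assms(2) by auto
  then show ?thesis
    by (auto simp: max_ideal_of_def \<kappa>_eq_0_iff \<kappa>_0 simp flip: \<kappa>_inverse)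
qed

lemma map_poly_\<kappa>_mult: "map_poly \<kappa> (p * q) = map_poly \<kappa> p * map_poly \<kappa> q"
  by (intro poly_eqI) (simp only: coeff_map_poly \<kappa>_0 coeff_mult \<kappa>_sum \<kappa>_mult)

text \<open>Over an algebraically closed constant field \<open>p\<close> splits, and the maximal
  ideal is prime, so one of the linear factors \<open>g - \<kappa> c\<close> lies in it.\<close>

lemma root_residue:
  assumes Q: "val_ring K Q" "range \<kappa> \<subseteq> Q" and g: "g \<in> Q"
    and p: "p \<noteq> 0" "poly (map_poly \<kappa> p) g \<in> max_ideal_of Q"
  shows "\<exists>c. g - \<kappa> c \<in> max_ideal_of Q"
  using p
proof (induction "degree p" arbitrary: p rule: less_induct)
  case less
  interpret Q: val_ring K Q by fact
  show ?case
  proof (cases "degree p = 0")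
    case True
    then obtain c where "p = [:c:]" using degree_0_id by metis
    then show ?thesis using less.prems \<kappa>_in_max_ideal_iff[OF Q, of c] by (auto simp: map_poly_pCons \<kappa>_0)
  next
    case False
    then obtain a where "poly p a = 0" using alg_closed_imp_poly_has_root by blast
    then obtain q where q: "p = [:- a, 1:] * q" by (auto simp: poly_eq_0_iff_dvd elim: dvdE)
    have q0: "q \<noteq> 0" using less.prems q by auto

    have "poly (map_poly \<kappa> p) g = (g - \<kappa> a) * poly (map_poly \<kappa> q) g"
      unfolding q map_poly_\<kappa>_mult by (simp add: map_poly_pCons \<kappa>_0 \<kappa>_1 \<kappa>_uminus algebra_simps)
    moreover have "poly (map_poly \<kappa> q) g \<in> Q"
      unfolding poly_altdef using Q(2) g
      by (intro Q.sum_in Q.mult_in Q.power_in) (auto simp: coeff_map_poly \<kappa>_0)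
    moreover have "g - \<kappa> a \<in> Q" using g Q by (intro Q.diff_in) auto
    ultimately have "g - \<kappa> a \<in> Q.M \<or> poly (map_poly \<kappa> q) g \<in> Q.M"
      using less.prems(2) Q.M_prime by simp
    moreover have "degree q < degree p"
      using degree_mult_eq[of "[:- a, 1:]" q] q q0 by (simp del: mult_pCons_left)
    ultimately show ?thesis using less.hyps q0 by blast
  qed
qed

end

text \<open>A Kummer extension of degree \<open>d\<close> with generator \<open>w\<close>, an
  eigenvector of \<tau>. It is used both for \<open>K\<close> over the rational function field and
  for a single step of the tower. The eigenvector is what controls the stabiliser of a place in
  \<open>fundamental_identity\<close>.\<close>

locale cyclic_ext = fld_aut K \<tau> + F: subfld F + const_field \<kappa>
  for K :: "'b::Fields.field set" and \<tau> and F :: "'b set"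
    and \<kappa> :: "'a::{alg_closed_field, field_char_0} \<Rightarrow> 'b" +
  fixes d :: nat and w :: 'b and z :: 'a
  assumes F_sub: "F \<subseteq> K" and \<kappa>_F: "\<kappa> c \<in> F"
    and d_pos: "0 < d"
    and period: "g \<in> K \<Longrightarrow> (\<tau> ^^ d) g = g"
    and fixed: "g \<in> K \<Longrightarrow> \<tau> g = g \<longleftrightarrow> g \<in> F"
    and w: "w \<in> K" "w \<noteq> 0" "\<tau> w = \<kappa> z * w"
    and z_order: "0 < i \<Longrightarrow> i < d \<Longrightarrow> z ^ i \<noteq> 1"
begin

lemma F_in_K: "a \<in> F \<Longrightarrow> a \<in> K" using F_sub by blast
lemma \<kappa>_K: "\<kappa> c \<in> K" using \<kappa>_F F_sub by blast

lemma funpow_aut_mem: "g \<in> K \<Longrightarrow> (\<tau> ^^ i) g \<in> K"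
  using fld_aut.aut_mem[OF fld_aut_funpow] .

lemma funpow_fixed: "g \<in> F \<Longrightarrow> (\<tau> ^^ i) g = g"
  by (induction i) (auto simp: fixed F_in_K)

definition norm :: "'b \<Rightarrow> 'b" where "norm g = (\<Prod>i<d. (\<tau> ^^ i) g)"

lemma prod_cyclic_shift:
  fixes h :: "nat \<Rightarrow> 'c::comm_monoid_mult"
  assumes "h d = h 0" shows "(\<Prod>i<d. h (Suc i)) = (\<Prod>i<d. h i)"
proof -
  obtain k where k: "d = Suc k" using d_pos by (cases d) auto
  have "(\<Prod>i<d. h (Suc i)) = (\<Prod>i<k. h (Suc i)) * h d" by (simp add: k)
  also have "\<dots> = h 0 * (\<Prod>i<k. h (Suc i))" by (simp add: assms mult.commute)
  also have "\<dots> = (\<Prod>i<d. h i)" unfolding k by (rule prod.lessThan_Suc_shift[symmetric])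
  finally show ?thesis .
qed

lemma norm_mem: "g \<in> K \<Longrightarrow> norm g \<in> F"
proof -
  assume g: "g \<in> K"
  then have "\<tau> (norm g) = (\<Prod>i<d. (\<tau> ^^ Suc i) g)"
    unfolding norm_def by (subst aut_prod) (auto simp: funpow_aut_mem)
  also have "\<dots> = norm g" unfolding norm_def by (rule prod_cyclic_shift) (simp add: period g)
  finally show ?thesis using fixed[of "norm g"] g
    by (simp add: norm_def prod_mem funpow_aut_mem)
qed

lemma norm_eq_0_iff: "g \<in> K \<Longrightarrow> norm g = 0 \<longleftrightarrow> g = 0"
  using fld_aut.aut_eq_0_iff[OF fld_aut_funpow] d_pos by (auto simp: norm_def)

lemma norm_mult: "g \<in> K \<Longrightarrow> h \<in> K \<Longrightarrow> norm (g * h) = norm g * norm h"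
  using fld_aut.aut_mult[OF fld_aut_funpow] by (simp add: norm_def prod.distrib)

definition charpoly :: "'b \<Rightarrow> 'b poly" where "charpoly g = (\<Prod>i<d. [:- (\<tau> ^^ i) g, 1:])"

lemma charpoly_coeffs_in:
  assumes "ring_set B" "\<And>i. (\<tau> ^^ i) g \<in> B"
  shows "charpoly g \<in> coeffs_in B"
  unfolding charpoly_def
  by (intro prod_coeffs_in assms pCons_coeffs_in ring_setD[OF assms(1)])
    (simp add: coeffs_in_def ring_setD[OF assms(1)])

text \<open>\<tau> permutes the linear factors cyclically, so it fixes the coefficients.\<close>

lemma charpoly_F:
  assumes g: "g \<in> K" shows "coeff (charpoly g) i \<in> F"
proof -
  have lin: "[:- (\<tau> ^^ i) g, 1:] \<in> coeffs_in K" for i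
    by (intro pCons_coeffs_in ring_set_K uminus_mem funpow_aut_mem g one_mem)
      (simp add: coeffs_in_def zero_mem)
  have "map_poly \<tau> (charpoly g) = (\<Prod>i<d. map_poly \<tau> [:- (\<tau> ^^ i) g, 1:])"
    unfolding charpoly_def by (rule map_poly_aut_prod) (use lin in auto)
  also have "\<dots> = (\<Prod>i<d. [:- (\<tau> ^^ Suc i) g, 1:])"
    using g by (intro prod.cong refl) (simp add: map_poly_pCons aut_0 aut_1 aut_uminus funpow_aut_mem)
  also have "\<dots> = charpoly g" unfolding charpoly_def
    by (rule prod_cyclic_shift) (simp add: period g)
  finally have "\<tau> (coeff (charpoly g) i) = coeff (charpoly g) i"
    by (metis aut_0 coeff_map_poly)
  moreover have "coeff (charpoly g) i \<in> K"
    using charpoly_coeffs_in[OF ring_set_K, of g] g funpow_aut_mem by (simp add: coeffs_in_def)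
  ultimately show ?thesis using fixed by blast
qed

lemma degree_charpoly: "degree (charpoly g) = d"
  and charpoly_monic: "coeff (charpoly g) d = 1"
proof -
  show "degree (charpoly g) = d"
    unfolding charpoly_def by (subst degree_prod_eq_sum_degree) auto
  then show "coeff (charpoly g) d = 1"
    using lead_coeff_prod[of "\<lambda>i. [:- (\<tau> ^^ i) g, 1:]" "{..<d}"] by (simp add: charpoly_def)
qed

lemma charpoly_root: "(\<Sum>i\<le>d. coeff (charpoly g) i * g ^ i) = 0"
proof -
  have "poly (charpoly g) g = 0"
    unfolding charpoly_def poly_prod using d_pos by (intro prod_zero) (auto intro!: bexI[of _ 0])
  then show ?thesis by (simp add: poly_altdef degree_charpoly)
qed

lemma charpoly_root': "g ^ d = (\<Sum>i<d. - coeff (charpoly g) i * g ^ i)"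
  using charpoly_root[of g] charpoly_monic[of g]
  by (simp add: lessThan_Suc_atMost[symmetric] sum_negf add_eq_0_iff)

lemma const_places_image: "Q \<in> const_places K \<Longrightarrow> (\<tau> ^^ i) ` Q \<in> const_places K"
proof -
  assume Q: "Q \<in> const_places K"
  interpret \<tau>i: fld_aut K "\<tau> ^^ i" by (rule fld_aut_funpow)
  have "range \<kappa> \<subseteq> (\<tau> ^^ i) ` Q"
    using Q funpow_fixed[OF \<kappa>_F, of i] by (force simp: const_places_def image_iff)
  moreover have "(\<tau> ^^ i) ` Q \<noteq> K"
    using Q inj_on_image_eq_iff[OF \<tau>i.inj_aut, of Q K] \<tau>i.aut_image val_ring.subset[of K Q]
    by (auto simp: const_places_def)
  ultimately show ?thesis using \<tau>i.val_ring_image[of Q] Q by (auto simp: const_places_def)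
qed

lemma image_inter_F: "Q \<subseteq> K \<Longrightarrow> (\<tau> ^^ i) ` Q \<inter> F = Q \<inter> F"
proof -
  assume Q: "Q \<subseteq> K"
  interpret \<tau>i: fld_aut K "\<tau> ^^ i" by (rule fld_aut_funpow)
  have "g \<in> (\<tau> ^^ i) ` Q \<longleftrightarrow> g \<in> Q" if "g \<in> F" for g
    using \<tau>i.aut_in_image_iff[OF F_in_K[OF that] Q] funpow_fixed[OF that] by simp
  then show ?thesis by blast
qed

lemma val_ring_inter:
  assumes "val_ring K Q" shows "val_ring F (Q \<inter> F)"
proof -
  interpret Q: val_ring K Q by fact
  show ?thesis by unfold_locales
    (auto simp: Q.one_in F.one_mem Q.diff_in F.diff_mem Q.mult_in F.mult_mem F.inverse_mem F_in_K
      dest: Q.total[OF F_in_K])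
qed

text \<open>\<open>K\<close> is integral over \<open>F\<close> through \<open>charpoly\<close>; a
  valuation ring containing all of \<open>F\<close> is integrally closed and would be all of
  \<open>K\<close>.\<close>

lemma inter_const_place:
  assumes "Q \<in> const_places K" shows "Q \<inter> F \<in> const_places F"
proof -
  interpret Q: val_ring K Q using assms by (simp add: const_places_def)
  have "Q \<inter> F \<noteq> F"
  proof
    assume "Q \<inter> F = F"
    then have FQ: "F \<subseteq> Q" by blast
    have "g \<in> Q" if g: "g \<in> K" for g
      using charpoly_F[OF g] FQ
      by (intro Q.integrally_closed[OF g _ charpoly_root']) (auto intro: Q.uminus_in)
    then show False using assms Q.in_K by (auto simp: const_places_def)
  qed
  then show ?thesis using val_ring_inter[of Q] assms \<kappa>_F by (auto simp: const_places_def)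
qed

lemma max_ideal_inter: "max_ideal_of (Q \<inter> F) = max_ideal_of Q \<inter> F"
  by (auto simp: max_ideal_of_def F.inverse_mem)

text \<open>Two terms of the equation given by \<open>charpoly g\<close> have the same value, so a
  power \<open>g ^ k\<close> with \<open>0 < k\<close> and \<open>k \<le> d\<close> has the value of
  an element of \<open>F\<close>. The exponent \<open>fact d\<close> is a common multiple of all
  such \<open>k\<close>.\<close>

lemma power_ratio:
  assumes "val_ring K Q" and g: "g \<in> K" "g \<noteq> 0"
  shows "\<exists>c\<in>F - {0}. g ^ fact d / c \<in> Q \<and> c / g ^ fact d \<in> Q"
proof -
  interpret Q: val_ring K Q by fact
  define u where "u i = coeff (charpoly g) i * g ^ i" for i
  define A where "A = {i. i \<le> d \<and> coeff (charpoly g) i \<noteq> 0}"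
  have dA: "d \<in> A" by (simp add: A_def charpoly_monic)
  have "sum u A = (\<Sum>i\<le>d. u i)" unfolding A_def u_def
    by (intro sum.mono_neutral_left) auto
  then have s: "sum u A = 0" using charpoly_root[of g] by (simp add: u_def)
  have uK: "u i \<in> K - {0}" if "i \<in> A" for i
    using that g charpoly_F[OF g(1), of i] by (auto simp: u_def A_def F_in_K mult_mem power_mem)
  have A: "finite A" "A \<noteq> {}" using dA by (auto simp: A_def)
  obtain i j where ij: "i \<in> A" "j \<in> A" "i \<noteq> j" "u i / u j \<in> Q" "u j / u i \<in> Q"
    by (rule Q.sum_eq_0_same_value[OF A uK s])
  have "\<exists>k>0. k \<le> d \<and> (\<exists>c\<in>F - {0}. g ^ k / c \<in> Q \<and> c / g ^ k \<in> Q)"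
    using ij
  proof (induction i j rule: linorder_wlog)
    case (le i j)
    define c where "c = coeff (charpoly g) i / coeff (charpoly g) j"
    have "c \<in> F - {0}" using le.prems charpoly_F[OF g(1)] by (auto simp: c_def A_def F.divide_mem)
    moreover have gj: "g ^ j = g ^ i * g ^ (j - i)" using le by (simp flip: power_add)
    have "g ^ (j - i) / c = u j / u i" "c / g ^ (j - i) = u i / u j"
      using le.prems g by (auto simp: c_def u_def A_def gj)
    then have "g ^ (j - i) / c \<in> Q \<and> c / g ^ (j - i) \<in> Q" using le.prems by simp
    moreover have "j - i > 0" "j - i \<le> d" using le by (auto simp: A_def)
    ultimately show ?case by blast
  next
    case (sym i j)
    then show ?case by auto
  qed
  then obtain k c where k: "k > 0" "k \<le> d" and c: "c \<in> F - {0}" "g ^ k / c \<in> Q" "c / g ^ k \<in> Q" by blast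
  have "k dvd fact d" using k by (simp add: dvd_fact)
  then obtain q where q: "fact d = k * q" by (auto elim: dvdE)
  have "(g ^ k / c) ^ q \<in> Q" "(c / g ^ k) ^ q \<in> Q" using c Q.power_in by auto
  then have "g ^ fact d / c ^ q \<in> Q \<and> c ^ q / g ^ fact d \<in> Q"
    by (simp add: q power_mult power_divide)
  then show ?thesis using c by (intro bexI[of _ "c ^ q"]) (auto simp: F.power_mem)
qed

text \<open>The value of \<open>g\<close> is defined as the order of some \<open>c\<close> in
  \<open>F\<close> that has the same value as \<open>g ^ fact d\<close>. Two such \<open>c\<close>
  differ by a unit of \<open>Q \<inter> F\<close>, so the choice is harmless; the result is not
  normalised, which \<open>dvr\<close> tolerates.\<close>

lemma dvr_lift:
  assumes Q: "val_ring K Q" and P: "dvr F (Q \<inter> F)"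
  shows "dvr K Q"
proof -
  interpret Q: val_ring K Q by fact
  interpret P: dvr F "Q \<inter> F" by fact
  define rel where "rel g c \<longleftrightarrow> c \<in> F - {0} \<and> g ^ fact d / c \<in> Q \<and> c / g ^ fact d \<in> Q" for g c
  define \<phi> where "\<phi> g = ord_at (Q \<inter> F) (SOME c. rel g c)" for g
  have ex: "\<exists>c. rel g c" if "g \<in> K" "g \<noteq> 0" for g
    using power_ratio[OF Q that] by (auto simp: rel_def)
  have uniq: "\<phi> g = ord_at (Q \<inter> F) c" if g: "g \<in> K" "g \<noteq> 0" and c: "rel g c" for g c
  proof -
    define c' where "c' = (SOME c. rel g c)"
    have c': "rel g c'" unfolding c'_def by (rule someI) (rule c)
    have "(g ^ fact d / c') * (c / g ^ fact d) \<in> Q" "(g ^ fact d / c) * (c' / g ^ fact d) \<in> Q"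
      by (rule Q.mult_in; use c c' in \<open>simp add: rel_def\<close>)+
    moreover have "(g ^ fact d / c') * (c / g ^ fact d) = c / c'"
      "(g ^ fact d / c) * (c' / g ^ fact d) = inverse (c / c')"
      using g c c' by (auto simp: rel_def)
    ultimately have "c / c' \<in> Q \<inter> F" "inverse (c / c') \<in> Q \<inter> F"
      using c c' by (auto simp: rel_def F.divide_mem F.inverse_mem)
    then have "ord_at (Q \<inter> F) (c / c') = 0"
      using P.ord_zero_iff[of "c / c'"] c c' by (auto simp: rel_def)
    then have "ord_at (Q \<inter> F) c = ord_at (Q \<inter> F) c'"
      using c c' by (auto simp: rel_def P.ord_divide)
    then show ?thesis by (simp add: \<phi>_def c'_def)
  qed
  have relI: "rel (g * h) (c * c')" if "rel g c" "rel h c'" for g h c c'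
  proof -
    have "(g ^ fact d / c) * (h ^ fact d / c') \<in> Q" "(c / g ^ fact d) * (c' / h ^ fact d) \<in> Q"
      by (rule Q.mult_in; use that in \<open>simp add: rel_def\<close>)+
    then show ?thesis using that by (auto simp: rel_def F.mult_mem power_mult_distrib)
  qed
  have v: "is_val K Q \<phi>" unfolding is_val_def
  proof (intro conjI ballI)
    fix g h assume g: "g \<in> K - {0}" and h: "h \<in> K - {0}"
    then obtain c c' where c: "rel g c" "rel h c'" using ex by blast
    then show "\<phi> (g * h) = \<phi> g + \<phi> h"
      using g h relI[OF c] uniq[of "g * h" "c * c'"] uniq[of g c] uniq[of h c']
      by (auto simp: mult_mem P.ord_mult rel_def)
  next
    fix g assume g: "g \<in> K - {0}"
    then obtain c where c: "rel g c" using ex by blast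
    have "g \<in> Q \<longleftrightarrow> g ^ fact d \<in> Q" using Q.power_in_iff[of g "fact d"] g by simp
    also have "\<dots> \<longleftrightarrow> c \<in> Q"
    proof
      assume "g ^ fact d \<in> Q"
      then have "g ^ fact d * (c / g ^ fact d) \<in> Q" using c by (intro Q.mult_in) (auto simp: rel_def)
      then show "c \<in> Q" using g by simp
    next
      assume "c \<in> Q"
      then have "c * (g ^ fact d / c) \<in> Q" using c by (intro Q.mult_in) (auto simp: rel_def)
      then show "g ^ fact d \<in> Q" using c by (simp add: rel_def)
    qed
    also have "\<dots> \<longleftrightarrow> 0 \<le> \<phi> g"
      using uniq[of g c] g c P.ord_nonneg_iff[of c] by (auto simp: rel_def)
    finally show "g \<in> Q \<longleftrightarrow> 0 \<le> \<phi> g" .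
  qed
  obtain t where t: "t \<in> F" "t \<noteq> 0" "ord_at (Q \<inter> F) t = 1" using P.ex_uniformizer by auto
  have "rel t (t ^ fact d)" using t by (auto simp: rel_def F.power_mem Q.one_in)
  then have "\<phi> t = fact d" using uniq[OF F_in_K[OF t(1)] t(2)] t by (simp add: P.ord_power)
  then show ?thesis
    by unfold_locales (use v t F_in_K in \<open>auto intro!: exI[of _ \<phi>] bexI[of _ t]\<close>)
qed

text \<open>Conjugates of \<open>g\<close> need not lie in \<open>Q\<close>, so the coefficients of
  \<open>charpoly g\<close> may have poles. Dividing by a coefficient \<open>c j\<close> of least
  order makes all of them regular and one of them 1. Reducing them to constants gives a nonzero
  polynomial over the constants that has the residue of \<open>g\<close> as a root.\<close>

lemma cplace_lift:
  assumes Q: "val_ring K Q" and P: "cplace F (Q \<inter> F) \<kappa>"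
  shows "cplace K Q \<kappa>"
proof -
  interpret P: cplace F "Q \<inter> F" \<kappa> by fact
  interpret Q: dvr K Q by (rule dvr_lift[OF Q]) unfold_locales
  show ?thesis
  proof
    show "\<kappa> c \<in> Q" for c using P.const_in by auto
    then have \<kappa>Q: "range \<kappa> \<subseteq> Q" by auto
    fix g assume g: "g \<in> Q"
    define c where "c i = coeff (charpoly g) i" for i
    have cF: "c i \<in> F" for i using charpoly_F[OF Q.in_K[OF g]] by (simp add: c_def)
    have "\<exists>j\<in>{j. j \<le> d \<and> c j \<noteq> 0}. \<forall>i\<in>{j. j \<le> d \<and> c j \<noteq> 0}. ord_at (Q \<inter> F) (c j) \<le> ord_at (Q \<inter> F) (c i)"
    proof -
      have "finite {j. j \<le> d \<and> c j \<noteq> 0}" "{j. j \<le> d \<and> c j \<noteq> 0} \<noteq> {}"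
        using charpoly_monic[of g] by (auto simp: c_def)
      then show ?thesis
        using arg_min_if_finite(1,2)[of "{j. j \<le> d \<and> c j \<noteq> 0}" "\<lambda>j. ord_at (Q \<inter> F) (c j)"]
        by (meson not_le)
    qed
    then obtain j where j: "j \<le> d" "c j \<noteq> 0"
      and jmin: "\<And>i. i \<le> d \<Longrightarrow> c i \<noteq> 0 \<Longrightarrow> ord_at (Q \<inter> F) (c j) \<le> ord_at (Q \<inter> F) (c i)" by blast
    have "c i / c j \<in> Q \<inter> F" if "i \<le> d" for i
      using P.ord_nonneg_iff[of "c i / c j"] P.ord_divide[of "c i" "c j"] jmin[OF that] cF j
      by (cases "c i = 0") (auto simp: P.zero_in F.divide_mem F.zero_mem Q.zero_in)
    then have "\<forall>i. \<exists>r. i \<le> d \<longrightarrow> c i / c j - \<kappa> r \<in> max_ideal_of Q"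
      using P.residue max_ideal_inter by blast
    then obtain r where r: "\<And>i. i \<le> d \<Longrightarrow> c i / c j - \<kappa> (r i) \<in> max_ideal_of Q" by metis
    define p where "p = (\<Sum>i\<le>d. monom (r i) i)"
    have cp: "coeff p i = (if i \<le> d then r i else 0)" for i
      by (simp add: p_def coeff_sum)
    have "poly (map_poly \<kappa> p) g = (\<Sum>i\<le>d. \<kappa> (r i) * g ^ i)"
    proof -
      have "degree (map_poly \<kappa> p) \<le> d"
        by (rule degree_le) (simp add: coeff_map_poly \<kappa>_0 cp)
      then have "poly (map_poly \<kappa> p) g = (\<Sum>i\<le>d. coeff (map_poly \<kappa> p) i * g ^ i)"
        by (auto simp: poly_altdef coeff_eq_0 le_degree intro!: sum.mono_neutral_left)
      then show ?thesis by (simp add: coeff_map_poly \<kappa>_0 cp)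
    qed
    also have "\<dots> = - (\<Sum>i\<le>d. (c i / c j - \<kappa> (r i)) * g ^ i)"
    proof -
      have "(\<Sum>i\<le>d. c i / c j * g ^ i) = (\<Sum>i\<le>d. c i * g ^ i) / c j"
        by (simp add: sum_divide_distrib)
      then show ?thesis using charpoly_root[of g]
        by (simp add: c_def left_diff_distrib sum_subtractf)
    qed
    also have "\<dots> \<in> max_ideal_of Q"
      using r g by (intro Q.uminus_M Q.sum_M Q.mult_M Q.power_in) auto
    finally have "poly (map_poly \<kappa> p) g \<in> max_ideal_of Q" .
    moreover have "p \<noteq> 0"
    proof
      assume "p = 0"
      then have "r j = 0" using cp[of j] j by simp
      then show False using r[OF j(1)] j Q.one_notin_M by (simp add: \<kappa>_0)
    qed
    ultimately show "\<exists>c. g - \<kappa> c \<in> max_ideal_of Q"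
      using root_residue[OF Q \<kappa>Q g] by blast
  qed
qed

end

section \<open>Places in cyclic extensions\<close>

text \<open>The description of \<open>ram_index\<close>, for an arbitrary ambient field.\<close>

definition ramification :: "'b::Fields.field set \<Rightarrow> 'b set \<Rightarrow> int"
  where "ramification P Q = (THE e. \<exists>t. uniformizer P t \<and> e = ord_at Q t)"

context cyclic_ext
begin

definition fib :: "'b set \<Rightarrow> 'b set set" where "fib P = {Q \<in> const_places K. Q \<inter> F = P}"

lemma fib_image: "Q \<in> fib P \<Longrightarrow> (\<tau> ^^ i) ` Q \<in> fib P"
  using const_places_image image_inter_F[of Q i] by (auto simp: fib_def const_places_def val_ring.subset)

end

locale cyclic_ext_place = cyclic_ext K \<tau> F \<kappa> d w z + P: cplace F P \<kappa>
  for K :: "'b::Fields.field set" and \<tau> and F :: "'b set"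
    and \<kappa> :: "'a::{alg_closed_field, field_char_0} \<Rightarrow> 'b" and d w z and P
begin

lemma fib_cplace: "Q \<in> fib P \<Longrightarrow> cplace K Q \<kappa>"
  using cplace_lift[of Q] P.cplace_axioms by (auto simp: fib_def const_places_def)

text \<open>Chevalley's theorem for a uniformizer \<open>t\<close> of \<open>P\<close> gives a
  valuation ring \<open>B\<close> of \<open>K\<close> above \<open>P\<close> without
  \<open>inverse t\<close>. Then \<open>B \<inter> F\<close> is proper and contains
  \<open>P\<close>, hence equals it by maximality of discrete valuation rings.\<close>

lemma fib_nonempty: "fib P \<noteq> {}"
proof -
  obtain t where t: "t \<in> F" "t \<noteq> 0" "ord_at P t = 1" using P.ex_uniformizer by auto
  have tP: "t \<in> P" "inverse t \<notin> P"
    using t P.ord_nonneg_iff[of t] P.ord_nonneg_iff[of "inverse t"] P.ord_inverse[of t] F.inverse_mem by auto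
  obtain B where B: "val_ring K B" "P \<subseteq> B" "inverse t \<notin> B"
    using ex_val_ring_above[of K P t] subfld_axioms P.subset F_sub tP t
    by (auto simp: ring_set_def P.one_in P.diff_in P.mult_in)
  have "B \<noteq> K" using B inverse_mem F_in_K t by auto
  moreover have "range \<kappa> \<subseteq> B" using B P.const_in by auto
  moreover have "B \<inter> F = P"
    using B P.subset t F.inverse_mem by (intro P.dvr_maximal val_ring_inter) auto
  ultimately show ?thesis using B by (auto simp: fib_def const_places_def)
qed

context
  fixes Q assumes Q: "Q \<in> fib P"
begin

interpretation Q: cplace K Q \<kappa> by (rule fib_cplace[OF Q])

lemma QF: "Q \<inter> F = P" using Q by (simp add: fib_def)

lemma ramification_ord:
  "h \<in> F \<Longrightarrow> h \<noteq> 0 \<Longrightarrow> ord_at Q h = ramification P Q * ord_at P h" (is "_ \<Longrightarrow> _ \<Longrightarrow> ?thesis1")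
  and ramification_pos: "ramification P Q > 0"
proof -
  obtain t where t: "t \<in> F" "t \<noteq> 0" "ord_at P t = 1" using P.ex_uniformizer by auto
  have eq: "ord_at Q h = ord_at Q t * ord_at P h" if h: "h \<in> F" "h \<noteq> 0" for h
  proof -
    define u where "u = h / t powi (ord_at P h)"
    have u: "u \<in> F" "u \<noteq> 0" using h t by (auto simp: u_def F.divide_mem F.power_int_mem)
    have "ord_at P u = 0" using h t unfolding u_def
      by (subst P.ord_divide) (auto simp: F.power_int_mem P.ord_power_int)
    then have "u \<in> P" "inverse u \<in> P" using P.ord_zero_iff u by auto
    then have "u \<in> Q" "inverse u \<in> Q" using QF by auto
    then have "ord_at Q u = 0" using Q.ord_zero_iff F_in_K u by auto
    then show ?thesis using h t unfolding u_def
      by (subst (asm) Q.ord_divide) (auto simp: F_in_K power_int_mem Q.ord_power_int)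
  qed
  have "ramification P Q = ord_at Q t"
    unfolding ramification_def
  proof (rule the_equality)
    show "\<exists>s. uniformizer P s \<and> ord_at Q t = ord_at Q s" using P.uniformizer_iff t by blast
    fix e assume "\<exists>s. uniformizer P s \<and> e = ord_at Q s"
    then show "e = ord_at Q t" using P.uniformizer_iff eq by auto
  qed
  then show "h \<in> F \<Longrightarrow> h \<noteq> 0 \<Longrightarrow> ?thesis1" using eq by simp
  have "t \<in> max_ideal_of P" using P.ord_pos_iff t by simp
  then have "t \<in> max_ideal_of Q" using max_ideal_inter[of Q] QF by auto
  then show "ramification P Q > 0" using Q.ord_pos_iff[of t] F_in_K t \<open>ramification P Q = ord_at Q t\<close> by simp
qed

end

lemma ramification_image:
  assumes Q: "Q \<in> fib P" shows "ramification P ((\<tau> ^^ i) ` Q) = ramification P Q"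
proof -
  interpret \<tau>i: fld_aut K "\<tau> ^^ i" by (rule fld_aut_funpow)
  interpret Q: cplace K Q \<kappa> by (rule fib_cplace[OF Q])
  obtain t where t: "t \<in> F" "t \<noteq> 0" "ord_at P t = 1" using P.ex_uniformizer by auto
  have "ord_at ((\<tau> ^^ i) ` Q) ((\<tau> ^^ i) t) = ord_at Q t"
    using \<tau>i.dvr_image(2)[OF Q.dvr_axioms F_in_K] t by simp
  then show ?thesis
    using ramification_ord[OF fib_image[OF Q] t(1,2)] ramification_ord[OF Q t(1,2)] t funpow_fixed by simp
qed

lemma funpow_image_add: "(\<tau> ^^ (i + j)) ` Q = (\<tau> ^^ i) ` (\<tau> ^^ j) ` Q"
  by (simp add: funpow_add image_comp)

lemma funpow_image_period: "Q \<subseteq> K \<Longrightarrow> (\<tau> ^^ d) ` Q = Q"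
  using period by (force simp: image_iff)

lemma funpow_image_mod: "Q \<subseteq> K \<Longrightarrow> (\<tau> ^^ i) ` Q = (\<tau> ^^ (i mod d)) ` Q"
proof -
  assume Q: "Q \<subseteq> K"
  have "(\<tau> ^^ (d * k)) ` Q = Q" for k
    by (induction k) (simp_all add: funpow_image_add funpow_image_period Q)
  then show ?thesis
    using funpow_image_add[of "i mod d" "d * (i div d)" Q] by (simp add: mod_mult_div_eq)
qed

lemma ord_norm:
  assumes Q: "Q \<in> fib P" and g: "g \<in> K" "g \<noteq> 0"
  shows "ord_at Q (norm g) = (\<Sum>i<d. ord_at Q ((\<tau> ^^ i) g))"
proof -
  interpret Q: cplace K Q \<kappa> by (rule fib_cplace[OF Q])
  show ?thesis unfolding norm_def using g fld_aut.aut_eq_0_iff[OF fld_aut_funpow]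
    by (intro Q.ord_prod) (auto simp: funpow_aut_mem)
qed

lemma ord_funpow:
  assumes Q: "Q \<in> fib P" and g: "g \<in> K" "g \<noteq> 0" and i: "i \<le> d"
  shows "ord_at Q ((\<tau> ^^ i) g) = ord_at ((\<tau> ^^ (d - i)) ` Q) g"
proof -
  interpret Q: cplace K Q \<kappa> by (rule fib_cplace[OF Q])
  interpret R: cplace K "(\<tau> ^^ (d - i)) ` Q" \<kappa> by (rule fib_cplace[OF fib_image[OF Q]])
  have "(\<tau> ^^ i) ` (\<tau> ^^ (d - i)) ` Q = Q"
    using i Q.subset by (simp flip: funpow_image_add add: funpow_image_period)
  then show ?thesis
    using fld_aut.dvr_image(2)[OF fld_aut_funpow R.dvr_axioms g, of i] by simp
qed

text \<open>Were \<open>Q'\<close> not conjugate to \<open>Q\<close>, approximation would give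
  \<open>g\<close> with a simple zero at \<open>Q\<close> and order 0 at all other conjugates of
  \<open>Q\<close> and \<open>Q'\<close>. Its norm would vanish at \<open>Q\<close> but not at
  \<open>Q'\<close>, although it comes from \<open>F\<close> and both places lie above
  \<open>P\<close>.\<close>

lemma fib_transitive:
  assumes Q: "Q \<in> fib P" and Q': "Q' \<in> fib P"
  shows "\<exists>i<d. Q' = (\<tau> ^^ i) ` Q"
proof (rule ccontr)
  assume neg: "\<not> ?thesis"
  interpret Q: cplace K Q \<kappa> by (rule fib_cplace[OF Q])
  interpret Q': cplace K Q' \<kappa> by (rule fib_cplace[OF Q'])
  define \<Omega> where "\<Omega> = (\<lambda>i. (\<tau> ^^ i) ` Q) ` {..<d} \<union> (\<lambda>i. (\<tau> ^^ i) ` Q') ` {..<d} - {Q}"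
  have fibs: "R \<in> fib P" if "R \<in> \<Omega>" for R using that fib_image Q Q' by (auto simp: \<Omega>_def)
  have "\<exists>g\<in>K - {0}. ord_at Q g = 1 \<and> (\<forall>R\<in>\<Omega>. ord_at R g = 0)"
  proof (rule \<kappa>_weak_approximation)
    show "dvr K R \<and> range \<kappa> \<subseteq> R" if "R \<in> \<Omega>" for R
      using fib_cplace[OF fibs[OF that]] by (auto simp: cplace_def cplace.const_in)
  qed (use Q.dvr_axioms Q.const_in in \<open>auto simp: \<Omega>_def\<close>)
  then obtain g where g: "g \<in> K" "g \<noteq> 0" "ord_at Q g = 1" "\<And>R. R \<in> \<Omega> \<Longrightarrow> ord_at R g = 0" by blast
  have Nz: "norm g \<in> F" "norm g \<noteq> 0" using g norm_mem norm_eq_0_iff by auto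
  have orb: "ord_at R g \<ge> 0" if "R = (\<tau> ^^ j) ` Q" for R j
    using g(4)[of "(\<tau> ^^ (j mod d)) ` Q"] g(3) funpow_image_mod[OF Q.subset, of j] that d_pos
    by (cases "R = Q") (auto simp: \<Omega>_def)
  have "ord_at Q (norm g) = (\<Sum>i<d. ord_at Q ((\<tau> ^^ i) g))" by (rule ord_norm[OF Q g(1,2)])
  also have "\<dots> \<ge> (\<Sum>i\<in>{0}. ord_at Q ((\<tau> ^^ i) g))"
    using d_pos orb ord_funpow[OF Q g(1,2)] by (intro sum_mono2) auto
  finally have "ord_at Q (norm g) > 0" using g(3) by simp
  moreover have "ord_at Q' (norm g) = 0"
  proof -
    have "ord_at Q' ((\<tau> ^^ i) g) = 0" if i: "i < d" for i
    proof -
      define R where "R = (\<tau> ^^ (d - i)) ` Q'"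
      have "R \<noteq> Q"
      proof
        assume "R = Q"
        then have "(\<tau> ^^ i) ` Q = (\<tau> ^^ (i + (d - i))) ` Q'" by (simp only: R_def funpow_image_add)
        then show False using neg i funpow_image_period[OF Q'.subset] by auto
      qed
      moreover have "R = (\<tau> ^^ ((d - i) mod d)) ` Q'" unfolding R_def by (rule funpow_image_mod[OF Q'.subset])
      then have "R \<in> (\<lambda>i. (\<tau> ^^ i) ` Q') ` {..<d}" using d_pos by auto
      ultimately have "R \<in> \<Omega>" by (simp add: \<Omega>_def)
      then show ?thesis using g(4) ord_funpow[OF Q' g(1,2), of i] i by (simp add: R_def)
    qed
    then show ?thesis by (simp add: ord_norm[OF Q' g(1,2)])
  qed
  ultimately show False
    using ramification_ord[OF Q Nz] ramification_ord[OF Q' Nz] ramification_pos[OF Q'] by auto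
qed

lemma finite_fib: "finite (fib P)"
proof -
  obtain Q where "Q \<in> fib P" using fib_nonempty by auto
  then have "fib P \<subseteq> (\<lambda>i. (\<tau> ^^ i) ` Q) ` {..<d}" using fib_transitive by blast
  then show ?thesis by (rule finite_subset) simp
qed

lemma ramification_eq:
  assumes "Q \<in> fib P" "Q' \<in> fib P" shows "ramification P Q = ramification P Q'"
  using fib_transitive[OF assms] ramification_image[OF assms(1)] by auto

lemma sum_fib_funpow:
  assumes g: "g \<in> K" "g \<noteq> 0" and i: "i < d"
  shows "(\<Sum>Q\<in>fib P. ord_at Q ((\<tau> ^^ i) g)) = (\<Sum>Q\<in>fib P. ord_at Q g)"
proof -
  have sub: "Q \<subseteq> K" if "Q \<in> fib P" for Q
    using that by (auto simp: fib_def const_places_def val_ring.subset)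
  have eq: "(\<tau> ^^ i) ` (\<tau> ^^ (d - i)) ` Q = Q" "(\<tau> ^^ (d - i)) ` (\<tau> ^^ i) ` Q = Q" if "Q \<in> fib P" for Q
    using i sub[OF that] by (simp_all flip: funpow_image_add add: funpow_image_period)
  show ?thesis
    by (rule sum.reindex_bij_witness[where i = "\<lambda>Q. (\<tau> ^^ i) ` Q" and j = "\<lambda>Q. (\<tau> ^^ (d - i)) ` Q"])
      (use i eq fib_image ord_funpow[OF _ g] in auto)
qed

text \<open>The order of \<open>norm g\<close> summed over the fibre is computed twice: by
  ramification from below, and factor by factor with \<tau> permuting the fibre.\<close>

lemma sum_fib_norm:
  assumes g: "g \<in> K" "g \<noteq> 0" and Q: "Q \<in> fib P"
  shows "int d * (\<Sum>Q\<in>fib P. ord_at Q g) = int (card (fib P)) * ramification P Q * ord_at P (norm g)"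
proof -
  have Nz: "norm g \<in> F" "norm g \<noteq> 0" using g norm_mem norm_eq_0_iff by auto
  have "(\<Sum>Q\<in>fib P. ord_at Q (norm g)) = (\<Sum>Q'\<in>fib P. ramification P Q * ord_at P (norm g))"
    by (intro sum.cong refl) (use ramification_ord[OF _ Nz] ramification_eq[OF _ Q] in auto)
  then have "int (card (fib P)) * ramification P Q * ord_at P (norm g) = (\<Sum>Q\<in>fib P. ord_at Q (norm g))"
    by simp
  also have "\<dots> = (\<Sum>Q\<in>fib P. \<Sum>i<d. ord_at Q ((\<tau> ^^ i) g))"
    by (intro sum.cong refl ord_norm g)
  also have "\<dots> = (\<Sum>i<d. \<Sum>Q\<in>fib P. ord_at Q ((\<tau> ^^ i) g))" by (rule sum.swap)
  also have "\<dots> = int d * (\<Sum>Q\<in>fib P. ord_at Q g)" using sum_fib_funpow[OF g] by simp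
  finally show ?thesis by simp
qed

text \<open>All residue degrees are 1, so only the number of places and the ramification index
  occur. An element of order 1 at \<open>Q\<close> and 0 at the rest of the fibre shows that their
  product divides \<open>d\<close>. Conversely, the pigeonhole principle yields a power
  \<open>\<tau> ^^ r\<close> stabilising \<open>Q\<close> with \<open>r\<close> positive and at most
  the size of the fibre, and the eigenvector \<open>w\<close> shows
  \<open>d \<le> r * e\<close>.\<close>

theorem fundamental_identity:
  assumes Q: "Q \<in> fib P"
  shows "int (card (fib P)) * ramification P Q = int d"
proof -
  interpret Q: cplace K Q \<kappa> by (rule fib_cplace[OF Q])
  define e where "e = ramification P Q"
  have e: "e > 0" using ramification_pos[OF Q] by (simp add: e_def)
  have "\<exists>g\<in>K - {0}. ord_at Q g = 1 \<and> (\<forall>R\<in>fib P - {Q}. ord_at R g = 0)"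
  proof (rule \<kappa>_weak_approximation)
    show "dvr K R \<and> range \<kappa> \<subseteq> R" if "R \<in> fib P - {Q}" for R
      using fib_cplace[of R] that by (auto simp: cplace_def cplace.const_in)
  qed (use Q.dvr_axioms Q.const_in finite_fib in auto)
  then obtain g where g: "g \<in> K" "g \<noteq> 0" "ord_at Q g = 1" "\<And>R. R \<in> fib P - {Q} \<Longrightarrow> ord_at R g = 0" by blast
  have "(\<Sum>Q\<in>fib P. ord_at Q g) = 1"
    using sum.remove[OF finite_fib Q, of "\<lambda>Q. ord_at Q g"] g by simp
  then have "int d = int (card (fib P)) * e * ord_at P (norm g)"
    using sum_fib_norm[OF g(1,2) Q] by (simp add: e_def)
  then have dv: "int (card (fib P)) * e dvd int d" by simp
  have "\<not> inj_on (\<lambda>i. (\<tau> ^^ i) ` Q) {..card (fib P)}"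
  proof
    assume "inj_on (\<lambda>i. (\<tau> ^^ i) ` Q) {..card (fib P)}"
    then have "card {..card (fib P)} \<le> card (fib P)"
      using finite_fib fib_image[OF Q] by (intro card_inj_on_le) auto
    then show False by simp
  qed
  then obtain i j where ij: "i < j" "j \<le> card (fib P)" "(\<tau> ^^ i) ` Q = (\<tau> ^^ j) ` Q"
    unfolding inj_on_def by (metis atMost_iff linorder_neqE_nat)
  define r where "r = j - i"
  interpret \<tau>r: fld_aut K "\<tau> ^^ r" by (rule fld_aut_funpow)
  have rQ: "(\<tau> ^^ r) ` Q = Q"
  proof -
    have "(\<tau> ^^ i) ` (\<tau> ^^ r) ` Q = (\<tau> ^^ i) ` Q"
      using ij by (simp add: r_def flip: funpow_image_add)
    moreover have "inj_on (\<tau> ^^ i) K" by (rule fld_aut.inj_aut[OF fld_aut_funpow])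
    ultimately show ?thesis
      using inj_on_image_eq_iff[of "\<tau> ^^ i" K "(\<tau> ^^ r) ` Q" Q] Q.subset \<tau>r.aut_mem by blast
  qed
  \<comment> \<open>The unit \<open>w ^ e / t ^ ord w\<close> is multiplied by \<open>z ^ (r * e)\<close>, but its residue is fixed by the stabilizer.\<close>
  obtain t where t: "t \<in> F" "t \<noteq> 0" "ord_at P t = 1" using P.ex_uniformizer by auto
  define u where "u = w ^ nat e / t powi ord_at Q w"
  have u: "u \<in> K" "u \<noteq> 0" using w t by (auto simp: u_def F_in_K divide_mem power_mem power_int_mem)
  have "ord_at Q u = 0" unfolding u_def using w t e ramification_ord[OF Q t(1,2)]
    by (subst Q.ord_divide) (auto simp: F_in_K power_mem power_int_mem Q.ord_power Q.ord_power_int e_def)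
  then have uQ: "u \<in> Q" "inverse u \<in> Q" using Q.ord_zero_iff u by auto
  obtain b where b: "u - \<kappa> b \<in> max_ideal_of Q" using Q.residue uQ by blast
  have b0: "b \<noteq> 0"
  proof
    assume "b = 0"
    then have "u \<in> max_ideal_of Q" using b \<kappa>_0 by simp
    then show False using uQ(2) u(2) by (simp add: max_ideal_of_def)
  qed
  have \<tau>w: "(\<tau> ^^ k) w = \<kappa> (z ^ k) * w" for k
  proof (induction k)
    case (Suc k)
    have "\<tau> (\<kappa> (z ^ k) * w) = \<kappa> (z ^ k) * (\<kappa> z * w)"
      using w \<kappa>_K \<kappa>_F fixed[OF \<kappa>_K] by (simp add: aut_mult)
    then show ?case using Suc by (simp add: \<kappa>_mult mult_ac)
  qed (simp add: \<kappa>_1)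
  have \<tau>u: "(\<tau> ^^ r) u = \<kappa> (z ^ (r * nat e)) * u"
  proof -
    have "(\<tau> ^^ r) (t powi ord_at Q w) = t powi ord_at Q w"
      by (rule funpow_fixed) (simp add: F.power_int_mem t)
    then have "(\<tau> ^^ r) u = (\<kappa> (z ^ r) * w) ^ nat e / t powi ord_at Q w"
      unfolding u_def using w t \<tau>w
      by (subst \<tau>r.aut_divide) (auto simp: power_mem power_int_mem F_in_K \<tau>r.aut_power)
    also have "\<dots> = \<kappa> ((z ^ r) ^ nat e) * u"
      unfolding u_def \<kappa>_power[of _ "nat e"] by (simp add: power_mult_distrib)
    finally show ?thesis by (simp add: power_mult)
  qed
  have "(\<tau> ^^ r) (u - \<kappa> b) \<in> max_ideal_of ((\<tau> ^^ r) ` Q)"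
    using \<tau>r.aut_max_ideal_iff[OF Q.val_ring_axioms] b u \<kappa>_K diff_mem by blast
  then have "\<kappa> (z ^ (r * nat e)) * u - \<kappa> b \<in> max_ideal_of Q"
    using rQ u \<tau>u funpow_fixed[OF \<kappa>_F] by (simp add: \<tau>r.aut_diff \<kappa>_K)
  moreover have \<kappa>Q: "range \<kappa> \<subseteq> Q" using Q.const_in by auto
  moreover have "(u - \<kappa> b) * \<kappa> (z ^ (r * nat e)) \<in> max_ideal_of Q"
    by (rule Q.mult_M[OF b Q.const_in])
  ultimately have "\<kappa> (z ^ (r * nat e)) * u - \<kappa> b - (u - \<kappa> b) * \<kappa> (z ^ (r * nat e)) \<in> max_ideal_of Q"
    using Q.diff_M by blast
  moreover have "\<kappa> (z ^ (r * nat e)) * u - \<kappa> b - (u - \<kappa> b) * \<kappa> (z ^ (r * nat e)) = \<kappa> (b * (z ^ (r * nat e) - 1))"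
    by (simp add: \<kappa>_mult \<kappa>_diff \<kappa>_1 algebra_simps)
  ultimately have "z ^ (r * nat e) = 1"
    using \<kappa>_in_max_ideal_iff[OF Q.val_ring_axioms \<kappa>Q] b0 by auto
  then have "\<not> r * nat e < d" using z_order[of "r * nat e"] e ij by (auto simp: r_def)
  then have "int d \<le> int r * e" using e by (metis int_nat_eq le_less not_le of_nat_le_iff of_nat_mult)
  also have "\<dots> \<le> int (card (fib P)) * e" using ij e by (intro mult_right_mono) (auto simp: r_def)
  finally show ?thesis
    using zdvd_imp_le[OF dv] d_pos by (simp add: e_def)
qed

text \<open>The divisor of the norm is the push-forward of the divisor, the form in which norms
  enter the divisibility argument.\<close>

lemma sum_fib: "g \<in> K \<Longrightarrow> g \<noteq> 0 \<Longrightarrow> (\<Sum>Q\<in>fib P. ord_at Q g) = ord_at P (norm g)"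
proof -
  assume g: "g \<in> K" "g \<noteq> 0"
  obtain Q where Q: "Q \<in> fib P" using fib_nonempty by auto
  show ?thesis using sum_fib_norm[OF g Q] fundamental_identity[OF Q] d_pos by simp
qed

lemma sum_ramification: "(\<Sum>Q\<in>fib P. ramification P Q) = int d"
proof -
  obtain Q where Q: "Q \<in> fib P" using fib_nonempty by auto
  have "(\<Sum>Q'\<in>fib P. ramification P Q') = (\<Sum>Q'\<in>fib P. ramification P Q)"
    by (intro sum.cong refl ramification_eq Q)
  then show ?thesis using fundamental_identity[OF Q] by simp
qed

end

section \<open>Function fields of curves: finitely many zeros and poles, and degree zero\<close>

locale curve_field = subfld F + const_field \<kappa>
  for F :: "'b::Fields.field set" and \<kappa> :: "'a::{alg_closed_field, field_char_0} \<Rightarrow> 'b" +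
  assumes const_mem: "\<kappa> c \<in> F"
    and cplaces: "P \<in> const_places F \<Longrightarrow> cplace F P \<kappa>"
    and finite_support: "g \<in> F \<Longrightarrow> g \<noteq> 0 \<Longrightarrow> finite {P \<in> const_places F. ord_at P g \<noteq> 0}"
    and sum_ord: "g \<in> F \<Longrightarrow> g \<noteq> 0 \<Longrightarrow> (\<Sum>P | P \<in> const_places F \<and> ord_at P g \<noteq> 0. ord_at P g) = 0"
    and places_nonempty: "const_places F \<noteq> {}"
begin

text \<open>Subtract the residue of \<open>g\<close> at one place: a nonconstant \<open>g\<close>
  would give a nonzero function with a zero and no pole, contradicting degree 0.\<close>

lemma regular_const:
  assumes g: "g \<in> F" "\<And>P. P \<in> const_places F \<Longrightarrow> g \<in> P"
  shows "g \<in> range \<kappa>"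
proof (rule ccontr)
  assume nc: "g \<notin> range \<kappa>"
  obtain P where P: "P \<in> const_places F" using places_nonempty by auto
  interpret P: cplace F P \<kappa> by (rule cplaces[OF P])
  obtain c where c: "g - \<kappa> c \<in> max_ideal_of P" using P.residue g(2)[OF P] by blast
  define h where "h = g - \<kappa> c"
  have h: "h \<in> F" "h \<noteq> 0" using g const_mem nc by (auto simp: h_def diff_mem)
  have "ord_at Q h \<ge> 0" if Q: "Q \<in> const_places F" for Q
  proof -
    interpret Q: cplace F Q \<kappa> by (rule cplaces[OF Q])
    have "h \<in> Q" unfolding h_def by (intro Q.diff_in g(2)[OF Q] Q.const_in)
    then show ?thesis using Q.ord_nonneg_iff h by simp
  qed
  moreover have "ord_at P h > 0" using P.ord_pos_iff h c by (simp add: h_def)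
  ultimately have "(\<Sum>P | P \<in> const_places F \<and> ord_at P h \<noteq> 0. ord_at P h) > 0"
    using P finite_support[OF h] by (intro sum_pos2[of _ P]) auto
  then show False using sum_ord[OF h] by simp
qed

end

text \<open>Away from the zeros and poles of the coefficients of \<open>charpoly g\<close> and
  \<open>charpoly (inverse g)\<close>, both \<open>g\<close> and \<open>inverse g\<close> are
  integral, which bounds the support. The degree of the divisor of \<open>g\<close> is that of
  \<open>norm g\<close> on the lower curve.\<close>

lemma (in cyclic_ext) curve_field_lift:
  assumes "curve_field F \<kappa>"
  shows "curve_field K \<kappa>"
proof -
  interpret C: curve_field F \<kappa> by fact
  have fibre: "Q \<inter> F \<in> const_places F" "Q \<in> fib (Q \<inter> F)" if "Q \<in> const_places K" for Q
    using that inter_const_place by (auto simp: fib_def)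
  have cp: "cyclic_ext_place K \<tau> F \<kappa> d w z P" if "P \<in> const_places F" for P
    using C.cplaces[OF that] cyclic_ext_axioms by (simp add: cyclic_ext_place_def)
  have fin: "finite {Q \<in> const_places K. ord_at Q g \<noteq> 0}" if g: "g \<in> K" "g \<noteq> 0" for g
  proof -
    define c where "c g i = coeff (charpoly g) i" for g i
    define B where "B = (\<Union>h\<in>{g, inverse g}. \<Union>i\<in>{i. i < d \<and> c h i \<noteq> 0}.
      {P \<in> const_places F. ord_at P (c h i) \<noteq> 0})"
    have cF: "c h i \<in> F" if "h \<in> K" for h i using that charpoly_F by (simp add: c_def)
    have "finite B" unfolding B_def
      using g by (intro finite_UN_I C.finite_support) (auto simp: cF inverse_mem)
    have reg: "h \<in> Q" if Q: "Q \<in> const_places K" "Q \<inter> F \<notin> B" and h: "h \<in> {g, inverse g}" for h Q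
    proof -
      interpret Q: val_ring K Q using Q by (simp add: const_places_def)
      interpret P: cplace F "Q \<inter> F" \<kappa> by (rule C.cplaces[OF fibre(1)[OF Q(1)]])
      have hK: "h \<in> K" using h g inverse_mem by auto
      have "c h i \<in> Q" if i: "i < d" for i
      proof (cases "c h i = 0")
        case False
        then have "ord_at (Q \<inter> F) (c h i) = 0" using Q h i fibre(1)[OF Q(1)] by (auto simp: B_def)
        then show ?thesis using P.ord_nonneg_iff[OF cF[OF hK] False] by simp
      qed (simp add: Q.zero_in)
      then show ?thesis
        by (intro Q.integrally_closed[OF hK _ charpoly_root']) (auto simp: c_def intro: Q.uminus_in)
    qed
    have "{Q \<in> const_places K. ord_at Q g \<noteq> 0} \<subseteq> (\<Union>P\<in>B. fib P)"
    proof
      fix Q assume Q: "Q \<in> {Q \<in> const_places K. ord_at Q g \<noteq> 0}"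
      interpret Q: dvr K Q
        using Q fibre[of Q] cyclic_ext_place.fib_cplace[OF cp] by (auto simp: cplace_def)
      have "Q \<inter> F \<in> B"
      proof (rule ccontr)
        assume "Q \<inter> F \<notin> B"
        then have "g \<in> Q" "inverse g \<in> Q" using reg Q by auto
        then show False using Q.ord_zero_iff g Q by auto
      qed
      then show "Q \<in> (\<Union>P\<in>B. fib P)" using fibre Q by auto
    qed
    moreover have "finite (\<Union>P\<in>B. fib P)"
      using \<open>finite B\<close> cyclic_ext_place.finite_fib[OF cp] by (intro finite_UN_I) (auto simp: B_def)
    ultimately show ?thesis by (rule finite_subset)
  qed
  show ?thesis
  proof (intro curve_field.intro curve_field_axioms.intro subfld_axioms const_field_axioms)
    show "\<kappa> c \<in> K" for c by (rule \<kappa>_K)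
    show "cplace K Q \<kappa>" if "Q \<in> const_places K" for Q
      using fibre[OF that] cyclic_ext_place.fib_cplace[OF cp] by auto
    show "finite {Q \<in> const_places K. ord_at Q g \<noteq> 0}" if "g \<in> K" "g \<noteq> 0" for g by (rule fin[OF that])
    show "(\<Sum>P | P \<in> const_places K \<and> ord_at P g \<noteq> 0. ord_at P g) = 0" if g: "g \<in> K" "g \<noteq> 0" for g
    proof -
      have Nz: "norm g \<in> F" "norm g \<noteq> 0" using g norm_mem norm_eq_0_iff by auto
      define S where "S = {Q \<in> const_places K. ord_at Q g \<noteq> 0}"
      \<comment> \<open>\<open>T\<close> contains the places below the support of \<open>g\<close>
        and the support of \<open>norm g\<close>, so that both sums can be extended to it.\<close>
      define T where "T = (\<lambda>Q. Q \<inter> F) ` S \<union> {P \<in> const_places F. ord_at P (norm g) \<noteq> 0}"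
      have T: "finite T" "T \<subseteq> const_places F"
        using fin[OF g] C.finite_support[OF Nz] fibre by (auto simp: T_def S_def)
      have fT: "finite (fib P)" if "P \<in> T" for P
        using cyclic_ext_place.finite_fib[OF cp] that T by blast
      have "(\<Sum>Q\<in>S. ord_at Q g) = (\<Sum>Q\<in>(\<Union>P\<in>T. fib P). ord_at Q g)"
      proof (rule sum.mono_neutral_left)
        show "finite (\<Union>P\<in>T. fib P)" using T fT by blast
        show "S \<subseteq> (\<Union>P\<in>T. fib P)" using fibre by (auto simp: S_def T_def)
        show "\<forall>Q\<in>(\<Union>P\<in>T. fib P) - S. ord_at Q g = 0" by (auto simp: S_def fib_def)
      qed
      also have "\<dots> = (\<Sum>P\<in>T. \<Sum>Q\<in>fib P. ord_at Q g)"
        using T fT by (intro sum.UNION_disjoint) (auto simp: fib_def)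
      also have "\<dots> = (\<Sum>P\<in>T. ord_at P (norm g))"
        using T by (intro sum.cong refl cyclic_ext_place.sum_fib[OF cp] g) auto
      also have "\<dots> = (\<Sum>P | P \<in> const_places F \<and> ord_at P (norm g) \<noteq> 0. ord_at P (norm g))"
        using T by (intro sum.mono_neutral_right) (auto simp: T_def)
      also have "\<dots> = 0" by (rule C.sum_ord[OF Nz])
      finally show ?thesis by (simp add: S_def)
    qed
    show "const_places K \<noteq> {}"
      using C.places_nonempty cyclic_ext_place.fib_nonempty[OF cp] by (fastforce simp: fib_def)
  qed
qed

section \<open>The rational function field\<close>

lemma fun_of_poly_simps [simp]:
  "fun_of_poly 0 = 0" "fun_of_poly 1 = 1"
  "fun_of_poly (p + q) = fun_of_poly p + fun_of_poly q"
  "fun_of_poly (p - q) = fun_of_poly p - fun_of_poly q"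
  "fun_of_poly (- p) = - fun_of_poly p"
  "fun_of_poly (p * q) = fun_of_poly p * fun_of_poly q"
  "fun_of_poly p = fun_of_poly q \<longleftrightarrow> p = q"
  "fun_of_poly p = 0 \<longleftrightarrow> p = 0"
  by (simp_all add: fun_of_poly_def)

lemma fun_of_poly_power: "fun_of_poly (p ^ n) = fun_of_poly p ^ n"
  by (induction n) auto

lemma fun_of_poly_sum: "fun_of_poly (sum u A) = (\<Sum>i\<in>A. fun_of_poly (u i))"
  by (induction A rule: infinite_finite_induct) auto

abbreviation const_fun :: "'a::{alg_closed_field, field_char_0} \<Rightarrow> 'a ffun"
  where "const_fun c \<equiv> fun_of_poly [:c:]"

interpretation cf: const_field const_fun
proof
  show "const_fun (1::'a) = 1" by (metis fun_of_poly_simps(2) one_pCons)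
  show "const_fun (a + b) = const_fun a + const_fun b" for a b :: 'a
    by (simp flip: fun_of_poly_simps(3))
  show "const_fun (a * b) = const_fun a * const_fun b" for a b :: 'a
    by (simp flip: fun_of_poly_simps(6))
qed

definition rat_field :: "'a::{alg_closed_field, field_char_0} ffun set"
  where "rat_field = {fun_of_poly p / fun_of_poly q | p q. q \<noteq> 0}"

lemma rat_fieldI: "q \<noteq> 0 \<Longrightarrow> fun_of_poly p / fun_of_poly q \<in> rat_field"
  by (auto simp: rat_field_def)

lemma rat_fieldE:
  assumes "g \<in> rat_field" obtains p q where "q \<noteq> 0" "g = fun_of_poly p / fun_of_poly q"
  using assms by (auto simp: rat_field_def)

lemma fun_of_poly_rat: "fun_of_poly p \<in> rat_field"
  using rat_fieldI[of 1 p] by simp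

lemma fun_of_poly_divide_diff:
  "q \<noteq> 0 \<Longrightarrow> q' \<noteq> 0 \<Longrightarrow> fun_of_poly p / fun_of_poly q - fun_of_poly p' / fun_of_poly q'
     = fun_of_poly (p * q' - p' * q) / fun_of_poly (q * q')"
  by (simp add: field_simps)

lemma fun_of_poly_divide_mult:
  "fun_of_poly p / fun_of_poly q * (fun_of_poly p' / fun_of_poly q') = fun_of_poly (p * p') / fun_of_poly (q * q')"
  by simp

interpretation rat: subfld rat_field
proof
  show "1 \<in> rat_field" using fun_of_poly_rat[of 1] by simp
  fix a b :: "'a ffun" assume "a \<in> rat_field" "b \<in> rat_field"
  then obtain p q p' q' where "q \<noteq> 0" "q' \<noteq> 0" "a = fun_of_poly p / fun_of_poly q" "b = fun_of_poly p' / fun_of_poly q'"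
    by (metis rat_fieldE)
  then have "a - b = fun_of_poly (p * q' - p' * q) / fun_of_poly (q * q')" "q * q' \<noteq> 0"
    "a * b = fun_of_poly (p * p') / fun_of_poly (q * q')"
    using fun_of_poly_divide_diff by auto
  then show "a - b \<in> rat_field" "a * b \<in> rat_field" by (metis rat_fieldI)+
next
  fix a :: "'a ffun" assume "a \<in> rat_field"
  then obtain p q where pq: "q \<noteq> 0" "a = fun_of_poly p / fun_of_poly q" by (rule rat_fieldE)
  then show "inverse a \<in> rat_field"
    using rat_fieldI[of p q] fun_of_poly_rat[of 0] by (cases "p = 0") auto
qed

text \<open>Well defined on nonzero functions for additive \<psi>, by cross-multiplication. It is
  instantiated by the order of vanishing at a point and by minus the degree.\<close>

definition rat_val :: "('a poly \<Rightarrow> int) \<Rightarrow> 'a::{alg_closed_field, field_char_0} ffun \<Rightarrow> int"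
  where "rat_val \<psi> g = (case SOME (p, q). q \<noteq> 0 \<and> g = fun_of_poly p / fun_of_poly q of (p, q) \<Rightarrow> \<psi> p - \<psi> q)"

lemma rat_val:
  assumes \<psi>: "\<And>p q. p \<noteq> 0 \<Longrightarrow> q \<noteq> 0 \<Longrightarrow> \<psi> (p * q) = \<psi> p + \<psi> q" and "p \<noteq> 0" "q \<noteq> 0"
  shows "rat_val \<psi> (fun_of_poly p / fun_of_poly q) = \<psi> p - \<psi> q"
proof -
  define pq where "pq = (SOME (p', q'). q' \<noteq> 0 \<and> fun_of_poly p / fun_of_poly q = fun_of_poly p' / fun_of_poly q')"
  have "case pq of (p', q') \<Rightarrow> q' \<noteq> 0 \<and> fun_of_poly p / fun_of_poly q = fun_of_poly p' / fun_of_poly q'"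
    unfolding pq_def by (rule someI[of _ "(p, q)"]) (use assms in auto)
  then obtain p' q' where pq': "pq = (p', q')" "q' \<noteq> 0" "fun_of_poly p / fun_of_poly q = fun_of_poly p' / fun_of_poly q'"
    by (cases pq) auto
  then have "fun_of_poly (p * q') = fun_of_poly (p' * q)"
    using assms by (simp add: field_simps)
  then have eq: "p * q' = p' * q" by (simp only: fun_of_poly_simps(7))
  then have "p' \<noteq> 0" using assms pq' by auto
  then have "\<psi> p + \<psi> q' = \<psi> p' + \<psi> q" using \<psi>[of p q'] \<psi>[of p' q] eq assms pq' by simp
  then show ?thesis using pq'(1) unfolding rat_val_def pq_def[symmetric] by simp
qed

lemma rat_val_mult:
  assumes \<psi>: "\<And>p q. p \<noteq> 0 \<Longrightarrow> q \<noteq> 0 \<Longrightarrow> \<psi> (p * q) = \<psi> p + \<psi> q"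
    and "g \<in> rat_field - {0}" "h \<in> rat_field - {0}"
  shows "rat_val \<psi> (g * h) = rat_val \<psi> g + rat_val \<psi> h"
proof -
  obtain p q p' q' where "q \<noteq> 0" "q' \<noteq> 0" "g = fun_of_poly p / fun_of_poly q" "h = fun_of_poly p' / fun_of_poly q'"
    using assms by (metis DiffD1 rat_fieldE)
  moreover from this have "p \<noteq> 0" "p' \<noteq> 0" using assms by auto
  ultimately show ?thesis
    by (simp only: fun_of_poly_divide_mult rat_val[OF \<psi>] mult_eq_0_iff simp_thms not_False_eq_True \<psi>)
qed

lemma order_additive: "p \<noteq> 0 \<Longrightarrow> q \<noteq> 0 \<Longrightarrow> int (order a (p * q)) = int (order a p) + int (order a q)"
  by (simp add: order_mult)

lemma degree_additive:
  "p \<noteq> 0 \<Longrightarrow> q \<noteq> 0 \<Longrightarrow> - int (degree (p * q :: 'a::idom poly)) = - int (degree p) + - int (degree q)"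
  by (simp add: degree_mult_eq)

definition inf_place :: "'a::{alg_closed_field, field_char_0} ffun set"
  where "inf_place = {fun_of_poly p / fun_of_poly q | p q. q \<noteq> 0 \<and> degree p \<le> degree q}"

lemma affine_place_iff:
  assumes "p \<noteq> 0" "q \<noteq> 0"
  shows "fun_of_poly p / fun_of_poly q \<in> affine_place a \<longleftrightarrow> order a q \<le> order a p"
proof
  assume "fun_of_poly p / fun_of_poly q \<in> affine_place a"
  then obtain p' q' where *: "fun_of_poly p / fun_of_poly q = fun_of_poly p' / fun_of_poly q'" "poly q' a \<noteq> 0"
    by (auto simp: affine_place_def)
  then have nz: "q' \<noteq> 0" "p' \<noteq> 0" using assms by auto
  have "int (order a p) - int (order a q) = int (order a p') - int (order a q')"
    using rat_val[of "\<lambda>p. int (order a p)", OF order_additive] assms nz *(1) by metis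
  moreover have "order a q' = 0" using *(2) nz order_root[of q' a] by simp
  ultimately show "order a q \<le> order a p" by simp
next
  assume le: "order a q \<le> order a p"
  obtain q' where q': "q = [:- a, 1:] ^ order a q * q'" "\<not> [:- a, 1:] dvd q'"
    using order_decomp[OF assms(2)] by blast
  have "[:- a, 1:] ^ order a q dvd p" using le by (simp add: order_divides)
  then obtain p' where p': "p = [:- a, 1:] ^ order a q * p'" by (auto elim: dvdE)
  define s where "s = [:- a, 1:] ^ order a q"
  have ps: "p = s * p'" and qs: "q = s * q'" using p' q'(1) by (simp_all add: s_def)
  have "fun_of_poly p / fun_of_poly q = fun_of_poly p' / fun_of_poly q'"
    using assms unfolding ps qs by simp
  moreover have "poly q' a \<noteq> 0" using q'(2) by (simp add: poly_eq_0_iff_dvd)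
  ultimately show "fun_of_poly p / fun_of_poly q \<in> affine_place a" by (auto simp: affine_place_def)
qed

lemma inf_place_iff:
  assumes "p \<noteq> 0" "q \<noteq> 0"
  shows "fun_of_poly p / fun_of_poly q \<in> inf_place \<longleftrightarrow> degree p \<le> degree q"
proof
  assume "fun_of_poly p / fun_of_poly q \<in> inf_place"
  then obtain p' q' where *: "fun_of_poly p / fun_of_poly q = fun_of_poly p' / fun_of_poly q'" "q' \<noteq> 0" "degree p' \<le> degree q'"
    by (auto simp: inf_place_def)
  then have "p' \<noteq> 0" using assms by auto
  then have "- int (degree p) - (- int (degree q)) = - int (degree p') - (- int (degree q'))"
    using rat_val[of "\<lambda>p. - int (degree p)", OF degree_additive] assms * by metis
  then show "degree p \<le> degree q" using * by simp
qed (use assms in \<open>auto simp: inf_place_def\<close>)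

text \<open>Common ground of the finite places and the infinite one. The quotient of
  \<open>t\<close> by \<open>u\<close> is a uniformizer: \<open>x - a\<close> at a finite point,
  \<open>1 / x\<close> at infinity.\<close>

lemma val_ring_of_rat_val:
  assumes \<psi>: "\<And>p q. p \<noteq> 0 \<Longrightarrow> q \<noteq> 0 \<Longrightarrow> \<psi> (p * q) = \<psi> p + \<psi> q"
    and P: "\<And>p q. p \<noteq> 0 \<Longrightarrow> q \<noteq> 0 \<Longrightarrow> fun_of_poly p / fun_of_poly q \<in> P \<longleftrightarrow> \<psi> q \<le> \<psi> p"
    and sub: "P \<subseteq> rat_field" and diff: "\<And>a b. a \<in> P \<Longrightarrow> b \<in> P \<Longrightarrow> a - b \<in> P" and "0 \<in> P"
    and t: "t \<noteq> 0" "u \<noteq> 0" "\<psi> t = \<psi> u + 1"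
  shows "dvr rat_field P" "p \<noteq> 0 \<Longrightarrow> q \<noteq> 0 \<Longrightarrow> ord_at P (fun_of_poly p / fun_of_poly q) = \<psi> p - \<psi> q"
proof -
  have v: "is_val rat_field P (rat_val \<psi>)" unfolding is_val_def
  proof (intro conjI ballI)
    fix g :: "'a ffun" assume g: "g \<in> rat_field - {0}"
    then obtain p q where pq: "q \<noteq> 0" "g = fun_of_poly p / fun_of_poly q" by (metis DiffD1 rat_fieldE)
    then have "p \<noteq> 0" using g by auto
    then show "g \<in> P \<longleftrightarrow> 0 \<le> rat_val \<psi> g" using pq P rat_val[OF \<psi>] by auto
  qed (rule rat_val_mult[OF \<psi>])
  define \<pi> where "\<pi> = fun_of_poly t / fun_of_poly u"
  have \<pi>: "\<pi> \<in> rat_field" "\<pi> \<noteq> 0" "rat_val \<psi> \<pi> = 1"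
    unfolding \<pi>_def using rat_val[OF \<psi> t(1,2)] t by (auto intro: rat_fieldI)
  show D: "dvr rat_field P"
  proof
    show "P \<subseteq> rat_field" by (rule sub)
    show "1 \<in> P" using rat.is_val_nonneg[OF v rat.one_mem] rat.is_val_one[OF v] by simp
    show "a - b \<in> P" if "a \<in> P" "b \<in> P" for a b by (rule diff[OF that])
    show "a * b \<in> P" if ab: "a \<in> P" "b \<in> P" for a b
    proof (cases "a = 0 \<or> b = 0")
      case False
      have K: "a \<in> rat_field" "b \<in> rat_field" using ab sub by auto
      then have "0 \<le> rat_val \<psi> a" "0 \<le> rat_val \<psi> b" using ab False rat.is_val_nonneg[OF v] by auto
      then show ?thesis
        using False K rat.is_val_nonneg[OF v rat.mult_mem[OF K]] rat.is_val_mult[OF v K] by simp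
    qed (use \<open>0 \<in> P\<close> in auto)
    show "a \<in> P \<or> inverse a \<in> P" if a: "a \<in> rat_field" for a
    proof (cases "a = 0")
      case False
      then show ?thesis using rat.is_val_nonneg[OF v a] rat.is_val_inverse[OF v a]
        rat.is_val_nonneg[OF v rat.inverse_mem[OF a]] by auto
    qed (use \<open>0 \<in> P\<close> in auto)
    show "\<exists>\<phi>. is_val rat_field P \<phi> \<and> (\<exists>g\<in>rat_field - {0}. \<phi> g \<noteq> 0)"
      using v \<pi> by (intro exI[of _ "rat_val \<psi>"]) (auto intro!: bexI[of _ \<pi>])
  qed
  show "ord_at P (fun_of_poly p / fun_of_poly q) = \<psi> p - \<psi> q" if "p \<noteq> 0" "q \<noteq> 0"
    using dvr.ord_at_eqI[OF D v \<pi>, of "fun_of_poly p / fun_of_poly q"] rat_val[OF \<psi> that] that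
    by (simp add: rat_fieldI)
qed

lemma affine_place_sub: "affine_place a \<subseteq> rat_field"
  by (auto simp: affine_place_def intro!: rat_fieldI)

lemma affine_place_dvr: "dvr rat_field (affine_place a)"
  and ord_affine_place: "p \<noteq> 0 \<Longrightarrow> q \<noteq> 0 \<Longrightarrow>
    ord_at (affine_place a) (fun_of_poly p / fun_of_poly q) = int (order a p) - int (order a q)"
proof -
  have d: "g - h \<in> affine_place a" if g: "g \<in> affine_place a" and h: "h \<in> affine_place a" for g h
  proof -
    obtain p q where "poly q a \<noteq> 0" "g = fun_of_poly p / fun_of_poly q"
      using g by (auto simp: affine_place_def)
    moreover obtain p' q' where "poly q' a \<noteq> 0" "h = fun_of_poly p' / fun_of_poly q'"
      using h by (auto simp: affine_place_def)
    moreover from calculation have "q \<noteq> 0" "q' \<noteq> 0" by auto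
    ultimately have "g - h = fun_of_poly (p * q' - p' * q) / fun_of_poly (q * q')" "poly (q * q') a \<noteq> 0"
      by (metis fun_of_poly_divide_diff) (simp add: \<open>poly q a \<noteq> 0\<close> \<open>poly q' a \<noteq> 0\<close>)
    then show ?thesis unfolding affine_place_def by blast
  qed
  have 0: "0 \<in> affine_place a" unfolding affine_place_def by (intro CollectI exI[of _ 0] exI[of _ 1]) simp
  have t: "[:- a, 1:] \<noteq> 0" "(1::'a poly) \<noteq> 0" "int (order a [:- a, 1:]) = int (order a 1) + 1"
    using order_power_n_n[of a 1] by (auto simp: order_0I)
  note * = val_ring_of_rat_val[of "\<lambda>p. int (order a p)" "affine_place a",
      OF order_additive _ affine_place_sub d 0 t]
  have iff: "fun_of_poly p / fun_of_poly q \<in> affine_place a \<longleftrightarrow> int (order a q) \<le> int (order a p)"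
    if "p \<noteq> 0" "q \<noteq> 0" for p q using affine_place_iff[OF that] by simp
  show "dvr rat_field (affine_place a)" by (rule *(1)[OF _ _ iff])
  show "p \<noteq> 0 \<Longrightarrow> q \<noteq> 0 \<Longrightarrow> ord_at (affine_place a) (fun_of_poly p / fun_of_poly q) = int (order a p) - int (order a q)"
    by (rule *(2)[OF _ _ iff])
qed

lemma inf_place_sub: "inf_place \<subseteq> rat_field"
  by (auto simp: inf_place_def intro!: rat_fieldI)

lemma
  fixes p q :: "'a::{alg_closed_field, field_char_0} poly"
  shows inf_place_dvr: "dvr (rat_field :: 'a ffun set) inf_place"
    and ord_inf_place: "p \<noteq> 0 \<Longrightarrow> q \<noteq> 0 \<Longrightarrow>
      ord_at inf_place (fun_of_poly p / fun_of_poly q) = int (degree q) - int (degree p)"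
proof -
  have d: "g - h \<in> inf_place" if g: "g \<in> inf_place" and h: "h \<in> inf_place" for g h :: "'a ffun"
  proof -
    obtain p q where pq: "q \<noteq> 0" "degree p \<le> degree q" "g = fun_of_poly p / fun_of_poly q"
      using g by (auto simp: inf_place_def)
    obtain p' q' where pq': "q' \<noteq> 0" "degree p' \<le> degree q'" "h = fun_of_poly p' / fun_of_poly q'"
      using h by (auto simp: inf_place_def)
    note pq = pq pq'
    from pq have "g - h = fun_of_poly (p * q' - p' * q) / fun_of_poly (q * q')" "q * q' \<noteq> 0"
      by (metis fun_of_poly_divide_diff) (use pq in simp)
    moreover have "degree (p * q' - p' * q) \<le> degree (q * q')"
      using pq by (intro degree_diff_le) (auto simp: degree_mult_eq intro: order.trans[OF degree_mult_le])
    ultimately show ?thesis unfolding inf_place_def by blast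
  qed
  have 0: "0 \<in> inf_place" unfolding inf_place_def by (intro CollectI exI[of _ 0] exI[of _ 1]) simp
  have t: "(1::'a poly) \<noteq> 0" "[:0, 1::'a:] \<noteq> 0" "- int (degree (1::'a poly)) = - int (degree [:0, 1::'a:]) + 1"
    by auto
  note * = val_ring_of_rat_val[of "\<lambda>p::'a poly. - int (degree p)" inf_place,
      OF degree_additive _ inf_place_sub d 0 t]
  have iff: "fun_of_poly p / fun_of_poly q \<in> inf_place \<longleftrightarrow> - int (degree q) \<le> - int (degree p)"
    if "p \<noteq> 0" "q \<noteq> 0" for p q :: "'a poly" using inf_place_iff[OF that] by simp
  show "dvr (rat_field :: 'a ffun set) inf_place" by (rule *(1)[OF _ _ iff])
  show "ord_at inf_place (fun_of_poly p / fun_of_poly q) = int (degree q) - int (degree p)"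
    if "p \<noteq> 0" "q \<noteq> 0" for p q :: "'a poly"
  proof -
    have "p \<noteq> 0 \<Longrightarrow> q \<noteq> 0 \<Longrightarrow> ord_at inf_place (fun_of_poly p / fun_of_poly q) = - int (degree p) - - int (degree q)"
      by (rule *(2)[OF _ _ iff])
    then show ?thesis using that by simp
  qed
qed

lemma affine_place_cplace: "cplace rat_field (affine_place a) const_fun"
proof -
  interpret dvr rat_field "affine_place a" by (rule affine_place_dvr)
  show ?thesis
  proof
    show c: "const_fun c \<in> affine_place a" for c
      unfolding affine_place_def by (intro CollectI exI[of _ "[:c:]"] exI[of _ 1]) auto
    fix g assume "g \<in> affine_place a"
    then obtain p q where pq: "g = fun_of_poly p / fun_of_poly q" "poly q a \<noteq> 0" by (auto simp: affine_place_def)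
    then have q0: "q \<noteq> 0" by auto
    define c where "c = poly p a / poly q a"
    define r where "r = p - [:c:] * q"
    have eq: "g - const_fun c = fun_of_poly r / fun_of_poly q"
      using q0 by (simp add: pq r_def field_simps flip: fun_of_poly_simps)
    have "g - const_fun c \<in> M"
    proof (cases "r = 0")
      case True
      then show ?thesis using eq zero_in_M by simp
    next
      case False
      have "poly r a = 0" using pq by (simp add: r_def c_def)
      then have "order a r > 0" using False order_root[of r a] by auto
      moreover have "order a q = 0" using pq by (simp add: order_0I)
      ultimately show ?thesis
        unfolding eq using ord_affine_place[OF False q0, of a] False q0
        by (subst ord_pos_iff) (auto intro!: rat_fieldI)
    qed
    then show "\<exists>c. g - const_fun c \<in> M" by blast
  qed
qed

lemma inf_place_cplace: "cplace rat_field inf_place const_fun"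
proof -
  interpret dvr "rat_field :: 'a ffun set" inf_place by (rule inf_place_dvr)
  show "cplace (rat_field :: 'a ffun set) inf_place const_fun"
  proof
    show c: "const_fun c \<in> inf_place" for c :: 'a
      unfolding inf_place_def by (intro CollectI exI[of _ "[:c:]"] exI[of _ 1]) auto
    fix g :: "'a ffun" assume "g \<in> inf_place"
    then obtain p q where pq: "g = fun_of_poly p / fun_of_poly q" "q \<noteq> 0" "degree p \<le> degree q" by (auto simp: inf_place_def)
    \<comment> \<open>The value at infinity, which is 0 when the degree of \<open>p\<close> is
      smaller.\<close>
    define c where "c = coeff p (degree q) / lead_coeff q"
    define r where "r = p - smult c q"
    have eq: "g - const_fun c = fun_of_poly r / fun_of_poly q"
    proof -
      have "fun_of_poly r = fun_of_poly p - const_fun c * fun_of_poly q"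
        by (simp add: r_def flip: fun_of_poly_simps)
      then show ?thesis using pq by (simp add: field_simps)
    qed
    have "g - const_fun c \<in> M"
    proof (cases "r = 0")
      case True
      then show ?thesis using eq zero_in_M by simp
    next
      case False
      have "coeff r (degree q) = 0" using pq by (simp add: r_def c_def)
      moreover have "degree r \<le> degree q"
        unfolding r_def using pq by (intro degree_diff_le) (auto intro: order.trans[OF degree_smult_le])
      ultimately have "degree r < degree q" using False by (metis le_neq_implies_less leading_coeff_0_iff)
      then show ?thesis
        unfolding eq using ord_inf_place[OF False pq(2)] False pq
        by (subst ord_pos_iff) (auto intro!: rat_fieldI)
    qed
    then show "\<exists>c. g - const_fun c \<in> M" by blast
  qed
qed

text \<open>If \<open>x\<close> is regular, some nonzero polynomial lies in the maximal ideal, since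
  otherwise \<open>P\<close> would be everything; one of its roots \<open>a\<close> is the residue
  of \<open>x\<close>, and \<open>P\<close> contains \<open>affine_place a\<close>. Otherwise
  \<open>1 / x\<close> lies in the maximal ideal and \<open>P\<close> contains
  \<open>inf_place\<close>. Both are discrete, so containment is equality.\<close>

lemma rat_places: "cf.const_places rat_field = insert inf_place (range affine_place)"
proof (intro equalityI subsetI)
  fix P :: "'a ffun set" assume "P \<in> insert inf_place (range affine_place)"
  then have "cplace rat_field P const_fun" using inf_place_cplace affine_place_cplace by auto
  then interpret P: cplace rat_field P const_fun .
  show "P \<in> cf.const_places rat_field"
    using P.proper P.const_in P.val_ring_axioms by (auto simp: cf.const_places_def)
next
  fix P :: "'a ffun set" assume P: "P \<in> cf.const_places rat_field"
  then interpret P: val_ring rat_field P by (simp add: cf.const_places_def)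
  have \<kappa>P: "range const_fun \<subseteq> P" and nontriv: "P \<noteq> rat_field" using P by (auto simp: cf.const_places_def)
  define x where "x = fun_of_poly [:0, 1::'a:]"
  have pC: "fun_of_poly (pCons c p) = const_fun c + x * fun_of_poly p" for c p
    by (simp add: x_def flip: fun_of_poly_simps)
  have x0: "x \<noteq> 0" and xr: "x \<in> rat_field" by (simp_all add: x_def fun_of_poly_rat)
  show "P \<in> insert inf_place (range affine_place)"
  proof (cases "x \<in> P")
    case True
    have pP: "fun_of_poly p \<in> P" for p
    proof (induction p)
      case (pCons c p)
      then show ?case unfolding pC[of c p] using \<kappa>P True by (intro P.add_in P.mult_in) auto
    qed (simp add: P.zero_in)
    have "\<exists>q. q \<noteq> 0 \<and> fun_of_poly q \<in> P.M"
    proof (rule ccontr)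
      assume neg: "\<not> ?thesis"
      have "g \<in> P" if g: "g \<in> rat_field" for g
      proof -
        obtain p q where pq: "q \<noteq> 0" "g = fun_of_poly p / fun_of_poly q" using g by (rule rat_fieldE)
        then have "inverse (fun_of_poly q) \<in> P" using neg P.M_iff[OF fun_of_poly_rat, of q] by auto
        then have "fun_of_poly p * inverse (fun_of_poly q) \<in> P" using pP by (intro P.mult_in)
        then show ?thesis using pq by (simp add: divide_inverse)
      qed
      then show False using nontriv P.in_K by blast
    qed
    then obtain q where q: "q \<noteq> 0" "fun_of_poly q \<in> P.M" by blast

    have px: "poly (map_poly const_fun p) x = fun_of_poly p" for p
    proof (induction p)
      case (pCons c p)
      then show ?case unfolding pC[of c p] by (simp add: map_poly_pCons)
    qed simp
    obtain a where a: "x - const_fun a \<in> P.M"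
      using cf.root_residue[OF P.val_ring_axioms \<kappa>P True q(1)] q(2) px by auto
    have xa: "x - const_fun a = fun_of_poly [:- a, 1:]" using pC[of "- a" "[:1:]"] by (simp add: cf.\<kappa>_uminus cf.\<kappa>_1)
    have "affine_place a \<subseteq> P"
    proof
      fix g assume "g \<in> affine_place a"
      then obtain p q where pq: "g = fun_of_poly p / fun_of_poly q" "poly q a \<noteq> 0" by (auto simp: affine_place_def)
      have "inverse (fun_of_poly q) \<in> P"
      proof (rule ccontr)
        assume "inverse (fun_of_poly q) \<notin> P"
        then have qM: "fun_of_poly q \<in> P.M" using pP by (simp add: max_ideal_of_def)
        have "[:- a, 1:] dvd q - [:poly q a:]" by (simp flip: poly_eq_0_iff_dvd)
        then obtain r where r: "q - [:poly q a:] = [:- a, 1:] * r" by (auto elim: dvdE)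
        have "fun_of_poly [:- a, 1:] * fun_of_poly r \<in> P.M"
          using a xa pP by (intro P.mult_M) auto
        then have "fun_of_poly (q - [:poly q a:]) \<in> P.M" unfolding r by (simp only: fun_of_poly_simps(6))
        then have "fun_of_poly q - (fun_of_poly q - const_fun (poly q a)) \<in> P.M"
          using P.diff_M[OF qM, of "fun_of_poly (q - [:poly q a:])"] by (simp only: fun_of_poly_simps(4))
        then have "const_fun (poly q a) \<in> P.M" by simp
        then show False using cf.\<kappa>_in_max_ideal_iff[OF P.val_ring_axioms \<kappa>P] pq by simp
      qed
      then have "fun_of_poly p * inverse (fun_of_poly q) \<in> P" using pP by (intro P.mult_in)
      then show "g \<in> P" using pq by (simp add: divide_inverse)
    qed
    then have "P = affine_place a"
      using dvr.dvr_maximal[OF affine_place_dvr P.val_ring_axioms] nontriv by blast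
    then show ?thesis by blast
  next
    case False
    then have ix: "inverse x \<in> P" using P.total[OF xr] by blast
    have ixM: "inverse x \<in> P.M" using ix False by (simp add: max_ideal_of_def)
    \<comment> \<open>Dividing by \<open>x ^ n\<close> leaves the coefficient of degree
      \<open>n\<close> as residue; with \<open>n = degree q\<close> this makes the rescaled
      denominator a unit.\<close>
    have pm: "fun_of_poly p * inverse x ^ n - const_fun (coeff p n) \<in> P.M \<and> fun_of_poly p * inverse x ^ n \<in> P"
      if "degree p \<le> n" for p n
      using that
    proof (induction p arbitrary: n)
      case 0
      then show ?case using P.zero_in_M P.zero_in by simp
    next
      case (pCons c p)
      show ?case
      proof (cases n)
        case 0
        then have "p = 0" using pCons by (auto split: if_splits)
        then show ?thesis using 0 P.zero_in_M \<kappa>P by (auto simp: pCons)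
      next
        case (Suc k)
        then have IH: "fun_of_poly p * inverse x ^ k - const_fun (coeff p k) \<in> P.M" "fun_of_poly p * inverse x ^ k \<in> P"
          using pCons.IH[of k] pCons.prems by (auto split: if_splits simp: P.zero_in_M P.zero_in)
        have "fun_of_poly (pCons c p) * inverse x ^ n = inverse x * (const_fun c * inverse x ^ k) + fun_of_poly p * inverse x ^ k"
          using x0 by (simp add: Suc pC[of c p] field_simps)
        moreover have c: "inverse x * (const_fun c * inverse x ^ k) \<in> P.M"
          using \<kappa>P ix by (intro P.mult_M ixM P.mult_in P.power_in) auto
        ultimately show ?thesis
          using IH P.add_M[OF c IH(1)] P.add_in[OF P.M_in[OF c] IH(2)] by (simp add: Suc add_diff_eq)
      qed
    qed
    have "inf_place \<subseteq> P"
    proof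
      fix g :: "'a ffun" assume "g \<in> inf_place"
      then obtain p q where pq: "g = fun_of_poly p / fun_of_poly q" "q \<noteq> 0" "degree p \<le> degree q" by (auto simp: inf_place_def)
      define h where "h = fun_of_poly q * inverse x ^ degree q"
      have h: "h - const_fun (lead_coeff q) \<in> P.M" "h \<in> P" using pm[of q "degree q"] by (auto simp: h_def)
      have "h \<notin> P.M"
      proof
        assume "h \<in> P.M"
        then have "h - (h - const_fun (lead_coeff q)) \<in> P.M" by (rule P.diff_M[OF _ h(1)])
        then show False using cf.\<kappa>_in_max_ideal_iff[OF P.val_ring_axioms \<kappa>P] pq by simp
      qed
      then have "inverse h \<in> P" using h by (auto simp: max_ideal_of_def)
      then have "fun_of_poly p * inverse x ^ degree q * inverse h \<in> P" using pm[OF pq(3)] P.mult_in by blast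
      also have "fun_of_poly p * inverse x ^ degree q * inverse h = g"
        using pq x0 by (simp add: h_def field_simps)
      finally show "g \<in> P" .
    qed
    then have "P = inf_place"
      using dvr.dvr_maximal[OF inf_place_dvr P.val_ring_axioms] nontriv by blast
    then show ?thesis by blast
  qed
qed

lemma affine_place_eq_iff: "affine_place a = affine_place b \<longleftrightarrow> a = b"
  and inf_place_neq: "inf_place \<noteq> affine_place a"
proof -
  have *: "ord_at (affine_place b) (fun_of_poly [:- a, 1:]) = (if a = b then 1 else 0)" for a b :: 'a
    using ord_affine_place[of "[:- a, 1:]" 1 b] order_power_n_n[of a 1] by (auto simp: order_0I)
  have "ord_at inf_place (fun_of_poly [:- a, 1:]) = -1"
    using ord_inf_place[of "[:- a, 1:]" 1] by simp
  then show "inf_place \<noteq> affine_place a" using *[of a a] by auto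
  show "affine_place a = affine_place b \<longleftrightarrow> a = b"
    using *[of b a] *[of a a] by (cases "a = b") auto
qed

lemma sum_order:
  fixes p :: "'a::alg_closed_field poly"
  assumes "p \<noteq> 0" "finite A" "{a. poly p a = 0} \<subseteq> A"
  shows "(\<Sum>a\<in>A. order a p) = degree p"
proof -
  obtain B where B: "size B = degree p" "p = smult (lead_coeff p) (\<Prod>x\<in>#B. [:-x, 1:])"
    using alg_closed_imp_factorization[OF assms(1)] by blast
  have "proots (\<Prod>x\<in>#B. [:-x, 1:]) = B"
  proof (induction B)
    case (add x B)
    have "(\<Prod>x\<in>#B. [:-x, 1:]) \<noteq> 0" by (auto simp: prod_mset_zero_iff)
    then show ?case using add by (simp add: proots_mult del: mult_pCons_left)
  qed simp
  then have "proots p = B" using B(2) assms(1) by (metis leading_coeff_0_iff proots_smult)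
  then have "degree p = (\<Sum>a\<in>set_mset (proots p). count (proots p) a)"
    using B(1) by (simp add: size_multiset_overloaded_eq)
  also have "\<dots> = (\<Sum>a\<in>A. order a p)"
    using assms by (intro sum.mono_neutral_cong_left) (auto simp: order_root)
  finally show ?thesis by simp
qed

text \<open>Zeros and poles at finite points contribute the difference of the degrees of numerator
  and denominator, which the place at infinity cancels.\<close>

theorem rat_curve_field: "curve_field rat_field const_fun"
proof (intro curve_field.intro curve_field_axioms.intro rat.subfld_axioms cf.const_field_axioms)
  show "const_fun c \<in> rat_field" for c :: 'a by (rule fun_of_poly_rat)
  show "cplace rat_field P const_fun" if "P \<in> cf.const_places rat_field" for P :: "'a ffun set"
    using that affine_place_cplace inf_place_cplace by (auto simp: rat_places)
  show "cf.const_places (rat_field :: 'a ffun set) \<noteq> {}" by (simp add: rat_places)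
  fix g :: "'a ffun" assume g: "g \<in> rat_field" "g \<noteq> 0"
  then obtain p q where pq: "q \<noteq> 0" "g = fun_of_poly p / fun_of_poly q" by (metis rat_fieldE)
  then have p0: "p \<noteq> 0" using g by auto
  define Z where "Z = {a. poly p a = 0} \<union> {a. poly q a = 0}"
  have Z: "finite Z" using poly_roots_finite pq p0 by (auto simp: Z_def)
  have ord: "ord_at (affine_place a) g = int (order a p) - int (order a q)" for a
    using ord_affine_place[OF p0 pq(1)] pq(2) by simp
  have sub: "{P \<in> cf.const_places rat_field. ord_at P g \<noteq> 0} \<subseteq> insert inf_place (affine_place ` Z)"
  proof
    fix P assume "P \<in> {P \<in> cf.const_places rat_field. ord_at P g \<noteq> 0}"
    then have "P = inf_place \<or> (\<exists>a. P = affine_place a \<and> int (order a p) - int (order a q) \<noteq> 0)"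
      using ord by (auto simp: rat_places)
    then show "P \<in> insert inf_place (affine_place ` Z)"
      using p0 pq(1) by (auto simp: Z_def order_root)
  qed
  then show "finite {P \<in> cf.const_places rat_field. ord_at P g \<noteq> 0}"
    by (rule finite_subset) (simp add: Z)
  have "(\<Sum>P | P \<in> cf.const_places rat_field \<and> ord_at P g \<noteq> 0. ord_at P g)
      = (\<Sum>P\<in>insert inf_place (affine_place ` Z). ord_at P g)"
    using Z sub by (intro sum.mono_neutral_left) (auto simp: rat_places)
  also have "\<dots> = ord_at inf_place g + (\<Sum>P\<in>affine_place ` Z. ord_at P g)"
    using Z inf_place_neq by (subst sum.insert) auto
  also have "(\<Sum>P\<in>affine_place ` Z. ord_at P g) = (\<Sum>a\<in>Z. int (order a p) - int (order a q))"
    by (subst sum.reindex) (auto simp: inj_on_def affine_place_eq_iff ord)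
  also have "\<dots> = int (degree p) - int (degree q)"
    using sum_order[OF p0 Z] sum_order[OF pq(1) Z] by (simp add: sum_subtractf Z_def flip: of_nat_sum)
  finally show "(\<Sum>P | P \<in> cf.const_places rat_field \<and> ord_at P g \<noteq> 0. ord_at P g) = 0"
    using ord_inf_place[OF p0 pq(1)] pq(2) by simp
qed

section \<open>Superelliptic function fields\<close>

lemma map_poly_hom:
  assumes "h 0 = 0" "\<And>a b. h (a + b) = h a + h b" "\<And>a b. h (a * b) = h a * h b"
  shows "map_poly h (p + q) = map_poly h p + map_poly h q"
    and "map_poly h (p * q) = map_poly h p * map_poly h q"
proof -
  have s: "h (sum u A) = (\<Sum>i\<in>A. h (u i))" for u :: "nat \<Rightarrow> _" and A
    by (induction A rule: infinite_finite_induct) (auto simp: assms)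
  show "map_poly h (p + q) = map_poly h p + map_poly h q"
    by (intro poly_eqI) (simp add: coeff_map_poly assms)
  show "map_poly h (p * q) = map_poly h p * map_poly h q"
    by (intro poly_eqI) (simp add: coeff_map_poly coeff_mult assms s)
qed

lemma eval_xw_simps [simp]:
  "eval_xw w 0 = 0" "eval_xw w 1 = 1"
  "eval_xw w (P + Q) = eval_xw w P + eval_xw w Q"
  "eval_xw w (P - Q) = eval_xw w P - eval_xw w Q"
  "eval_xw w (P * Q) = eval_xw w P * eval_xw w Q"
  "eval_xw w (pCons p P) = fun_of_poly p + w * eval_xw w P"
proof -
  note h = map_poly_hom[of fun_of_poly]
  show add: "eval_xw w (P + Q) = eval_xw w P + eval_xw w Q" for P Q by (simp add: eval_xw_def h)
  show "eval_xw w (P * Q) = eval_xw w P * eval_xw w Q" by (simp add: eval_xw_def h)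
  show "eval_xw w (P - Q) = eval_xw w P - eval_xw w Q" using add[of "P - Q" Q] by simp
  show "eval_xw w 0 = 0" "eval_xw w 1 = 1" by (simp_all add: eval_xw_def map_poly_1')
  show "eval_xw w (pCons p P) = fun_of_poly p + w * eval_xw w P"
    by (simp add: eval_xw_def map_poly_pCons)
qed

lemma eval_xw_prod: "eval_xw w (prod u A) = (\<Prod>i\<in>A. eval_xw w (u i))"
  by (induction A rule: infinite_finite_induct) auto

lemma eval_xw_monom: "eval_xw w (monom p n) = fun_of_poly p * w ^ n"
  by (induction n) (auto simp: monom_0 monom_Suc)

lemma eval_xw_sum_le:
  assumes "degree P \<le> n" shows "eval_xw w P = (\<Sum>i\<le>n. fun_of_poly (coeff P i) * w ^ i)"
proof -
  have "eval_xw w P = (\<Sum>i\<le>degree (map_poly fun_of_poly P). coeff (map_poly fun_of_poly P) i * w ^ i)"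
    by (simp add: eval_xw_def poly_altdef)
  also have "\<dots> = (\<Sum>i\<le>n. coeff (map_poly fun_of_poly P) i * w ^ i)"
    using assms by (intro sum.mono_neutral_left) (auto simp: coeff_eq_0 degree_map_poly)
  finally show ?thesis by (simp add: coeff_map_poly)
qed

lemma function_fieldI: "eval_xw w Q \<noteq> 0 \<Longrightarrow> eval_xw w P / eval_xw w Q \<in> function_field w"
  by (auto simp: function_field_def)

lemma function_fieldE:
  assumes "g \<in> function_field w"
  obtains P Q where "eval_xw w Q \<noteq> 0" "g = eval_xw w P / eval_xw w Q"
  using assms by (auto simp: function_field_def)

lemma eval_xw_in: "eval_xw w P \<in> function_field w"
  using function_fieldI[of w 1 P] by simp

lemma fun_of_poly_in: "fun_of_poly p \<in> function_field w"
  using eval_xw_in[of w "[:p:]"] by simp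

lemma w_in: "w \<in> function_field w"
  using eval_xw_in[of w "[:0, 1:]"] by simp

lemma function_field_subfld: "subfld (function_field w)"
proof
  show "1 \<in> function_field w" using eval_xw_in[of w 1] by simp
  fix a b assume "a \<in> function_field w" "b \<in> function_field w"
  then obtain P Q P' Q' where *: "eval_xw w Q \<noteq> 0" "a = eval_xw w P / eval_xw w Q"
    "eval_xw w Q' \<noteq> 0" "b = eval_xw w P' / eval_xw w Q'" by (metis function_fieldE)
  have "a - b = eval_xw w (P * Q' - P' * Q) / eval_xw w (Q * Q')"
    "a * b = eval_xw w (P * P') / eval_xw w (Q * Q')"
    unfolding *(2,4) using *(1,3) by (simp_all add: field_simps)
  moreover have "eval_xw w (Q * Q') \<noteq> 0" using * by simp
  ultimately show "a - b \<in> function_field w" "a * b \<in> function_field w" by (metis function_fieldI)+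
next
  fix a assume "a \<in> function_field w"
  then obtain P Q where *: "eval_xw w Q \<noteq> 0" "a = eval_xw w P / eval_xw w Q" by (rule function_fieldE)
  then show "inverse a \<in> function_field w"
    using function_fieldI[of w P Q] eval_xw_in[of w 0] by (cases "eval_xw w P = 0") auto
qed

lemma rat_field_sub: "rat_field \<subseteq> function_field w"
  using subfld.divide_mem[OF function_field_subfld fun_of_poly_in fun_of_poly_in]
  by (auto simp: rat_field_def)

lemma function_field_mono:
  assumes "v \<in> function_field w" shows "function_field v \<subseteq> function_field w"
proof -
  interpret subfld "function_field w" by (rule function_field_subfld)
  have "eval_xw v P \<in> function_field w" for P
    by (induction P) (auto simp: zero_mem intro!: add_mem mult_mem fun_of_poly_in assms)
  then show ?thesis by (auto elim!: function_fieldE intro: divide_mem)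
qed

lemma function_field_rat:
  assumes "w \<in> rat_field" shows "function_field w = rat_field"
proof
  have "eval_xw w P \<in> rat_field" for P
    by (induction P) (auto simp: rat.zero_mem intro!: rat.add_mem rat.mult_mem fun_of_poly_rat assms)
  then show "function_field w \<subseteq> rat_field" by (auto elim!: function_fieldE intro: rat.divide_mem)
qed (rule rat_field_sub)

text \<open>This is \<open>fun_act\<close> with an arbitrary map of polynomials in place of
  conjugation of coefficients, so that deck transformations and the Galois action share one proof of
  well-definedness.\<close>

definition fun_map ::
  "'a::{alg_closed_field, field_char_0} ffun \<Rightarrow> ('a poly poly \<Rightarrow> 'a poly poly) \<Rightarrow> 'a ffun \<Rightarrow> 'a ffun"
  where "fun_map w \<Phi> g = (THE h. \<exists>P Q. eval_xw w Q \<noteq> 0 \<and> g = eval_xw w P / eval_xw w Q \<and>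
     h = eval_xw w (\<Phi> P) / eval_xw w (\<Phi> Q))"

lemma fun_act_eq: "fun_act w \<sigma> = fun_map w (map_poly (map_poly \<sigma>))"
  by (simp add: fun_act_def fun_map_def fun_eq_iff)

locale fun_endo =
  fixes w :: "'a::{alg_closed_field, field_char_0} ffun" and \<Phi> :: "'a poly poly \<Rightarrow> 'a poly poly"
  assumes \<Phi>_add: "\<Phi> (P + Q) = \<Phi> P + \<Phi> Q" and \<Phi>_mult: "\<Phi> (P * Q) = \<Phi> P * \<Phi> Q"
    and \<Phi>_kernel: "eval_xw w (\<Phi> P) = 0 \<longleftrightarrow> eval_xw w P = 0"
    and \<Phi>_surj: "surj \<Phi>"
begin

lemma \<Phi>_diff: "\<Phi> (P - Q) = \<Phi> P - \<Phi> Q"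
  using \<Phi>_add[of "P - Q" Q] by simp

lemma fun_map_eval:
  assumes "eval_xw w Q \<noteq> 0"
  shows "fun_map w \<Phi> (eval_xw w P / eval_xw w Q) = eval_xw w (\<Phi> P) / eval_xw w (\<Phi> Q)"
  unfolding fun_map_def
proof (rule the_equality)
  fix h assume "\<exists>P' Q'. eval_xw w Q' \<noteq> 0 \<and> eval_xw w P / eval_xw w Q = eval_xw w P' / eval_xw w Q' \<and>
    h = eval_xw w (\<Phi> P') / eval_xw w (\<Phi> Q')"
  then obtain P' Q' where *: "eval_xw w Q' \<noteq> 0" "eval_xw w P / eval_xw w Q = eval_xw w P' / eval_xw w Q'"
    "h = eval_xw w (\<Phi> P') / eval_xw w (\<Phi> Q')" by blast
  then have "eval_xw w (P * Q' - P' * Q) = 0" using assms by (simp add: field_simps)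
  then have "eval_xw w (\<Phi> (P * Q' - P' * Q)) = 0" by (simp only: \<Phi>_kernel)
  then have "eval_xw w (\<Phi> P) * eval_xw w (\<Phi> Q') = eval_xw w (\<Phi> P') * eval_xw w (\<Phi> Q)"
    by (simp add: \<Phi>_diff \<Phi>_mult)
  then show "h = eval_xw w (\<Phi> P) / eval_xw w (\<Phi> Q)"
    unfolding *(3) using *(1) assms \<Phi>_kernel by (simp add: frac_eq_eq)
qed (use assms in blast)

lemma \<Phi>_1: "\<Phi> 1 = 1"
proof -
  obtain P where "\<Phi> P = 1" using \<Phi>_surj by (metis surjD)
  then show ?thesis using \<Phi>_mult[of P 1] by simp
qed

lemma fun_map_eval': "fun_map w \<Phi> (eval_xw w P) = eval_xw w (\<Phi> P)"
  using fun_map_eval[of 1 P] \<Phi>_1 by simp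

lemma fun_map_aut: "fld_aut (function_field w) (fun_map w \<Phi>)"
proof (intro fld_aut.intro fld_aut_axioms.intro function_field_subfld)
  fix a b assume "a \<in> function_field w" "b \<in> function_field w"
  then obtain P Q P' Q' where *: "eval_xw w Q \<noteq> 0" "a = eval_xw w P / eval_xw w Q"
    "eval_xw w Q' \<noteq> 0" "b = eval_xw w P' / eval_xw w Q'" by (metis function_fieldE)
  have "a + b = eval_xw w (P * Q' + P' * Q) / eval_xw w (Q * Q')"
    "a * b = eval_xw w (P * P') / eval_xw w (Q * Q')"
    unfolding *(2,4) using *(1,3) by (simp_all add: add_frac_eq)
  moreover have "eval_xw w (Q * Q') \<noteq> 0" using * by simp
  ultimately have "fun_map w \<Phi> (a + b) = eval_xw w (\<Phi> (P * Q' + P' * Q)) / eval_xw w (\<Phi> (Q * Q'))"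
    "fun_map w \<Phi> (a * b) = eval_xw w (\<Phi> (P * P')) / eval_xw w (\<Phi> (Q * Q'))"
    by (metis fun_map_eval)+
  then show "fun_map w \<Phi> (a + b) = fun_map w \<Phi> a + fun_map w \<Phi> b"
    "fun_map w \<Phi> (a * b) = fun_map w \<Phi> a * fun_map w \<Phi> b"
    using * \<Phi>_kernel[of Q] \<Phi>_kernel[of Q'] by (simp_all add: fun_map_eval \<Phi>_add \<Phi>_mult add_frac_eq)
next
  show "fun_map w \<Phi> ` function_field w = function_field w"
  proof (intro equalityI subsetI)
    fix g assume "g \<in> fun_map w \<Phi> ` function_field w"
    then obtain P Q where "eval_xw w Q \<noteq> 0" "g = fun_map w \<Phi> (eval_xw w P / eval_xw w Q)"
      by (auto elim: function_fieldE)
    then show "g \<in> function_field w" using \<Phi>_kernel by (auto simp: fun_map_eval intro: function_fieldI)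
  next
    fix g assume "g \<in> function_field w"
    then obtain P Q where *: "eval_xw w Q \<noteq> 0" "g = eval_xw w P / eval_xw w Q" by (rule function_fieldE)
    obtain P' Q' where PQ': "P = \<Phi> P'" "Q = \<Phi> Q'" using \<Phi>_surj by (metis surjD)
    then have nz: "eval_xw w Q' \<noteq> 0" using *(1) \<Phi>_kernel[of Q'] by simp
    then have "g = fun_map w \<Phi> (eval_xw w P' / eval_xw w Q')" using *(2) PQ' by (simp only: fun_map_eval[OF nz])
    then show "g \<in> fun_map w \<Phi> ` function_field w" using function_fieldI[OF nz] by blast
  qed
qed

end

lemma coprime_dvd_lemma: "coprime a m \<Longrightarrow> (m::nat) dvd d * a \<Longrightarrow> m dvd d"
  by (simp add: coprime_commute coprime_dvd_mult_left_iff)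

lemma order_power: "p \<noteq> 0 \<Longrightarrow> order a (p ^ n) = n * order a (p :: 'a::idom poly)"
  by (induction n) (auto simp: order_mult order_0I)

text \<open>One level of the tower, with \<open>m\<close> in the role of \<open>l ^ s\<close>. The
  case \<open>m = 1\<close> is the projective line, so the bottom of the tower needs no separate
  treatment. The point \<xi> is the same at all levels.\<close>

locale superelliptic =
  fixes m :: nat and f :: "'a::{alg_closed_field, field_char_0} poly" and w :: "'a ffun"
    and \<xi> :: 'a and \<zeta> :: 'a
  assumes m_pos: "0 < m" and f_nz: "f \<noteq> 0" and w_power: "w ^ m = fun_of_poly f"
    and coprime_order: "coprime (order \<xi> f) m"
    and \<zeta>_power: "\<zeta> ^ m = 1" and \<zeta>_order: "0 < i \<Longrightarrow> i < m \<Longrightarrow> \<zeta> ^ i \<noteq> 1"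
begin

abbreviation "K \<equiv> function_field w"

sublocale K: subfld K by (rule function_field_subfld)

definition "rel = monom 1 m - [:f:]"

lemma eval_rel: "eval_xw w rel = 0"
  by (simp add: rel_def eval_xw_monom w_power)

lemma lead_coeff_rel: "degree rel = m" "lead_coeff rel = 1" "rel \<noteq> 0"
proof -
  have "coeff rel m = 1" using m_pos by (auto simp: rel_def coeff_pCons split: nat.split)
  moreover have "degree rel \<le> m" unfolding rel_def
    by (intro degree_diff_le) (auto intro: degree_monom_le)
  ultimately have "degree rel = m" using le_degree[of rel m] by auto
  then show "degree rel = m" "lead_coeff rel = 1" "rel \<noteq> 0"
    using \<open>coeff rel m = 1\<close> by auto
qed

lemma w_nz: "w \<noteq> 0" using w_power m_pos f_nz by (auto simp: power_0_left)

text \<open>The constant coefficient of a relation of minimal degree \<open>d\<close> is, up to a root of unity and the leading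
  coefficient, equal to \<open>w ^ d\<close>; comparing orders at \<open>\<xi>\<close> forces \<open>m\<close> to divide \<open>d\<close>.\<close>

lemma no_small_relation:
  assumes "P \<noteq> 0" "eval_xw w P = 0" shows "m \<le> degree P"
proof -
  define d where "d = (LEAST d. \<exists>P. P \<noteq> 0 \<and> eval_xw w P = 0 \<and> degree P = d)"
  have "\<exists>P. P \<noteq> 0 \<and> eval_xw w P = 0 \<and> degree P = d"
    unfolding d_def by (rule LeastI_ex) (use assms in blast)
  then obtain P0 where P0: "P0 \<noteq> 0" "eval_xw w P0 = 0" "degree P0 = d" by blast
  have least: "d \<le> degree Q" if "Q \<noteq> 0" "eval_xw w Q = 0" for Q
    unfolding d_def by (rule Least_le) (use that in blast)
  define p where "p = map_poly fun_of_poly P0"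
  have p: "p \<noteq> 0" "degree p = d" "lead_coeff p = fun_of_poly (lead_coeff P0)"
    using P0 by (auto simp: p_def degree_map_poly coeff_map_poly map_poly_eq_0_iff)
  have "d \<noteq> 0"
  proof
    assume "d = 0"
    then obtain c where "P0 = [:c:]" using P0 degree_0_id by metis
    then show False using P0 by auto
  qed
  \<comment> \<open>By minimality the pseudo-remainder vanishes, so \<open>P0\<close> divides the
    nonzero multiple \<open>smult c rel\<close> and every root of \<open>p\<close> is an
    \<open>m\<close>-th root of \<open>f\<close>.\<close>
  obtain q r where qr: "pseudo_divmod rel P0 = (q, r)" by (cases "pseudo_divmod rel P0")
  define c where "c = lead_coeff P0 ^ (Suc (degree rel) - degree P0)"
  have eq: "smult c rel = P0 * q + r" and rdeg: "r = 0 \<or> degree r < d"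
    using pseudo_divmod[OF P0(1) qr] unfolding c_def P0(3) by auto
  have "eval_xw w (smult c rel) = 0" using eval_rel eval_xw_simps(5)[of w "[:c:]" rel] by simp
  then have "eval_xw w r = 0" using P0(2) unfolding eq by simp
  then have "r = 0" using rdeg least by force
  have c0: "c \<noteq> 0" using P0(1) by (simp add: c_def)
  have hom: "map_poly fun_of_poly (u * v) = map_poly fun_of_poly u * map_poly fun_of_poly v" for u v :: "'a poly poly"
    by (rule map_poly_hom) auto
  have roots: "x ^ m = fun_of_poly f" if "poly p x = 0" for x
  proof -
    have "eval_xw x P0 = 0" using that by (simp add: eval_xw_def p_def)
    then have "eval_xw x (smult c rel) = 0" using eq \<open>r = 0\<close> by simp
    then have "fun_of_poly c * eval_xw x rel = 0" using eval_xw_simps(5)[of x "[:c:]" rel] by simp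
    then show ?thesis using c0 by (simp add: rel_def eval_xw_monom)
  qed
  obtain A where A: "size A = degree p" "p = smult (lead_coeff p) (\<Prod>x\<in>#A. [:-x, 1:])"
    using alg_closed_imp_factorization[OF p(1)] by blast
  have "x ^ m = fun_of_poly f" if "x \<in># A" for x
  proof (rule roots)
    have "poly (\<Prod>x\<in>#A. [:-x, 1:]) x = 0" using that by (induction A) auto
    then show "poly p x = 0" by (subst A(2)) simp
  qed
  then have "poly (\<Prod>x\<in>#A. [:-x, 1:]) 0 ^ m = (- 1) ^ (m * size A) * fun_of_poly f ^ size A"
  proof (induction A)
    case (add x A)
    then have "(- x) ^ m = (- 1) ^ m * fun_of_poly f" by (simp add: power_minus[of x])
    moreover have "poly (\<Prod>x\<in>#add_mset x A. [:-x, 1:]) 0 = (- x) * poly (\<Prod>x\<in>#A. [:-x, 1:]) 0" by simp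
    ultimately show ?case using add by (simp only: power_mult_distrib) (simp add: power_add)
  qed simp
  moreover have "poly p 0 = lead_coeff p * poly (\<Prod>x\<in>#A. [:-x, 1:]) 0" by (subst A(2)) simp
  ultimately have "poly p 0 ^ m = lead_coeff p ^ m * ((- 1) ^ (m * d) * fun_of_poly f ^ d)"
    using A(1) p(2) by (simp add: power_mult_distrib)
  moreover have "poly p 0 = fun_of_poly (coeff P0 0)"
    by (simp add: p_def poly_0_coeff_0 coeff_map_poly)
  ultimately have "fun_of_poly (coeff P0 0 ^ m) = fun_of_poly (lead_coeff P0 ^ m * ((- 1) ^ (m * d) * f ^ d))"
    by (simp add: p(3) fun_of_poly_power)
  then have e: "coeff P0 0 ^ m = lead_coeff P0 ^ m * ((- 1) ^ (m * d) * f ^ d)"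
    by (simp only: fun_of_poly_simps(7))
  have nz: "lead_coeff P0 ^ m \<noteq> 0" "(- 1) ^ (m * d) * f ^ d \<noteq> 0" "(- 1 :: 'a poly) ^ (m * d) \<noteq> 0" "f ^ d \<noteq> 0"
    using P0 f_nz by auto
  then have "coeff P0 0 \<noteq> 0" using e m_pos by (metis mult_eq_0_iff power_0_left less_irrefl)
  moreover have "order \<xi> ((- 1 :: 'a poly) ^ (m * d)) = 0" by (rule order_0I) (simp add: poly_power)
  ultimately have "m * order \<xi> (coeff P0 0) = m * order \<xi> (lead_coeff P0) + d * order \<xi> f"
    using arg_cong[OF e, of "order \<xi>"] nz P0(1) f_nz by (simp add: order_mult order_power)
  then have "m dvd d * order \<xi> f" by (metis dvd_add_right_iff dvd_triv_left)
  then have "m dvd d" using coprime_order by (rule coprime_dvd_lemma[rotated])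
  then have "m \<le> d" using \<open>d \<noteq> 0\<close> by (simp add: dvd_imp_le)
  then show ?thesis using least[OF assms] by simp
qed

lemma reduce: "\<exists>q R. P = rel * q + R \<and> degree R < m"
proof -
  obtain q r where qr: "pseudo_divmod P rel = (q, r)" by (cases "pseudo_divmod P rel")
  show ?thesis using pseudo_divmod[OF lead_coeff_rel(3) qr] m_pos lead_coeff_rel
    by (intro exI[of _ q] exI[of _ r]) auto
qed

lemma eval_eq_0_iff: "eval_xw w P = 0 \<longleftrightarrow> rel dvd P"
proof
  assume 0: "eval_xw w P = 0"
  obtain q R where P: "P = rel * q + R" "degree R < m" using reduce by blast
  then have "eval_xw w R = 0" using 0 eval_rel by simp
  then have "R = 0" using no_small_relation P(2) by force
  then show "rel dvd P" using P by simp
qed (auto elim!: dvdE simp: eval_rel)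

lemma eval_inj: "eval_xw w P = 0 \<Longrightarrow> degree P < m \<Longrightarrow> P = 0"
  using no_small_relation by force

text \<open>The kernel of evaluation at \<open>w\<close> is generated by \<open>rel\<close>, so
  every ring automorphism fixing \<open>rel\<close> induces an automorphism of \<open>K\<close>. The
  inverse \<Psi> supplies surjectivity and shows that divisibility by \<open>rel\<close> is
  reflected.\<close>

lemma fun_endoI:
  assumes "\<And>P Q. \<Phi> (P + Q) = \<Phi> P + \<Phi> Q" "\<And>P Q. \<Phi> (P * Q) = \<Phi> P * \<Phi> Q" "\<Phi> rel = rel"
    and \<Psi>: "\<And>P Q. \<Psi> (P * Q) = \<Psi> P * \<Psi> Q" "\<Psi> rel = rel"
    and inv: "\<And>P. \<Phi> (\<Psi> P) = P" "\<And>P. \<Psi> (\<Phi> P) = P"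
  shows "fun_endo w \<Phi>"
proof
  show "eval_xw w (\<Phi> P) = 0 \<longleftrightarrow> eval_xw w P = 0" for P
    unfolding eval_eq_0_iff dvd_def using assms by metis
  show "surj \<Phi>" using inv by (metis surjI)
qed (fact assms)+

text \<open>Replaces \<open>w\<close> by \<open>\<zeta> ^ j * w\<close>; on the curve this is the
  \<open>j\<close>-th power of the deck transformation.\<close>

definition twist :: "nat \<Rightarrow> 'a poly poly \<Rightarrow> 'a poly poly"
  where "twist j P = pcompose P [:0, [:\<zeta> ^ j:]:]"

lemma coeff_twist: "coeff (twist j P) i = smult (\<zeta> ^ (j * i)) (coeff P i)"
proof -
  have "coeff (twist j P) i = [:\<zeta> ^ j:] ^ i * coeff P i"
    by (simp add: twist_def coeff_pcompose_linear)
  also have "[:\<zeta> ^ j:] ^ i = [:\<zeta> ^ (j * i):]"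
    by (simp add: power_mult) (induction i, auto simp: one_pCons)
  finally show ?thesis by simp
qed

lemma twist_rel: "twist j rel = rel"
proof (rule poly_eqI)
  fix i show "coeff (twist j rel) i = coeff rel i"
    using \<zeta>_power by (cases "i = 0 \<or> i = m")
      (auto simp: coeff_twist power_mult mult.commute[of j], auto simp: rel_def coeff_pCons split: nat.split)
qed

lemma twist_twist: "twist i (twist j P) = twist (i + j) P"
  by (intro poly_eqI) (simp add: coeff_twist distrib_right power_add)

lemma twist_period: "m dvd j \<Longrightarrow> twist j P = P"
  using \<zeta>_power by (intro poly_eqI) (auto simp: coeff_twist power_mult elim!: dvdE)

lemma fun_endo_twist: "fun_endo w (twist j)"
\<comment> \<open>The inverse exponent is \<open>- j\<close> modulo \<open>m\<close>, kept natural
  by adding \<open>m * j\<close>.\<close>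
proof (rule fun_endoI[where \<Psi> = "twist (m * j - j)"])
  have "j \<le> m * j" using m_pos by simp
  then show "twist j (twist (m * j - j) P) = P" "twist (m * j - j) (twist j P) = P" for P
    by (simp_all add: twist_twist twist_period)
qed (auto simp: twist_rel, auto simp: twist_def pcompose_add pcompose_mult)

definition rot :: "nat \<Rightarrow> 'a ffun \<Rightarrow> 'a ffun" where "rot j = fun_map w (twist j)"

sublocale rot: fld_aut K "rot j" for j
  unfolding rot_def by (rule fun_endo.fun_map_aut[OF fun_endo_twist])

lemma rot_eval: "rot j (eval_xw w P) = eval_xw w (twist j P)"
  unfolding rot_def by (rule fun_endo.fun_map_eval'[OF fun_endo_twist])

lemma rot_w: "rot j w = const_fun (\<zeta> ^ j) * w"
  using rot_eval[of j "[:0, 1:]"] by (simp add: twist_def pcompose_pCons mult.commute)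

lemma rot_fun_of_poly: "rot j (fun_of_poly p) = fun_of_poly p"
  using rot_eval[of j "[:p:]"] by (simp add: twist_def)

lemma rot_rot: "g \<in> K \<Longrightarrow> rot i (rot j g) = rot (i + j) g"
  by (auto elim!: function_fieldE simp: rot.aut_divide eval_xw_in rot_eval twist_twist)

lemma rot_period: "g \<in> K \<Longrightarrow> m dvd j \<Longrightarrow> rot j g = g"
  by (auto elim!: function_fieldE simp: rot.aut_divide eval_xw_in rot_eval twist_period)

lemma rot_funpow: "g \<in> K \<Longrightarrow> (rot j ^^ i) g = rot (j * i) g"
  by (induction i) (auto simp: rot_period rot_rot)

lemma zeta_power_eq_1_iff: "\<zeta> ^ i = 1 \<longleftrightarrow> m dvd i"
proof -
  have "\<zeta> ^ i = \<zeta> ^ (i mod m)"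
    using \<zeta>_power by (metis (no_types) div_mult_mod_eq mult.commute mult_1 power_add power_mult power_one)
  then show ?thesis using \<zeta>_order[of "i mod m"] m_pos by (auto simp: dvd_eq_mod_eq_0)
qed

text \<open>Invariance under \<open>twist 1\<close> kills all coefficients in degrees not divisible
  by \<open>m\<close>, and powers of \<open>w ^ m\<close> are powers of \<open>f\<close>.\<close>

lemma polynomial_norm: "\<exists>q. eval_xw w (\<Prod>i<m. twist i Q) = fun_of_poly q"
proof -
  define R where "R = (\<Prod>i<m. twist i Q)"
  interpret t: fun_endo w "twist 1" by (rule fun_endo_twist)
  have tp: "twist 1 (prod u A) = (\<Prod>i\<in>A. twist 1 (u i))" for u :: "nat \<Rightarrow> _" and A
    by (induction A rule: infinite_finite_induct) (auto simp: t.\<Phi>_1 t.\<Phi>_mult simp del: One_nat_def)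
  obtain k where k: "m = Suc k" using m_pos by (cases m) auto
  have "twist 1 R = (\<Prod>i<m. twist (Suc i) Q)" unfolding R_def tp by (simp add: twist_twist)
  also have "\<dots> = (\<Prod>i<k. twist (Suc i) Q) * twist 0 Q" using twist_period[of m Q] twist_period[of 0 Q] by (simp add: k)
  also have "\<dots> = R"
    using prod.lessThan_Suc_shift[of "\<lambda>i. twist i Q" k] by (simp add: R_def k mult.commute)
  finally have inv: "twist 1 R = R" .
  have c0: "coeff R i = 0" if "\<not> m dvd i" for i
  proof -
    have "smult (\<zeta> ^ i) (coeff R i) = coeff R i" using coeff_twist[of 1 R i] inv by simp
    then have "smult (\<zeta> ^ i - 1) (coeff R i) = 0" by (simp add: smult_diff_left)
    then show ?thesis using that zeta_power_eq_1_iff by simp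
  qed
  have "eval_xw w R = (\<Sum>i\<le>degree R. fun_of_poly (coeff R i) * w ^ i)" by (rule eval_xw_sum_le) simp
  also have "\<dots> = (\<Sum>i\<le>degree R. fun_of_poly (coeff R i * f ^ (i div m)))"
  proof (rule sum.cong[OF refl])
    fix i
    show "fun_of_poly (coeff R i) * w ^ i = fun_of_poly (coeff R i * f ^ (i div m))"
      using c0[of i] m_pos by (cases "m dvd i") (auto simp: power_mult w_power fun_of_poly_power elim!: dvdE)
  qed
  finally show ?thesis by (metis R_def fun_of_poly_sum)
qed

text \<open>The other conjugates of the denominator rationalise it, and division by the monic
  \<open>rel\<close> lowers the degree of the numerator below \<open>m\<close>.\<close>

lemma reduced_form:
  assumes "g \<in> K"
  obtains P q where "q \<noteq> 0" "degree P < m" "g = eval_xw w P / fun_of_poly q"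
proof -
  obtain P Q where PQ: "eval_xw w Q \<noteq> 0" "g = eval_xw w P / eval_xw w Q" using assms by (rule function_fieldE)
  obtain q where q: "eval_xw w (\<Prod>i<m. twist i Q) = fun_of_poly q" using polynomial_norm by blast
  define Q' where "Q' = (\<Prod>i\<in>{..<m} - {0}. twist i Q)"
  have split: "(\<Prod>i<m. twist i Q) = Q * Q'"
    using m_pos twist_period[of 0 Q] by (simp add: Q'_def prod.remove[of "{..<m}" 0])
  have "eval_xw w (twist i Q) \<noteq> 0" for i
    using PQ fun_endo.\<Phi>_kernel[OF fun_endo_twist] by blast
  then have "eval_xw w Q' \<noteq> 0" by (simp add: Q'_def eval_xw_prod)
  moreover have q': "fun_of_poly q = eval_xw w Q * eval_xw w Q'" using q split by simp
  ultimately have g: "g = eval_xw w (P * Q') / fun_of_poly q" and "fun_of_poly q \<noteq> 0"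
    unfolding PQ(2) q' using PQ(1) by simp_all
  then have q0: "q \<noteq> 0" by simp
  obtain s R where R: "P * Q' = rel * s + R" "degree R < m" using reduce by blast
  then have "eval_xw w (P * Q') = eval_xw w R" using eval_rel by (metis add_0 eval_xw_simps(3,5) mult_zero_left)
  then show thesis using that[OF q0 R(2)] g by simp
qed

context
  fixes j d assumes jd: "m = j * d"
begin

lemma eval_power_eq: "eval_xw (w ^ d) P = eval_xw w (pcompose P (monom 1 d))"
  by (induction P) (auto simp: pcompose_pCons eval_xw_monom)

lemma rot_eval_power: "rot j (eval_xw (w ^ d) P) = eval_xw (w ^ d) P"
proof (induction P)
  case (pCons p P)
  have "eval_xw (w ^ d) P \<in> K" unfolding eval_power_eq by (rule eval_xw_in)
  moreover have "rot j (w ^ d) = w ^ d"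
    using jd \<zeta>_power
    by (simp add: rot.aut_power w_in rot_w power_mult_distrib power_mult[symmetric] flip: cf.\<kappa>_power)
      (metis cf.\<kappa>_1 mult_1)
  ultimately show ?case using pCons
    by (simp add: rot.aut_add rot.aut_mult K.mult_mem K.power_mem w_in fun_of_poly_in rot_fun_of_poly)
qed (simp add: rot.aut_0)

text \<open>The coefficients of \<open>P\<close> of degree below \<open>m\<close> are determined by
  the function, so invariance under \<open>rot j\<close> means \<open>\<zeta> ^ (j * i) = 1\<close>
  wherever \<open>coeff P i\<close> is nonzero. Only exponents divisible by \<open>d\<close>
  survive.\<close>

lemma rot_fixed: "g \<in> K \<Longrightarrow> rot j g = g \<longleftrightarrow> g \<in> function_field (w ^ d)"
proof
  assume g: "g \<in> K" "rot j g = g"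
  obtain P q where Pq: "q \<noteq> 0" "degree P < m" "g = eval_xw w P / fun_of_poly q" using g(1) by (rule reduced_form)
  have "rot j (eval_xw w P) = eval_xw w P"
    using g(2) Pq by (simp add: rot.aut_divide eval_xw_in fun_of_poly_in rot_fun_of_poly)
  then have "eval_xw w (twist j P - P) = 0" by (simp add: rot_eval)
  moreover have "degree (twist j P - P) \<le> degree P"
    by (rule degree_le) (simp add: coeff_twist coeff_eq_0)
  ultimately have tw: "twist j P = P" using eval_inj Pq(2) by fastforce
  have c0: "coeff P i = 0" if "\<not> d dvd i" for i
  proof -
    have "smult (\<zeta> ^ (j * i) - 1) (coeff P i) = 0"
      using coeff_twist[of j P i] tw by (simp add: smult_diff_left)
    then show ?thesis using that zeta_power_eq_1_iff[of "j * i"] jd m_pos by auto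
  qed
  have d0: "d > 0" using jd m_pos by simp
  \<comment> \<open>The range up to \<open>m\<close> is more than enough: it reaches every multiple
    of \<open>d\<close> below \<open>m\<close>, and \<open>P\<close> has degree below
    \<open>m\<close>.\<close>
  define P' where "P' = (\<Sum>i\<le>m. monom (coeff P (d * i)) i)"
  have "eval_xw (w ^ d) P' = (\<Sum>i\<le>m. fun_of_poly (coeff P (d * i)) * w ^ (d * i))"
  proof -
    have *: "eval_xw v (sum u A) = (\<Sum>i\<in>A. eval_xw v (u i))" for v and u :: "nat \<Rightarrow> 'a poly poly" and A
      by (induction A rule: infinite_finite_induct) auto
    show ?thesis unfolding P'_def by (simp add: * eval_xw_monom power_mult)
  qed
  also have "\<dots> = (\<Sum>i\<in>(\<lambda>i. d * i) ` {..m}. fun_of_poly (coeff P i) * w ^ i)"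
    using d0 by (subst sum.reindex) (auto simp: inj_on_def)
  also have "\<dots> = (\<Sum>i\<in>{..m * d}. fun_of_poly (coeff P i) * w ^ i)"
  proof (rule sum.mono_neutral_left)
    show "\<forall>i\<in>{..m * d} - (*) d ` {..m}. fun_of_poly (coeff P i) * w ^ i = 0"
    proof
      fix i assume i: "i \<in> {..m * d} - (*) d ` {..m}"
      have "\<not> d dvd i"
      proof
        assume "d dvd i"
        then obtain k where "i = d * k" by (auto elim: dvdE)
        then show False using i d0 by auto
      qed
      then show "fun_of_poly (coeff P i) * w ^ i = 0" using c0 by simp
    qed
  qed auto
  also have "\<dots> = eval_xw w P"
    using Pq(2) d0 by (intro eval_xw_sum_le[symmetric]) (metis less_imp_le mult.right_neutral mult_le_mono2 One_nat_def Suc_leI order.trans)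
  finally have "g = eval_xw (w ^ d) P' / fun_of_poly q" using Pq by simp
  then show "g \<in> function_field (w ^ d)"
    using subfld.divide_mem[OF function_field_subfld eval_xw_in fun_of_poly_in] by simp
next
  assume "g \<in> function_field (w ^ d)"
  then show "rot j g = g"
    using eval_xw_in[of w] by (auto elim!: function_fieldE simp: rot.aut_divide eval_power_eq rot_eval_power[unfolded eval_power_eq])
qed

lemma cyclic_ext: "cyclic_ext K (rot j) (function_field (w ^ d)) const_fun d w (\<zeta> ^ j)"
proof (intro cyclic_ext.intro cyclic_ext_axioms.intro rot.fld_aut_axioms function_field_subfld cf.const_field_axioms)
  show "function_field (w ^ d) \<subseteq> K" by (intro function_field_mono K.power_mem w_in)
  show "const_fun c \<in> function_field (w ^ d)" for c by (rule fun_of_poly_in)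
  show "0 < d" using jd m_pos by simp
  show "(rot j ^^ d) g = g" if "g \<in> K" for g using that jd by (simp add: rot_funpow rot_period)
  show "rot j g = g \<longleftrightarrow> g \<in> function_field (w ^ d)" if "g \<in> K" for g by (rule rot_fixed[OF that])
  show "w \<in> K" "w \<noteq> 0" "rot j w = const_fun (\<zeta> ^ j) * w" by (rule w_in, rule w_nz, rule rot_w)
  show "(\<zeta> ^ j) ^ i \<noteq> 1" if "0 < i" "i < d" for i
    using that \<zeta>_order[of "j * i"] jd m_pos by (simp flip: power_mult)
qed

end

lemma base_field: "function_field (w ^ m) = rat_field"
  unfolding w_power by (intro function_field_rat fun_of_poly_rat)

sublocale E: cyclic_ext K "rot 1" rat_field const_fun m w \<zeta>
  using cyclic_ext[of 1 m] by (simp add: base_field)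

sublocale C: curve_field K const_fun
  by (rule E.curve_field_lift[OF rat_curve_field])

end

section \<open>Divisors and Jacobians\<close>

lemma places_eq: "places w = cf.const_places (function_field w)"
proof -
  interpret K: subfld "function_field w" by (rule function_field_subfld)
  interpret R: ring "ring_of_type_algebra :: 'a ffun ring" by (rule ring_from_type_algebra)
  have sr: "subring P ring_of_type_algebra \<longleftrightarrow> 1 \<in> P \<and> (\<forall>a\<in>P. \<forall>b\<in>P. a - b \<in> P \<and> a * b \<in> P)" for P :: "'a ffun set"
  proof
    have inv: "\<ominus>\<^bsub>ring_of_type_algebra\<^esub> a = - a" for a :: "'a ffun"
      by (rule R.minus_equality) (auto simp: ring_of_type_algebra_def)
    assume s: "subring P ring_of_type_algebra"
    have m: "- a \<in> P" if "a \<in> P" for a using subringE(5)[OF s that] inv by simp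
    have "a + b \<in> P" "a * b \<in> P" if "a \<in> P" "b \<in> P" for a b
      using subringE(6,7)[OF s that] by (simp_all add: ring_of_type_algebra_def)
    then have "a - b \<in> P \<and> a * b \<in> P" if "a \<in> P" "b \<in> P" for a b
      using that m[of b] by (metis add_uminus_conv_diff)
    then show "1 \<in> P \<and> (\<forall>a\<in>P. \<forall>b\<in>P. a - b \<in> P \<and> a * b \<in> P)"
      using subringE(3)[OF s] by (auto simp: ring_of_type_algebra_def)
  next
    assume P: "1 \<in> P \<and> (\<forall>a\<in>P. \<forall>b\<in>P. a - b \<in> P \<and> a * b \<in> P)"
    then have r: "ring_set P" by (auto simp: ring_set_def)
    have inv: "\<ominus>\<^bsub>ring_of_type_algebra\<^esub> a = - a" for a :: "'a ffun"
      by (rule R.minus_equality) (auto simp: ring_of_type_algebra_def)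
    show "subring P ring_of_type_algebra"
      by (rule R.subringI)
        (use ring_setD[OF r] inv in \<open>auto simp: ring_of_type_algebra_def[of] \<close>)
  qed
  show ?thesis unfolding places_def cf.const_places_def val_ring_def val_ring_axioms_def sr
    using K.subfld_axioms by (auto simp: psubset_eq)
qed

lemma ram_index_eq_ramification: "ram_index P Q = ramification P Q"
  by (simp add: ram_index_def ramification_def)

lemma divisor_degree_sum:
  assumes "finite S" "Poly_Mapping.keys D \<subseteq> S"
  shows "divisor_degree D = (\<Sum>P\<in>S. Poly_Mapping.lookup D P)"
  unfolding divisor_degree_def using assms
  by (intro sum.mono_neutral_left) (auto simp: in_keys_iff)

lemma divisor_degree_add: "divisor_degree (D + E) = divisor_degree D + divisor_degree E"
proof -
  let ?S = "Poly_Mapping.keys D \<union> Poly_Mapping.keys E"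
  have "divisor_degree (D + E) = (\<Sum>P\<in>?S. Poly_Mapping.lookup (D + E) P)"
    by (rule divisor_degree_sum) (auto dest: subsetD[OF keys_add])
  then show ?thesis
    by (simp add: lookup_add sum.distrib divisor_degree_sum[of ?S D] divisor_degree_sum[of ?S E])
qed

lemma divisor_degree_cmul: "divisor_degree (frag_cmul c D) = c * divisor_degree D"
  using divisor_degree_sum[of "Poly_Mapping.keys D" "frag_cmul c D"]
    divisor_degree_sum[of "Poly_Mapping.keys D" D] keys_cmul[of c D]
  by (simp add: sum_distrib_left)

lemma divisor_degree_0 [simp]: "divisor_degree 0 = 0"
  by (simp add: divisor_degree_def)

lemma divisor_degree_uminus: "divisor_degree (- D) = - divisor_degree D"
  using divisor_degree_cmul[of "-1" D] by simp

lemma divisor_degree_diff: "divisor_degree (D - E) = divisor_degree D - divisor_degree E"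
  using divisor_degree_add[of D "- E"] by (simp add: divisor_degree_uminus)

lemma divisor_degree_frag_of [simp]: "divisor_degree (frag_of P) = 1"
  by (simp add: divisor_degree_def)

lemma divisor_degree_frag_sum: "divisor_degree (sum u A) = (\<Sum>i\<in>A. divisor_degree (u i))"
  by (induction A rule: infinite_finite_induct) (auto simp: divisor_degree_add)

lemma divisor_degree_extend:
  "divisor_degree (frag_extend b D) = (\<Sum>P\<in>Poly_Mapping.keys D. Poly_Mapping.lookup D P * divisor_degree (b P))"
  by (simp add: frag_extend_def divisor_degree_frag_sum divisor_degree_cmul)

lemma lookup_sum': "Poly_Mapping.lookup (sum u A) Q = (\<Sum>i\<in>A. Poly_Mapping.lookup (u i) Q)"
  by (induction A rule: infinite_finite_induct) (auto simp: lookup_add)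

lemma lookup_extend:
  "Poly_Mapping.lookup (frag_extend b D) Q
     = (\<Sum>P\<in>Poly_Mapping.keys D. Poly_Mapping.lookup D P * Poly_Mapping.lookup (b P) Q)"
  by (simp add: frag_extend_def lookup_sum')

text \<open>Turns cosets and powers of the multiplicative quotient group into differences and
  integer multiples. \<open>G\<close> is meant to be \<open>Div0 w\<close>, \<open>H\<close> the
  principal divisors.\<close>

locale divisor_group =
  fixes G :: "('p \<Rightarrow>\<^sub>0 int) monoid" and H :: "('p \<Rightarrow>\<^sub>0 int) set"
  assumes G_ops: "x \<otimes>\<^bsub>G\<^esub> y = x + y" "\<one>\<^bsub>G\<^esub> = 0"
    and G_0: "0 \<in> carrier G" and G_diff: "x \<in> carrier G \<Longrightarrow> y \<in> carrier G \<Longrightarrow> x - y \<in> carrier G"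
    and H_sub: "H \<subseteq> carrier G" and H_0: "0 \<in> H" and H_diff: "x \<in> H \<Longrightarrow> y \<in> H \<Longrightarrow> x - y \<in> H"
begin

lemma G_uminus: "x \<in> carrier G \<Longrightarrow> - x \<in> carrier G" using G_diff[OF G_0] by simp
lemma G_add: "x \<in> carrier G \<Longrightarrow> y \<in> carrier G \<Longrightarrow> x + y \<in> carrier G"
  using G_diff[of x "- y"] G_uminus by simp
lemma H_uminus: "x \<in> H \<Longrightarrow> - x \<in> H" using H_diff[OF H_0] by simp
lemma H_add: "x \<in> H \<Longrightarrow> y \<in> H \<Longrightarrow> x + y \<in> H" using H_diff[of x "- y"] H_uminus by simp
lemma G_sum: "(\<And>i. i \<in> A \<Longrightarrow> u i \<in> carrier G) \<Longrightarrow> sum u A \<in> carrier G"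
  by (induction A rule: infinite_finite_induct) (auto simp: G_0 G_add)
lemma comm_group_G: "comm_group G"
proof (rule comm_groupI)
  show "\<exists>y\<in>carrier G. y \<otimes>\<^bsub>G\<^esub> x = \<one>\<^bsub>G\<^esub>" if "x \<in> carrier G" for x
    using that by (intro bexI[of _ "- x"]) (auto simp: G_ops G_uminus)
qed (auto simp: G_ops G_0 G_add ac_simps)

lemma inv_G: "x \<in> carrier G \<Longrightarrow> inv\<^bsub>G\<^esub> x = - x"
  using comm_group_G by (intro group.inv_equality) (auto simp: comm_group_def G_ops G_uminus)

lemma pow_G: "x [^]\<^bsub>G\<^esub> (n :: nat) = frag_cmul (int n) x"
  by (induction n) (auto simp: G_ops frag_cmul_distrib nat_pow_def add.commute)

lemma subgroup_H: "subgroup H G"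
  by (rule subgroup.intro) (use H_sub in \<open>auto simp: G_ops H_0 H_add inv_G H_uminus\<close>)

lemma normal_H: "H \<lhd> G"
  using comm_group_G subgroup_H by (simp add: comm_group.normal_iff_subgroup)

lemma comm_group_quotient: "comm_group (G Mod H)"
  by (rule comm_group.abelian_FactGroup[OF comm_group_G subgroup_H])

lemma coset_eq: "H #>\<^bsub>G\<^esub> x = (\<lambda>h. h + x) ` H"
  by (auto simp: r_coset_def G_ops)

lemma coset_eq_iff: "H #>\<^bsub>G\<^esub> x = H #>\<^bsub>G\<^esub> y \<longleftrightarrow> x - y \<in> H"
proof
  assume "H #>\<^bsub>G\<^esub> x = H #>\<^bsub>G\<^esub> y"
  then have "x \<in> (\<lambda>h. h + y) ` H" unfolding coset_eq using H_0 by force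
  then show "x - y \<in> H" by auto
next
  assume xy: "x - y \<in> H"
  have "h + x \<in> (\<lambda>h. h + y) ` H" "h + y \<in> (\<lambda>h. h + x) ` H" if "h \<in> H" for h
  proof -
    show "h + x \<in> (\<lambda>h. h + y) ` H"
      using H_add[OF that xy] by (intro image_eqI[of _ _ "h + (x - y)"]) auto
    show "h + y \<in> (\<lambda>h. h + x) ` H"
      using H_diff[OF that xy] by (intro image_eqI[of _ _ "h - (x - y)"]) auto
  qed
  then show "H #>\<^bsub>G\<^esub> x = H #>\<^bsub>G\<^esub> y" unfolding coset_eq by blast
qed

lemma quotient_carrier: "carrier (G Mod H) = (\<lambda>x. H #>\<^bsub>G\<^esub> x) ` carrier G"
  by (simp add: carrier_FactGroup)

lemma quotient_mult:
  "x \<in> carrier G \<Longrightarrow> y \<in> carrier G \<Longrightarrow> (H #>\<^bsub>G\<^esub> x) \<otimes>\<^bsub>G Mod H\<^esub> (H #>\<^bsub>G\<^esub> y) = H #>\<^bsub>G\<^esub> (x + y)"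
  using normal.rcos_sum[OF normal_H] by (simp add: G_ops)

lemma quotient_pow:
  "x \<in> carrier G \<Longrightarrow> (H #>\<^bsub>G\<^esub> x) [^]\<^bsub>G Mod H\<^esub> (n :: nat) = H #>\<^bsub>G\<^esub> (frag_cmul (int n) x)"
  using normal.FactGroup_pow[OF normal_H] by (simp add: pow_G)

end

locale curve =
  fixes w :: "'a::{alg_closed_field, field_char_0} ffun"
  assumes curve_field: "curve_field (function_field w) const_fun"
begin

abbreviation "Fw \<equiv> function_field w"

sublocale C: curve_field Fw const_fun by (rule curve_field)

lemma place_cplace: "P \<in> places w \<Longrightarrow> cplace Fw P const_fun"
  using C.cplaces by (simp add: places_eq)

lemma place_dvr: "P \<in> places w \<Longrightarrow> dvr Fw P"
  using place_cplace by (simp add: cplace_def)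

text \<open>\<open>Abs_poly_mapping\<close> is meaningful only for finite support, which is known
  for nonzero \<open>g\<close> in \<open>Fw\<close>.\<close>

definition dv :: "'a ffun \<Rightarrow> 'a ffun set \<Rightarrow>\<^sub>0 int"
  where "dv g = Abs_poly_mapping (\<lambda>P. if P \<in> places w then ord_at P g else 0)"

context
  fixes g assumes g: "g \<in> Fw" "g \<noteq> 0"
begin

lemma lookup_dv: "Poly_Mapping.lookup (dv g) P = (if P \<in> places w then ord_at P g else 0)"
proof -
  have "finite {P. (if P \<in> places w then ord_at P g else 0) \<noteq> 0}"
    by (rule finite_subset[OF _ C.finite_support[OF g]]) (auto simp: places_eq split: if_splits)
  then show ?thesis by (simp add: dv_def lookup_Abs_poly_mapping)
qed

lemma keys_dv: "Poly_Mapping.keys (dv g) = {P \<in> places w. ord_at P g \<noteq> 0}"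
  by (auto simp: in_keys_iff lookup_dv split: if_splits)

lemma degree_dv: "divisor_degree (dv g) = 0"
  using C.sum_ord[OF g] by (simp add: divisor_degree_def keys_dv lookup_dv places_eq)

lemma dv_eqI:
  "(\<And>P. P \<in> places w \<Longrightarrow> Poly_Mapping.lookup D P = ord_at P g) \<Longrightarrow> Poly_Mapping.keys D \<subseteq> places w \<Longrightarrow> D = dv g"
  by (intro poly_mapping_eqI) (auto simp: lookup_dv in_keys_iff)

end

lemma dv_divide: "g \<in> Fw \<Longrightarrow> g \<noteq> 0 \<Longrightarrow> h \<in> Fw \<Longrightarrow> h \<noteq> 0 \<Longrightarrow> dv (g / h) = dv g - dv h"
  by (intro poly_mapping_eqI) (auto simp: lookup_minus lookup_dv C.divide_mem dvr.ord_divide[OF place_dvr])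

lemma dv_1: "dv 1 = 0"
  by (intro poly_mapping_eqI) (auto simp: lookup_dv C.one_mem dvr.ord_one[OF place_dvr])

lemma dv_eq_0: "g \<in> Fw \<Longrightarrow> g \<noteq> 0 \<Longrightarrow> dv g = 0 \<Longrightarrow> g \<in> range const_fun"
proof (rule C.regular_const)
  fix P assume g: "g \<in> Fw" "g \<noteq> 0" and d: "dv g = 0" and P: "P \<in> cf.const_places Fw"
  then have "ord_at P g = 0" using lookup_dv[OF g, of P] by (simp add: places_eq)
  then show "g \<in> P" using dvr.ord_nonneg_iff[OF place_dvr, of P g] P g by (simp add: places_eq)
qed

lemma principal_eq: "principal_divisors w = dv ` (Fw - {0})"
proof (intro equalityI subsetI)
  fix D assume "D \<in> principal_divisors w"
  then show "D \<in> dv ` (Fw - {0})"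
    using dv_eqI by (fastforce simp: principal_divisors_def)
next
  fix D assume "D \<in> dv ` (Fw - {0})"
  then show "D \<in> principal_divisors w"
    by (auto simp: principal_divisors_def lookup_dv keys_dv intro!: bexI)
qed

lemma Div0_carrier: "carrier (Div0 w) = {D. Poly_Mapping.keys D \<subseteq> places w \<and> divisor_degree D = 0}"
  by (auto simp: Div0_def)

sublocale J: divisor_group "Div0 w" "principal_divisors w"
proof
  show "x \<otimes>\<^bsub>Div0 w\<^esub> y = x + y" for x y by (simp add: Div0_def free_Abelian_group_def)
  show "\<one>\<^bsub>Div0 w\<^esub> = 0" by (simp add: Div0_def free_Abelian_group_def)
  show "0 \<in> carrier (Div0 w)" by (simp add: Div0_carrier)
  show "x - y \<in> carrier (Div0 w)" if "x \<in> carrier (Div0 w)" "y \<in> carrier (Div0 w)" for x y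
    using that keys_diff[of x y] by (auto simp: Div0_carrier divisor_degree_diff)
  show "principal_divisors w \<subseteq> carrier (Div0 w)"
    by (auto simp: principal_eq Div0_carrier keys_dv degree_dv)
  show "0 \<in> principal_divisors w" using dv_1 C.one_mem by (force simp: principal_eq)
  show "x - y \<in> principal_divisors w" if xy: "x \<in> principal_divisors w" "y \<in> principal_divisors w" for x y
  proof -
    obtain g h where "g \<in> Fw" "g \<noteq> 0" "h \<in> Fw" "h \<noteq> 0" "x = dv g" "y = dv h" using xy by (auto simp: principal_eq)
    then show ?thesis using dv_divide by (auto simp: principal_eq C.divide_mem intro!: image_eqI[of _ _ "g / h"])
  qed
qed

abbreviation "cl \<equiv> divisor_class w"

lemma cl_eq: "cl D = principal_divisors w #>\<^bsub>Div0 w\<^esub> D" by (simp add: divisor_class_def)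

lemma Jac_carrier: "carrier (Jac w) = cl ` carrier (Div0 w)"
  unfolding Jac_def cl_eq[abs_def] by (rule J.quotient_carrier)
lemma Jac_mult: "D \<in> carrier (Div0 w) \<Longrightarrow> E \<in> carrier (Div0 w) \<Longrightarrow> cl D \<otimes>\<^bsub>Jac w\<^esub> cl E = cl (D + E)"
  unfolding Jac_def cl_eq by (rule J.quotient_mult)
lemma Jac_pow: "D \<in> carrier (Div0 w) \<Longrightarrow> cl D [^]\<^bsub>Jac w\<^esub> (n :: nat) = cl (frag_cmul (int n) D)"
  unfolding Jac_def cl_eq by (rule J.quotient_pow)
lemma cl_eq_iff: "cl D = cl E \<longleftrightarrow> D - E \<in> principal_divisors w"
  unfolding cl_eq by (rule J.coset_eq_iff)
lemma cl_coset: "cl D = (\<lambda>h. h + D) ` principal_divisors w"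
  unfolding cl_eq by (rule J.coset_eq)
lemma comm_group_Jac: "comm_group (Jac w)"
  unfolding Jac_def by (rule J.comm_group_quotient)

end

section \<open>Automorphisms acting on divisors and divisor classes\<close>

locale curve_aut = curve w + \<alpha>: fld_aut "function_field w" \<alpha>
  for w :: "'a::{alg_closed_field, field_char_0} ffun" and \<alpha> +
  assumes const_image: "\<alpha> ` range const_fun = range const_fun"
begin

definition pact :: "('a ffun set \<Rightarrow>\<^sub>0 int) \<Rightarrow> ('a ffun set \<Rightarrow>\<^sub>0 int)"
  where "pact = frag_extend (\<lambda>P. frag_of (\<alpha> ` P))"

lemma place_sub: "P \<in> places w \<Longrightarrow> P \<subseteq> Fw"
  by (simp add: places_eq cf.const_places_def val_ring.subset)

text \<open>Constants are preserved as a set, not pointwise: deck transformations fix them, Galois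
  automorphisms move them. This is enough for the image to contain all constants.\<close>

lemma image_place: "P \<in> places w \<Longrightarrow> \<alpha> ` P \<in> places w"
proof -
  assume P: "P \<in> places w"
  have "range const_fun \<subseteq> \<alpha> ` P"
    using P const_image image_mono[of "range const_fun" P \<alpha>]
    by (simp add: places_eq cf.const_places_def del: image_subset_iff)
  moreover have "\<alpha> ` P \<noteq> Fw"
    using inj_on_image_eq_iff[OF \<alpha>.inj_aut place_sub[OF P], of Fw] \<alpha>.aut_image P
    by (auto simp: places_eq cf.const_places_def)
  ultimately show ?thesis
    using \<alpha>.val_ring_image P by (auto simp: places_eq cf.const_places_def)
qed

lemma inj_image: "P \<in> places w \<Longrightarrow> Q \<in> places w \<Longrightarrow> \<alpha> ` P = \<alpha> ` Q \<longleftrightarrow> P = Q"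
  by (rule inj_on_image_eq_iff[OF \<alpha>.inj_aut place_sub place_sub])

lemma surj_image:
  assumes Q: "Q \<in> places w" shows "\<exists>P\<in>places w. \<alpha> ` P = Q"
proof -
  define P where "P = {g \<in> Fw. \<alpha> g \<in> Q}"
  interpret Q: cplace Fw Q const_fun by (rule place_cplace[OF Q])
  have im: "\<alpha> ` P = Q"
  proof (intro equalityI subsetI)
    fix g assume g: "g \<in> Q"
    then have "g \<in> \<alpha> ` Fw" using Q.in_K \<alpha>.aut_image by simp
    then show "g \<in> \<alpha> ` P" using g by (auto simp: P_def)
  qed (auto simp: P_def)
  have "val_ring Fw P"
  proof
    show "a \<in> P \<or> inverse a \<in> P" if "a \<in> Fw" for a
      using that Q.total[of "\<alpha> a"] by (auto simp: P_def \<alpha>.aut_mem \<alpha>.aut_inverse C.inverse_mem)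
  qed (auto simp: P_def \<alpha>.aut_1 C.one_mem Q.one_in C.diff_mem \<alpha>.aut_diff Q.diff_in C.mult_mem \<alpha>.aut_mult Q.mult_in)
  moreover have "range const_fun \<subseteq> P"
  proof
    fix g :: "'a ffun" assume g: "g \<in> range const_fun"
    then have "\<alpha> g \<in> range const_fun" using const_image by blast
    then show "g \<in> P" using g Q.const_in C.const_mem by (auto simp: P_def)
  qed
  moreover have "P \<noteq> Fw" using im \<alpha>.aut_image Q.proper by auto
  ultimately show ?thesis using im by (auto simp: places_eq cf.const_places_def)
qed

lemma ord_image: "P \<in> places w \<Longrightarrow> g \<in> Fw \<Longrightarrow> g \<noteq> 0 \<Longrightarrow> ord_at (\<alpha> ` P) (\<alpha> g) = ord_at P g"
  by (rule \<alpha>.dvr_image(2)[OF place_dvr])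

lemma lookup_pact:
  assumes "Poly_Mapping.keys D \<subseteq> places w" "P \<in> places w"
  shows "Poly_Mapping.lookup (pact D) (\<alpha> ` P) = Poly_Mapping.lookup D P"
proof -
  have "Poly_Mapping.lookup (pact D) (\<alpha> ` P)
      = (\<Sum>Q\<in>Poly_Mapping.keys D. Poly_Mapping.lookup D Q * (if Q = P then 1 else 0))"
    unfolding pact_def lookup_extend using assms inj_image
    by (intro sum.cong refl) auto
  also have "\<dots> = Poly_Mapping.lookup D P" by (auto simp: in_keys_iff if_distrib cong: if_cong)
  finally show ?thesis .
qed

lemma keys_pact:
  assumes "Poly_Mapping.keys D \<subseteq> places w" shows "Poly_Mapping.keys (pact D) \<subseteq> places w"
proof
  fix Q assume "Q \<in> Poly_Mapping.keys (pact D)"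
  then have "(\<Sum>P\<in>Poly_Mapping.keys D. Poly_Mapping.lookup D P * Poly_Mapping.lookup (frag_of (\<alpha> ` P)) Q) \<noteq> 0"
    by (simp add: pact_def in_keys_iff lookup_extend del: lookup_frag_of)
  then obtain P where "P \<in> Poly_Mapping.keys D" "Poly_Mapping.lookup D P * Poly_Mapping.lookup (frag_of (\<alpha> ` P)) Q \<noteq> 0"
    by (rule sum.not_neutral_contains_not_neutral)
  then show "Q \<in> places w" using assms image_place by (auto split: if_splits)
qed

lemma degree_pact: "divisor_degree (pact D) = divisor_degree D"
  by (simp add: pact_def divisor_degree_extend) (simp add: divisor_degree_def)

lemma pact_add: "pact (D + E) = pact D + pact E" by (simp add: pact_def frag_extend_add)
lemma pact_diff: "pact (D - E) = pact D - pact E" by (simp add: pact_def frag_extend_diff)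
lemma pact_cmul: "pact (frag_cmul c D) = frag_cmul c (pact D)" by (simp add: pact_def frag_extend_cmul)
lemma pact_0: "pact 0 = 0" by (simp add: pact_def)
lemma pact_frag_of: "pact (frag_of P) = frag_of (\<alpha> ` P)" by (simp add: pact_def)

lemma pact_dv: "g \<in> Fw \<Longrightarrow> g \<noteq> 0 \<Longrightarrow> pact (dv g) = dv (\<alpha> g)"
proof (rule dv_eqI)
  assume g: "g \<in> Fw" "g \<noteq> 0"
  show "\<alpha> g \<in> Fw" "\<alpha> g \<noteq> 0" using g by (auto simp: \<alpha>.aut_mem \<alpha>.aut_eq_0_iff)
  have k: "Poly_Mapping.keys (dv g) \<subseteq> places w" using g by (auto simp: keys_dv)
  then show "Poly_Mapping.keys (pact (dv g)) \<subseteq> places w" by (rule keys_pact)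
  fix Q assume "Q \<in> places w"
  then obtain P where "P \<in> places w" "Q = \<alpha> ` P" using surj_image by blast
  then show "Poly_Mapping.lookup (pact (dv g)) Q = ord_at Q (\<alpha> g)"
    using k g by (simp add: lookup_pact lookup_dv ord_image)
qed

lemma pact_Div0: "D \<in> carrier (Div0 w) \<Longrightarrow> pact D \<in> carrier (Div0 w)"
  by (simp add: Div0_carrier keys_pact degree_pact)

lemma pact_principal: "pact ` principal_divisors w = principal_divisors w"
proof -
  have "pact ` dv ` (Fw - {0}) = dv ` \<alpha> ` (Fw - {0})"
    unfolding image_image by (intro image_cong refl) (auto simp: pact_dv)
  also have "\<alpha> ` (Fw - {0}) = Fw - {0}"
    using \<alpha>.aut_image \<alpha>.aut_eq_0_iff \<alpha>.aut_mem by (auto simp: image_iff)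
  finally show ?thesis by (simp add: principal_eq)
qed

lemma pact_cl: "pact ` cl D = cl (pact D)"
proof -
  have "pact ` cl D = (\<lambda>h. h + pact D) ` pact ` principal_divisors w"
    unfolding cl_coset image_image by (simp add: pact_add)
  then show ?thesis by (simp add: pact_principal cl_coset)
qed



end

context superelliptic
begin

sublocale curve w by unfold_locales

end

section \<open>Linear polynomials are norms\<close>

text \<open>Gaussian elimination without division: rows are cross-multiplied with the pivot, which
  keeps the solution inside the domain. The coefficients will be polynomials in
  \<open>x\<close>.\<close>

lemma underdetermined_system:
  fixes A :: "nat \<Rightarrow> nat \<Rightarrow> 'r::idom"
  shows "\<exists>c. (\<exists>j\<le>m. c j \<noteq> 0) \<and> (\<forall>i<m. (\<Sum>j\<le>m. A i j * c j) = 0)"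
proof (induction m arbitrary: A)
  case 0
  then show ?case by (intro exI[of _ "\<lambda>_. 1"]) auto
next
  case (Suc m)
  show ?case
  proof (cases "\<forall>i<Suc m. A i (Suc m) = 0")
    case True
    then show ?thesis
      by (intro exI[of _ "\<lambda>j. if j = Suc m then 1 else 0"]) auto
  next
    case False
    then obtain k where k: "k < Suc m" "A k (Suc m) \<noteq> 0" by auto
    define a where "a = A k (Suc m)"
    define s where "s i = (if i < k then i else Suc i)" for i
    \<comment> \<open>Eliminate the last unknown with row \<open>k\<close>; \<open>s\<close> enumerates the other rows.\<close>
    define B where "B i j = a * A (s i) j - A (s i) (Suc m) * A k j" for i j
    obtain c where c: "\<exists>j\<le>m. c j \<noteq> 0" "\<And>i. i < m \<Longrightarrow> (\<Sum>j\<le>m. B i j * c j) = 0"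
      using Suc.IH[of B] by blast
    define c' where "c' j = (if j = Suc m then - (\<Sum>j\<le>m. A k j * c j) else a * c j)" for j
    have sum: "(\<Sum>j\<le>Suc m. A i j * c' j) = a * (\<Sum>j\<le>m. A i j * c j) - A i (Suc m) * (\<Sum>j\<le>m. A k j * c j)" for i
    proof -
      have "(\<Sum>j\<le>m. A i j * c' j) = a * (\<Sum>j\<le>m. A i j * c j)"
        by (auto simp: c'_def sum_distrib_left mult_ac intro!: sum.cong)
      then show ?thesis by (simp add: c'_def)
    qed
    have "(\<Sum>j\<le>Suc m. A i j * c' j) = 0" if i: "i < Suc m" for i
    proof (cases "i = k")
      case True
      then show ?thesis unfolding sum by (simp add: a_def)
    next
      case False
      have "\<exists>i'<m. i = s i'"
      proof (cases "i < k")
        case True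
        then show ?thesis using k by (intro exI[of _ i]) (auto simp: s_def)
      next
        case False
        then show ?thesis using \<open>i \<noteq> k\<close> i by (intro exI[of _ "i - 1"]) (auto simp: s_def)
      qed
      then obtain i' where i': "i' < m" "i = s i'" by blast
      have "(\<Sum>j\<le>m. B i' j * c j) = a * (\<Sum>j\<le>m. A i j * c j) - A i (Suc m) * (\<Sum>j\<le>m. A k j * c j)"
        by (simp add: B_def i'(2) algebra_simps sum_subtractf sum_distrib_left)
      then show ?thesis unfolding sum using c(2)[OF i'(1)] by simp
    qed
    moreover have "\<exists>j\<le>Suc m. c' j \<noteq> 0"
    proof -
      obtain j where "j \<le> m" "c j \<noteq> 0" using c(1) by blast
      then show ?thesis using k by (intro exI[of _ j]) (auto simp: c'_def a_def)
    qed
    ultimately show ?thesis by blast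
  qed
qed

lemma pcompose_one: "pcompose 1 q = (1 :: 'r::comm_ring_1 poly)"
  by (metis one_pCons pcompose_const)

text \<open>The product is invariant under replacing the variable \<open>X\<close> by
  \<open>r * X\<close>, so its coefficient of degree \<open>i\<close> is fixed by multiplication by
  \<open>r ^ i\<close>.\<close>

lemma coeff_twisted_product:
  fixes r :: "'r::idom" and Q :: "'r poly"
  assumes m: "0 < m" "r ^ m = 1" and ord: "r ^ i \<noteq> 1"
  shows "coeff (\<Prod>k<m. pcompose Q [:0, r ^ k:]) i = 0"
proof -
  define R where "R = (\<Prod>k<m. pcompose Q [:0, r ^ k:])"
  have comp: "pcompose (pcompose Q [:0, u:]) [:0, v:] = pcompose Q [:0, v * u:]" for u v
    by (intro poly_eqI) (simp add: coeff_pcompose_linear power_mult_distrib)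
  obtain n where n: "m = Suc n" using m by (cases m) auto
  have "pcompose R [:0, r:] = (\<Prod>k<m. pcompose Q [:0, r ^ Suc k:])"
    by (simp add: R_def pcompose_prod comp)
  also have "\<dots> = (\<Prod>k<n. pcompose Q [:0, r ^ Suc k:]) * pcompose Q [:0, r ^ 0:]"
    using m(2) by (simp add: n)
  also have "\<dots> = R"
    using prod.lessThan_Suc_shift[of "\<lambda>k. pcompose Q [:0, r ^ k:]" n] by (simp add: R_def n mult.commute)
  finally have "r ^ i * coeff R i = coeff R i" by (metis coeff_pcompose_linear)
  then have "(r ^ i - 1) * coeff R i = 0" by (simp add: left_diff_distrib)
  then show ?thesis using ord by (simp add: R_def)
qed

context superelliptic
begin

text \<open>That \<open>x - a\<close> is a norm from \<open>k(x, w)\<close> is the reciprocity of a symbol: with \<open>t ^ m = x - a\<close>, the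
  function \<open>f\<close> is a norm from \<open>k(t)\<close> by inspection of its linear factors (a Steinberg relation).
  Then \<open>w\<close> acts on \<open>k(t)\<close> by \<open>v(t) \<mapsto> \<beta>(t) v(t / \<zeta>)\<close>, where \<open>f = Norm \<beta>\<close>, making \<open>k(t)\<close> a
  one-dimensional space over \<open>k(x, w)\<close> on which \<open>t\<close> acts semilinearly. The scalar by which \<open>t\<close> acts on
  \<open>1\<close> has norm \<open>t ^ m = x - a\<close>.\<close>

definition "r = inverse \<zeta>"

lemma zeta_nz: "\<zeta> \<noteq> 0" using \<zeta>_power m_pos by (auto simp: power_0_left)

lemma r_power_eq_1_iff: "r ^ i = 1 \<longleftrightarrow> m dvd i"
  using zeta_power_eq_1_iff[of i] by (simp add: r_def power_inverse)

context
  fixes a :: 'a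
begin

text \<open>The embedding of polynomials in \<open>x\<close> into polynomials in \<open>t\<close> by
  \<open>x = t ^ m + a\<close>.\<close>

definition "subst_t p = pcompose p (monom 1 m + [:a:])" for p :: "'a poly"

lemma subst_t_simps [simp]:
  "subst_t 0 = 0" "subst_t 1 = 1" "subst_t (p + q) = subst_t p + subst_t q" "subst_t (- p) = - subst_t p"
  "subst_t (p - q) = subst_t p - subst_t q" "subst_t (p * q) = subst_t p * subst_t q" "subst_t [:c:] = [:c:]"
  by (simp_all add: subst_t_def pcompose_add pcompose_mult pcompose_diff pcompose_uminus pcompose_one)

lemma subst_t_linear: "subst_t [:- a, 1:] = monom 1 m"
  by (simp add: subst_t_def pcompose_pCons)

lemma subst_t_eq_0_iff: "subst_t p = 0 \<longleftrightarrow> p = 0"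
proof -
  have "degree (monom 1 m + [:a:]) = m"
    using m_pos by (subst degree_add_eq_left) (auto simp: degree_monom_eq)
  then show ?thesis using m_pos unfolding subst_t_def by (intro pcompose_eq_0_iff) auto
qed

text \<open>Linear factors and constants suffice. In terms of \<open>t\<close> the factor
  \<open>x - b\<close> is \<open>t ^ m + (a - b)\<close>, and this is the norm of a linear
  polynomial in \<open>t\<close>; a constant is the norm of an \<open>m\<close>-th root of
  itself.\<close>

lemma f_is_norm: "\<exists>\<beta>. (\<Prod>i<m. pcompose \<beta> [:0, r ^ i:]) = subst_t f"
proof -
  have "\<exists>\<beta>. (\<Prod>i<m. pcompose \<beta> [:0, r ^ i:]) = subst_t p" if "p \<noteq> 0" for p
    using that
  proof (induction "degree p" arbitrary: p rule: less_induct)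
    case less
    show ?case
    proof (cases "degree p = 0")
      case True
      then obtain c where c: "p = [:c:]" using degree_0_id by metis
      obtain b where "b ^ m = c" using nth_root_exists[OF m_pos] by blast
      then show ?thesis by (intro exI[of _ "[:b:]"]) (simp add: c pcompose_const poly_const_pow)
    next
      case False
      then obtain b where "poly p b = 0" using alg_closed_imp_poly_has_root by blast
      then obtain q where q: "p = [:- b, 1:] * q" by (auto simp: poly_eq_0_iff_dvd elim: dvdE)
      have q0: "q \<noteq> 0" using less.prems q by auto
      have "degree q < degree p"
        using degree_mult_eq[of "[:- b, 1:]" q] q q0 by (simp del: mult_pCons_left)
      then obtain \<beta> where \<beta>: "(\<Prod>i<m. pcompose \<beta> [:0, r ^ i:]) = subst_t q"
        using less.hyps q0 by blast
      \<comment> \<open>\<epsilon> is the leading coefficient contributed by the conjugates of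
        \<open>t\<close>; \<delta> is chosen to cancel it, and \<eta> gives the right constant term.
        The intermediate coefficients vanish by \<open>coeff_twisted_product\<close>.\<close>
      define \<epsilon> where "\<epsilon> = (\<Prod>i<m. r ^ i)"
      have e0: "\<epsilon> \<noteq> 0" using zeta_nz by (simp add: \<epsilon>_def r_def)
      obtain \<eta> where \<eta>: "\<eta> ^ m = a - b" using nth_root_exists[OF m_pos] by blast
      obtain \<delta> where \<delta>: "\<delta> ^ m = inverse \<epsilon>" using nth_root_exists[OF m_pos] by blast
      define N where "N = (\<Prod>i<m. pcompose [:\<eta>, \<delta>:] [:0, r ^ i:])"
      have lin: "pcompose [:\<eta>, \<delta>:] [:0, r ^ i:] = [:\<eta>, \<delta> * r ^ i:]" for i
        by (simp add: pcompose_pCons)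
      have "N = monom 1 m + [:a - b:]"
      proof (rule poly_eqI)
        fix i
        have d: "\<delta> \<noteq> 0" using \<delta> e0 m_pos by (auto simp: power_0_left)
        have deg: "degree N = m" unfolding N_def lin
          using d zeta_nz by (subst degree_prod_eq_sum_degree) (auto simp: r_def)
        have "coeff N m = (\<Prod>i<m. lead_coeff [:\<eta>, \<delta> * r ^ i:])"
          using deg lead_coeff_prod[of "\<lambda>i. [:\<eta>, \<delta> * r ^ i:]" "{..<m}"] by (simp add: N_def lin)
        also have "\<dots> = \<delta> ^ m * \<epsilon>" using d zeta_nz by (simp add: r_def \<epsilon>_def prod.distrib)
        finally have cm: "coeff N m = 1" using \<delta> e0 by simp
        have c0: "coeff N 0 = a - b"
          using \<eta> by (simp add: N_def lin poly_prod flip: poly_0_coeff_0)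
        have rhs: "coeff (monom 1 m + [:a - b:]) i = (if i = m then 1 else if i = 0 then a - b else 0)"
          using m_pos by (cases i) auto
        consider "i = 0" | "i = m" | "i > m" | "i \<noteq> 0 \<and> i < m" by linarith
        then show "coeff N i = coeff (monom 1 m + [:a - b:]) i"
        proof cases
          case 1
          then show ?thesis unfolding rhs using c0 m_pos by simp
        next
          case 2
          then show ?thesis unfolding rhs using cm by simp
        next
          case 3
          then show ?thesis unfolding rhs using deg by (simp add: coeff_eq_0)
        next
          case 4
          then have "r ^ i \<noteq> 1" using r_power_eq_1_iff by (auto dest: dvd_imp_le)
          then have "coeff N i = 0" unfolding N_def
            using r_power_eq_1_iff[of m] by (intro coeff_twisted_product) (auto simp: m_pos)
          then show ?thesis unfolding rhs using 4 by simp
        qed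
      qed
      also have "\<dots> = subst_t [:- b, 1:]" by (simp add: subst_t_def pcompose_pCons)
      finally have "N * (\<Prod>i<m. pcompose \<beta> [:0, r ^ i:]) = subst_t p"
        unfolding \<beta> q by (simp only: subst_t_simps)
      then show ?thesis unfolding N_def
        by (intro exI[of _ "[:\<eta>, \<delta>:] * \<beta>"]) (simp only: pcompose_mult prod.distrib)
    qed
  qed
  then show ?thesis using f_nz by blast
qed

definition "\<beta> = (SOME \<beta>. (\<Prod>i<m. pcompose \<beta> [:0, r ^ i:]) = subst_t f)"

lemma norm_\<beta>: "(\<Prod>i<m. pcompose \<beta> [:0, r ^ i:]) = subst_t f"
  unfolding \<beta>_def by (rule someI_ex) (rule f_is_norm)

text \<open>Multiplication by \<open>w\<close> on polynomials in \<open>t\<close>. Its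
  \<open>m\<close>-th iterate is multiplication by the norm of \<beta>, that is, by
  \<open>f\<close>.\<close>

definition "Y v = \<beta> * pcompose v [:0, r:]"

text \<open>A module structure over polynomials in \<open>x\<close> and \<open>w\<close>:
  coefficients act through \<open>subst_t\<close> and \<open>w\<close> through \<open>Y\<close>,
  evaluated by Horner's scheme.\<close>

definition act :: "'a poly poly \<Rightarrow> 'a poly \<Rightarrow> 'a poly"
  where "act P v = fold_coeffs (\<lambda>c u. subst_t c * v + Y u) P 0"

lemma Y_simps: "Y 0 = 0" "Y (u + v) = Y u + Y v"
  by (simp_all add: Y_def pcompose_add algebra_simps)

lemma Y_subst_t: "Y (subst_t c * v) = subst_t c * Y v"
proof -
  have rm: "r ^ m = 1" using r_power_eq_1_iff[of m] by simp
  have "pcompose (monom 1 m + [:a:]) [:0, r:] = monom 1 m + [:a:]"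
  proof (rule poly_eqI)
    fix i show "coeff (pcompose (monom 1 m + [:a:]) [:0, r:]) i = coeff (monom 1 m + [:a:]) i"
      using rm m_pos by (cases i) (auto simp: coeff_pcompose_linear poly_monom power_0_left)
  qed
  then have "pcompose (subst_t c) [:0, r:] = subst_t c"
    by (simp add: subst_t_def flip: pcompose_assoc)
  then show ?thesis by (simp add: Y_def pcompose_mult mult_ac)
qed

lemma act_0 [simp]: "act 0 v = 0" by (simp add: act_def)

lemma act_pCons: "act (pCons c P) v = subst_t c * v + Y (act P v)"
  by (cases "c = 0 \<and> P = 0") (auto simp: act_def Y_simps)

lemma act_add: "act (P + Q) v = act P v + act Q v"
  by (induction P Q rule: poly_induct2) (auto simp: act_pCons Y_simps algebra_simps)

lemma act_smult: "act (smult c P) v = subst_t c * act P v"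
  by (induction P) (auto simp: act_pCons Y_subst_t algebra_simps)

lemma act_vec_smult: "act P (subst_t c * v) = subst_t c * act P v"
  by (induction P) (auto simp: act_pCons Y_subst_t algebra_simps)

lemma act_mult: "act (P * Q) v = act P (act Q v)"
  by (induction P) (auto simp: act_pCons act_add act_smult)

lemma act_vec_0: "act P 0 = 0"
  using act_vec_smult[of P 0 0] by simp

lemma act_monom: "act (monom c n) v = subst_t c * (Y ^^ n) v"
  by (induction n) (auto simp: monom_0 monom_Suc act_pCons Y_simps Y_subst_t)

lemma Y_funpow: "(Y ^^ n) v = (\<Prod>i<n. pcompose \<beta> [:0, r ^ i:]) * pcompose v [:0, r ^ n:]"
proof (induction n)
  case (Suc n)
  have comp: "pcompose (pcompose u [:0, p:]) [:0, q:] = pcompose u [:0, q * p:]" for u :: "'a poly" and p q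
    by (intro poly_eqI) (simp add: coeff_pcompose_linear power_mult_distrib)
  have "(Y ^^ Suc n) v = (\<beta> * (\<Prod>i<n. pcompose \<beta> [:0, r ^ Suc i:])) * pcompose v [:0, r ^ Suc n:]"
    by (simp add: Suc Y_def pcompose_mult pcompose_prod comp mult.assoc)
  also have "\<beta> * (\<Prod>i<n. pcompose \<beta> [:0, r ^ Suc i:]) = (\<Prod>i<Suc n. pcompose \<beta> [:0, r ^ i:])"
    by (subst prod.lessThan_Suc_shift) simp
  finally show ?case .
qed simp

lemma act_rel: "act rel v = 0"
proof -
  have "act (monom 1 m) v = subst_t f * v"
    using r_power_eq_1_iff[of m] by (simp add: act_monom Y_funpow norm_\<beta>)
  then show ?thesis using act_add[of rel "[:f:]" v] by (simp add: rel_def act_pCons Y_simps)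
qed

text \<open>\<open>Y\<close> turns the factor \<open>t\<close> into \<open>r * t\<close>, so moving
  \<open>t\<close> past \<open>Y\<close> costs the factor \<zeta>, exactly as \<open>w\<close> is
  scaled under \<open>twist 1\<close>.\<close>

lemma Y_t: "monom 1 1 * Y v = smult \<zeta> (Y (monom 1 1 * v))"
proof -
  have "pcompose (monom 1 1) [:0, r:] = smult r (monom 1 1)"
    by (simp add: monom_Suc pcompose_pCons pcompose_one)
  then show ?thesis using zeta_nz by (simp add: Y_def pcompose_mult r_def mult_ac)
qed

lemma twist_pCons: "twist j (pCons c P) = pCons c (smult [:\<zeta> ^ j:] (twist j P))"
  by (simp add: twist_def pcompose_pCons)

lemma act_t: "monom 1 1 * act P v = act (twist 1 P) (monom 1 1 * v)"
proof (induction P)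
  case (pCons c P)
  have "monom 1 1 * Y (act P v) = smult \<zeta> (Y (act (twist 1 P) (monom 1 1 * v)))"
    using Y_t pCons by metis
  also have "\<dots> = Y (act (smult [:\<zeta>:] (twist 1 P)) (monom 1 1 * v))"
    using Y_subst_t[of "[:\<zeta>:]"] by (simp add: act_smult)
  finally show ?case by (simp add: act_pCons twist_pCons algebra_simps)
qed (simp add: twist_def)

lemma act_t_power: "monom 1 1 ^ n * act P v = act (twist n P) (monom 1 1 ^ n * v)"
proof (induction n)
  case 0
  then show ?case by (simp add: twist_period)
next
  case (Suc n)
  have "monom 1 1 ^ Suc n * act P v = monom 1 1 * act (twist n P) (monom 1 1 ^ n * v)"
    by (simp only: Suc[symmetric] power_Suc mult.assoc)
  also have "\<dots> = act (twist 1 (twist n P)) (monom 1 1 * (monom 1 1 ^ n * v))" by (rule act_t)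
  finally show ?case by (simp only: twist_twist power_Suc mult.assoc plus_1_eq_Suc)
qed

text \<open>If \<open>eval_xw w G\<close> were nonzero, clearing the denominator of its inverse
  would give \<open>H\<close> with \<open>H * G\<close> congruent to a nonzero polynomial
  \<open>q\<close> in \<open>x\<close> modulo \<open>rel\<close>. If \<open>G\<close> kills 1, so
  does \<open>q\<close>, but \<open>q\<close> acts by multiplication by the nonzero
  \<open>subst_t q\<close>.\<close>

lemma act_inj:
  assumes "act G 1 = 0" shows "eval_xw w G = 0"
proof (rule ccontr)
  assume nz: "eval_xw w G \<noteq> 0"
  obtain H q where Hq: "q \<noteq> 0" "inverse (eval_xw w G) = eval_xw w H / fun_of_poly q"
    using reduced_form[OF K.inverse_mem[OF eval_xw_in]] by metis
  have "eval_xw w (H * G - [:q:]) = 0" using Hq nz by (simp add: field_simps)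
  then have "rel dvd H * G - [:q:]" by (simp only: eval_eq_0_iff)
  then obtain S where S: "H * G - [:q:] = rel * S" by (rule dvdE)
  have "act (H * G) 1 = act [:q:] 1 + act (rel * S) 1"
    unfolding S[symmetric] act_add[symmetric] by simp
  also have "\<dots> = subst_t q" by (simp add: act_pCons Y_simps act_mult act_rel)
  finally show False using assms Hq subst_t_eq_0_iff by (simp add: act_mult act_vec_0)
qed

text \<open>Powers of \<open>t\<close> below \<open>m\<close> span over polynomials in
  \<open>x\<close>: multiplying by \<open>t\<close> shifts them, and the overflow
  \<open>t ^ m\<close> is \<open>x - a\<close> and joins the constant coefficient.\<close>

lemma decompose_t: "\<exists>A. v = (\<Sum>j<m. monom 1 j * subst_t (A j))"
proof (induction v)
  case 0
  then show ?case by (intro exI[of _ "\<lambda>_. 0"]) auto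
next
  case (pCons c v)
  then obtain A where A: "v = (\<Sum>j<m. monom 1 j * subst_t (A j))" by blast
  obtain n where n: "m = Suc n" using m_pos by (cases m) auto
  have "pCons c v = [:c:] + monom 1 1 * v"
    by (simp add: monom_Suc)
  also have "monom 1 1 * v = (\<Sum>j<m. monom 1 (Suc j) * subst_t (A j))"
    unfolding A by (simp add: sum_distrib_left mult.assoc[symmetric] mult_monom)
  also have "\<dots> = (\<Sum>j<n. monom 1 (Suc j) * subst_t (A j)) + subst_t ([:- a, 1:] * A n)"
    unfolding subst_t_simps(6) subst_t_linear by (simp add: n)
  finally have "pCons c v = (\<Sum>j<n. monom 1 (Suc j) * subst_t (A j)) + subst_t ([:c:] + [:- a, 1:] * A n)"
    by (simp only: subst_t_simps add_ac)
  also have "\<dots> = (\<Sum>j<m. monom 1 j * subst_t (case j of 0 \<Rightarrow> [:c:] + [:- a, 1:] * A n | Suc j \<Rightarrow> A j))"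
    unfolding n sum.lessThan_Suc_shift by (simp add: monom_0 add.commute)
  finally show ?case by blast
qed

text \<open>The \<open>m\<close> vectors \<open>(Y ^^ j) 1\<close> together with \<open>t\<close>
  are \<open>m + 1\<close> vectors in a module spanned by \<open>m\<close> elements, hence
  dependent. The coefficient of \<open>t\<close> cannot vanish, as the others are independent by
  \<open>act_inj\<close> and \<open>eval_inj\<close>.\<close>

lemma t_multiplier: "\<exists>P c. c \<noteq> 0 \<and> act P 1 = subst_t c * monom 1 1"
proof -
  define v where "v j = (if j < m then (Y ^^ j) 1 else monom 1 1)" for j
  have "\<forall>j. \<exists>A. v j = (\<Sum>i<m. monom 1 i * subst_t (A i))" using decompose_t by blast
  then obtain A where A: "\<And>j. v j = (\<Sum>i<m. monom 1 i * subst_t (A j i))" by metis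
  obtain c where c: "\<exists>j\<le>m. c j \<noteq> 0" "\<And>i. i < m \<Longrightarrow> (\<Sum>j\<le>m. A j i * c j) = 0"
    using underdetermined_system[of m "\<lambda>i j. A j i"] by blast
  have ss: "subst_t (sum u B) = (\<Sum>i\<in>B. subst_t (u i))" for u :: "nat \<Rightarrow> _" and B
    by (induction B rule: infinite_finite_induct) auto
  have "(\<Sum>j\<le>m. subst_t (c j) * v j) = (\<Sum>j\<le>m. \<Sum>i<m. monom 1 i * subst_t (A j i * c j))"
    unfolding A by (simp add: sum_distrib_left mult_ac)
  also have "\<dots> = (\<Sum>i<m. monom 1 i * subst_t (\<Sum>j\<le>m. A j i * c j))"
    by (subst sum.swap) (simp only: ss sum_distrib_left)
  also have "\<dots> = 0" using c(2) by simp
  finally have dep: "(\<Sum>j<m. subst_t (c j) * (Y ^^ j) 1) + subst_t (c m) * monom 1 1 = 0"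
    by (simp add: v_def lessThan_Suc_atMost[symmetric])
  define P where "P = (\<Sum>j<m. monom (c j) j)"
  have as: "act (sum u B) 1 = (\<Sum>i\<in>B. act (u i) 1)" for u :: "nat \<Rightarrow> _" and B
    by (induction B rule: infinite_finite_induct) (auto simp: act_add)
  have aP: "act P 1 = - (subst_t (c m) * monom 1 1)"
    using dep by (simp add: P_def as act_monom eq_neg_iff_add_eq_0)
  have "c m \<noteq> 0"
  proof
    assume cm: "c m = 0"
    then have "eval_xw w P = 0" using aP by (intro act_inj) simp
    moreover have "degree P < m" unfolding P_def
      using m_pos by (intro degree_sum_less) (auto intro: le_less_trans[OF degree_monom_le])
    ultimately have "P = 0" by (rule eval_inj)
    moreover have "coeff P j = c j" if "j < m" for j using that by (simp add: P_def coeff_sum)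
    ultimately have "c j = 0" if "j \<le> m" for j using that cm by (cases "j = m") auto
    then show False using c(1) by blast
  qed
  then show ?thesis using aP by (intro exI[of _ P] exI[of _ "- c m"]) simp
qed

end

text \<open>Applying the conjugates \<open>twist k P\<close> one after another to 1 and moving
  \<open>t\<close> past them gives \<open>c ^ m * t ^ m\<close>, which is \<open>c ^ m\<close> times
  \<open>x - a\<close>. By \<open>act_inj\<close> this is an identity in \<open>K\<close>, and
  dividing \<open>P\<close> by \<open>c\<close> gives the required norm.\<close>

theorem linear_is_norm: "\<exists>g\<in>K - {0}. E.norm g = fun_of_poly [:- a, 1:]"
proof -
  obtain P c where c: "c \<noteq> 0" and P: "act a P 1 = subst_t a c * monom 1 1"
    using t_multiplier by blast
  have "act a (\<Prod>k<n. twist k P) 1 = subst_t a (c ^ n) * monom 1 1 ^ n" for n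
  proof (induction n)
    case (Suc n)
    have "act a (\<Prod>k<Suc n. twist k P) 1 = act a (twist n P * (\<Prod>k<n. twist k P)) 1"
      by (simp add: mult.commute)
    also have "\<dots> = act a (twist n P) (subst_t a (c ^ n) * (monom 1 1 ^ n * 1))"
      unfolding act_mult Suc by simp
    also have "\<dots> = subst_t a (c ^ n) * (monom 1 1 ^ n * (subst_t a c * monom 1 1))"
      unfolding act_vec_smult act_t_power[symmetric] P by simp
    finally show ?case by (simp add: mult_ac)
  qed (simp add: act_pCons Y_simps one_pCons[of, symmetric] flip: one_pCons, simp add: one_pCons act_pCons Y_simps)
  then have "act a (\<Prod>k<m. twist k P) 1 = subst_t a (c ^ m * [:- a, 1:])"
    unfolding subst_t_simps(6) subst_t_linear by (simp add: monom_power)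
  then have "act a ((\<Prod>k<m. twist k P) - [:c ^ m * [:- a, 1:]:]) 1 = 0"
    using act_add[of a "(\<Prod>k<m. twist k P) - [:c ^ m * [:- a, 1:]:]" "[:c ^ m * [:- a, 1:]:]" 1]
    by (simp add: act_pCons Y_simps del: mult_pCons_right)
  then have "eval_xw w ((\<Prod>k<m. twist k P) - [:c ^ m * [:- a, 1:]:]) = 0" by (rule act_inj)
  then have pr: "(\<Prod>k<m. rot k (eval_xw w P)) = fun_of_poly c ^ m * fun_of_poly [:- a, 1:]"
    by (simp add: eval_xw_prod rot_eval fun_of_poly_power del: mult_pCons_right)
  define g where "g = eval_xw w P / fun_of_poly c"
  have g: "g \<in> K" unfolding g_def by (intro K.divide_mem eval_xw_in fun_of_poly_in)
  have "E.norm g = (\<Prod>k<m. rot k g)"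
    unfolding E.norm_def by (simp add: rot_funpow[OF g])
  also have "\<dots> = (\<Prod>k<m. rot k (eval_xw w P)) / fun_of_poly c ^ m"
    by (simp add: g_def rot.aut_divide eval_xw_in fun_of_poly_in rot_fun_of_poly prod_dividef)
  also have "\<dots> = fun_of_poly [:- a, 1:]" using c by (simp add: pr)
  finally have N: "E.norm g = fun_of_poly [:- a, 1:]" .
  then have "g \<noteq> 0" using E.norm_eq_0_iff[OF g] by auto
  then show ?thesis using N g by blast
qed

end

section \<open>Divisibility of the Jacobian\<close>

lemma frag_cmul_diff: "frag_cmul c (x - y) = frag_cmul c x - frag_cmul c y"
  by (intro poly_mapping_eqI) (simp add: lookup_minus algebra_simps)

lemma prime_dvd_choose_prime_power:
  assumes "prime (l::nat)" "0 < i" "i < l ^ s"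
  shows "l dvd (l ^ s choose i)"
proof (rule ccontr)
  assume "\<not> ?thesis"
  then have cop: "coprime (l ^ s) (l ^ s choose i)"
    using assms(1) by (simp add: prime_imp_coprime)
  have "i * (l ^ s choose i) = l ^ s * (l ^ s - 1 choose (i - 1))"
    using assms times_binomial_minus1_eq by simp
  then have "l ^ s dvd i * (l ^ s choose i)" by simp
  then have "l ^ s dvd i" using cop by (simp add: coprime_dvd_mult_left_iff)
  then show False using dvd_imp_le[of "l ^ s" i] assms by simp
qed

context curve_aut
begin

definition "delta D = D - pact D"

lemma delta_principal: "D \<in> principal_divisors w \<Longrightarrow> delta D \<in> principal_divisors w"
  using pact_principal by (auto simp: delta_def intro!: J.H_diff)

lemma funpow_pact_Div0: "D \<in> carrier (Div0 w) \<Longrightarrow> (pact ^^ i) D \<in> carrier (Div0 w)"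
  by (induction i) (auto simp: pact_Div0)

lemma delta_diff: "delta (D - E) = delta D - delta E"
  by (simp add: delta_def pact_diff)

lemma funpow_delta:
  "(delta ^^ k) D = (\<Sum>i\<le>k. frag_cmul ((- 1) ^ i * int (k choose i)) ((pact ^^ i) D))"
proof (induction k)
  case (Suc k)
  define u where "u i = (pact ^^ i) D" for i
  have ps: "pact (sum v A) = (\<Sum>i\<in>A. pact (v i))" for v :: "nat \<Rightarrow> _" and A
    by (induction A rule: infinite_finite_induct) (auto simp: pact_0 pact_add)
  define c where "c k i = (- 1) ^ i * int (k choose i)" for k i
  have "(delta ^^ Suc k) D = (\<Sum>i\<le>k. frag_cmul (c k i) (u i)) - (\<Sum>i\<le>k. frag_cmul (c k i) (u (Suc i)))"
    by (simp add: Suc delta_def ps pact_cmul u_def c_def)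
  also have "(\<Sum>i\<le>k. frag_cmul (c k i) (u i)) = u 0 + (\<Sum>i\<le>k. frag_cmul (c k (Suc i)) (u (Suc i)))"
  proof -
    have "(\<Sum>i\<le>k. frag_cmul (c k i) (u i)) = (\<Sum>i\<le>Suc k. frag_cmul (c k i) (u i))"
      by (simp add: c_def)
    also have "\<dots> = frag_cmul (c k 0) (u 0) + (\<Sum>i\<le>k. frag_cmul (c k (Suc i)) (u (Suc i)))"
      by (rule sum.atMost_Suc_shift)
    finally show ?thesis by (simp add: c_def)
  qed
  also have "u 0 + (\<Sum>i\<le>k. frag_cmul (c k (Suc i)) (u (Suc i))) - (\<Sum>i\<le>k. frag_cmul (c k i) (u (Suc i)))
      = u 0 + (\<Sum>i\<le>k. frag_cmul (c (Suc k) (Suc i)) (u (Suc i)))"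
  proof -
    have *: "frag_cmul (c k (Suc i)) x - frag_cmul (c k i) x = frag_cmul (c (Suc k) (Suc i)) x" for i x
      by (intro poly_mapping_eqI) (simp add: lookup_minus c_def algebra_simps)
    show ?thesis by (simp only: add_diff_eq[symmetric] sum_subtractf[symmetric] *)
  qed
  also have "\<dots> = (\<Sum>i\<le>Suc k. frag_cmul (c (Suc k) i) (u i))"
    by (subst sum.atMost_Suc_shift) (simp add: c_def)
  finally show ?case by (simp add: u_def c_def)
qed simp

end

context superelliptic
begin

sublocale R: curve_aut w "rot j" for j
proof
  show "rot j ` range const_fun = range const_fun"
    by (auto simp: rot_fun_of_poly image_image)
qed

abbreviation "down Q \<equiv> Q \<inter> rat_field"

lemma down_place: "Q \<in> places w \<Longrightarrow> down Q \<in> cf.const_places rat_field"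
  and fib_down: "Q \<in> places w \<Longrightarrow> Q \<in> E.fib (down Q)"
  using E.inter_const_place by (auto simp: places_eq E.fib_def)

lemma fib_places: "Q \<in> E.fib P \<Longrightarrow> Q \<in> places w" "Q \<in> E.fib P \<Longrightarrow> down Q = P"
  by (auto simp: E.fib_def places_eq)

lemma ext_place: "P \<in> cf.const_places rat_field \<Longrightarrow> cyclic_ext_place Fw (rot 1) rat_field const_fun m w \<zeta> P"
  using curve_field.cplaces[OF rat_curve_field] E.cyclic_ext_axioms by (simp add: cyclic_ext_place_def)

text \<open>From \<open>w ^ m = f\<close>, \<open>m\<close> times the order of \<open>w\<close>
  equals the ramification index times the order of \<open>f\<close> at \<xi>. Coprimality makes
  \<open>m\<close> divide the index, which itself divides \<open>m\<close>.\<close>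

lemma total_ramification:
  "\<exists>Q\<in>places w. E.fib (affine_place \<xi>) = {Q} \<and> ramification (affine_place \<xi>) Q = int m"
proof -
  interpret P: cyclic_ext_place Fw "rot 1" rat_field const_fun m w \<zeta> "affine_place \<xi>"
    by (rule ext_place) (simp add: rat_places)
  obtain Q where Q: "Q \<in> E.fib (affine_place \<xi>)" using P.fib_nonempty by auto
  interpret Q: cplace Fw Q const_fun by (rule P.fib_cplace[OF Q])
  define e where "e = ramification (affine_place \<xi>) Q"
  have "int m * ord_at Q w = ord_at Q (fun_of_poly f)"
    using Q.ord_power[OF w_in w_nz, of m] w_power by simp
  also have "\<dots> = e * int (order \<xi> f)"
    using P.ramification_ord[OF Q fun_of_poly_rat] ord_affine_place[of f 1 \<xi>] f_nz by (simp add: e_def)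
  finally have "int m dvd e * int (order \<xi> f)" by (metis dvd_triv_left)
  moreover have "coprime (int m) (int (order \<xi> f))"
    using coprime_order by (simp add: coprime_commute)
  ultimately have "int m dvd e" by (simp add: coprime_dvd_mult_left_iff)
  moreover have card: "int (card (E.fib (affine_place \<xi>))) * e = int m"
    using P.fundamental_identity[OF Q] by (simp add: e_def)
  moreover have "e > 0" using P.ramification_pos[OF Q] by (simp add: e_def)
  ultimately have e: "e = int m"
    using zdvd_antisym_nonneg[of e "int m"] dvd_triv_right[of e "int (card (E.fib (affine_place \<xi>)))"] by simp
  then have "card (E.fib (affine_place \<xi>)) = 1" using card m_pos by simp
  then show ?thesis using Q fib_places(1)[OF Q] e by (auto simp: card_1_singleton_iff e_def)
qed

definition "Q0 = (SOME Q. Q \<in> places w \<and> E.fib (affine_place \<xi>) = {Q} \<and> ramification (affine_place \<xi>) Q = int m)"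

lemma Q0: "Q0 \<in> places w" "E.fib (affine_place \<xi>) = {Q0}" "ramification (affine_place \<xi>) Q0 = int m"
proof -
  have "Q0 \<in> places w \<and> E.fib (affine_place \<xi>) = {Q0} \<and> ramification (affine_place \<xi>) Q0 = int m"
    unfolding Q0_def by (rule someI_ex) (use total_ramification in blast)
  then show "Q0 \<in> places w" "E.fib (affine_place \<xi>) = {Q0}" "ramification (affine_place \<xi>) Q0 = int m" by auto
qed

lemma rot_Q0: "rot j ` Q0 = Q0"
proof -
  have eq: "rot j ` Q0 = (rot 1 ^^ j) ` Q0"
    using R.place_sub[OF Q0(1)] by (intro image_cong refl) (auto simp: rot_funpow)
  have "(rot 1 ^^ j) ` Q0 \<in> E.fib (affine_place \<xi>)"
    using E.fib_image[of Q0 "affine_place \<xi>" j] Q0(2) by simp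
  then show ?thesis using Q0(2) eq by simp
qed

text \<open>The divisor \<open>p - \<xi>\<close> on the line is cut out by a quotient of linear
  polynomials, or by the inverse of one when \<open>p\<close> is at infinity; these are norms since
  linear polynomials are.\<close>

lemma ex_norm_difference:
  assumes "p \<in> cf.const_places rat_field"
  shows "\<exists>g\<in>Fw - {0}. \<forall>q\<in>cf.const_places rat_field.
    ord_at q (E.norm g) = (if q = p then 1 else 0) - (if q = affine_place \<xi> then 1 else 0)"
proof -
  obtain g0 where g0: "g0 \<in> Fw" "g0 \<noteq> 0" "E.norm g0 = fun_of_poly [:- \<xi>, 1:]" using linear_is_norm by blast
  have lin: "ord_at q (fun_of_poly [:- a, 1:]) = (if q = affine_place a then 1 else if q = inf_place then - 1 else 0)"
    if "q \<in> cf.const_places rat_field" for q and a :: 'a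
  proof -
    have "ord_at (affine_place b) (fun_of_poly [:- a, 1:]) = (if b = a then 1 else 0)" for b
      using ord_affine_place[of "[:- a, 1:]" 1 b] order_power_n_n[of a 1] by (auto simp: order_0I)
    moreover have "ord_at inf_place (fun_of_poly [:- a, 1:]) = -1"
      using ord_inf_place[of "[:- a, 1:]" 1] by simp
    moreover have "q = inf_place \<or> (\<exists>b. q = affine_place b)" using that by (auto simp: rat_places)
    ultimately show ?thesis
      by (elim disjE exE) (simp_all only: affine_place_eq_iff inf_place_neq inf_place_neq[symmetric] if_True if_False simp_thms)
  qed
  have dq: "dvr rat_field q" if "q \<in> cf.const_places rat_field" for q
    using curve_field.cplaces[OF rat_curve_field that] by (simp add: cplace_def)
  show ?thesis
  proof (cases "p = inf_place")
    case True
    have "E.norm (inverse g0) = inverse (fun_of_poly [:- \<xi>, 1:])"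
    proof -
      have "E.norm (inverse g0) * E.norm g0 = E.norm 1"
        using E.norm_mult[OF K.inverse_mem[OF g0(1)] g0(1)] g0(2) by simp
      also have "E.norm 1 = 1" using fld_aut.aut_1[OF rot.fld_aut_funpow] unfolding E.norm_def by simp
      finally show ?thesis
        using g0(3) inverse_unique[of "fun_of_poly [:- \<xi>, 1:]" "E.norm (inverse g0)"] by (simp add: mult.commute)
    qed
    then have "ord_at q (E.norm (inverse g0)) = (if q = p then 1 else 0) - (if q = affine_place \<xi> then 1 else 0)"
      if "q \<in> cf.const_places rat_field" for q
      using dvr.ord_inverse[OF dq[OF that] fun_of_poly_rat, of "[:- \<xi>, 1:]"] lin[OF that, of \<xi>] True inf_place_neq
      by auto
    then show ?thesis using g0 K.inverse_mem by (intro bexI[of _ "inverse g0"]) auto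
  next
    case False
    then obtain a where a: "p = affine_place a" using assms by (auto simp: rat_places)
    obtain g where g: "g \<in> Fw" "g \<noteq> 0" "E.norm g = fun_of_poly [:- a, 1:]" using linear_is_norm by blast
    have "E.norm (g / g0) * E.norm g0 = E.norm g"
      using E.norm_mult[OF K.divide_mem[OF g(1) g0(1)] g0(1)] g0(2) by simp
    then have "E.norm (g / g0) = fun_of_poly [:- a, 1:] / fun_of_poly [:- \<xi>, 1:]"
      using g g0 by (simp add: field_simps)
    then have "ord_at q (E.norm (g / g0)) = (if q = p then 1 else 0) - (if q = affine_place \<xi> then 1 else 0)"
      if "q \<in> cf.const_places rat_field" for q
      using dvr.ord_divide[OF dq[OF that] fun_of_poly_rat _ fun_of_poly_rat, of "[:- a, 1:]" "[:- \<xi>, 1:]"]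
        lin[OF that, of \<xi>] lin[OF that, of a] inf_place_neq by (auto simp: a)
    then show ?thesis using g g0 K.divide_mem by (intro bexI[of _ "g / g0"]) auto
  qed
qed

text \<open>Divisors whose class lies in the image of \<open>1 - \<tau>\<close>. The preimage
  \<open>E\<close> must have degree 0, so that the passage from \<open>D\<close> to \<open>E\<close>
  can be iterated.\<close>

definition "\<H> = {D. \<exists>E\<in>carrier (Div0 w). D - R.delta 1 E \<in> principal_divisors w}"

lemma \<H>_diff: "D \<in> \<H> \<Longrightarrow> D' \<in> \<H> \<Longrightarrow> D - D' \<in> \<H>"
proof -
  assume "D \<in> \<H>" "D' \<in> \<H>"
  then obtain E E' where E: "E \<in> carrier (Div0 w)" "D - R.delta 1 E \<in> principal_divisors w"
    "E' \<in> carrier (Div0 w)" "D' - R.delta 1 E' \<in> principal_divisors w" by (auto simp: \<H>_def)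
  have "D - D' - R.delta 1 (E - E') = (D - R.delta 1 E) - (D' - R.delta 1 E')"
    by (simp only: R.delta_diff) (simp add: algebra_simps)
  then have "D - D' - R.delta 1 (E - E') \<in> principal_divisors w" using E J.H_diff by metis
  then show ?thesis using E J.G_diff unfolding \<H>_def by blast
qed

lemma \<H>_principal: "D \<in> principal_divisors w \<Longrightarrow> D \<in> \<H>"
  unfolding \<H>_def using J.G_0 by (auto simp: R.delta_def R.pact_0 intro!: bexI[of _ 0])

lemma \<H>_0: "0 \<in> \<H>" by (rule \<H>_principal) (rule J.H_0)

lemma \<H>_add: "D \<in> \<H> \<Longrightarrow> D' \<in> \<H> \<Longrightarrow> D + D' \<in> \<H>"
  using \<H>_diff[of D "- D'"] \<H>_diff[OF \<H>_0, of D'] by simp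

lemma \<H>_sum: "(\<And>i. i \<in> A \<Longrightarrow> u i \<in> \<H>) \<Longrightarrow> sum u A \<in> \<H>"
  by (induction A rule: infinite_finite_induct) (auto simp: \<H>_0 \<H>_add)

lemma \<H>_cmul: "D \<in> \<H> \<Longrightarrow> frag_cmul c D \<in> \<H>"
proof -
  assume D: "D \<in> \<H>"
  have n: "frag_cmul (int n) D \<in> \<H>" for n
    by (induction n) (auto simp: \<H>_0 \<H>_add D frag_cmul_distrib)
  then have "frag_cmul (- int n) D \<in> \<H>" for n
    using \<H>_diff[OF \<H>_0 n] by simp
  then show ?thesis using n by (cases c rule: int_cases2) auto
qed

lemma frag_of_diff_Div0: "P \<in> places w \<Longrightarrow> Q \<in> places w \<Longrightarrow> frag_of P - frag_of Q \<in> carrier (Div0 w)"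
  using keys_diff[of "frag_of P" "frag_of Q"] by (auto simp: Div0_carrier divisor_degree_diff)

text \<open>A fibre is one orbit, and along it the difference telescopes.\<close>

lemma same_fibre_\<H>:
  assumes P: "P \<in> places w" and Q: "Q \<in> places w" and eq: "down P = down Q"
  shows "frag_of P - frag_of Q \<in> \<H>"
proof -
  have "frag_of P - frag_of ((rot 1 ^^ i) ` P) \<in> \<H> \<and> (rot 1 ^^ i) ` P \<in> places w" for i
  proof (induction i)
    case 0
    then show ?case using P by (simp add: \<H>_0)
  next
    case (Suc i)
    define S where "S = (rot 1 ^^ i) ` P"
    have S: "S \<in> places w" using Suc by (simp add: S_def)
    have im: "(rot 1 ^^ Suc i) ` P = rot 1 ` S" by (simp add: S_def image_image)
    \<comment> \<open>Subtracting the fixed place \<open>Q0\<close> does not change the image under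
      \<open>1 - \<tau>\<close> but brings the degree to 0.\<close>
    have "R.delta 1 (frag_of S - frag_of Q0) = frag_of S - frag_of (rot 1 ` S)"
      using rot_Q0[of 1] by (simp add: R.delta_def R.pact_diff R.pact_frag_of)
    then have "frag_of S - frag_of (rot 1 ` S) \<in> \<H>"
      unfolding \<H>_def using frag_of_diff_Div0[OF S Q0(1)] J.H_0
      by (intro CollectI bexI[of _ "frag_of S - frag_of Q0"]) (auto simp del: One_nat_def)
    then have "(frag_of P - frag_of S) + (frag_of S - frag_of (rot 1 ` S)) \<in> \<H>"
      using Suc by (intro \<H>_add) (auto simp: S_def)
    then show ?case using R.image_place[OF S, of 1] unfolding im by simp
  qed
  moreover obtain i where "Q = (rot 1 ^^ i) ` P"
    using cyclic_ext_place.fib_transitive[OF ext_place[OF down_place[OF P]] fib_down[OF P], of Q] fib_down[OF Q] eq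
    by auto
  ultimately show ?thesis by blast
qed

text \<open>Moving every point to a chosen representative of its fibre changes \<open>D\<close> only
  by differences within fibres, and what remains is 0 because the multiplicities cancel on each
  fibre.\<close>

lemma fibre_degree_0_\<H>:
  assumes D: "Poly_Mapping.keys D \<subseteq> places w"
    and 0: "\<And>q. q \<in> cf.const_places rat_field \<Longrightarrow> (\<Sum>Q\<in>E.fib q. Poly_Mapping.lookup D Q) = 0"
  shows "D \<in> \<H>"
proof -
  define rep where "rep q = (SOME Q. Q \<in> E.fib q)" for q
  have rep: "rep q \<in> E.fib q" if "q \<in> cf.const_places rat_field" for q
    unfolding rep_def using cyclic_ext_place.fib_nonempty[OF ext_place[OF that]] by (simp add: some_in_eq)
  have z: "frag_extend (\<lambda>Q. frag_of (rep (down Q))) D = 0"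
  proof (rule poly_mapping_eqI)
    fix S
    have "Poly_Mapping.lookup (frag_extend (\<lambda>Q. frag_of (rep (down Q))) D) S
      = (\<Sum>Q\<in>Poly_Mapping.keys D. if rep (down Q) = S then Poly_Mapping.lookup D Q else 0)"
      unfolding lookup_extend by (intro sum.cong refl) auto
    also have "\<dots> = 0"
    proof (cases "\<exists>q\<in>cf.const_places rat_field. S = rep q")
      case True
      then obtain q where q: "q \<in> cf.const_places rat_field" "S = rep q" by blast
      have iff: "rep (down Q) = S \<longleftrightarrow> Q \<in> E.fib q" if "Q \<in> places w" for Q
        using rep[OF q(1)] rep[OF down_place[OF that]] fib_places(2) q(2) fib_down[OF that] by metis
      have fin: "finite (E.fib q)" by (rule cyclic_ext_place.finite_fib[OF ext_place[OF q(1)]])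
      have "(\<Sum>Q\<in>Poly_Mapping.keys D. if rep (down Q) = S then Poly_Mapping.lookup D Q else 0)
        = (\<Sum>Q\<in>Poly_Mapping.keys D \<inter> E.fib q. Poly_Mapping.lookup D Q)"
        using D iff by (subst sum.inter_restrict) (auto intro!: sum.cong)
      also have "\<dots> = (\<Sum>Q\<in>E.fib q. Poly_Mapping.lookup D Q)"
        using fin by (intro sum.mono_neutral_left) (auto simp: in_keys_iff)
      finally show ?thesis using 0[OF q(1)] by simp
    next
      case False
      then show ?thesis using D down_place by (intro sum.neutral) auto
    qed
    finally show "Poly_Mapping.lookup (frag_extend (\<lambda>Q. frag_of (rep (down Q))) D) S = Poly_Mapping.lookup 0 S" by simp
  qed
  have "D = frag_extend frag_of D" by (rule frag_expansion)
  also have "\<dots> = frag_extend frag_of D - frag_extend (\<lambda>Q. frag_of (rep (down Q))) D" using z by simp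
  also have "\<dots> = (\<Sum>Q\<in>Poly_Mapping.keys D. frag_cmul (Poly_Mapping.lookup D Q) (frag_of Q - frag_of (rep (down Q))))"
    by (simp add: frag_extend_def frag_cmul_diff sum_subtractf)
  also have "\<dots> \<in> \<H>"
  proof (intro \<H>_sum \<H>_cmul same_fibre_\<H>)
    fix Q assume "Q \<in> Poly_Mapping.keys D"
    then have Q: "Q \<in> places w" using D by auto
    show "Q \<in> places w" by fact
    show "rep (down Q) \<in> places w" "down Q = down (rep (down Q))"
      using fib_places[OF rep[OF down_place[OF Q]]] by auto
  qed
  finally show ?thesis .
qed

text \<open>Subtract the divisor of a function whose norm has divisor \<open>p - \<xi>\<close>, with
  \<open>p\<close> the point below \<open>P\<close>. By \<open>sum_fib\<close> the result has degree
  0 on every fibre.\<close>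

lemma point_difference_\<H>:
  assumes P: "P \<in> places w" shows "frag_of P - frag_of Q0 \<in> \<H>"
proof -
  obtain g where g: "g \<in> Fw" "g \<noteq> 0" and og: "\<And>q. q \<in> cf.const_places rat_field \<Longrightarrow>
    ord_at q (E.norm g) = (if q = down P then 1 else 0) - (if q = affine_place \<xi> then 1 else 0)"
    using ex_norm_difference[OF down_place[OF P]] by blast
  have dQ0: "down Q0 = affine_place \<xi>" using Q0(2) fib_places(2) by blast
  define D where "D = frag_of P - frag_of Q0 - dv g"
  have "D \<in> \<H>"
  proof (rule fibre_degree_0_\<H>)
    show "Poly_Mapping.keys D \<subseteq> places w"
    proof -
      have "Poly_Mapping.keys D \<subseteq> (Poly_Mapping.keys (frag_of P) \<union> Poly_Mapping.keys (frag_of Q0)) \<union> Poly_Mapping.keys (dv g)"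
        unfolding D_def by (intro order.trans[OF keys_diff] Un_mono order.refl keys_diff)
      then show ?thesis using P Q0(1) keys_dv[OF g] by auto
    qed
    fix q :: "'a ffun set" assume q: "q \<in> cf.const_places rat_field"
    interpret q: cyclic_ext_place Fw "rot 1" rat_field const_fun m w \<zeta> q by (rule ext_place[OF q])
    have "(\<Sum>Q\<in>E.fib q. Poly_Mapping.lookup (dv g) Q) = (\<Sum>Q\<in>E.fib q. ord_at Q g)"
      using fib_places(1) by (intro sum.cong refl) (simp add: lookup_dv[OF g])
    also have "\<dots> = ord_at q (E.norm g)" by (rule q.sum_fib[OF g])
    finally have s: "(\<Sum>Q\<in>E.fib q. Poly_Mapping.lookup (dv g) Q) = ord_at q (E.norm g)" .
    have f: "(\<Sum>Q\<in>E.fib q. Poly_Mapping.lookup (frag_of S) Q) = (if q = down S then 1 else 0)" if S: "S \<in> places w" for S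
    proof -
      have "S \<in> E.fib q \<longleftrightarrow> q = down S" using fib_down[OF S] fib_places(2)[of S q] by auto
      then show ?thesis using q.finite_fib by simp
    qed
    show "(\<Sum>Q\<in>E.fib q. Poly_Mapping.lookup D Q) = 0"
      unfolding D_def using og[OF q] s f[OF P] f[OF Q0(1)] dQ0
      by (simp add: lookup_minus sum_subtractf del: lookup_frag_of)
  qed
  moreover have "dv g \<in> \<H>" using g by (intro \<H>_principal) (auto simp: principal_eq)
  ultimately have "D + dv g \<in> \<H>" by (rule \<H>_add)
  then show ?thesis by (simp add: D_def)
qed

text \<open>In degree 0 the multiples of \<open>Q0\<close> cancel, so \<open>D\<close> is a
  combination of differences \<open>Q - Q0\<close>.\<close>

lemma Div0_\<H>:
  assumes D: "D \<in> carrier (Div0 w)" shows "D \<in> \<H>"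
proof -
  have "(\<Sum>Q\<in>Poly_Mapping.keys D. frag_cmul (Poly_Mapping.lookup D Q) (frag_of Q0)) = 0"
    using D by (intro poly_mapping_eqI)
      (auto simp: lookup_sum' Div0_carrier divisor_degree_def sum_distrib_right[symmetric])
  moreover have "D = frag_extend frag_of D" by (rule frag_expansion)
  ultimately have "D = (\<Sum>Q\<in>Poly_Mapping.keys D. frag_cmul (Poly_Mapping.lookup D Q) (frag_of Q - frag_of Q0))"
    by (simp add: frag_extend_def frag_cmul_diff sum_subtractf)
  also have "\<dots> \<in> \<H>"
    using D by (intro \<H>_sum \<H>_cmul point_difference_\<H>) (auto simp: Div0_carrier)
  finally show ?thesis .
qed

lemma iterated_delta:
  assumes "D \<in> carrier (Div0 w)"
  shows "\<exists>E\<in>carrier (Div0 w). D - (R.delta 1 ^^ k) E \<in> principal_divisors w"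
proof (induction k)
  case 0
  then show ?case using assms J.H_0 by (intro bexI[of _ D]) auto
next
  case (Suc k)
  then obtain E where E: "E \<in> carrier (Div0 w)" "D - (R.delta 1 ^^ k) E \<in> principal_divisors w" by blast
  obtain E' where E': "E' \<in> carrier (Div0 w)" "E - R.delta 1 E' \<in> principal_divisors w"
    using Div0_\<H>[OF E(1)] by (auto simp: \<H>_def)
  have df: "(R.delta 1 ^^ k) (x - y) = (R.delta 1 ^^ k) x - (R.delta 1 ^^ k) y" for x y
    by (induction k) (simp_all only: funpow.simps id_apply o_apply R.delta_diff)
  have "(R.delta 1 ^^ k) (E - R.delta 1 E') \<in> principal_divisors w"
    using E'(2) by (induction k) (simp_all only: funpow.simps id_apply o_apply R.delta_principal)
  then have "(D - (R.delta 1 ^^ k) E) + ((R.delta 1 ^^ k) E - (R.delta 1 ^^ k) (R.delta 1 E')) \<in> principal_divisors w"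
    using E unfolding df by (intro J.H_add)
  then show ?case using E'(1) by (intro bexI[of _ E']) (simp_all only: funpow_Suc_right o_apply, simp)
qed

lemma funpow_pact_period:
  assumes "D \<in> carrier (Div0 w)" shows "(R.pact 1 ^^ m) D = D"
proof -
  have fr: "(R.pact 1 ^^ i) (frag_of P) = frag_of ((rot 1 ^^ i) ` P)" for i P
    by (induction i) (simp_all only: funpow.simps id_apply o_apply R.pact_frag_of image_image image_ident)
  have add: "(R.pact 1 ^^ i) (x + y) = (R.pact 1 ^^ i) x + (R.pact 1 ^^ i) y" for i x y
    by (induction i) (simp_all only: funpow.simps id_apply o_apply R.pact_add)
  have cm: "(R.pact 1 ^^ i) (frag_cmul c x) = frag_cmul c ((R.pact 1 ^^ i) x)" for i c x
    by (induction i) (simp_all only: funpow.simps id_apply o_apply R.pact_cmul)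
  have z: "(R.pact 1 ^^ i) 0 = 0" for i using cm[of i 0 0] by simp
  have s: "(R.pact 1 ^^ i) (sum u A) = (\<Sum>j\<in>A. (R.pact 1 ^^ i) (u j))" for i A and u :: "'a ffun set \<Rightarrow> _"
    by (induction A rule: infinite_finite_induct) (simp_all add: z add del: One_nat_def)
  have "D = frag_extend frag_of D" by (rule frag_expansion)
  then have D: "D = (\<Sum>P\<in>Poly_Mapping.keys D. frag_cmul (Poly_Mapping.lookup D P) (frag_of P))"
    by (simp add: frag_extend_def)
  have im: "(rot 1 ^^ m) ` P = P" if P: "P \<in> places w" for P
    using R.place_sub[OF P] E.period by (force simp: image_iff)
  have "(R.pact 1 ^^ m) D = (\<Sum>P\<in>Poly_Mapping.keys D. frag_cmul (Poly_Mapping.lookup D P) (frag_of ((rot 1 ^^ m) ` P)))"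
    by (subst D) (simp only: s cm fr)
  also have "\<dots> = (\<Sum>P\<in>Poly_Mapping.keys D. frag_cmul (Poly_Mapping.lookup D P) (frag_of P))"
    using assms im by (intro sum.cong refl) (auto simp: Div0_carrier)
  finally show ?thesis using D by simp
qed

theorem Jac_divisible:
  assumes l: "prime l" and m: "m = l ^ s" and U: "U \<in> carrier (Jac w)"
  shows "\<exists>V\<in>carrier (Jac w). V [^]\<^bsub>Jac w\<^esub> l = U"
proof -
  obtain D where D: "D \<in> carrier (Div0 w)" "U = cl D" using U by (auto simp: Jac_carrier)
  obtain E where E: "E \<in> carrier (Div0 w)" "D - (R.delta 1 ^^ m) E \<in> principal_divisors w"
    using iterated_delta[OF D(1)] by blast
  \<comment> \<open>Coefficients of \<open>(1 - \<tau>) ^ m\<close> after reduction by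
    \<open>\<tau> ^ m = 1\<close>: the top term \<open>(- 1) ^ m\<close> joins the constant
    term.\<close>
  define c where "c i = (if i = 0 then 1 + (- 1) ^ m else (- 1) ^ i * int (m choose i))" for i
  have dv: "int l dvd c i" if "i < m" for i
  proof (cases "i = 0")
    case True
    show ?thesis
    proof (cases "odd m")
      case False
      \<comment> \<open>The coefficient \<open>1 + (- 1) ^ m\<close> is 0 for odd \<open>m\<close>;
        for even \<open>m\<close> it is 2, and then \<open>l = 2\<close>.\<close>
      then have "even l" by (simp add: m)
      then have "l = 2" using l primes_dvd_imp_eq[of 2 l] two_is_prime_nat by simp
      then show ?thesis using True False by (simp add: c_def)
    qed (use True in \<open>simp add: c_def\<close>)
  next
    case False
    then have "l dvd (m choose i)" using prime_dvd_choose_prime_power[OF l] that m by simp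
    then have "int l dvd int (m choose i)" by simp
    then show ?thesis using False by (simp add: c_def)
  qed
  define u where "u i = (R.pact 1 ^^ i) E" for i
  have "(R.delta 1 ^^ m) E = (\<Sum>i\<le>m. frag_cmul ((- 1) ^ i * int (m choose i)) (u i))"
    unfolding u_def by (rule R.funpow_delta)
  also have "\<dots> = (\<Sum>i<m. frag_cmul ((- 1) ^ i * int (m choose i)) (u i)) + frag_cmul ((- 1) ^ m) E"
    using funpow_pact_period[OF E(1)] by (simp add: lessThan_Suc_atMost[symmetric] u_def)
  also have "\<dots> = (\<Sum>i<m. frag_cmul (c i) (u i))"
  proof -
    have "frag_cmul (c 0) (u 0) = E + frag_cmul ((- 1) ^ m) E"
      by (simp add: c_def u_def frag_cmul_distrib)
    moreover have "(\<Sum>i\<in>{..<m} - {0}. frag_cmul (c i) (u i)) = (\<Sum>i\<in>{..<m} - {0}. frag_cmul ((- 1) ^ i * int (m choose i)) (u i))"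
      by (intro sum.cong refl) (simp add: c_def)
    ultimately show ?thesis
      using m_pos by (simp add: sum.remove[of "{..<m}" 0] u_def)
  qed
  also have "\<dots> = (\<Sum>i<m. frag_cmul (int l) (frag_cmul (c i div int l) (u i)))"
    using dv by (intro sum.cong refl) simp
  also have "\<dots> = frag_cmul (int l) (\<Sum>i<m. frag_cmul (c i div int l) (u i))"
    by (simp add: frag_cmul_sum)
  finally have eq: "(R.delta 1 ^^ m) E = frag_cmul (int l) (\<Sum>i<m. frag_cmul (c i div int l) (u i))" .
  define V where "V = (\<Sum>i<m. frag_cmul (c i div int l) (u i))"
  have uD: "u i \<in> carrier (Div0 w)" for i unfolding u_def by (rule R.funpow_pact_Div0[OF E(1)])
  have cD: "frag_cmul b x \<in> carrier (Div0 w)" if "x \<in> carrier (Div0 w)" for b x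
    using that keys_cmul[of b x] by (auto simp: Div0_carrier divisor_degree_cmul)
  have V: "V \<in> carrier (Div0 w)" unfolding V_def by (intro J.G_sum cD uD)
  have "cl V [^]\<^bsub>Jac w\<^esub> l = cl D"
    unfolding Jac_pow[OF V] cl_eq_iff using J.H_uminus[OF E(2)] unfolding eq V_def by simp
  then show ?thesis using V D by (intro bexI[of _ "cl V"]) (auto simp: Jac_carrier)
qed

end

section \<open>Pullback and Galois action\<close>

lemma galD:
  assumes "\<sigma> \<in> gal k"
  shows "bij \<sigma>" "\<sigma> (a + b) = \<sigma> a + \<sigma> b" "\<sigma> (a * b) = \<sigma> a * \<sigma> b" "\<sigma> 0 = 0" "\<sigma> 1 = 1"
    "a \<in> k \<Longrightarrow> \<sigma> a = a"
proof -
  show b: "bij \<sigma>" and add: "\<sigma> (a + b) = \<sigma> a + \<sigma> b" for a b using assms by (auto simp: gal_def)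
  show m: "\<sigma> (a * b) = \<sigma> a * \<sigma> b" for a b using assms by (auto simp: gal_def)
  show "a \<in> k \<Longrightarrow> \<sigma> a = a" using assms by (auto simp: gal_def)
  show z: "\<sigma> 0 = 0" using add[of 0 0] by (metis add_0 add_right_cancel)
  obtain c where "\<sigma> c = 1" using b by (metis bij_pointE)
  then show "\<sigma> 1 = 1" using m[of c 1] by simp
qed

lemma gal_inv: "\<sigma> \<in> gal k \<Longrightarrow> inv_into UNIV \<sigma> \<in> gal k"
proof -
  assume s: "\<sigma> \<in> gal k"
  note g = galD[OF s]
  have i: "inv_into UNIV \<sigma> (\<sigma> a) = a" "\<sigma> (inv_into UNIV \<sigma> a) = a" for a
    using g(1) by (auto simp: bij_is_inj bij_is_surj surj_f_inv_f)
  have "inv_into UNIV \<sigma> (a + b) = inv_into UNIV \<sigma> a + inv_into UNIV \<sigma> b" "inv_into UNIV \<sigma> (a * b) = inv_into UNIV \<sigma> a * inv_into UNIV \<sigma> b" for a b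
    using g(2,3)[of "inv_into UNIV \<sigma> a" "inv_into UNIV \<sigma> b"] i by metis+
  moreover have "inv_into UNIV \<sigma> a = a" if "a \<in> k" for a using g(6)[OF that] i by metis
  ultimately show ?thesis using g(1) by (auto simp: gal_def bij_imp_bij_inv)
qed

lemma gal_comp: "\<sigma> \<in> gal k \<Longrightarrow> \<tau> \<in> gal k \<Longrightarrow> \<sigma> \<circ> \<tau> \<in> gal k"
  by (auto simp: gal_def bij_comp)

lemma gal_id: "id \<in> gal k"
  by (auto simp: gal_def)

text \<open>\<open>X ^ d - 1\<close> has at most \<open>d\<close> roots, and the first
  \<open>d\<close> powers of \<open>u\<close> are distinct ones.\<close>

lemma roots_of_unity_powers:
  fixes u c :: "'a::field"
  assumes "0 < d" "u ^ d = 1" "\<And>i. 0 < i \<Longrightarrow> i < d \<Longrightarrow> u ^ i \<noteq> 1" "c ^ d = 1"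
  shows "\<exists>i<d. c = u ^ i"
proof -
  define p where "p = monom 1 d - [:1::'a:]"
  have pz: "{x. poly p x = 0} = {x. x ^ d = 1}" by (simp add: p_def poly_monom)
  have "coeff p d = 1" using assms(1) by (cases d) (auto simp: p_def)
  then have p0: "p \<noteq> 0" by auto
  have "degree p \<le> d" unfolding p_def by (intro degree_diff_le) (auto intro: degree_monom_le)
  then have card: "card {x::'a. x ^ d = 1} \<le> d" using card_poly_roots_bound[OF p0] pz by simp
  have fin: "finite {x::'a. x ^ d = 1}" using poly_roots_finite[OF p0] pz by simp
  have u0: "u \<noteq> 0" using assms(1,2) by (auto simp: power_0_left)
  have "inj_on (\<lambda>i. u ^ i) {..<d}"
  proof (rule linorder_inj_onI)
    fix i k assume ik: "i < k" "i \<in> {..<d}" "k \<in> {..<d}"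
    then have "u ^ k = u ^ i * u ^ (k - i)" by (simp flip: power_add)
    then show "u ^ i \<noteq> u ^ k" using assms(3)[of "k - i"] ik u0 by auto
  qed auto
  then have "card ((\<lambda>i. u ^ i) ` {..<d}) = d" by (simp add: card_image)
  moreover have sub: "(\<lambda>i. u ^ i) ` {..<d} \<subseteq> {x. x ^ d = 1}"
    using assms(2) by (auto simp: power_commutes simp flip: power_mult) (metis mult.commute power_mult power_one)
  ultimately have "(\<lambda>i. u ^ i) ` {..<d} = {x. x ^ d = 1}"
    using card fin by (intro card_seteq) auto
  then show ?thesis using assms(4) by blast
qed

context superelliptic
begin

text \<open>Lower levels are instances of the same locale at the same \<xi>, so results for
  \<open>w\<close> apply to \<open>w ^ d\<close> as well.\<close>

lemma tower_step:
  assumes "m = j * d" shows "superelliptic j f (w ^ d) \<xi> (\<zeta> ^ d)"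
proof
  show "0 < j" "f \<noteq> 0" using m_pos assms f_nz by auto
  show "(w ^ d) ^ j = fun_of_poly f" using w_power assms by (simp add: mult.commute flip: power_mult)
  show "coprime (order \<xi> f) j" using coprime_order assms by simp
  show "(\<zeta> ^ d) ^ j = 1" using \<zeta>_power assms by (simp add: mult.commute flip: power_mult)
  show "(\<zeta> ^ d) ^ i \<noteq> 1" if "0 < i" "i < j" for i
    using \<zeta>_order[of "d * i"] that assms m_pos by (simp add: mult.commute flip: power_mult)
qed

context
  fixes j d assumes jd: "m = j * d"
begin

interpretation V: superelliptic j f "w ^ d" \<xi> "\<zeta> ^ d" by (rule tower_step[OF jd])

interpretation T: cyclic_ext Fw "rot j" V.Fw const_fun d w "\<zeta> ^ j" by (rule cyclic_ext[OF jd])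

lemma d_pos: "0 < d" using jd m_pos by simp

lemma V_sub: "V.Fw \<subseteq> Fw" by (rule T.F_sub)

lemma ext_place': "P \<in> places (w ^ d) \<Longrightarrow> cyclic_ext_place Fw (rot j) V.Fw const_fun d w (\<zeta> ^ j) P"
  using V.place_cplace T.cyclic_ext_axioms by (simp add: cyclic_ext_place_def)

lemma fibre_eq: "fibre (w ^ d) w P = T.fib P"
  by (simp add: fibre_def T.fib_def places_eq)

lemma restrict_place: "Q \<in> places w \<Longrightarrow> Q \<inter> V.Fw \<in> places (w ^ d)"
  and in_fib: "Q \<in> places w \<Longrightarrow> Q \<in> T.fib (Q \<inter> V.Fw)"
  using T.inter_const_place by (auto simp: places_eq T.fib_def)

lemma fib_in: "Q \<in> T.fib P \<Longrightarrow> Q \<in> places w" "Q \<in> T.fib P \<Longrightarrow> Q \<inter> V.Fw = P"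
  by (auto simp: T.fib_def places_eq)

abbreviation "pullback \<equiv> div_pullback (w ^ d) w"

lemma lookup_pullback:
  assumes D: "Poly_Mapping.keys D \<subseteq> places (w ^ d)" and Q: "Q \<in> places w"
  shows "Poly_Mapping.lookup (pullback D) Q = ramification (Q \<inter> V.Fw) Q * Poly_Mapping.lookup D (Q \<inter> V.Fw)"
proof -
  have *: "Poly_Mapping.lookup (\<Sum>Q'\<in>T.fib P. frag_cmul (ramification P Q') (frag_of Q')) Q
      = (if P = Q \<inter> V.Fw then ramification P Q else 0)" if P: "P \<in> places (w ^ d)" for P
  proof -
    have fin: "finite (T.fib P)" by (rule cyclic_ext_place.finite_fib[OF ext_place'[OF P]])
    have "Q \<in> T.fib P \<longleftrightarrow> P = Q \<inter> V.Fw" using in_fib[OF Q] fib_in by blast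
    then show ?thesis using fin by (simp add: lookup_sum' if_distrib cong: if_cong)
  qed
  have "Poly_Mapping.lookup (pullback D) Q
      = (\<Sum>P\<in>Poly_Mapping.keys D. Poly_Mapping.lookup D P * (if P = Q \<inter> V.Fw then ramification P Q else 0))"
    unfolding div_pullback_def lookup_extend fibre_eq ram_index_eq_ramification
  proof (rule sum.cong[OF refl])
    fix P assume "P \<in> Poly_Mapping.keys D"
    then have "P \<in> places (w ^ d)" using D by blast
    then show "Poly_Mapping.lookup D P * Poly_Mapping.lookup (\<Sum>Q'\<in>T.fib P. frag_cmul (ramification P Q') (frag_of Q')) Q
        = Poly_Mapping.lookup D P * (if P = Q \<inter> V.Fw then ramification P Q else 0)"
      by (simp only: *)
  qed
  also have "\<dots> = ramification (Q \<inter> V.Fw) Q * Poly_Mapping.lookup D (Q \<inter> V.Fw)"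
    by (auto simp: in_keys_iff if_distrib cong: if_cong)
  finally show ?thesis .
qed

lemma keys_pullback: "Poly_Mapping.keys (pullback D) \<subseteq> places w"
proof
  fix Q assume "Q \<in> Poly_Mapping.keys (pullback D)"
  then have "(\<Sum>P\<in>Poly_Mapping.keys D. Poly_Mapping.lookup D P *
    Poly_Mapping.lookup (\<Sum>Q'\<in>T.fib P. frag_cmul (ramification P Q') (frag_of Q')) Q) \<noteq> 0"
    by (simp add: in_keys_iff div_pullback_def lookup_extend fibre_eq ram_index_eq_ramification)
  then obtain P where "Poly_Mapping.lookup (\<Sum>Q'\<in>T.fib P. frag_cmul (ramification P Q') (frag_of Q')) Q \<noteq> 0"
    by (metis (no_types, lifting) mult_zero_right sum.not_neutral_contains_not_neutral)
  then obtain Q' where "Q' \<in> T.fib P" "Poly_Mapping.lookup (frag_cmul (ramification P Q') (frag_of Q')) Q \<noteq> 0"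
    unfolding lookup_sum' by (metis (no_types, lifting) sum.not_neutral_contains_not_neutral)
  then show "Q \<in> places w" using fib_in(1) by (auto split: if_splits)
qed

lemma degree_pullback:
  assumes D: "Poly_Mapping.keys D \<subseteq> places (w ^ d)"
  shows "divisor_degree (pullback D) = int d * divisor_degree D"
proof -
  have "divisor_degree (\<Sum>Q\<in>T.fib P. frag_cmul (ramification P Q) (frag_of Q)) = int d" if "P \<in> places (w ^ d)" for P
    using cyclic_ext_place.sum_ramification[OF ext_place'[OF that]]
    by (simp add: divisor_degree_frag_sum divisor_degree_cmul)
  then have "divisor_degree (pullback D) = (\<Sum>P\<in>Poly_Mapping.keys D. Poly_Mapping.lookup D P * int d)"
    unfolding div_pullback_def divisor_degree_extend fibre_eq ram_index_eq_ramification
    using D by (intro sum.cong refl) auto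
  then show ?thesis by (simp add: divisor_degree_def sum_distrib_left mult.commute)
qed

lemma pullback_add: "pullback (D + E) = pullback D + pullback E"
  and pullback_diff: "pullback (D - E) = pullback D - pullback E"
  by (simp_all add: div_pullback_def frag_extend_add frag_extend_diff)

lemma pullback_dv:
  assumes h: "h \<in> V.Fw" "h \<noteq> 0" shows "pullback (V.dv h) = dv h"
proof (rule dv_eqI)
  show hw: "h \<in> Fw" "h \<noteq> 0" using h V_sub by auto
  show "Poly_Mapping.keys (pullback (V.dv h)) \<subseteq> places w" by (rule keys_pullback)
  fix Q assume Q: "Q \<in> places w"
  have k: "Poly_Mapping.keys (V.dv h) \<subseteq> places (w ^ d)" using V.keys_dv[OF h] by auto
  show "Poly_Mapping.lookup (pullback (V.dv h)) Q = ord_at Q h"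
    unfolding lookup_pullback[OF k Q] V.lookup_dv[OF h]
    using cyclic_ext_place.ramification_ord[OF ext_place'[OF restrict_place[OF Q]] in_fib[OF Q] h]
      restrict_place[OF Q] by simp
qed

lemma pullback_Div0: "D \<in> carrier (Div0 (w ^ d)) \<Longrightarrow> pullback D \<in> carrier (Div0 w)"
  by (simp add: Div0_carrier V.Div0_carrier keys_pullback degree_pullback)

lemma Jac_pullback_cl:
  assumes "D \<in> carrier (Div0 (w ^ d))"
  shows "Jac_pullback (w ^ d) w (V.cl D) = cl (pullback D)"
proof -
  have "cl (pullback D') = cl (pullback D)" if "D' \<in> V.cl D" for D'
  proof -
    obtain h where h: "h \<in> V.Fw" "h \<noteq> 0" "D' = V.dv h + D"
      using \<open>D' \<in> V.cl D\<close> by (auto simp: V.cl_coset V.principal_eq)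
    then have "pullback D' - pullback D = dv h" by (simp add: pullback_add pullback_dv)
    then show ?thesis unfolding cl_eq_iff using h V_sub by (auto simp: principal_eq)
  qed
  moreover have "D \<in> V.cl D" using V.J.H_0 by (auto simp: V.cl_coset intro!: image_eqI[of _ _ 0])
  ultimately show ?thesis unfolding Jac_pullback_def by blast
qed

lemma pullback_principal:
  assumes D: "D \<in> carrier (Div0 (w ^ d))" and pr: "pullback D \<in> principal_divisors w"
  shows "D \<in> principal_divisors (w ^ d)"
proof -
  obtain g where g: "g \<in> Fw" "g \<noteq> 0" "pullback D = dv g" using pr by (auto simp: principal_eq)
  have kD: "Poly_Mapping.keys D \<subseteq> places (w ^ d)" using D by (simp add: V.Div0_carrier)
  \<comment> \<open>A pulled-back divisor is invariant under deck transformations of the covering,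
    so \<open>rot j g / g\<close> will have trivial divisor and be constant.\<close>
  have "dv (rot j g) = dv g"
  proof (rule dv_eqI[OF g(1,2), symmetric, THEN sym])
    have rg: "rot j g \<in> Fw" "rot j g \<noteq> 0" using g rot.aut_mem rot.aut_eq_0_iff by auto
    show "Poly_Mapping.keys (dv (rot j g)) \<subseteq> places w" using keys_dv[OF rg] by auto
    fix Q assume "Q \<in> places w"
    then obtain R where R: "R \<in> places w" "Q = rot j ` R" using R.surj_image[of Q j] by blast
    have "Poly_Mapping.lookup (dv (rot j g)) Q = ord_at R g"
      using R rg g R.image_place R.ord_image by (simp add: lookup_dv)
    also have "\<dots> = Poly_Mapping.lookup (pullback D) R" using g R by (simp add: lookup_dv)
    also have "\<dots> = Poly_Mapping.lookup (pullback D) Q"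
    proof -
      have "Q \<inter> V.Fw = R \<inter> V.Fw" using T.image_inter_F[OF R.place_sub[OF R(1)], of 1] R(2) by simp
      moreover have "ramification (R \<inter> V.Fw) Q = ramification (R \<inter> V.Fw) R"
        using cyclic_ext_place.ramification_image[OF ext_place'[OF restrict_place[OF R(1)]] in_fib[OF R(1)], of 1] R(2)
        by simp
      ultimately show ?thesis using R R.image_place kD by (simp add: lookup_pullback)
    qed
    also have "\<dots> = ord_at Q g" using g R R.image_place by (simp add: lookup_dv)
    finally show "Poly_Mapping.lookup (dv (rot j g)) Q = ord_at Q g" .
  qed
  then have "dv (rot j g / g) = 0" using g rot.aut_mem rot.aut_eq_0_iff by (subst dv_divide) auto
  then obtain c where c: "rot j g / g = const_fun c"
    using dv_eq_0[of "rot j g / g"] g rot.aut_mem rot.aut_eq_0_iff by (auto simp: K.divide_mem)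
  then have rg: "rot j g = const_fun c * g" using g by (simp add: field_simps)
  have "(rot j ^^ i) g = const_fun (c ^ i) * g" for i
  proof (induction i)
    case (Suc i)
    then show ?case using g rg
      by (simp add: rot.aut_mult fun_of_poly_in rot_fun_of_poly) (simp add: cf.\<kappa>_mult mult_ac)
  qed (simp add: cf.\<kappa>_1)
  then have "const_fun (c ^ d) * g = g" using T.period[OF g(1)] by simp
  then have "c ^ d = 1" using g cf.\<kappa>_1 cf.\<kappa>_inj by (metis mult_cancel_right2)
  moreover have "(\<zeta> ^ j) ^ d = 1" using \<zeta>_power jd by (simp flip: power_mult)
  ultimately obtain i where i: "i < d" "c = (\<zeta> ^ j) ^ i"
    using roots_of_unity_powers[of d "\<zeta> ^ j" c] d_pos T.z_order by blast
  \<comment> \<open>\<open>w ^ i\<close> has the same eigenvalue as \<open>g\<close>, so the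
    quotient descends to the lower field.\<close>
  define h where "h = g / w ^ i"
  have h: "h \<in> Fw" "h \<noteq> 0" using g w_nz by (auto simp: h_def K.divide_mem K.power_mem w_in)
  have "rot j h = h"
    using g w_nz zeta_nz unfolding h_def
    by (simp add: rot.aut_divide rot.aut_power K.power_mem w_in rg rot_w i(2) power_mult_distrib cf.\<kappa>_power[symmetric] cf.\<kappa>_eq_0_iff)
  then have hV: "h \<in> V.Fw" using T.fixed[OF h(1)] by simp
  interpret Q0: dvr Fw Q0 by (rule place_dvr[OF Q0(1)])
  interpret T0: cyclic_ext_place Fw "rot j" V.Fw const_fun d w "\<zeta> ^ j" "Q0 \<inter> V.Fw"
    by (rule ext_place'[OF restrict_place[OF Q0(1)]])
  \<comment> \<open>\<open>Q0\<close> is alone in its fibre over the line, hence also over the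
    intermediate curve, and so totally ramified there.\<close>
  have "T.fib (Q0 \<inter> V.Fw) = {Q0}"
  proof -
    have "Q = Q0" if Q: "Q \<in> T.fib (Q0 \<inter> V.Fw)" for Q
    proof -
      have "down Q = Q \<inter> V.Fw \<inter> rat_field" "down Q0 = Q0 \<inter> V.Fw \<inter> rat_field"
        using rat_field_sub[of "w ^ d"] by auto
      then have "down Q = down Q0" using fib_in(2)[OF Q] by metis
      moreover have "down Q0 = affine_place \<xi>" using Q0(2) fib_places(2) by blast
      ultimately have "down Q = affine_place \<xi>" by simp
      then show ?thesis using fib_down[OF fib_in(1)[OF Q]] Q0(2) by simp
    qed
    then show ?thesis using in_fib[OF Q0(1)] by blast
  qed
  then have e: "ramification (Q0 \<inter> V.Fw) Q0 = int d"
    using T0.fundamental_identity[OF in_fib[OF Q0(1)]] by simp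
  have "int m * ord_at Q0 w = int m * int (order \<xi> f)"
  proof -
    have "int m * ord_at Q0 w = ord_at Q0 (fun_of_poly f)"
      using Q0.ord_power[OF w_in w_nz, of m] w_power by simp
    also have "\<dots> = int m * int (order \<xi> f)"
      using cyclic_ext_place.ramification_ord[OF ext_place[of "affine_place \<xi>"], of Q0 "fun_of_poly f"]
        Q0 ord_affine_place[of f 1 \<xi>] f_nz fun_of_poly_rat[of f] by (simp add: rat_places)
    finally show ?thesis .
  qed
  then have ow: "ord_at Q0 w = int (order \<xi> f)" using m_pos by simp
  have "ord_at Q0 g = int d * Poly_Mapping.lookup D (Q0 \<inter> V.Fw)"
    using lookup_pullback[OF kD Q0(1)] lookup_dv[OF g(1,2), of Q0] g(3) Q0(1) e by simp
  moreover have "ord_at Q0 h = int d * ord_at (Q0 \<inter> V.Fw) h"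
    using T0.ramification_ord[OF in_fib[OF Q0(1)] hV h(2)] e by simp
  moreover have "ord_at Q0 h = ord_at Q0 g - int i * int (order \<xi> f)"
    unfolding h_def using g w_nz by (simp add: Q0.ord_divide Q0.ord_power K.power_mem w_in ow)
  \<comment> \<open>At \<open>Q0\<close> the orders of \<open>g\<close> and \<open>h\<close> are
    both multiples of \<open>d\<close>, one as a pulled-back multiplicity, the other through
    ramification. Hence so is the order of \<open>w ^ i\<close>, which is \<open>i\<close> times the
    order of \<open>f\<close> at \<xi>.\<close>
  ultimately have "int (order \<xi> f) * int i = int d * (Poly_Mapping.lookup D (Q0 \<inter> V.Fw) - ord_at (Q0 \<inter> V.Fw) h)"
    by (simp add: algebra_simps)
  then have "int d dvd int (order \<xi> f * i)" by simp
  then have "d dvd order \<xi> f * i" by (simp only: of_nat_dvd_iff)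
  moreover have "coprime d (order \<xi> f)" using coprime_order jd by (simp add: coprime_commute)
  ultimately have "d dvd i" by (simp add: coprime_dvd_mult_right_iff)
  then have "i = 0" using i(1) by (auto dest: dvd_imp_le)
  then have gV: "g \<in> V.Fw" using hV by (simp add: h_def)
  have "D = V.dv g"
  proof (rule V.dv_eqI[OF gV g(2) _ kD])
    fix P assume P: "P \<in> places (w ^ d)"
    interpret P: cyclic_ext_place Fw "rot j" V.Fw const_fun d w "\<zeta> ^ j" P by (rule ext_place'[OF P])
    obtain Q where Q: "Q \<in> T.fib P" using P.fib_nonempty by auto
    have "ramification P Q * Poly_Mapping.lookup D P = ramification P Q * ord_at P g"
      using lookup_pullback[OF kD fib_in(1)[OF Q]] P.ramification_ord[OF Q gV g(2)] fib_in[OF Q]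
        lookup_dv[OF g(1,2), of Q] g(3) by auto
    then show "Poly_Mapping.lookup D P = ord_at P g" using P.ramification_pos[OF Q] by simp
  qed
  then show ?thesis using gV g(2) by (auto simp: V.principal_eq)
qed

text \<open>Two maps occur because \<open>fun_act w\<close> and \<open>fun_act (w ^ d)\<close> need
  only agree on the lower field. Transport by an automorphism preserves ramification indices, which
  gives the equality coefficient by coefficient.\<close>

lemma pullback_pact:
  assumes \<alpha>: "curve_aut w \<alpha>" and \<alpha>': "curve_aut (w ^ d) \<alpha>'"
    and eq: "\<And>g. g \<in> V.Fw \<Longrightarrow> \<alpha> g = \<alpha>' g" and D: "Poly_Mapping.keys D \<subseteq> places (w ^ d)"
  shows "pullback (curve_aut.pact \<alpha>' D) = curve_aut.pact \<alpha> (pullback D)"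
proof -
  interpret A: curve_aut w \<alpha> by fact
  interpret B: curve_aut "w ^ d" \<alpha>' by fact
  show ?thesis
  proof (rule poly_mapping_eqI)
    fix Q
    show "Poly_Mapping.lookup (pullback (B.pact D)) Q = Poly_Mapping.lookup (A.pact (pullback D)) Q"
    proof (cases "Q \<in> places w")
      case False
      then have "Q \<notin> Poly_Mapping.keys (pullback (B.pact D))" "Q \<notin> Poly_Mapping.keys (A.pact (pullback D))"
        using keys_pullback A.keys_pact[OF keys_pullback] by blast+
      then show ?thesis by (simp add: in_keys_iff)
    next
      case True
      then obtain R where R: "R \<in> places w" "Q = \<alpha> ` R" using A.surj_image by blast
      define P where "P = R \<inter> V.Fw"
      have P: "P \<in> places (w ^ d)" using restrict_place[OF R(1)] by (simp add: P_def)
      have QP: "Q \<inter> V.Fw = \<alpha>' ` P"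
      proof -
        have "\<alpha> ` R \<inter> \<alpha>' ` V.Fw = \<alpha> ` R \<inter> \<alpha> ` V.Fw" using eq by (simp cong: image_cong)
        also have "\<dots> = \<alpha> ` (R \<inter> V.Fw)"
          by (rule inj_on_image_Int[OF A.\<alpha>.inj_aut A.place_sub[OF R(1)] V_sub, symmetric])
        also have "\<dots> = \<alpha>' ` P" unfolding P_def using eq by (intro image_cong) auto
        finally show ?thesis using B.\<alpha>.aut_image R(2) by simp
      qed
      have P': "\<alpha>' ` P \<in> places (w ^ d)" by (rule B.image_place[OF P])
      have Rf: "R \<in> T.fib P" using in_fib[OF R(1)] by (simp add: P_def)
      have Qf: "Q \<in> T.fib (\<alpha>' ` P)" using in_fib[OF True] by (simp add: QP)
      interpret P: dvr V.Fw P by (rule V.place_dvr[OF P])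
      obtain t where t: "t \<in> V.Fw" "t \<noteq> 0" "ord_at P t = 1" using P.ex_uniformizer by auto
      have "ramification (\<alpha>' ` P) Q = ord_at Q (\<alpha>' t)"
        using cyclic_ext_place.ramification_ord[OF ext_place'[OF P'] Qf, of "\<alpha>' t"] t B.ord_image[OF P t(1,2)]
        by (simp add: B.\<alpha>.aut_mem B.\<alpha>.aut_eq_0_iff)
      also have "\<dots> = ord_at R t" using A.ord_image[OF R(1), of t] t V_sub eq R(2) by auto
      also have "\<dots> = ramification P R"
        using cyclic_ext_place.ramification_ord[OF ext_place'[OF P] Rf t(1,2)] t by simp
      finally have r: "ramification (\<alpha>' ` P) Q = ramification P R" .
      have "Poly_Mapping.lookup (pullback (B.pact D)) Q = ramification P R * Poly_Mapping.lookup D P"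
        unfolding lookup_pullback[OF B.keys_pact[OF D] True] QP r B.lookup_pact[OF D P] ..
      also have "\<dots> = Poly_Mapping.lookup (A.pact (pullback D)) Q"
        unfolding R(2) A.lookup_pact[OF keys_pullback R(1)] lookup_pullback[OF D R(1)] by (simp add: P_def)
      finally show ?thesis .
    qed
  qed
qed

end

section \<open>Galois automorphisms acting on the function field\<close>

context
  fixes k :: "'a set"
  assumes f_k: "\<And>i. coeff f i \<in> k"
begin

abbreviation "gmap \<sigma> \<equiv> map_poly (map_poly (\<sigma> :: 'a \<Rightarrow> 'a))"

text \<open>Since \<open>f\<close> is defined over \<open>k\<close>, conjugating coefficients fixes
  \<open>rel\<close>; the inverse automorphism supplies \<Psi>.\<close>

lemma fun_endo_gal:
  assumes \<sigma>: "\<sigma> \<in> gal k" shows "fun_endo w (gmap \<sigma>)"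
proof (rule fun_endoI[where \<Psi> = "gmap (inv_into UNIV \<sigma>)"])
  note g = galD[OF \<sigma>] and i = galD[OF gal_inv[OF \<sigma>]]
  have h: "map_poly \<tau> (p + q) = map_poly \<tau> p + map_poly \<tau> q" "map_poly \<tau> (p * q) = map_poly \<tau> p * map_poly \<tau> q"
    if "\<tau> \<in> gal k" for \<tau> p q by (rule map_poly_hom; use galD[OF that] in simp)+
  show "gmap \<sigma> (P + Q) = gmap \<sigma> P + gmap \<sigma> Q" "gmap \<sigma> (P * Q) = gmap \<sigma> P * gmap \<sigma> Q"
    "gmap (inv_into UNIV \<sigma>) (P * Q) = gmap (inv_into UNIV \<sigma>) P * gmap (inv_into UNIV \<sigma>) Q" for P Q
    by (rule map_poly_hom; use h[OF \<sigma>] h[OF gal_inv[OF \<sigma>]] in simp)+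
  have fx: "map_poly \<tau> f = f" if "\<tau> \<in> gal k" for \<tau>
    using galD[OF that] f_k by (intro poly_eqI) (simp add: coeff_map_poly)
  have "gmap \<tau> rel = rel" if t: "\<tau> \<in> gal k" for \<tau>
  proof (rule poly_eqI)
    fix i
    have m1: "map_poly \<tau> 1 = 1" using galD[OF t] by (simp add: map_poly_1')
    have "coeff (gmap \<tau> rel) i = map_poly \<tau> (coeff rel i)" by (simp add: coeff_map_poly)
    also have "\<dots> = coeff rel i"
      using m_pos m1 fx[OF t] galD[OF t]
      by (cases "i = 0"; cases "i = m")
        (auto simp: rel_def coeff_pCons simp del: map_poly_1' split: nat.splits,
         (metis (no_types, lifting) fx[OF t] map_poly_hom(1) add.right_inverse map_poly_0 eq_neg_iff_add_eq_0 add.commute))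
    finally show "coeff (gmap \<tau> rel) i = coeff rel i" .
  qed
  then show "gmap \<sigma> rel = rel" "gmap (inv_into UNIV \<sigma>) rel = rel" using \<sigma> gal_inv by auto
  have "\<sigma> (inv_into UNIV \<sigma> x) = x" "inv_into UNIV \<sigma> (\<sigma> x) = x" for x
    using g(1) by (auto simp: bij_is_inj bij_is_surj surj_f_inv_f)
  then show "gmap \<sigma> (gmap (inv_into UNIV \<sigma>) P) = P" "gmap (inv_into UNIV \<sigma>) (gmap \<sigma> P) = P" for P
    using g i by (auto simp: poly_eq_iff coeff_map_poly)
qed

lemma fun_act_eval:
  assumes "\<sigma> \<in> gal k" shows "fun_act w \<sigma> (eval_xw w P) = eval_xw w (gmap \<sigma> P)"
  unfolding fun_act_eq by (rule fun_endo.fun_map_eval'[OF fun_endo_gal[OF assms]])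

lemma fun_act_fun_of_poly:
  assumes "\<sigma> \<in> gal k" shows "fun_act w \<sigma> (fun_of_poly p) = fun_of_poly (map_poly \<sigma> p)"
  using fun_act_eval[OF assms, of "[:p:]"] galD[OF assms] by (simp add: map_poly_pCons)

lemma fun_act_w:
  assumes "\<sigma> \<in> gal k" shows "fun_act w \<sigma> w = w"
  using fun_act_eval[OF assms, of "[:0, 1:]"] galD[OF assms] by (simp add: map_poly_pCons map_poly_1')

lemma curve_aut_gal:
  assumes \<sigma>: "\<sigma> \<in> gal k" shows "curve_aut w (fun_act w \<sigma>)"
proof -
  have a: "fld_aut Fw (fun_act w \<sigma>)"
    unfolding fun_act_eq by (rule fun_endo.fun_map_aut[OF fun_endo_gal[OF \<sigma>]])
  have c: "fun_act w \<sigma> (const_fun c) = const_fun (\<sigma> c)" for c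
    using fun_act_fun_of_poly[OF \<sigma>, of "[:c:]"] galD[OF \<sigma>] by (simp add: map_poly_pCons)
  have "fun_act w \<sigma> ` range const_fun = range const_fun"
  proof -
    have "fun_act w \<sigma> ` range const_fun = const_fun ` range \<sigma>" by (simp add: image_image c)
    then show ?thesis using galD(1)[OF \<sigma>] by (simp add: bij_is_surj)
  qed
  then show ?thesis
    by (intro curve_aut.intro curve_aut_axioms.intro a) unfold_locales
qed

lemma div_act_eq: "div_act w \<sigma> = curve_aut.pact (fun_act w \<sigma>)"
  if "\<sigma> \<in> gal k"
  using curve_aut.pact_def[OF curve_aut_gal[OF that]] by (simp add: div_act_def)

lemma fun_act_comp:
  assumes \<sigma>: "\<sigma> \<in> gal k" and \<tau>: "\<tau> \<in> gal k" and g: "g \<in> Fw"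
  shows "fun_act w (\<sigma> \<circ> \<tau>) g = fun_act w \<sigma> (fun_act w \<tau> g)"
proof -
  interpret s: curve_aut w "fun_act w \<sigma>" by (rule curve_aut_gal[OF \<sigma>])
  interpret t: curve_aut w "fun_act w \<tau>" by (rule curve_aut_gal[OF \<tau>])
  interpret st: curve_aut w "fun_act w (\<sigma> \<circ> \<tau>)" by (rule curve_aut_gal[OF gal_comp[OF \<sigma> \<tau>]])
  obtain P Q where PQ: "eval_xw w Q \<noteq> 0" "g = eval_xw w P / eval_xw w Q" using g by (rule function_fieldE)
  have m: "gmap (\<sigma> \<circ> \<tau>) P = gmap \<sigma> (gmap \<tau> P)" for P
    using galD[OF \<sigma>] galD[OF \<tau>] by (simp add: poly_eq_iff coeff_map_poly)
  show ?thesis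
    unfolding PQ(2) by (simp add: s.\<alpha>.aut_divide t.\<alpha>.aut_divide st.\<alpha>.aut_divide eval_xw_in
      fun_act_eval[OF \<sigma>] fun_act_eval[OF \<tau>] fun_act_eval[OF gal_comp[OF \<sigma> \<tau>]] m)
qed

lemma fun_act_id:
  assumes g: "g \<in> Fw" shows "fun_act w id g = g"
proof -
  interpret s: curve_aut w "fun_act w id" by (rule curve_aut_gal[OF gal_id])
  obtain P Q where PQ: "eval_xw w Q \<noteq> 0" "g = eval_xw w P / eval_xw w Q" using g by (rule function_fieldE)
  have m: "gmap id P = P" for P by (simp add: poly_eq_iff coeff_map_poly)
  show ?thesis
    unfolding PQ(2) by (simp add: s.\<alpha>.aut_divide eval_xw_in fun_act_eval[OF gal_id] m)
qed

text \<open>\<open>fun_act\<close> depends on the generator used to write functions. Both versions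
  conjugate coefficients and fix powers of \<open>w ^ d\<close>, so they agree on the lower
  field.\<close>

lemma fun_act_restrict:
  assumes jd: "m = j * d" and \<sigma>: "\<sigma> \<in> gal k" and g: "g \<in> function_field (w ^ d)"
  shows "fun_act w \<sigma> g = fun_act (w ^ d) \<sigma> g"
proof -
  interpret V: superelliptic j f "w ^ d" \<xi> "\<zeta> ^ d" by (rule tower_step[OF jd])
  interpret s: curve_aut w "fun_act w \<sigma>" by (rule curve_aut_gal[OF \<sigma>])
  interpret v: curve_aut "w ^ d" "fun_act (w ^ d) \<sigma>"
    by (rule superelliptic.curve_aut_gal[OF V.superelliptic_axioms f_k \<sigma>])
  have sub: "V.Fw \<subseteq> Fw" by (rule function_field_mono) (intro K.power_mem w_in)
  have e: "fun_act w \<sigma> (eval_xw (w ^ d) P) = eval_xw (w ^ d) (gmap \<sigma> P)" for P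
  proof (induction P)
    case 0
    then show ?case by (simp add: s.\<alpha>.aut_0)
  next
    case (pCons p P)
    have "eval_xw (w ^ d) P \<in> Fw" using eval_xw_in sub by blast
    then show ?case using pCons galD[OF \<sigma>]
      by (simp add: s.\<alpha>.aut_add s.\<alpha>.aut_mult s.\<alpha>.aut_power fun_act_w[OF \<sigma>] K.mult_mem K.power_mem w_in fun_of_poly_in
        fun_act_fun_of_poly[OF \<sigma>] map_poly_pCons)
  qed
  obtain P Q where PQ: "eval_xw (w ^ d) Q \<noteq> 0" "g = eval_xw (w ^ d) P / eval_xw (w ^ d) Q" using g by (rule function_fieldE)
  have "eval_xw (w ^ d) P \<in> Fw" for P using eval_xw_in sub by blast
  then show ?thesis
    unfolding PQ(2) by (simp add: s.\<alpha>.aut_divide v.\<alpha>.aut_divide eval_xw_in e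
      superelliptic.fun_act_eval[OF V.superelliptic_axioms f_k \<sigma>])
qed

end

end

section \<open>Torsion of the quotient\<close>

lemma (in group) coset_eq_iff_mem:
  assumes "subgroup H G" "x \<in> carrier G" "y \<in> carrier G"
  shows "H #> x = H #> y \<longleftrightarrow> x \<otimes> inv y \<in> H"
  using repr_independence[of x H y] rcos_self[OF assms(2,1)] subgroup.rcos_module[OF assms(1) is_group assms(3,2)] assms
  by auto

lemma subgroup_torsion:
  assumes "comm_group G" shows "subgroup (carrier (torsion l G)) G"
proof -
  interpret comm_group G by fact
  show ?thesis
    by (rule subgroupI) (auto simp: torsion_def nat_pow_distrib nat_pow_inv)
qed

lemma torsion_eq: "torsion l G = G\<lparr>carrier := carrier (torsion l G)\<rparr>"
  by (simp add: torsion_def)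

lemma torsion_simps:
  "x \<otimes>\<^bsub>torsion l G\<^esub> y = x \<otimes>\<^bsub>G\<^esub> y" "\<one>\<^bsub>torsion l G\<^esub> = \<one>\<^bsub>G\<^esub>"
  "H #>\<^bsub>torsion l G\<^esub> x = H #>\<^bsub>G\<^esub> x"
  "x \<in> carrier (torsion l G) \<longleftrightarrow> x \<in> carrier G \<and> x [^]\<^bsub>G\<^esub> l = \<one>\<^bsub>G\<^esub>"
  by (auto simp: torsion_def r_coset_def)

lemma comm_group_torsion:
  assumes "comm_group G" shows "comm_group (torsion l G)"
proof -
  interpret comm_group G by fact
  have "group (torsion l G)"
    by (subst torsion_eq) (rule subgroup_imp_group[OF subgroup_torsion[OF assms]])
  then show ?thesis
    by (rule group.group_comm_groupI) (auto simp: torsion_simps m_comm)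
qed

lemma isoD:
  assumes "\<phi> \<in> iso M N"
  shows "x \<in> carrier M \<Longrightarrow> \<phi> x \<in> carrier N" "x \<in> carrier M \<Longrightarrow> y \<in> carrier M \<Longrightarrow> \<phi> (x \<otimes>\<^bsub>M\<^esub> y) = \<phi> x \<otimes>\<^bsub>N\<^esub> \<phi> y"
    "inj_on \<phi> (carrier M)" "\<phi> ` carrier M = carrier N"
  using assms by (auto simp: iso_def hom_def bij_betw_def)

lemma galois_module_torsion:
  assumes "galois_module \<Gamma> M act" shows "galois_module \<Gamma> (torsion l M) act"
proof -
  interpret M: comm_group M using assms by (simp add: galois_module_def)
  have "act \<sigma> \<in> iso (torsion l M) (torsion l M)" if \<sigma>: "\<sigma> \<in> \<Gamma>" for \<sigma>
  proof -
    have i: "act \<sigma> \<in> iso M M" using assms \<sigma> by (simp add: galois_module_def)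
    interpret h: group_hom M M "act \<sigma>"
      using i by unfold_locales (simp add: iso_def)
    have iff: "act \<sigma> x [^]\<^bsub>M\<^esub> l = \<one>\<^bsub>M\<^esub> \<longleftrightarrow> x [^]\<^bsub>M\<^esub> l = \<one>\<^bsub>M\<^esub>" if "x \<in> carrier M" for x
      using inj_onD[OF isoD(3)[OF i], of "x [^]\<^bsub>M\<^esub> l" "\<one>\<^bsub>M\<^esub>"] that by (auto simp flip: h.hom_nat_pow)
    have "act \<sigma> ` carrier (torsion l M) = carrier (torsion l M)"
    proof (intro equalityI subsetI)
      fix y assume y: "y \<in> carrier (torsion l M)"
      then obtain x where "x \<in> carrier M" "y = act \<sigma> x" using isoD(4)[OF i] by (auto simp: torsion_simps)
      then show "y \<in> act \<sigma> ` carrier (torsion l M)" using y iff by (auto simp: torsion_simps)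
    qed (auto simp: torsion_simps iff)
    moreover have "inj_on (act \<sigma>) (carrier (torsion l M))"
      by (rule inj_on_subset[OF isoD(3)[OF i]]) (auto simp: torsion_simps)
    ultimately show ?thesis
      by (auto simp: iso_def hom_def bij_betw_def torsion_simps)
  qed
  moreover have "act id a = a \<and> (\<forall>\<sigma>\<in>\<Gamma>. \<forall>\<tau>\<in>\<Gamma>. act (\<sigma> \<circ> \<tau>) a = act \<sigma> (act \<tau> a))" if "a \<in> carrier M" for a
    using assms that by (auto simp: galois_module_def)
  ultimately show ?thesis
    unfolding galois_module_def using comm_group_torsion[OF M.comm_group_axioms] by (auto simp: torsion_simps)
qed

lemma act_coset:
  assumes "\<phi> \<in> hom M M" "H \<subseteq> carrier M" "\<phi> ` H = H" "x \<in> carrier M"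
  shows "\<phi> ` (H #>\<^bsub>M\<^esub> x) = H #>\<^bsub>M\<^esub> \<phi> x"
proof -
  have *: "\<phi> (h \<otimes>\<^bsub>M\<^esub> x) = \<phi> h \<otimes>\<^bsub>M\<^esub> \<phi> x" if "h \<in> H" for h
    using assms that by (intro hom_mult[OF assms(1)]) auto
  have coset: "H #>\<^bsub>M\<^esub> y = (\<lambda>h. h \<otimes>\<^bsub>M\<^esub> y) ` H" for y by (auto simp: r_coset_def)
  have "\<phi> ` (H #>\<^bsub>M\<^esub> x) = (\<lambda>h. \<phi> h \<otimes>\<^bsub>M\<^esub> \<phi> x) ` H"
    unfolding coset image_image using * by (intro image_cong refl)
  also have "\<dots> = (\<lambda>h. h \<otimes>\<^bsub>M\<^esub> \<phi> x) ` \<phi> ` H" by (simp add: image_image)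
  finally show ?thesis unfolding assms(3) coset .
qed

lemma galois_module_quotient:
  assumes M: "galois_module \<Gamma> M act" and H: "subgroup H M" and stable: "\<And>\<sigma>. \<sigma> \<in> \<Gamma> \<Longrightarrow> act \<sigma> ` H = H"
    and \<Gamma>: "id \<in> \<Gamma>" "\<And>\<sigma> \<tau>. \<sigma> \<in> \<Gamma> \<Longrightarrow> \<tau> \<in> \<Gamma> \<Longrightarrow> \<sigma> \<circ> \<tau> \<in> \<Gamma>"
  shows "galois_module \<Gamma> (M Mod H) (\<lambda>\<sigma> U. act \<sigma> ` U)"
proof -
  interpret M: comm_group M using M by (simp add: galois_module_def)
  interpret N: normal H M using H by (simp add: M.normal_iff_subgroup)
  have i: "act \<sigma> \<in> iso M M" if "\<sigma> \<in> \<Gamma>" for \<sigma> using M that by (simp add: galois_module_def)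
  have c: "act \<sigma> ` (H #>\<^bsub>M\<^esub> x) = H #>\<^bsub>M\<^esub> act \<sigma> x" if "\<sigma> \<in> \<Gamma>" "x \<in> carrier M" for \<sigma> x
    using i[OF that(1)] that N.subset stable by (intro act_coset) (auto simp: iso_def)
  have "(\<lambda>U. act \<sigma> ` U) \<in> iso (M Mod H) (M Mod H)" if \<sigma>: "\<sigma> \<in> \<Gamma>" for \<sigma>
  proof -
    interpret h: group_hom M M "act \<sigma>"
      using i[OF \<sigma>] by unfold_locales (simp add: iso_def)
    have "(\<lambda>U. act \<sigma> ` U) \<in> hom (M Mod H) (M Mod H)"
    proof (rule homI)
      show "act \<sigma> ` U \<in> carrier (M Mod H)" if "U \<in> carrier (M Mod H)" for U
        using that c[OF \<sigma>] by (auto simp: carrier_FactGroup simp del: image_subset_iff)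
      fix U V assume "U \<in> carrier (M Mod H)" "V \<in> carrier (M Mod H)"
      then obtain x y where xy: "x \<in> carrier M" "U = H #>\<^bsub>M\<^esub> x" "y \<in> carrier M" "V = H #>\<^bsub>M\<^esub> y"
        by (auto simp: carrier_FactGroup)
      have "act \<sigma> ` (U \<otimes>\<^bsub>M Mod H\<^esub> V) = H #>\<^bsub>M\<^esub> act \<sigma> (x \<otimes>\<^bsub>M\<^esub> y)"
        using xy c[OF \<sigma>] by (simp add: N.rcos_sum)
      then show "act \<sigma> ` (U \<otimes>\<^bsub>M Mod H\<^esub> V) = act \<sigma> ` U \<otimes>\<^bsub>M Mod H\<^esub> act \<sigma> ` V"
        using xy by (simp add: c[OF \<sigma>] N.rcos_sum)
    qed
    moreover have "(\<lambda>U. act \<sigma> ` U) ` carrier (M Mod H) = carrier (M Mod H)"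
    proof -
      have "(\<lambda>U. act \<sigma> ` U) ` carrier (M Mod H) = (\<lambda>x. H #>\<^bsub>M\<^esub> x) ` act \<sigma> ` carrier M"
        unfolding carrier_FactGroup image_image using c[OF \<sigma>] by (intro image_cong) auto
      then show ?thesis using isoD(4)[OF i[OF \<sigma>]] by (simp add: carrier_FactGroup)
    qed
    moreover have "inj_on (\<lambda>U. act \<sigma> ` U) (carrier (M Mod H))"
    proof (rule inj_onI)
      fix U V assume "U \<in> carrier (M Mod H)" "V \<in> carrier (M Mod H)" and eq: "act \<sigma> ` U = act \<sigma> ` V"
      then obtain x y where xy: "x \<in> carrier M" "U = H #>\<^bsub>M\<^esub> x" "y \<in> carrier M" "V = H #>\<^bsub>M\<^esub> y"
        by (auto simp: carrier_FactGroup)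
      have "act \<sigma> x \<otimes>\<^bsub>M\<^esub> inv\<^bsub>M\<^esub> act \<sigma> y \<in> H"
        using eq xy M.coset_eq_iff_mem[OF H, of "act \<sigma> x" "act \<sigma> y"] by (simp add: c[OF \<sigma>])
      then have "act \<sigma> (x \<otimes>\<^bsub>M\<^esub> inv\<^bsub>M\<^esub> y) \<in> act \<sigma> ` H" using xy stable[OF \<sigma>] by simp
      then have "x \<otimes>\<^bsub>M\<^esub> inv\<^bsub>M\<^esub> y \<in> H"
        using inj_on_image_mem_iff[OF isoD(3)[OF i[OF \<sigma>]] _ N.subset, of "x \<otimes>\<^bsub>M\<^esub> inv\<^bsub>M\<^esub> y"] xy
        by (simp del: h.hom_mult)
      then show "U = V" using xy M.coset_eq_iff_mem[OF H] by simp
    qed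
    ultimately show ?thesis by (simp add: iso_def bij_betw_def)
  qed
  moreover have "act id ` U = U \<and> (\<forall>\<sigma>\<in>\<Gamma>. \<forall>\<tau>\<in>\<Gamma>. act (\<sigma> \<circ> \<tau>) ` U = act \<sigma> ` act \<tau> ` U)"
    if U: "U \<in> carrier (M Mod H)" for U
  proof -
    obtain x where x: "x \<in> carrier M" "U = H #>\<^bsub>M\<^esub> x" using U by (auto simp: carrier_FactGroup)
    have "act \<tau> x \<in> carrier M" if "\<tau> \<in> \<Gamma>" for \<tau> using isoD(1)[OF i[OF that] x(1)] .
    then show ?thesis using M x \<Gamma> by (simp add: c galois_module_def)
  qed
  ultimately show ?thesis
    unfolding galois_module_def using M.abelian_FactGroup[OF H] by simp
qed

text \<open>The snake lemma for multiplication by \<open>l\<close> on \<open>J' \<rightarrow> J \<rightarrow> J / J'\<close>: the cokernel of \<open>l\<close> on \<open>J'\<close> vanishes.\<close>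

theorem torsion_quotient_iso:
  assumes J: "galois_module \<Gamma> J act" and J': "comm_group J'"
    and \<pi>: "\<pi> \<in> hom J' J" "inj_on \<pi> (carrier J')"
    and divisible: "\<And>U. U \<in> carrier J' \<Longrightarrow> \<exists>V\<in>carrier J'. V [^]\<^bsub>J'\<^esub> l = U"
    and stable: "\<And>\<sigma>. \<sigma> \<in> \<Gamma> \<Longrightarrow> act \<sigma> ` \<pi> ` carrier J' = \<pi> ` carrier J'"
    and \<Gamma>: "id \<in> \<Gamma>" "\<And>\<sigma> \<tau>. \<sigma> \<in> \<Gamma> \<Longrightarrow> \<tau> \<in> \<Gamma> \<Longrightarrow> \<sigma> \<circ> \<tau> \<in> \<Gamma>"
  shows "\<exists>\<psi>. galois_module_iso \<Gamma> (torsion (l::nat) J Mod (\<pi> ` carrier (torsion l J'))) (\<lambda>\<sigma> U. act \<sigma> ` U)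
      (torsion l (J Mod (\<pi> ` carrier J'))) (\<lambda>\<sigma> U. act \<sigma> ` U) \<psi>
    \<and> (\<forall>a\<in>carrier (torsion l J). \<psi> ((\<pi> ` carrier (torsion l J')) #>\<^bsub>torsion l J\<^esub> a) = (\<pi> ` carrier J') #>\<^bsub>J\<^esub> a)"
proof -
  interpret J: comm_group J using J by (simp add: galois_module_def)
  interpret J': comm_group J' by fact
  interpret \<pi>: group_hom J' J \<pi> using \<pi>(1) by unfold_locales
  define N where "N = \<pi> ` carrier J'"
  define N' where "N' = \<pi> ` carrier (torsion l J')"
  define T where "T = torsion l J"
  have N: "subgroup N J" unfolding N_def by (rule \<pi>.img_is_subgroup)
  interpret N: normal N J using N by (simp add: J.normal_iff_subgroup)
  \<comment> \<open>Injectivity of \<pi>: \<open>l\<close>-torsion in the image comes from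
    \<open>l\<close>-torsion in \<open>J'\<close>.\<close>
  have N': "N' = N \<inter> carrier T"
  proof -
    have "\<pi> b [^]\<^bsub>J\<^esub> l = \<one>\<^bsub>J\<^esub> \<longleftrightarrow> b [^]\<^bsub>J'\<^esub> l = \<one>\<^bsub>J'\<^esub>" if "b \<in> carrier J'" for b
      using inj_onD[OF \<pi>(2), of "b [^]\<^bsub>J'\<^esub> l" "\<one>\<^bsub>J'\<^esub>"] that by (auto simp flip: \<pi>.hom_nat_pow)
    then show ?thesis by (auto simp: N'_def N_def T_def torsion_simps)
  qed
  have TJ: "galois_module \<Gamma> T act" unfolding T_def by (rule galois_module_torsion[OF J])
  interpret T: comm_group T using TJ by (simp add: galois_module_def)
  have N'T: "subgroup N' T"
    unfolding N' T_def using J.subgroup_incl[OF J.subgroups_Inter_pair[OF N subgroup_torsion[OF J.comm_group_axioms]] subgroup_torsion[OF J.comm_group_axioms, of l]]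
    by (subst torsion_eq) auto
  interpret N': normal N' T using N'T by (simp add: T.normal_iff_subgroup)
  have stN: "act \<sigma> ` N = N" if "\<sigma> \<in> \<Gamma>" for \<sigma> using stable[OF that] by (simp add: N_def)
  have iT: "act \<sigma> \<in> iso T T" and iJ: "act \<sigma> \<in> iso J J" if "\<sigma> \<in> \<Gamma>" for \<sigma>
    using that TJ J by (auto simp: galois_module_def)
  have TsubJ: "carrier T \<subseteq> carrier J" by (auto simp: T_def torsion_simps)
  have stN': "act \<sigma> ` N' = N'" if \<sigma>: "\<sigma> \<in> \<Gamma>" for \<sigma>
    unfolding N' using inj_on_image_Int[OF isoD(3)[OF iJ[OF \<sigma>]] N.subset TsubJ] stN[OF \<sigma>] isoD(4)[OF iT[OF \<sigma>]] by simp
  have M1: "galois_module \<Gamma> (T Mod N') (\<lambda>\<sigma> U. act \<sigma> ` U)"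
    by (rule galois_module_quotient[OF TJ N'T stN' \<Gamma>])
  have M2: "galois_module \<Gamma> (torsion l (J Mod N)) (\<lambda>\<sigma> U. act \<sigma> ` U)"
    by (rule galois_module_torsion[OF galois_module_quotient[OF J N stN \<Gamma>]])
  \<comment> \<open>Enlarging a coset of \<open>N'\<close> to the coset of \<open>N\<close>
    containing it gives the induced map without choosing representatives.\<close>
  define \<psi> where "\<psi> U = N <#>\<^bsub>J\<^esub> U" for U
  have cT: "N' #>\<^bsub>T\<^esub> a = N' #>\<^bsub>J\<^esub> a" for a by (simp add: T_def torsion_simps)
  have \<psi>: "\<psi> (N' #>\<^bsub>T\<^esub> a) = N #>\<^bsub>J\<^esub> a" if a: "a \<in> carrier T" for a
  proof (intro equalityI subsetI)
    fix x assume "x \<in> \<psi> (N' #>\<^bsub>T\<^esub> a)"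
    then have "x \<in> N <#>\<^bsub>J\<^esub> (N' #>\<^bsub>J\<^esub> a)" by (simp only: \<psi>_def cT)
    then obtain u v where uv: "u \<in> N" "v \<in> N'" "x = u \<otimes>\<^bsub>J\<^esub> (v \<otimes>\<^bsub>J\<^esub> a)"
      by (auto simp: set_mult_def r_coset_def)
    then have "x = (u \<otimes>\<^bsub>J\<^esub> v) \<otimes>\<^bsub>J\<^esub> a" "u \<otimes>\<^bsub>J\<^esub> v \<in> N"
      using a TsubJ N.subset N' N.m_closed by (auto simp: J.m_assoc subset_iff)
    then show "x \<in> N #>\<^bsub>J\<^esub> a" by (auto simp: r_coset_def)
  next
    fix x assume "x \<in> N #>\<^bsub>J\<^esub> a"
    then obtain u where u: "u \<in> N" "x = u \<otimes>\<^bsub>J\<^esub> a" by (auto simp: r_coset_def)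
    have "a \<in> N' #>\<^bsub>T\<^esub> a" by (rule T.rcos_self[OF a N'T])
    then show "x \<in> \<psi> (N' #>\<^bsub>T\<^esub> a)" using u by (auto simp: \<psi>_def set_mult_def)
  qed
  have pow: "(N #>\<^bsub>J\<^esub> a) [^]\<^bsub>J Mod N\<^esub> l = N #>\<^bsub>J\<^esub> (a [^]\<^bsub>J\<^esub> l)" if "a \<in> carrier J" for a
    by (rule N.FactGroup_pow[OF that])
  have N1: "N #>\<^bsub>J\<^esub> \<one>\<^bsub>J\<^esub> = N" using N.subset by simp
  have im: "\<psi> ` carrier (T Mod N') = carrier (torsion l (J Mod N))"
  proof (intro equalityI subsetI)
    fix U assume "U \<in> \<psi> ` carrier (T Mod N')"
    then obtain a where a: "a \<in> carrier T" "U = N #>\<^bsub>J\<^esub> a" using \<psi> by (auto simp: carrier_FactGroup)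
    then show "U \<in> carrier (torsion l (J Mod N))"
      using pow[of a] N1 by (auto simp: T_def torsion_simps carrier_FactGroup)
  next
    fix U assume U: "U \<in> carrier (torsion l (J Mod N))"
    then obtain a where a: "a \<in> carrier J" "U = N #>\<^bsub>J\<^esub> a" "N #>\<^bsub>J\<^esub> (a [^]\<^bsub>J\<^esub> l) = N"
      using pow by (auto simp: torsion_simps carrier_FactGroup)
    then have "a [^]\<^bsub>J\<^esub> l \<in> N" using J.rcos_self[OF _ N, of "a [^]\<^bsub>J\<^esub> l"] by simp
    then obtain b where b: "b \<in> carrier J'" "a [^]\<^bsub>J\<^esub> l = \<pi> b" by (auto simp: N_def)
    obtain c where c: "c \<in> carrier J'" "c [^]\<^bsub>J'\<^esub> l = b" using divisible[OF b(1)] by blast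
    \<comment> \<open>The \<open>l\<close>-th powers of \<open>a\<close> and of
      \<open>\<pi> c\<close> are both \<open>\<pi> b\<close>, so dividing \<open>a\<close> by
      \<open>\<pi> c\<close> makes it torsion without changing its class.\<close>
    define a' where "a' = a \<otimes>\<^bsub>J\<^esub> inv\<^bsub>J\<^esub> \<pi> c"
    have a': "a' \<in> carrier J" using a c by (simp add: a'_def)
    have "a' [^]\<^bsub>J\<^esub> l = \<pi> b \<otimes>\<^bsub>J\<^esub> inv\<^bsub>J\<^esub> (\<pi> c [^]\<^bsub>J\<^esub> l)"
      using a c b by (simp add: a'_def J.nat_pow_distrib J.nat_pow_inv)
    also have "\<pi> c [^]\<^bsub>J\<^esub> l = \<pi> b" using c by (simp flip: \<pi>.hom_nat_pow)
    finally have "a' \<in> carrier T" using a' b by (simp add: T_def torsion_simps)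
    moreover have "N #>\<^bsub>J\<^esub> a' = U"
    proof -
      have "a' \<otimes>\<^bsub>J\<^esub> inv\<^bsub>J\<^esub> a = inv\<^bsub>J\<^esub> \<pi> c"
        using a c by (simp add: a'_def J.m_comm[of a] J.m_assoc)
      moreover have "inv\<^bsub>J\<^esub> \<pi> c \<in> N" using c by (intro N.m_inv_closed) (simp add: N_def)
      ultimately show ?thesis using J.coset_eq_iff_mem[OF N a' a(1)] a(2) by simp
    qed
    ultimately show "U \<in> \<psi> ` carrier (T Mod N')"
      using \<psi> by (force simp: carrier_FactGroup image_iff)
  qed
  have inj: "inj_on \<psi> (carrier (T Mod N'))"
  proof (rule inj_onI)
    fix U V assume "U \<in> carrier (T Mod N')" "V \<in> carrier (T Mod N')" and eq: "\<psi> U = \<psi> V"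
    then obtain a b where ab: "a \<in> carrier T" "U = N' #>\<^bsub>T\<^esub> a" "b \<in> carrier T" "V = N' #>\<^bsub>T\<^esub> b"
      by (auto simp: carrier_FactGroup)
    then have "a \<otimes>\<^bsub>J\<^esub> inv\<^bsub>J\<^esub> b \<in> N" using eq \<psi> J.coset_eq_iff_mem[OF N, of a b] TsubJ by auto
    moreover have "inv\<^bsub>T\<^esub> b = inv\<^bsub>J\<^esub> b"
      using J.m_inv_consistent[OF subgroup_torsion[OF J.comm_group_axioms, of l]] ab(3) torsion_eq[of l J] by (simp add: T_def)
    moreover have "a \<otimes>\<^bsub>T\<^esub> inv\<^bsub>T\<^esub> b \<in> carrier T" using ab by simp
    ultimately have "a \<otimes>\<^bsub>T\<^esub> inv\<^bsub>T\<^esub> b \<in> N'" unfolding N' by (simp add: T_def torsion_simps)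
    then show "U = V" using ab T.coset_eq_iff_mem[OF N'T] by simp
  qed
  have hom: "\<psi> \<in> hom (T Mod N') (torsion l (J Mod N))"
  proof (rule homI)
    show "\<psi> U \<in> carrier (torsion l (J Mod N))" if "U \<in> carrier (T Mod N')" for U using im that by blast
    fix U V assume "U \<in> carrier (T Mod N')" "V \<in> carrier (T Mod N')"
    then obtain a b where ab: "a \<in> carrier T" "U = N' #>\<^bsub>T\<^esub> a" "b \<in> carrier T" "V = N' #>\<^bsub>T\<^esub> b"
      by (auto simp: carrier_FactGroup)
    have "\<psi> (U \<otimes>\<^bsub>T Mod N'\<^esub> V) = N #>\<^bsub>J\<^esub> (a \<otimes>\<^bsub>T\<^esub> b)"
      using ab by (simp add: N'.rcos_sum \<psi>)
    also have "\<dots> = (N #>\<^bsub>J\<^esub> a) <#>\<^bsub>J\<^esub> (N #>\<^bsub>J\<^esub> b)"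
      using ab TsubJ N.rcos_sum[of a b] by (auto simp: T_def torsion_simps)
    finally show "\<psi> (U \<otimes>\<^bsub>T Mod N'\<^esub> V) = \<psi> U \<otimes>\<^bsub>torsion l (J Mod N)\<^esub> \<psi> V"
      using ab by (simp add: \<psi> torsion_simps)
  qed
  have "\<psi> (act \<sigma> ` U) = act \<sigma> ` \<psi> U" if \<sigma>: "\<sigma> \<in> \<Gamma>" and U: "U \<in> carrier (T Mod N')" for \<sigma> U
  proof -
    obtain a where a: "a \<in> carrier T" "U = N' #>\<^bsub>T\<^esub> a" using U by (auto simp: carrier_FactGroup)
    have "act \<sigma> ` U = N' #>\<^bsub>T\<^esub> act \<sigma> a"
      unfolding a(2) using iT[OF \<sigma>] N'.subset stN'[OF \<sigma>] a(1) by (intro act_coset) (auto simp: iso_def)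
    moreover have "act \<sigma> ` (N #>\<^bsub>J\<^esub> a) = N #>\<^bsub>J\<^esub> act \<sigma> a"
      using iJ[OF \<sigma>] N.subset stN[OF \<sigma>] a(1) TsubJ by (intro act_coset) (auto simp: iso_def)
    ultimately show ?thesis using \<psi> a isoD(1)[OF iT[OF \<sigma>] a(1)] by simp
  qed
  then have "galois_module_iso \<Gamma> (T Mod N') (\<lambda>\<sigma> U. act \<sigma> ` U) (torsion l (J Mod N)) (\<lambda>\<sigma> U. act \<sigma> ` U) \<psi>"
    unfolding galois_module_iso_def using M1 M2 hom im inj by (simp add: iso_def bij_betw_def)
  then show ?thesis using \<psi> unfolding T_def N_def N'_def by blast
qed

section \<open>Jacobians of the tower as Galois modules\<close>

context superelliptic
begin

context
  fixes j d assumes jd: "m = j * d"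
begin

interpretation V: superelliptic j f "w ^ d" \<xi> "\<zeta> ^ d" by (rule tower_step[OF jd])

lemma Jac_pullback_hom: "Jac_pullback (w ^ d) w \<in> hom (Jac (w ^ d)) (Jac w)"
proof (rule homI)
  fix U assume "U \<in> carrier (Jac (w ^ d))"
  then obtain D where "D \<in> carrier (Div0 (w ^ d))" "U = V.cl D" by (auto simp: V.Jac_carrier)
  then show "Jac_pullback (w ^ d) w U \<in> carrier (Jac w)"
    using Jac_pullback_cl[OF jd] pullback_Div0[OF jd] by (auto simp: Jac_carrier)
next
  fix U V assume "U \<in> carrier (Jac (w ^ d))" "V \<in> carrier (Jac (w ^ d))"
  then obtain D E where "D \<in> carrier (Div0 (w ^ d))" "U = V.cl D" "E \<in> carrier (Div0 (w ^ d))" "V = V.cl E"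
    by (auto simp: V.Jac_carrier)
  then show "Jac_pullback (w ^ d) w (U \<otimes>\<^bsub>Jac (w ^ d)\<^esub> V)
      = Jac_pullback (w ^ d) w U \<otimes>\<^bsub>Jac w\<^esub> Jac_pullback (w ^ d) w V"
    using Jac_pullback_cl[OF jd] pullback_Div0[OF jd] V.J.G_add
    by (simp add: V.Jac_mult Jac_mult pullback_add[OF jd])
qed

lemma Jac_pullback_inj: "inj_on (Jac_pullback (w ^ d) w) (carrier (Jac (w ^ d)))"
proof (rule inj_onI)
  fix U V assume "U \<in> carrier (Jac (w ^ d))" "V \<in> carrier (Jac (w ^ d))"
    and eq: "Jac_pullback (w ^ d) w U = Jac_pullback (w ^ d) w V"
  then obtain D E where DE: "D \<in> carrier (Div0 (w ^ d))" "U = V.cl D" "E \<in> carrier (Div0 (w ^ d))" "V = V.cl E"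
    by (auto simp: V.Jac_carrier)
  then have "div_pullback (w ^ d) w (D - E) \<in> principal_divisors w"
    using eq Jac_pullback_cl[OF jd] by (simp add: cl_eq_iff pullback_diff[OF jd])
  then have "D - E \<in> principal_divisors (w ^ d)"
    using DE by (intro pullback_principal[OF jd] V.J.G_diff)
  then show "U = V" using DE V.cl_eq_iff by simp
qed

end

context
  fixes k :: "'a set"
  assumes f_k: "\<And>i. coeff f i \<in> k"
begin

lemma Jac_act_cl: "\<sigma> \<in> gal k \<Longrightarrow> Jac_act w \<sigma> (cl D) = cl (div_act w \<sigma> D)"
  using curve_aut.pact_cl[OF curve_aut_gal[OF f_k]] by (simp add: Jac_act_def div_act_eq[OF f_k])

lemma div_act_Div0: "\<sigma> \<in> gal k \<Longrightarrow> D \<in> carrier (Div0 w) \<Longrightarrow> div_act w \<sigma> D \<in> carrier (Div0 w)"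
  using curve_aut.pact_Div0[OF curve_aut_gal[OF f_k]] by (simp add: div_act_eq[OF f_k])

lemma place_subset: "P \<in> places w \<Longrightarrow> P \<subseteq> Fw" by (rule R.place_sub)

lemma div_act_comp:
  assumes \<sigma>: "\<sigma> \<in> gal k" and \<tau>: "\<tau> \<in> gal k" and D: "D \<in> carrier (Div0 w)"
  shows "div_act w (\<sigma> \<circ> \<tau>) D = div_act w \<sigma> (div_act w \<tau> D)"
proof -
  have "div_act w \<sigma> (div_act w \<tau> D) = frag_extend ((\<lambda>P. frag_of (fun_act w \<sigma> ` P)) \<circ> (\<lambda>P. fun_act w \<tau> ` P)) D"
    unfolding div_act_def using frag_extend_compose[of _ "\<lambda>P. fun_act w \<tau> ` P" D] by (simp add: o_def)
  also have "\<dots> = div_act w (\<sigma> \<circ> \<tau>) D"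
    unfolding div_act_def
  proof (rule frag_extend_eq)
    fix P assume "P \<in> Poly_Mapping.keys D"
    then have "P \<subseteq> Fw" using D place_subset by (auto simp: Div0_carrier)
    then have "fun_act w (\<sigma> \<circ> \<tau>) ` P = fun_act w \<sigma> ` fun_act w \<tau> ` P"
      unfolding image_image using fun_act_comp[OF f_k \<sigma> \<tau>] by (intro image_cong refl) auto
    then show "((\<lambda>P. frag_of (fun_act w \<sigma> ` P)) \<circ> (\<lambda>P. fun_act w \<tau> ` P)) P = frag_of (fun_act w (\<sigma> \<circ> \<tau>) ` P)"
      by simp
  qed
  finally show ?thesis by simp
qed

lemma div_act_id:
  assumes D: "D \<in> carrier (Div0 w)" shows "div_act w id D = D"
proof -
  have "div_act w id D = frag_extend frag_of D"
    unfolding div_act_def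
  proof (rule frag_extend_eq)
    fix P assume "P \<in> Poly_Mapping.keys D"
    then have "P \<subseteq> Fw" using D place_subset by (auto simp: Div0_carrier)
    then have "fun_act w id ` P = P" using fun_act_id[OF f_k] by (force simp: image_iff)
    then show "frag_of (fun_act w id ` P) = frag_of P" by simp
  qed
  then show ?thesis using frag_expansion[of D] by simp
qed

lemma Jac_act_group:
  assumes "U \<in> carrier (Jac w)"
  shows "Jac_act w id U = U" "\<sigma> \<in> gal k \<Longrightarrow> \<tau> \<in> gal k \<Longrightarrow> Jac_act w (\<sigma> \<circ> \<tau>) U = Jac_act w \<sigma> (Jac_act w \<tau> U)"
    "\<sigma> \<in> gal k \<Longrightarrow> Jac_act w \<sigma> U \<in> carrier (Jac w)"
proof -
  obtain D where D: "D \<in> carrier (Div0 w)" "U = cl D" using assms by (auto simp: Jac_carrier)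
  show "Jac_act w id U = U" using D by (simp add: Jac_act_cl gal_id div_act_id)
  show "Jac_act w (\<sigma> \<circ> \<tau>) U = Jac_act w \<sigma> (Jac_act w \<tau> U)" if "\<sigma> \<in> gal k" "\<tau> \<in> gal k"
    using D that gal_comp[OF that] by (simp add: Jac_act_cl div_act_comp)
  show "Jac_act w \<sigma> U \<in> carrier (Jac w)" if "\<sigma> \<in> gal k"
    using D that div_act_Div0 by (auto simp: Jac_act_cl Jac_carrier)
qed

lemma Jac_act_inverse:
  assumes \<sigma>: "\<sigma> \<in> gal k" and U: "U \<in> carrier (Jac w)"
  shows "Jac_act w \<sigma> (Jac_act w (inv_into UNIV \<sigma>) U) = U" "Jac_act w (inv_into UNIV \<sigma>) (Jac_act w \<sigma> U) = U"
proof -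
  have "\<sigma> \<circ> inv_into UNIV \<sigma> = id" "inv_into UNIV \<sigma> \<circ> \<sigma> = id"
    using galD(1)[OF \<sigma>] by (auto simp: bij_is_inj bij_is_surj surj_f_inv_f fun_eq_iff)
  then show "Jac_act w \<sigma> (Jac_act w (inv_into UNIV \<sigma>) U) = U" "Jac_act w (inv_into UNIV \<sigma>) (Jac_act w \<sigma> U) = U"
    using Jac_act_group[OF U] \<sigma> gal_inv[OF \<sigma>] by metis+
qed

theorem galois_module_Jac: "galois_module (gal k) (Jac w) (Jac_act w)"
proof -
  have "Jac_act w \<sigma> \<in> iso (Jac w) (Jac w)" if \<sigma>: "\<sigma> \<in> gal k" for \<sigma>
  proof -
    have "Jac_act w \<sigma> \<in> hom (Jac w) (Jac w)"
    proof (rule homI)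
      show "Jac_act w \<sigma> U \<in> carrier (Jac w)" if "U \<in> carrier (Jac w)" for U by (rule Jac_act_group(3)[OF that \<sigma>])
      fix U V assume "U \<in> carrier (Jac w)" "V \<in> carrier (Jac w)"
      then obtain D E where "D \<in> carrier (Div0 w)" "U = cl D" "E \<in> carrier (Div0 w)" "V = cl E"
        by (auto simp: Jac_carrier)
      then show "Jac_act w \<sigma> (U \<otimes>\<^bsub>Jac w\<^esub> V) = Jac_act w \<sigma> U \<otimes>\<^bsub>Jac w\<^esub> Jac_act w \<sigma> V"
        using div_act_Div0[OF \<sigma>] by (simp add: Jac_mult Jac_act_cl[OF \<sigma>]) (simp add: div_act_def frag_extend_add)
    qed
    moreover have "bij_betw (Jac_act w \<sigma>) (carrier (Jac w)) (carrier (Jac w))"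
      using Jac_act_inverse[OF \<sigma>] Jac_act_group(3) \<sigma> gal_inv[OF \<sigma>]
      by (intro bij_betw_byWitness[where f' = "Jac_act w (inv_into UNIV \<sigma>)"]) auto
    ultimately show ?thesis by (simp add: iso_def)
  qed
  then show ?thesis
    unfolding galois_module_def using comm_group_Jac Jac_act_group by blast
qed

context
  fixes j d assumes jd: "m = j * d"
begin

interpretation V: superelliptic j f "w ^ d" \<xi> "\<zeta> ^ d" by (rule tower_step[OF jd])

text \<open>Pullback commutes with the action, which gives one inclusion for every automorphism; the
  other is that inclusion for the inverse.\<close>

lemma Jac_pullback_stable:
  assumes \<sigma>: "\<sigma> \<in> gal k"
  shows "Jac_act w \<sigma> ` Jac_pullback (w ^ d) w ` carrier (Jac (w ^ d)) = Jac_pullback (w ^ d) w ` carrier (Jac (w ^ d))"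
proof -
  define N where "N = Jac_pullback (w ^ d) w ` carrier (Jac (w ^ d))"
  have sub: "Jac_act w \<sigma> U \<in> N" if \<sigma>: "\<sigma> \<in> gal k" and U: "U \<in> N" for \<sigma> U
  proof -
    obtain D where D: "D \<in> carrier (Div0 (w ^ d))" "U = Jac_pullback (w ^ d) w (V.cl D)"
      using U by (auto simp: N_def V.Jac_carrier)
    have "Jac_act w \<sigma> U = cl (div_act w \<sigma> (div_pullback (w ^ d) w D))"
      using D \<sigma> by (simp add: Jac_pullback_cl[OF jd] Jac_act_cl)
    also have "div_act w \<sigma> (div_pullback (w ^ d) w D) = div_pullback (w ^ d) w (div_act (w ^ d) \<sigma> D)"
      unfolding div_act_eq[OF f_k \<sigma>] superelliptic.div_act_eq[OF V.superelliptic_axioms f_k \<sigma>]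
      using D(1) by (intro pullback_pact[OF jd, symmetric] curve_aut_gal[OF f_k \<sigma>]
        superelliptic.curve_aut_gal[OF V.superelliptic_axioms f_k \<sigma>] fun_act_restrict[OF f_k jd \<sigma>])
        (auto simp: V.Div0_carrier)
    also have "cl \<dots> = Jac_pullback (w ^ d) w (V.cl (div_act (w ^ d) \<sigma> D))"
      using Jac_pullback_cl[OF jd superelliptic.div_act_Div0[OF V.superelliptic_axioms f_k \<sigma> D(1)]] by simp
    finally show ?thesis
      using superelliptic.div_act_Div0[OF V.superelliptic_axioms f_k \<sigma> D(1)] by (auto simp: N_def V.Jac_carrier)
  qed
  have NJ: "U \<in> carrier (Jac w)" if "U \<in> N" for U
    using that Jac_pullback_hom[OF jd] by (auto simp: N_def hom_def)
  have "U \<in> Jac_act w \<sigma> ` N" if U: "U \<in> N" for U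
    using Jac_act_inverse(1)[OF \<sigma> NJ[OF U]] sub[OF gal_inv[OF \<sigma>] U] by (metis imageI)
  then have "Jac_act w \<sigma> ` N = N" using sub[OF \<sigma>] by blast
  then show ?thesis by (simp add: N_def)
qed

end

end

end

section \<open>A root of order prime to \<open>l\<close>, and primitive roots of unity\<close>

lemma ex_power_eq:
  fixes p :: "'a::alg_closed_field poly"
  assumes "0 < l" "p \<noteq> 0" "\<And>a. l dvd order a p"
  shows "\<exists>q. q ^ l = p"
  using assms(2,3)
proof (induction "degree p" arbitrary: p rule: less_induct)
  case less
  show ?case
  proof (cases "degree p = 0")
    case True
    then obtain c where c: "p = [:c:]" using degree_0_id by metis
    obtain b where "b ^ l = c" using nth_root_exists[OF assms(1)] by blast
    then show ?thesis by (intro exI[of _ "[:b:]"]) (simp add: c poly_const_pow)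
  next
    case False
    then obtain a where a: "poly p a = 0" using alg_closed_imp_poly_has_root by blast
    \<comment> \<open>The root is split off with its full multiplicity, so the cofactor has the same
      orders elsewhere and order 0 at \<open>a\<close>.\<close>
    define n where "n = order a p"
    have n: "n > 0" using a less.prems by (simp add: n_def order_root)
    obtain q where q: "p = [:- a, 1:] ^ n * q" "\<not> [:- a, 1:] dvd q"
      using order_decomp[OF less.prems(1), of a] by (auto simp: n_def)
    have q0: "q \<noteq> 0" using q(2) by auto
    have lin: "([:- a, 1:] ^ n :: 'a poly) \<noteq> 0" by simp
    have "degree q < degree p"
      using n q0 unfolding q(1) by (subst degree_mult_eq) (auto simp: degree_power_eq simp del: mult_pCons_left)
    moreover have "l dvd order b q" for b
    proof (cases "b = a")
      case True
      then have "order b q = 0" using q(2) by (simp add: order_0I poly_eq_0_iff_dvd)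
      then show ?thesis by simp
    next
      case False
      have "order b ([:- a, 1:] ^ n) = 0" using False by (intro order_0I) (simp add: poly_power)
      then have "order b p = order b q" using lin q0 unfolding q(1) by (subst order_mult) auto
      then show ?thesis using less.prems(2)[of b] by simp
    qed
    ultimately obtain g where g: "g ^ l = q" using less.hyps q0 by blast
    obtain e where e: "n = l * e" using less.prems(2)[of a] by (auto simp: n_def elim: dvdE)
    have "([:- a, 1:] ^ e * g) ^ l = p"
      by (simp only: q(1) e power_mult_distrib g power_mult[symmetric] mult.commute[of l])
    then show ?thesis by blast
  qed
qed

text \<open>If all orders were divisible by \<open>l\<close>, then \<open>f = g ^ l\<close>, and
  with \<open>W\<close> for the variable, \<open>W ^ (l ^ (n - 1)) - g\<close> would be a proper
  factor of \<open>W ^ (l ^ n) - f\<close>.\<close>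

lemma ex_order_not_dvd:
  fixes f :: "'a::{alg_closed_field, field_char_0} poly"
  assumes l: "prime (l::nat)" and n: "n \<ge> 1" and f: "f \<noteq> 0"
    and irr: "irreducible (monom 1 (l ^ n) - [:f:])"
  shows "\<exists>\<xi>. \<not> l dvd order \<xi> f"
proof (rule ccontr)
  assume "\<not> ?thesis"
  moreover have l1: "l > 1" using l by (rule prime_gt_1_nat)
  ultimately obtain g where g: "g ^ l = f" using ex_power_eq[OF _ f, of l] by auto
  define e where "e = l ^ (n - 1)"
  have e: "e > 0" "l ^ n = e * l" using l1 n by (cases n; simp add: e_def)+
  define A where "A = monom 1 e - [:g:]"
  have deg: "degree (monom 1 i - [:h:]) = i" if "i > 0" for i and h :: "'a poly"
  proof (rule antisym)
    show "degree (monom 1 i - [:h:]) \<le> i" by (intro degree_diff_le) (auto intro: degree_monom_le)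
    show "i \<le> degree (monom 1 i - [:h:])" using that by (intro le_degree) (auto simp: coeff_pCons split: nat.split)
  qed
  have "monom 1 (l ^ n) - [:f:] = monom 1 e ^ l - [:g:] ^ l"
    by (simp add: e(2) monom_power poly_const_pow g)
  also have "\<dots> = A * (\<Sum>i<l. [:g:] ^ (l - Suc i) * monom 1 e ^ i)"
    unfolding A_def by (rule power_diff_sumr2)
  finally obtain B where B: "monom 1 (l ^ n) - [:f:] = A * B" by blast
  have dA: "degree A = e" unfolding A_def by (rule deg[OF e(1)])
  have dAB: "degree (A * B) = l ^ n" unfolding B[symmetric] using l1 by (intro deg) auto
  have "A * B \<noteq> 0" using dAB l1 by auto
  then have "e + degree B = e * l" using dAB dA e(2) by (auto simp: degree_mult_eq)
  moreover have "e * l > e" using e l1 by simp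
  ultimately have "degree B \<noteq> 0" by linarith
  moreover have "A dvd 1 \<or> B dvd 1" by (rule irreducibleD[OF irr B])
  ultimately show False using dA e(1) by (auto simp: is_unit_poly_iff)
qed

text \<open>A nontrivial \<open>l\<close>-th root of unity is a root of
  \<open>1 + X + ... + X ^ (l - 1)\<close>, and taking \<open>l\<close>-th roots repeatedly raises
  the order up to \<open>l ^ n\<close>. The order of the result divides \<open>l ^ n\<close>, so it
  is a power of \<open>l\<close>, and it is enough that the power with exponent
  \<open>l ^ (n - 1)\<close> is not 1.\<close>

lemma ex_primitive_root:
  assumes l: "prime (l::nat)"
  shows "\<exists>\<zeta>::'a::{alg_closed_field, field_char_0}. \<zeta> ^ (l ^ n) = 1 \<and> (\<forall>i. 0 < i \<longrightarrow> i < l ^ n \<longrightarrow> \<zeta> ^ i \<noteq> 1)"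
proof (cases n)
  case 0
  then show ?thesis by (intro exI[of _ 1]) auto
next
  case (Suc k)
  have l1: "l > 1" using l by (rule prime_gt_1_nat)
  have "\<exists>\<zeta>::'a. \<zeta> ^ (l ^ Suc k) = 1 \<and> \<zeta> ^ (l ^ k) \<noteq> 1" for k
  proof (induction k)
    case 0
    obtain r where r: "(\<Sum>i\<le>l - 1. 1 * r ^ i) = (0::'a)"
      using alg_closed[of "l - 1" "\<lambda>_. 1"] l1 by auto
    have "{..l - 1} = {..<l}" using l1 by auto
    then have s: "(\<Sum>i<l. r ^ i) = 0" using r by simp
    then have "r ^ l = 1" using power_diff_1_eq[of r l] by simp
    moreover have "r \<noteq> 1" using s l1 by auto
    ultimately show ?case by (intro exI[of _ r]) auto
  next
    case (Suc k)
    then obtain \<zeta> :: 'a where \<zeta>: "\<zeta> ^ (l ^ Suc k) = 1" "\<zeta> ^ (l ^ k) \<noteq> 1" by blast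
    obtain r where "r ^ l = \<zeta>" using nth_root_exists[of l \<zeta>] l1 by auto
    then show ?case using \<zeta> by (intro exI[of _ r]) (auto simp: power_mult)
  qed
  then obtain \<zeta> :: 'a where \<zeta>: "\<zeta> ^ (l ^ Suc k) = 1" "\<zeta> ^ (l ^ k) \<noteq> 1" by blast
  have "\<zeta> ^ i \<noteq> 1" if i: "0 < i" "i < l ^ Suc k" for i
  proof
    assume i1: "\<zeta> ^ i = 1"
    define e where "e = (LEAST e. 0 < e \<and> \<zeta> ^ e = 1)"
    have e: "0 < e \<and> \<zeta> ^ e = 1" unfolding e_def by (rule LeastI[of _ i]) (use i i1 in auto)
    have least: "e \<le> j" if "0 < j" "\<zeta> ^ j = 1" for j unfolding e_def using that by (intro Least_le) auto
    have dvd: "e dvd j" if "\<zeta> ^ j = 1" for j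
    proof (rule ccontr)
      assume "\<not> e dvd j"
      then have "0 < j mod e" by (simp add: dvd_eq_mod_eq_0)
      moreover have "\<zeta> ^ j = (\<zeta> ^ e) ^ (j div e) * \<zeta> ^ (j mod e)"
        by (simp flip: power_mult power_add)
      then have "\<zeta> ^ (j mod e) = 1" using that e by simp
      ultimately have "e \<le> j mod e" using least[of "j mod e"] by simp
      moreover have "j mod e < e" using e by simp
      ultimately show False by simp
    qed
    obtain a where a: "a \<le> Suc k" "e = l ^ a"
      using dvd[OF \<zeta>(1)] unfolding divides_primepow_nat[OF l] by blast
    have "e \<le> i" using least i i1 by auto
    then have "l ^ a < l ^ Suc k" using i a by simp
    then have "a \<le> k" using a l1 power_strict_increasing_iff[OF l1, of a "Suc k"] by simp
    then have "e dvd l ^ k" unfolding a(2) by (rule le_imp_power_dvd)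
    then have "\<zeta> ^ (l ^ k) = 1" using e by (auto elim!: dvdE simp: power_mult)
    then show False using \<zeta>(2) by simp
  qed
  then show ?thesis using \<zeta>(1) Suc by blast
qed

theorem proposition2p3:
  fixes k S :: "'a::{alg_closed_field, field_char_0} set" and l n s :: nat
    and f :: "'a poly" and y :: "'a ffun"
  assumes "\<And>a::'a. Polynomial.algebraic a"
    and "number_field k"
    and "prime l"
    and "n \<ge> 1"
    and "f \<noteq> 0" and "\<And>i. coeff f i \<in> k"
    and "S = {\<xi>. poly f \<xi> = 0}"
    and "\<And>\<xi>. \<xi> \<in> S \<Longrightarrow> Polynomial.order \<xi> f < l ^ n"
    and "irreducible (Polynomial.monom 1 (l ^ n) - [:f:] :: 'a poly poly)"
    and "y ^ (l ^ n) = fun_of_poly f"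
    and "branch_locus (tower_coord l n y 0) (tower_coord l n y n) = affine_place ` S"
    and "jacobian_good_reduction_away_from l k (tower_coord l n y n)"
    and "field_of_set k (\<lambda>\<sigma> \<xi>. \<sigma> \<xi>) S \<subseteq> max_pro_ext l k"
    and "1 \<le> s" and "s \<le> n"
  shows "\<exists>\<psi>. galois_module_iso (gal k)
               (torsion l (J_tower l n y s) Mod (pi_star l n y s ` carrier (torsion l (J_tower l n y (s - 1)))))
               (quotient_act l n y s)
               (torsion l (A_tower l n y s)) (quotient_act l n y s) \<psi>
           \<and> (\<forall>a\<in>carrier (torsion l (J_tower l n y s)).
                \<psi> ((pi_star l n y s ` carrier (torsion l (J_tower l n y (s - 1)))) #>\<^bsub>torsion l (J_tower l n y s)\<^esub> a)
                = (pi_star l n y s ` carrier (J_tower l n y (s - 1))) #>\<^bsub>J_tower l n y s\<^esub> a)"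
proof -
  have l1: "l > 1" using assms(3) by (rule prime_gt_1_nat)
  obtain \<xi> where \<xi>: "\<not> l dvd order \<xi> f"
    using ex_order_not_dvd[OF assms(3,4,5,9)] by blast
  obtain \<zeta> :: 'a where \<zeta>: "\<zeta> ^ (l ^ n) = 1" "\<And>i. 0 < i \<Longrightarrow> i < l ^ n \<Longrightarrow> \<zeta> ^ i \<noteq> 1"
    using ex_primitive_root[OF assms(3)] by blast
  \<comment> \<open>Being prime to \<open>l\<close>, the order at \<xi> is prime to every power of
    \<open>l\<close>, so the same \<xi> serves all levels of the tower.\<close>
  have "coprime (order \<xi> f) (l ^ n)"
    using \<xi> assms(3) prime_imp_coprime[of l "order \<xi> f"] by (simp add: coprime_commute)
  then interpret Y: superelliptic "l ^ n" f y \<xi> \<zeta>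
    using l1 assms(5,10) \<zeta> by unfold_locales auto
  define w where "w = tower_coord l n y s"
  have "l ^ n = l ^ s * l ^ (n - s)" using assms(15) by (simp flip: power_add)
  then interpret W: superelliptic "l ^ s" f w \<xi> "\<zeta> ^ (l ^ (n - s))"
    unfolding w_def tower_coord_def by (rule Y.tower_step)
  \<comment> \<open>\<open>W\<close> is level \<open>s\<close> and \<open>V\<close>, generated by
    \<open>w ^ l\<close>, is level \<open>s - 1\<close>; for \<open>s = 1\<close> the latter is the
    line.\<close>
  have step: "l ^ s = l ^ (s - 1) * l" using assms(14) by (cases s) auto
  interpret V: superelliptic "l ^ (s - 1)" f "w ^ l" \<xi> "(\<zeta> ^ (l ^ (n - s))) ^ l"
    by (rule W.tower_step[OF step])
  have v: "tower_coord l n y (s - 1) = w ^ l"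
    using assms(14,15) by (simp add: w_def tower_coord_def Suc_diff_le flip: power_mult power_Suc2)
  have "\<exists>\<psi>. galois_module_iso (gal k) (torsion l (Jac w) Mod (Jac_pullback (w ^ l) w ` carrier (torsion l (Jac (w ^ l)))))
       (\<lambda>\<sigma> U. Jac_act w \<sigma> ` U) (torsion l (Jac w Mod (Jac_pullback (w ^ l) w ` carrier (Jac (w ^ l)))))
       (\<lambda>\<sigma> U. Jac_act w \<sigma> ` U) \<psi>
    \<and> (\<forall>a\<in>carrier (torsion l (Jac w)). \<psi> ((Jac_pullback (w ^ l) w ` carrier (torsion l (Jac (w ^ l)))) #>\<^bsub>torsion l (Jac w)\<^esub> a)
        = (Jac_pullback (w ^ l) w ` carrier (Jac (w ^ l))) #>\<^bsub>Jac w\<^esub> a)"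
    by (intro torsion_quotient_iso W.galois_module_Jac[OF assms(6)] V.comm_group_Jac W.Jac_pullback_hom[OF step]
        W.Jac_pullback_inj[OF step] V.Jac_divisible[OF assms(3) refl] W.Jac_pullback_stable[OF assms(6) step]
        gal_id gal_comp)
  moreover have "quotient_act l n y s = (\<lambda>\<sigma> U. Jac_act w \<sigma> ` U)"
    by (simp add: quotient_act_def w_def fun_eq_iff)
  ultimately show ?thesis
    unfolding A_tower_def J_tower_def pi_star_def v w_def[symmetric] by simp
qed

end
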